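(* Let $\Omega_1\subseteq\mathbb{R}^n$ and $\Omega_2\subseteq\mathbb{R}^m$ be open, let $f\in\mathcal{G}[\Omega_1,\Omega_2]$ be a c-bounded generalized map with representative $(f_\varepsilon)_\varepsilon$, and let $u\in\mathcal{G}(\Omega_2)$ with representative $(u_\varepsilon)_\varepsilon$. Define the pullback $f^{\ast}u := (u_\varepsilon(f_\varepsilon(x)))_\varepsilon+\mathcal{N}(\Omega_1)$. Then $f^{\ast}u$ is well-defined and $$\mathrm{WF}(f^{\ast}u)\subseteq f^{\ast}\,\mathrm{WF}(u)\ \cup\ \bigl(U_f(\mathrm{WF}(u))\times S^{n-1}\bigr)\ \cup\ \bigl((K_f(u)\cap S_f^c)\times S^{n-1}\bigr),$$ where $S_f^c=\Omega_1\setminus S_f$.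
   Context: All nets are indexed by $\varepsilon\in\,]0,1]$. For $\Omega\subseteq\mathbb{R}^d$ open, $\mathcal{E}_M(\Omega)$ is the set of nets $(u_\varepsilon)_\varepsilon$ of smooth functions on $\Omega$ such that for all compact $K\subset\Omega$ and all multi-indices $\alpha$ there is $p\in\mathbb{R}$ with $\sup_K|\partial^\alpha u_\varepsilon|=O(\varepsilon^{-p})$ as $\varepsilon\to0$; $\mathcal{N}(\Omega)$ is the ideal of nets in $\mathcal{E}_M(\Omega)$ with $\sup_K|u_\varepsilon|=O(\varepsilon^q)$ for all compact $K\subset\Omega$ and all $q\in\mathbb{R}$; $\mathcal{G}(\Omega)=\mathcal{E}_M(\Omega)/\mathcal{N}(\Omega)$ is the (special) Colombeau algebra. Replacing nets of functions by nets of real numbers gives the ring $\widetilde{\mathbb{R}}$ of generalized numbers. $\Omega\mapsto\mathcal{G}(\Omega)$ is a sheaf, so supports are defined; $\mathcal{G}_c(\Omega)$ is the set of elements of compact support, which have representatives supported in a joint compact set. $\mathcal{G}[\Omega_1,\Omega_2]$ is the set of $F\in\mathcal{G}(\Omega_1)^m$ that are c-bounded into $\Omega_2$: there is a representative $(F_\varepsilon)_\varepsilon$ such that for every compact $K\subset\Omega_1$ there are a compact $K'\subset\Omega_2$ and $\varepsilon_0>0$ with $F_\varepsilon(K)\subseteq K'$ for all $\varepsilon\le\varepsilon_0$. Representatives of c-bounded maps are taken to be of this kind. Generalized graph: for a c-bounded $F$, $C_F$ is the set of $(x,y)\in\Omega_1\times\Omega_2$ for which there are a net $(x_\varepsilon)_\varepsilon$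 in $\Omega_1$ with $\lim_{\varepsilon\to0}x_\varepsilon=x$ and a map $\tau:]0,1]\to]0,1]$ with $\tau(\varepsilon)\le\varepsilon$ such that $y$ is a cluster point (as $\varepsilon\to0$) of $(F_{\tau(\varepsilon)}(x_\varepsilon))_\varepsilon$. The same definition is used for generalized maps between open subsets of products of Euclidean spaces and spheres. Wave front set: $v\in\mathcal{G}(\mathbb{R}^d)$ is rapidly decreasing in the directions $\Gamma_0\subseteq S^{d-1}$ if it has a representative $(v_\varepsilon)_\varepsilon$ for which there is $N\in\mathbb{N}_0$ such that for all $p\in\mathbb{N}_0$, $\sup_{\lambda>0,\ \xi_1\in\Gamma_0}(1+\lambda^2)^{p/2}|v_\varepsilon(\lambda\xi_1)|=O(\varepsilon^{-N})$ as $\varepsilon\to0$. For $v\in\mathcal{G}_c(\Omega)$ the Fourier transform $\mathcal{F}(v)\in\mathcal{G}(\mathbb{R}^d)$ is the class of $(\int_\Omega v_\varepsilon(x)e^{-i\langle x,\cdot\rangle}dx)_\varepsilon$, with $(v_\varepsilon)_\varepsilon$ a representative with joint compact support. $\Sigma(v)\subseteq S^{d-1}$ is the complement of the set of points having an open neighborhood $\Gamma_0\subseteq S^{d-1}$ such that $\mathcal{F}(v)$ is rapidly decreasing in the directions $\Gamma_0$. For $u\in\mathcal{G}(\Omega)$, $\Sigma_{x}(u)=\bigcap_{\varphi\in C_c^\infty(\Omega),\,\varphi(x)\ne0}\Sigma(\varphi u)$ and $\mathrm{WF}(u)=\{(x,\xi)\in\Omega\times S^{d-1}\mid \xi\in\Sigma_x(u)\}$.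 Slow scale: a net $(\lambda_\varepsilon)_\varepsilon$ in $\mathbb{R}$ is of slow scale if there is $\varepsilon'\in\,]0,1]$ such that for every $t\ge0$ there is $C_t>0$ with $|\lambda_\varepsilon|^t\le C_t\varepsilon^{-1}$ for all $\varepsilon<\varepsilon'$. The set $D_f$: $D_f$ is the (open) set of $(x_0,\eta_0)\in\Omega_1\times S^{m-1}$ for which there exist a neighborhood $X\times V\subseteq\Omega_1\times S^{m-1}$ of $(x_0,\eta_0)$, a positive slow-scale net $(\sigma_\varepsilon)_\varepsilon$ and $\varepsilon'\in\,]0,1]$ such that for all $\varepsilon<\varepsilon'$ $$\inf_{(x,\eta)\in X\times V}|\sigma_\varepsilon\,{}^T\!df_\varepsilon(x)\eta|\ge1\quad\text{and}\quad\sup_{(x,\eta)\in X\times V^\perp}|\sigma_\varepsilon\,{}^T\!df_\varepsilon(x)\eta|\le1,$$ where ${}^T\!df_\varepsilon$ is the transposed Jacobian and $V^\perp=\{\eta\in S^{m-1}\mid\exists\eta_0\in V:\langle\eta,\eta_0\rangle=0\}$. For a closed set $\Gamma\subseteq\Omega_2\times S^{m-1}$: $$U_f(\Gamma)=\{x\in\mathbb{R}^n\mid\exists\, y,\eta:\ (x,y)\in C_f,\ (x,\eta)\notin D_f,\ (y,\eta)\in\Gamma\}.$$ If $D_f\neq\emptyset$, let $\Phi_f$ be the generalized map on $D_f$ with values in $\Omega_2\times S^{n-1}$ given by $(x,\eta)\mapsto\bigl(f_\varepsilon(x),\,{}^T\!df_\varepsilon(x)\eta/|{}^T\!df_\varepsilon(x)\eta|\bigr)$,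 with generalized graph $C_{\Phi_f}\subseteq D_f\times\Omega_2\times S^{n-1}$, and set $$f^\ast\Gamma=\{(x,\xi)\in\Omega_1\times S^{n-1}\mid\exists\,(y,\eta)\in\Gamma:\ (x,\eta,y,\xi)\in C_{\Phi_f}\}.$$ If $D_f=\emptyset$, set $f^\ast\Gamma=\Omega_1\times S^{n-1}$. $f$ is slow-scaled in all derivatives at $x_0\in\Omega_1$ if there is a neighborhood $X_0$ of $x_0$ such that for every $\alpha\in\mathbb{N}^n$ there are a slow-scale net $(r_{\alpha,\varepsilon})_\varepsilon$ and a constant $C_\alpha$ with $\sup_{X_0}|\partial^\alpha f_\varepsilon(x)|\le C_\alpha r_{\alpha,\varepsilon}$ for small $\varepsilon$. $S_f$ is the set of $x\in\Omega_1$ at which $f$ is slow-scaled in all derivatives. With $\pi_1:\Omega_1\times\Omega_2\to\Omega_1$ the projection, $$K_f(u)=\bigcap_{k\in\widetilde{\mathbb{R}}}\pi_1\bigl(C_f\cap(\Omega_1\times\mathrm{supp}(u-k))\bigr).$$ *)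

theory Defs
  imports "HOL-Analysis.Analysis" "HOL-Library.Landau_Symbols"
begin

text \<open>
  Nets are functions of a real parameter; only the values at parameters in \<open>]0,1]\<close> matter, and
  \<open>\<epsilon> \<rightarrow> 0\<close> is the filter \<^term>\<open>at_right (0::real)\<close>. Functions on an open set \<open>\<Omega>\<close> are total
  functions whose values outside \<open>\<Omega>\<close> are irrelevant.
\<close>

section \<open>Smooth functions and partial derivatives\<close>

definition partial_deriv :: "'n \<Rightarrow> (real^'n::finite \<Rightarrow> 'b::real_normed_vector) \<Rightarrow> real^'n \<Rightarrow> 'b" where
  "partial_deriv i f x = vector_derivative (\<lambda>t. f (x + t *\<^sub>R axis i 1)) (at 0)"

text \<open>
  A multi-index is written as the list of the coordinates to be differentiated; for smooth
  functions the order of the list is immaterial.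
\<close>

primrec partial_derivs :: "'n list \<Rightarrow> (real^'n::finite \<Rightarrow> 'b::real_normed_vector) \<Rightarrow> real^'n \<Rightarrow> 'b" where
  "partial_derivs [] f = f"
| "partial_derivs (i # \<alpha>) f = partial_deriv i (partial_derivs \<alpha> f)"

definition smooth_on :: "(real^'n::finite) set \<Rightarrow> (real^'n \<Rightarrow> 'b::real_normed_vector) \<Rightarrow> bool" where
  "smooth_on \<Omega> f \<longleftrightarrow> (\<forall>\<alpha>. \<forall>x\<in>\<Omega>. partial_derivs \<alpha> f differentiable (at x))"

definition test_functions :: "(real^'n::finite) set \<Rightarrow> (real^'n \<Rightarrow> complex) set" where
  "test_functions \<Omega> = {\<phi>. smooth_on UNIV \<phi> \<and> compact (closure {x. \<phi> x \<noteq> 0})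
                          \<and> closure {x. \<phi> x \<noteq> 0} \<subseteq> \<Omega>}"


section \<open>The special Colombeau algebra\<close>

type_synonym ('n, 'b) net = "real \<Rightarrow> real^'n \<Rightarrow> 'b"

text \<open>\<open>sup_bigo K v b\<close> is \<open>sup\<^sub>K |v\<^sub>\<epsilon>| = O(b\<^sub>\<epsilon>)\<close> as \<open>\<epsilon> \<rightarrow> 0\<close>, with the supremum taken in \<open>[0,\<infinity>]\<close>.\<close>

definition sup_bigo :: "'a set \<Rightarrow> (real \<Rightarrow> 'a \<Rightarrow> 'b::real_normed_vector) \<Rightarrow> (real \<Rightarrow> real) \<Rightarrow> bool" where
  "sup_bigo K v b \<longleftrightarrow> (\<exists>C. \<forall>\<^sub>F \<epsilon> in at_right 0. \<forall>x\<in>K. norm (v \<epsilon> x) \<le> C * b \<epsilon>)"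

definition moderate_nets :: "(real^'n::finite) set \<Rightarrow> ('n, 'b::real_normed_vector) net set" where
  "moderate_nets \<Omega> = {u. (\<forall>\<epsilon>\<in>{0<..1}. smooth_on \<Omega> (u \<epsilon>)) \<and>
     (\<forall>K \<alpha>. compact K \<and> K \<subseteq> \<Omega> \<longrightarrow>
        (\<exists>p::real. sup_bigo K (\<lambda>\<epsilon>. partial_derivs \<alpha> (u \<epsilon>)) (\<lambda>\<epsilon>. \<epsilon> powr (- p))))}"

definition negligible_nets :: "(real^'n::finite) set \<Rightarrow> ('n, 'b::real_normed_vector) net set" where
  "negligible_nets \<Omega> = {u \<in> moderate_nets \<Omega>.
     \<forall>K. compact K \<and> K \<subseteq> \<Omega> \<longrightarrow> (\<forall>q::real. sup_bigo K u (\<lambda>\<epsilon>. \<epsilon> powr q))}"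

definition colombeau_rel ::
    "(real^'n::finite) set \<Rightarrow> (('n, 'b::real_normed_vector) net \<times> ('n, 'b) net) set" where
  "colombeau_rel \<Omega> = {(r, s). r \<in> moderate_nets \<Omega> \<and> s \<in> moderate_nets \<Omega>
                             \<and> (\<lambda>\<epsilon> x. r \<epsilon> x - s \<epsilon> x) \<in> negligible_nets \<Omega>}"

text \<open>
  A generalized function is the set of its representatives. With values in \<^typ>\<open>real^'m\<close> this is
  the \<open>m\<close>-fold power of the algebra of real-valued generalized functions.
\<close>

definition colombeau :: "(real^'n::finite) set \<Rightarrow> ('n, 'b::real_normed_vector) net set set" where
  "colombeau \<Omega> = moderate_nets \<Omega> // colombeau_rel \<Omega>"

definition gclass ::
    "(real^'n::finite) set \<Rightarrow> ('n, 'b::real_normed_vector) net \<Rightarrow> ('n, 'b) net set" where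
  "gclass \<Omega> r = colombeau_rel \<Omega> `` {r}"

definition moderate_numbers :: "(real \<Rightarrow> real) set" where
  "moderate_numbers = {c. \<exists>p::real. c \<in> O[at_right 0](\<lambda>\<epsilon>. \<epsilon> powr (- p))}"

definition negligible_numbers :: "(real \<Rightarrow> real) set" where
  "negligible_numbers = {c. \<forall>q::real. c \<in> O[at_right 0](\<lambda>\<epsilon>. \<epsilon> powr q)}"

definition generalized_reals :: "(real \<Rightarrow> real) set set" where
  "generalized_reals = moderate_numbers //
     {(c, d). c \<in> moderate_numbers \<and> d \<in> moderate_numbers \<and> (\<lambda>\<epsilon>. c \<epsilon> - d \<epsilon>) \<in> negligible_numbers}"

text \<open>
  Operations on classes are unions over all representatives of the arguments; as the operations
  respect the equivalence, each union is a single class.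
\<close>

definition grestrict ::
    "(real^'n::finite) set \<Rightarrow> ('n, 'b::real_normed_vector) net set \<Rightarrow> ('n, 'b) net set" where
  "grestrict W u = (\<Union>r\<in>u. gclass W r)"

definition gmult :: "(real^'n::finite) set \<Rightarrow> (real^'n \<Rightarrow> complex) \<Rightarrow> ('n, complex) net set
    \<Rightarrow> ('n, complex) net set" where
  "gmult \<Omega> \<phi> u = (\<Union>r\<in>u. gclass \<Omega> (\<lambda>\<epsilon> x. \<phi> x * r \<epsilon> x))"

definition gminus_const :: "(real^'n::finite) set \<Rightarrow> ('n, complex) net set \<Rightarrow> (real \<Rightarrow> real) set
    \<Rightarrow> ('n, complex) net set" where
  "gminus_const \<Omega> u k = (\<Union>r\<in>u. \<Union>c\<in>k. gclass \<Omega> (\<lambda>\<epsilon> x. r \<epsilon> x - of_real (c \<epsilon>)))"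

definition gsupport ::
    "(real^'n::finite) set \<Rightarrow> ('n, 'b::real_normed_vector) net set \<Rightarrow> (real^'n) set" where
  "gsupport \<Omega> u = {x\<in>\<Omega>. \<not> (\<exists>W. open W \<and> x \<in> W \<and> W \<subseteq> \<Omega> \<and> grestrict W u = gclass W (\<lambda>_ _. 0))}"


section \<open>C-bounded maps and their generalized graphs\<close>

definition cbounded_net ::
    "(real^'n::finite) set \<Rightarrow> (real^'m::finite) set \<Rightarrow> ('n, real^'m) net \<Rightarrow> bool" where
  "cbounded_net \<Omega>\<^sub>1 \<Omega>\<^sub>2 F \<longleftrightarrow> (\<forall>K. compact K \<and> K \<subseteq> \<Omega>\<^sub>1 \<longrightarrow>
     (\<exists>K' \<epsilon>\<^sub>0. compact K' \<and> K' \<subseteq> \<Omega>\<^sub>2 \<and> \<epsilon>\<^sub>0 > 0 \<and> (\<forall>\<epsilon>\<in>{0<..1}. \<epsilon> \<le> \<epsilon>\<^sub>0 \<longrightarrow> F \<epsilon> ` K \<subseteq> K')))"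

definition cbounded_maps ::
    "(real^'n::finite) set \<Rightarrow> (real^'m::finite) set \<Rightarrow> ('n, real^'m) net set set" where
  "cbounded_maps \<Omega>\<^sub>1 \<Omega>\<^sub>2 = {F \<in> colombeau \<Omega>\<^sub>1. \<exists>r\<in>F. cbounded_net \<Omega>\<^sub>1 \<Omega>\<^sub>2 r}"

text \<open>
  The class \<open>(u\<^sub>\<epsilon> \<circ> f\<^sub>\<epsilon>)\<^sub>\<epsilon> + \<N>(\<Omega>\<^sub>1)\<close>. C-boundedness puts \<open>f\<^sub>\<epsilon>(K)\<close> into the domain of \<open>u\<^sub>\<epsilon>\<close> only for
  \<open>\<epsilon>\<close> below a bound depending on \<open>K\<close>, so \<open>u\<^sub>\<epsilon> \<circ> f\<^sub>\<epsilon>\<close> may be undefined on parts of \<open>\<Omega>\<^sub>1\<close> for each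
  single \<open>\<epsilon>\<close>. The representatives \<open>w\<close> are therefore the moderate nets that coincide with it on every
  compact set for small \<open>\<epsilon>\<close>, up to \<open>\<N>(\<Omega>\<^sub>1)\<close>. If \<open>f\<^sub>\<epsilon>(\<Omega>\<^sub>1) \<subseteq> \<Omega>\<^sub>2\<close> for all \<open>\<epsilon>\<close>, then
  \<open>w\<^sub>\<epsilon> = u\<^sub>\<epsilon> \<circ> f\<^sub>\<epsilon>\<close> is one of these. That the union is an element of \<^term>\<open>colombeau \<Omega>\<close> contains
  the moderateness of the composition and the uniqueness of its class.
\<close>

definition pullback ::
    "(real^'n::finite) set \<Rightarrow> ('n, real^'m::finite) net \<Rightarrow> ('m, complex) net \<Rightarrow> ('n, complex) net set" where
  "pullback \<Omega>\<^sub>1 f u =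
     (\<Union>w \<in> {w \<in> moderate_nets \<Omega>\<^sub>1. \<forall>K. compact K \<and> K \<subseteq> \<Omega>\<^sub>1 \<longrightarrow>
               (\<forall>\<^sub>F \<epsilon> in at_right 0. \<forall>x\<in>K. w \<epsilon> x = u \<epsilon> (f \<epsilon> x))}. gclass \<Omega>\<^sub>1 w)"

definition cluster_point :: "(real \<Rightarrow> 'a::topological_space) \<Rightarrow> 'a \<Rightarrow> bool" where
  "cluster_point z y \<longleftrightarrow> (\<forall>U. open U \<and> y \<in> U \<longrightarrow> (\<exists>\<^sub>F \<epsilon> in at_right 0. z \<epsilon> \<in> U))"

definition gen_graph :: "'a::topological_space set \<Rightarrow> 'b::topological_space set
    \<Rightarrow> (real \<Rightarrow> 'a \<Rightarrow> 'b) \<Rightarrow> ('a \<times> 'b) set" where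
  "gen_graph A B F = {(x, y). x \<in> A \<and> y \<in> B \<and>
     (\<exists>X \<tau>. (\<forall>\<epsilon>\<in>{0<..1}. X \<epsilon> \<in> A \<and> \<tau> \<epsilon> \<in> {0<..1} \<and> \<tau> \<epsilon> \<le> \<epsilon>) \<and> (X \<longlongrightarrow> x) (at_right 0)
            \<and> cluster_point (\<lambda>\<epsilon>. F (\<tau> \<epsilon>) (X \<epsilon>)) y)}"


section \<open>The wave front set\<close>

definition rapidly_decreasing :: "(real^'n::finite) set \<Rightarrow> ('n, complex) net set \<Rightarrow> bool" where
  "rapidly_decreasing \<Gamma>\<^sub>0 V \<longleftrightarrow> (\<exists>v\<in>V. \<exists>N::nat. \<forall>p::nat.
     sup_bigo ({0<..} \<times> \<Gamma>\<^sub>0) (\<lambda>\<epsilon> (l, \<xi>). (1 + l\<^sup>2) powr (real p / 2) * norm (v \<epsilon> (l *\<^sub>R \<xi>)))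
              (\<lambda>\<epsilon>. \<epsilon> powr (- real N)))"

definition joint_compact_support :: "(real^'n::finite) set \<Rightarrow> ('n, complex) net \<Rightarrow> bool" where
  "joint_compact_support \<Omega> w \<longleftrightarrow>
     (\<exists>L. compact L \<and> L \<subseteq> \<Omega> \<and> (\<forall>\<epsilon>\<in>{0<..1}. \<forall>x\<in>\<Omega> - L. w \<epsilon> x = 0))"

text \<open>
  The Fourier transform of a compactly supported generalized function is given here by the nets
  \<open>\<xi> \<mapsto> \<integral>\<^sub>\<Omega> w\<^sub>\<epsilon>(x) exp (-\<i> (x \<bullet> \<xi>)) dx\<close>,
  for \<open>w\<close> ranging over the representatives with joint compact support; it is
  not closed up under adding \<open>\<N>(\<real>\<^sup>d)\<close>. Elements of \<open>\<N>(\<real>\<^sup>d)\<close> are unrestricted at infinity: multiplying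
  such a net by a cut-off to \<open>|\<xi>| \<le> log (1/\<epsilon>)\<close> changes it by an element of \<open>\<N>(\<real>\<^sup>d)\<close> and makes it
  rapidly decreasing in all directions. Hence admitting all representatives modulo \<open>\<N>(\<real>\<^sup>d)\<close> in
  the definition of \<open>\<Sigma>\<close> would make every wave front set empty. The nets below for different
  \<open>w\<close> differ by negligible nets that are rapidly decreasing as well.
\<close>

definition fourier_nets ::
    "(real^'n::finite) set \<Rightarrow> ('n, complex) net set \<Rightarrow> ('n, complex) net set" where
  "fourier_nets \<Omega> v =
     {(\<lambda>\<epsilon> \<xi>. LINT x:\<Omega>|lborel. w \<epsilon> x * exp (- (\<i> * of_real (x \<bullet> \<xi>)))) | w.
        w \<in> v \<and> joint_compact_support \<Omega> w}"

definition Sigma_dirs :: "(real^'n::finite) set \<Rightarrow> ('n, complex) net set \<Rightarrow> (real^'n) set" where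
  "Sigma_dirs \<Omega> v = {\<xi> \<in> sphere 0 1.
     \<not> (\<exists>\<Gamma>\<^sub>0. openin (top_of_set (sphere 0 1)) \<Gamma>\<^sub>0 \<and> \<xi> \<in> \<Gamma>\<^sub>0 \<and> rapidly_decreasing \<Gamma>\<^sub>0 (fourier_nets \<Omega> v))}"

definition Sigma_at ::
    "(real^'n::finite) set \<Rightarrow> ('n, complex) net set \<Rightarrow> real^'n \<Rightarrow> (real^'n) set" where
  "Sigma_at \<Omega> u x = (\<Inter>\<phi> \<in> {\<phi> \<in> test_functions \<Omega>. \<phi> x \<noteq> 0}. Sigma_dirs \<Omega> (gmult \<Omega> \<phi> u))"

definition WF :: "(real^'n::finite) set \<Rightarrow> ('n, complex) net set \<Rightarrow> ((real^'n) \<times> (real^'n)) set" where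
  "WF \<Omega> u = {(x, \<xi>). x \<in> \<Omega> \<and> \<xi> \<in> sphere 0 1 \<and> \<xi> \<in> Sigma_at \<Omega> u x}"


section \<open>Slow scale and the sets attached to a c-bounded map\<close>

definition slow_scale :: "(real \<Rightarrow> real) \<Rightarrow> bool" where
  "slow_scale l \<longleftrightarrow> (\<exists>\<epsilon>'\<in>{0<..1}. \<forall>t\<ge>0. \<exists>C>0. \<forall>\<epsilon>. 0 < \<epsilon> \<and> \<epsilon> < \<epsilon>' \<longrightarrow> \<bar>l \<epsilon>\<bar> powr t \<le> C * inverse \<epsilon>)"

definition transp_jacobian ::
    "('n::finite, real^'m::finite) net \<Rightarrow> real \<Rightarrow> real^'n \<Rightarrow> real^'m \<Rightarrow> real^'n" where
  "transp_jacobian f \<epsilon> x \<eta> = transpose (jacobian (f \<epsilon>) (at x)) *v \<eta>"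

definition perp_dirs :: "(real^'m::finite) set \<Rightarrow> (real^'m) set" where
  "perp_dirs V = {\<eta> \<in> sphere 0 1. \<exists>\<eta>\<^sub>0\<in>V. \<eta> \<bullet> \<eta>\<^sub>0 = 0}"

definition D_set ::
    "(real^'n::finite) set \<Rightarrow> ('n, real^'m::finite) net \<Rightarrow> ((real^'n) \<times> (real^'m)) set" where
  "D_set \<Omega>\<^sub>1 f = {(x\<^sub>0, \<eta>\<^sub>0). x\<^sub>0 \<in> \<Omega>\<^sub>1 \<and> \<eta>\<^sub>0 \<in> sphere 0 1 \<and>
     (\<exists>X V \<sigma>. open X \<and> X \<subseteq> \<Omega>\<^sub>1 \<and> x\<^sub>0 \<in> X \<and>
        openin (top_of_set (sphere 0 1)) V \<and> \<eta>\<^sub>0 \<in> V \<and>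
        slow_scale \<sigma> \<and> (\<forall>\<epsilon>\<in>{0<..1}. \<sigma> \<epsilon> > 0) \<and>
        (\<exists>\<epsilon>'\<in>{0<..1}. \<forall>\<epsilon>. 0 < \<epsilon> \<and> \<epsilon> < \<epsilon>' \<longrightarrow>
           (\<forall>x\<in>X. \<forall>\<eta>\<in>V. norm (\<sigma> \<epsilon> *\<^sub>R transp_jacobian f \<epsilon> x \<eta>) \<ge> 1) \<and>
           (\<forall>x\<in>X. \<forall>\<eta>\<in>perp_dirs V. norm (\<sigma> \<epsilon> *\<^sub>R transp_jacobian f \<epsilon> x \<eta>) \<le> 1)))}"

definition U_set :: "(real^'n::finite) set \<Rightarrow> (real^'m::finite) set \<Rightarrow> ('n, real^'m) net
    \<Rightarrow> ((real^'m) \<times> (real^'m)) set \<Rightarrow> (real^'n) set" where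
  "U_set \<Omega>\<^sub>1 \<Omega>\<^sub>2 f \<Gamma> =
     {x. \<exists>y \<eta>. (x, y) \<in> gen_graph \<Omega>\<^sub>1 \<Omega>\<^sub>2 f \<and> (x, \<eta>) \<notin> D_set \<Omega>\<^sub>1 f \<and> (y, \<eta>) \<in> \<Gamma>}"

definition Phi_net :: "('n::finite, real^'m::finite) net
    \<Rightarrow> real \<Rightarrow> (real^'n) \<times> (real^'m) \<Rightarrow> (real^'m) \<times> (real^'n)" where
  "Phi_net f \<epsilon> = (\<lambda>(x, \<eta>).
     (f \<epsilon> x, transp_jacobian f \<epsilon> x \<eta> /\<^sub>R norm (transp_jacobian f \<epsilon> x \<eta>)))"

definition pullback_dirs :: "(real^'n::finite) set \<Rightarrow> (real^'m::finite) set \<Rightarrow> ('n, real^'m) net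
    \<Rightarrow> ((real^'m) \<times> (real^'m)) set \<Rightarrow> ((real^'n) \<times> (real^'n)) set" where
  "pullback_dirs \<Omega>\<^sub>1 \<Omega>\<^sub>2 f \<Gamma> =
     (if D_set \<Omega>\<^sub>1 f = {} then \<Omega>\<^sub>1 \<times> sphere 0 1
      else {(x, \<xi>). x \<in> \<Omega>\<^sub>1 \<and> \<xi> \<in> sphere 0 1 \<and>
             (\<exists>y \<eta>. (y, \<eta>) \<in> \<Gamma> \<and>
                ((x, \<eta>), (y, \<xi>)) \<in> gen_graph (D_set \<Omega>\<^sub>1 f) (\<Omega>\<^sub>2 \<times> sphere 0 1) (Phi_net f))})"

definition S_set :: "(real^'n::finite) set \<Rightarrow> ('n, real^'m::finite) net \<Rightarrow> (real^'n) set" where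
  "S_set \<Omega>\<^sub>1 f = {x\<^sub>0 \<in> \<Omega>\<^sub>1. \<exists>X\<^sub>0. open X\<^sub>0 \<and> X\<^sub>0 \<subseteq> \<Omega>\<^sub>1 \<and> x\<^sub>0 \<in> X\<^sub>0 \<and>
     (\<forall>\<alpha>. \<exists>r C. slow_scale r \<and>
        (\<forall>\<^sub>F \<epsilon> in at_right 0. \<forall>x\<in>X\<^sub>0. norm (partial_derivs \<alpha> (f \<epsilon>) x) \<le> C * r \<epsilon>))}"

definition K_set :: "(real^'n::finite) set \<Rightarrow> (real^'m::finite) set \<Rightarrow> ('n, real^'m) net
    \<Rightarrow> ('m, complex) net set \<Rightarrow> (real^'n) set" where
  "K_set \<Omega>\<^sub>1 \<Omega>\<^sub>2 f u = (\<Inter>k\<in>generalized_reals.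
     fst ` (gen_graph \<Omega>\<^sub>1 \<Omega>\<^sub>2 f \<inter> (\<Omega>\<^sub>1 \<times> gsupport \<Omega>\<^sub>2 (gminus_const \<Omega>\<^sub>2 u k))))"

end

theory Submission
  imports Defs "HOL-Probability.Characteristic_Functions" "HOL-Probability.Sinc_Integral"
begin

text \<open>
  Well-definedness rests on two observations. By the chain rule, the derivatives of
  \<open>u\<^sub>\<epsilon> \<circ> f\<^sub>\<epsilon>\<close> are sums of products of moderate nets, hence moderate; a representative
  living on all of \<open>\<Omega>\<^sub>1\<close> arises when \<open>u\<^sub>\<epsilon>\<close> is multiplied by cut-offs that exhaust \<open>\<Omega>\<^sub>2\<close> as
  \<open>\<epsilon> \<rightarrow> 0\<close> (\<open>pullback_rep_exists\<close>). Equivalent representatives of \<open>f\<close> and \<open>u\<close> give equivalent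
  compositions, by the mean value theorem (\<open>composition_negligible\<close>).

  For the inclusion, a point \<open>(x\<^sub>0, \<xi>\<^sub>0)\<close> has to be shown regular for the pullback in two
  situations. If \<open>x\<^sub>0 \<notin> K\<^sub>f(u)\<close>, there is a generalized constant \<open>k\<close> such that \<open>u - k\<close> vanishes
  near each \<open>y\<close> with \<open>(x\<^sub>0, y) \<in> C\<^sub>f\<close>. As \<open>f\<^sub>\<epsilon>\<close> maps a neighbourhood of \<open>x\<^sub>0\<close> into a compact set
  and stays away from every other \<open>y\<close> near \<open>x\<^sub>0\<close>, compactness shows that the pullback equals \<open>k\<close>
  near \<open>x\<^sub>0\<close>, and a test function times a constant has a rapidly decreasing Fourier transform
  (\<open>WF_pullback_outside_K_set\<close>).

  In the other situation \<open>x\<^sub>0 \<in> S\<^sub>f\<close>, while \<open>x\<^sub>0 \<notin> U\<^sub>f(WF u)\<close> and \<open>(x\<^sub>0, \<xi>\<^sub>0) \<notin> f\<^sup>* WF u\<close>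
  (\<open>WF_pullback_inside_S_set\<close>). For \<open>y\<close> with \<open>(x\<^sub>0, y) \<in> C\<^sub>f\<close> there is a cut-off \<open>\<psi>\<close> with
  \<open>\<psi>(y) \<noteq> 0\<close> such that the Fourier transform of \<open>\<psi> u\<close> is rapidly decreasing outside a small
  neighbourhood \<open>V\<close> of the set of \<open>\<eta>\<close> with \<open>(y, \<eta>) \<in> WF u\<close> (\<open>microlocalization\<close>). Finitely many
  such \<open>\<psi>\<close> suffice for a smooth decomposition of the pullback near \<open>x\<^sub>0\<close> (\<open>rapid_on_pullback\<close>).
  For an amplitude \<open>a\<close>, Fourier inversion turns the Fourier transform at \<open>\<zeta>\<close> of the piece
  \<open>a (\<psi> u\<^sub>\<epsilon>) \<circ> f\<^sub>\<epsilon>\<close> into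
  \<open>(2 \<pi>)\<^bsup>-m\<^esup> \<integral> F(\<psi> u\<^sub>\<epsilon>)(\<eta>) I\<^sub>\<epsilon>(\<zeta>, \<eta>) d\<eta>\<close> with
  \<open>I\<^sub>\<epsilon>(\<zeta>, \<eta>) = \<integral> a(x) exp (\<i> (f\<^sub>\<epsilon>(x) \<bullet> \<eta> - x \<bullet> \<zeta>)) dx\<close>, where \<open>F\<close> is the Fourier transform.
  Each \<open>\<eta>\<close> falls under one of three cases, with \<open>\<zeta>\<close> in a small cone around \<open>\<xi>\<^sub>0\<close>:

  \<^item> If \<open>|\<zeta>|\<close> is large compared with \<open>|\<eta>|\<close>, the gradient \<open>df\<^sub>\<epsilon>(x)\<^sup>T \<eta> - \<zeta>\<close> of the phase is
    comparable to \<open>\<zeta>\<close>, since \<open>df\<^sub>\<epsilon>\<close> is bounded by a slow-scale net.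

  \<^item> If \<open>\<eta>\<close> lies in the cone over \<open>V\<close>, membership in \<open>D\<^sub>f\<close> bounds \<open>|df\<^sub>\<epsilon>(x)\<^sup>T \<eta>|\<close> from below by
    \<open>|\<eta>|\<close> divided by a slow-scale net, and \<open>(x\<^sub>0, \<eta>, y, \<xi>\<^sub>0) \<notin> C\<^sub>\<Phi>\<close> separates the
    direction of \<open>df\<^sub>\<epsilon>(x)\<^sup>T \<eta>\<close> from that of \<open>\<zeta>\<close>. Again the gradient dominates \<open>|\<zeta>| + |\<eta>|\<close> up to a
    slow-scale factor (\<open>noncharacteristic_direction\<close>).

  \<^item> Otherwise \<open>F(\<psi> u\<^sub>\<epsilon>)(\<eta>)\<close> decreases rapidly in \<open>|\<eta>|\<close>, and \<open>|\<zeta>|\<close> is at most a slow-scale factor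
    times \<open>|\<eta>|\<close>.

  In the first two cases repeated integration by parts bounds \<open>I\<^sub>\<epsilon>\<close> by a slow-scale net divided by
  any prescribed power of \<open>|\<zeta>| + |\<eta>|\<close> (\<open>nonstationary_phase\<close>). The role of slow scale is that all powers of such nets
  are \<open>O(1/\<epsilon>)\<close>: whatever the order of decay, the total loss is the single factor \<open>1/\<epsilon>\<close>, so the
  exponent in the definition of rapid decrease does not depend on the order
  (\<open>microlocal_estimate\<close>). The same estimate with \<open>f\<close> the identity shows that multiplication by test
  functions preserves rapid decrease up to a shrinking of the cone (\<open>rapid_on_mult\<close>); this is what
  allows cut-offs for different directions to be combined by multiplication.
\<close>

section \<open>Partial derivatives\<close>

lemma partial_deriv_has_derivative:
  assumes "(g has_derivative g') (at x)"
  shows "partial_deriv i g x = g' (axis i 1)"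
proof -
  have "((\<lambda>t. g (x + t *\<^sub>R axis i 1)) has_vector_derivative g' (axis i 1)) (at 0)"
  proof -
    have "((\<lambda>t::real. x + t *\<^sub>R axis i 1) has_derivative (\<lambda>t. t *\<^sub>R axis i 1)) (at 0)"
      by (auto intro!: derivative_eq_intros)
    moreover have "(g has_derivative g') (at (x + 0 *\<^sub>R axis i 1))"
      using assms by simp
    ultimately have "((\<lambda>t::real. g (x + t *\<^sub>R axis i 1)) has_derivative (\<lambda>t. g' (t *\<^sub>R axis i 1))) (at 0)"
      by (rule has_derivative_compose)
    then show ?thesis
      using has_derivative_linear[OF assms]
      by (simp add: has_vector_derivative_def linear_scale)
  qed
  then show ?thesis
    unfolding partial_deriv_def by (rule vector_derivative_at)
qed

lemma partial_deriv_frechet: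
  "g differentiable (at x) \<Longrightarrow> partial_deriv i g x = frechet_derivative g (at x) (axis i 1)"
  by (simp add: partial_deriv_has_derivative frechet_derivative_works)

lemma vec_axis_expansion: "(v::real^'n::finite) = (\<Sum>j\<in>UNIV. v $ j *\<^sub>R axis j 1)"
  using basis_expansion[of v] by (simp add: scalar_mult_eq_scaleR)

lemma has_derivative_partial_derivs:
  assumes "g differentiable (at x)"
  shows "(g has_derivative (\<lambda>v. \<Sum>j\<in>UNIV. v $ j *\<^sub>R partial_deriv j g x)) (at x)"
proof -
  obtain g' where g': "(g has_derivative g') (at x)"
    using assms by (auto simp: differentiable_def)
  interpret linear g' using has_derivative_linear[OF g'] .
  have "g' v = (\<Sum>j\<in>UNIV. v $ j *\<^sub>R partial_deriv j g x)" for v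
  proof -
    have "g' v = g' (\<Sum>j\<in>UNIV. v $ j *\<^sub>R axis j 1)"
      by (subst vec_axis_expansion) simp
    then show ?thesis
      by (simp add: sum scale partial_deriv_has_derivative[OF g'])
  qed
  then have "g' = (\<lambda>v. \<Sum>j\<in>UNIV. v $ j *\<^sub>R partial_deriv j g x)" by auto
  with g' show ?thesis by simp
qed

lemma partial_deriv_cong:
  assumes "open U" "x \<in> U" "\<And>y. y \<in> U \<Longrightarrow> f y = g y"
  shows "partial_deriv i f x = partial_deriv i g x"
  unfolding partial_deriv_def
proof (rule vector_derivative_cong_eq)
  have "isCont (\<lambda>t::real. x + t *\<^sub>R axis i 1) 0" by simp
  then have "\<forall>\<^sub>F t in at (0::real). x + t *\<^sub>R axis i 1 \<in> U"
    using assms(1,2) unfolding isCont_def by (auto elim!: topological_tendstoD)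
  then have *: "\<forall>\<^sub>F t in nhds (0::real). x + t *\<^sub>R axis i 1 \<in> U"
    using assms(2) by (simp add: eventually_nhds_conv_at)
  show "\<forall>\<^sub>F t in nhds (0::real). t \<in> UNIV \<longrightarrow> f (x + t *\<^sub>R axis i 1) = g (x + t *\<^sub>R axis i 1)"
    using * by eventually_elim (use assms(3) in auto)
qed (use assms in auto)

lemma differentiable_cong_open:
  assumes "open U" "x \<in> U" "\<And>y. y \<in> U \<Longrightarrow> f y = g y" "f differentiable (at x)"
  shows "g differentiable (at x)"
  using assms by (metis differentiable_def has_derivative_transform_within_open)

lemma partial_derivs_append:
  "partial_derivs (\<alpha> @ \<beta>) f = partial_derivs \<alpha> (partial_derivs \<beta> f)"
  by (induction \<alpha>) auto

lemma partial_deriv_bilinear: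
  assumes "bounded_bilinear h" "f differentiable (at x)" "g differentiable (at x)"
  shows "partial_deriv i (\<lambda>y. h (f y) (g y)) x = h (f x) (partial_deriv i g x) + h (partial_deriv i f x) (g x)"
proof -
  obtain f' g' where f': "(f has_derivative f') (at x)" and g': "(g has_derivative g') (at x)"
    using assms by (auto simp: differentiable_def)
  show ?thesis
    using partial_deriv_has_derivative[OF bounded_bilinear.FDERIV[OF assms(1) f' g']]
      partial_deriv_has_derivative[OF g'] partial_deriv_has_derivative[OF f'] by simp
qed

lemma partial_deriv_add:
  assumes "f differentiable (at x)" "g differentiable (at x)"
  shows "partial_deriv i (\<lambda>y. f y + g y) x = partial_deriv i f x + partial_deriv i g x"
proof -
  obtain f' g' where f': "(f has_derivative f') (at x)" and g': "(g has_derivative g') (at x)"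
    using assms by (auto simp: differentiable_def)
  show ?thesis
    using partial_deriv_has_derivative[OF has_derivative_add[OF f' g']]
      partial_deriv_has_derivative[OF g'] partial_deriv_has_derivative[OF f'] by simp
qed

lemma partial_deriv_inverse:
  fixes f :: "real^'n::finite \<Rightarrow> complex"
  assumes "f differentiable (at x)" "f x \<noteq> 0"
  shows "partial_deriv i (\<lambda>y. inverse (f y)) x = - partial_deriv i f x * (inverse (f x) * inverse (f x))"
proof -
  obtain f' where f': "(f has_derivative f') (at x)"
    using assms by (auto simp: differentiable_def)
  show ?thesis
    using partial_deriv_has_derivative[OF Deriv.has_derivative_inverse[OF assms(2) f']]
      partial_deriv_has_derivative[OF f'] by simp
qed

lemma partial_deriv_compose:
  fixes f :: "real^'n::finite \<Rightarrow> real^'m::finite" and u :: "real^'m \<Rightarrow> 'b::real_normed_vector"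
  assumes "f differentiable (at x)" "u differentiable (at (f x))"
  shows "partial_deriv i (\<lambda>y. u (f y)) x = (\<Sum>k\<in>UNIV. partial_deriv i f x $ k *\<^sub>R partial_deriv k u (f x))"
proof -
  obtain f' where f': "(f has_derivative f') (at x)"
    using assms by (auto simp: differentiable_def)
  show ?thesis
    using partial_deriv_has_derivative[OF has_derivative_compose[OF f' has_derivative_partial_derivs[OF assms(2)]]]
      partial_deriv_has_derivative[OF f'] by simp
qed

lemma partial_deriv_const [simp]: "partial_deriv i (\<lambda>_. c) x = 0"
  by (rule partial_deriv_has_derivative[OF has_derivative_const])

section \<open>Families with gauged derivatives\<close>

text \<open>One calculus serves smooth functions, moderate nets, nets of slow scale and families with further
  parameters: a family over a filter \<open>F\<close> of indices is controlled by a set \<open>R\<close> of admissible bounds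
  (gauges) that is closed under the operations occurring in the product and chain rules. Bounds may
  depend on the point, so that \<open>R = UNIV\<close> imposes no bound at all and only smoothness is left.\<close>

locale gauge =
  fixes F :: "'i filter" and X :: "'i \<Rightarrow> (real^'n::finite) set"
    and R :: "('i \<Rightarrow> real^'n \<Rightarrow> real) set"
  assumes open_dom: "\<forall>\<^sub>F i in F. open (X i)"
    and gauge_const: "0 \<le> c \<Longrightarrow> (\<lambda>_ _. c) \<in> R"
    and gauge_abs: "r \<in> R \<Longrightarrow> (\<lambda>i x. \<bar>r i x\<bar>) \<in> R"
    and gauge_add: "r \<in> R \<Longrightarrow> s \<in> R \<Longrightarrow> (\<lambda>i x. r i x + s i x) \<in> R"
    and gauge_mult: "r \<in> R \<Longrightarrow> s \<in> R \<Longrightarrow> (\<lambda>i x. r i x * s i x) \<in> R"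
begin

definition bdd :: "('i \<Rightarrow> real^'n \<Rightarrow> 'b::real_normed_vector) \<Rightarrow> bool" where
  "bdd a \<longleftrightarrow> (\<exists>r\<in>R. \<forall>\<^sub>F i in F. \<forall>x\<in>X i. norm (a i x) \<le> r i x)"

definition evdiff :: "('i \<Rightarrow> real^'n \<Rightarrow> 'b::real_normed_vector) \<Rightarrow> bool" where
  "evdiff a \<longleftrightarrow> (\<forall>\<^sub>F i in F. \<forall>x\<in>X i. a i differentiable (at x))"

text \<open>The recursion on the order of differentiation is what makes the closure properties below easy:
  by the product, quotient and chain rules, the first derivatives of a product, an inverse or a
  composition are built from families that the induction hypothesis covers.\<close>

primrec tame_ord :: "nat \<Rightarrow> ('i \<Rightarrow> real^'n \<Rightarrow> 'b::real_normed_vector) \<Rightarrow> bool" where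
  "tame_ord 0 = bdd"
| "tame_ord (Suc n) = (\<lambda>a. bdd a \<and> evdiff a \<and> (\<forall>j. tame_ord n (\<lambda>i. partial_deriv j (a i))))"

definition tame :: "('i \<Rightarrow> real^'n \<Rightarrow> 'b::real_normed_vector) \<Rightarrow> bool" where
  "tame a \<longleftrightarrow> (\<forall>n. tame_ord n a)"

lemma tame_ord_bdd: "tame_ord n a \<Longrightarrow> bdd a"
  by (cases n) auto

lemma tame_ord_Suc: "tame_ord (Suc n) a \<Longrightarrow> tame_ord n a"
  by (induction n arbitrary: a) auto

lemma tame_bdd: "tame a \<Longrightarrow> bdd a"
  by (metis tame_def tame_ord_bdd)

lemma tame_evdiff: "tame a \<Longrightarrow> evdiff a"
  by (metis tame_def tame_ord.simps(2))

lemma tame_partial_deriv: "tame a \<Longrightarrow> tame (\<lambda>i. partial_deriv j (a i))"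
  unfolding tame_def by (metis tame_ord.simps(2))

lemma tame_partial_derivs: "tame a \<Longrightarrow> tame (\<lambda>i. partial_derivs \<alpha> (a i))"
  by (induction \<alpha>) (auto dest: tame_partial_deriv)

lemma tameI:
  assumes "\<And>\<alpha>. bdd (\<lambda>i. partial_derivs \<alpha> (a i))" "\<And>\<alpha>. evdiff (\<lambda>i. partial_derivs \<alpha> (a i))"
  shows "tame a"
proof -
  have "tame_ord n a" for n
    using assms
  proof (induction n arbitrary: a)
    case 0
    then show ?case using 0(1)[of "[]"] by simp
  next
    case (Suc n)
    have "tame_ord n (\<lambda>i. partial_deriv j (a i))" for j
      using Suc.prems[of "_ @ [j]"] by (intro Suc.IH) (simp_all add: partial_derivs_append)
    then show ?case using Suc.prems[of "[]"] by simp
  qed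
  then show ?thesis by (simp add: tame_def)
qed

lemma bdd_cong:
  assumes "bdd a" "\<forall>\<^sub>F i in F. \<forall>x\<in>X i. a i x = b i x"
  shows "bdd b"
proof -
  obtain r where "r \<in> R" "\<forall>\<^sub>F i in F. \<forall>x\<in>X i. norm (a i x) \<le> r i x"
    using assms(1) by (auto simp: bdd_def)
  then show ?thesis
    using assms(2) unfolding bdd_def by (intro bexI[of _ r]) (auto elim: eventually_elim2)
qed

lemma evdiff_cong:
  assumes "evdiff a" "\<forall>\<^sub>F i in F. \<forall>x\<in>X i. a i x = b i x"
  shows "evdiff b"
  using assms open_dom unfolding evdiff_def
  by eventually_elim (metis differentiable_cong_open)

lemma partial_deriv_ev_cong:
  assumes "\<forall>\<^sub>F i in F. \<forall>x\<in>X i. a i x = b i x"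
  shows "\<forall>\<^sub>F i in F. \<forall>x\<in>X i. partial_deriv j (a i) x = partial_deriv j (b i) x"
  using assms open_dom by eventually_elim (metis partial_deriv_cong)

lemma tame_ord_cong:
  assumes "tame_ord n a" "\<forall>\<^sub>F i in F. \<forall>x\<in>X i. a i x = b i x"
  shows "tame_ord n b"
  using assms
proof (induction n arbitrary: a b)
  case (Suc n)
  have "tame_ord n (\<lambda>i. partial_deriv j (b i))" for j
    using Suc.prems by (intro Suc.IH[OF _ partial_deriv_ev_cong[OF Suc.prems(2)]]) simp
  then show ?case
    using bdd_cong[OF _ Suc.prems(2)] evdiff_cong[OF _ Suc.prems(2)] Suc.prems(1) by simp
qed (use bdd_cong in auto)

lemma tame_cong:
  assumes "tame a" "\<forall>\<^sub>F i in F. \<forall>x\<in>X i. a i x = b i x"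
  shows "tame b"
  using assms tame_ord_cong unfolding tame_def by blast

lemma bdd_bilinear:
  assumes "bounded_bilinear h" "bdd a" "bdd b"
  shows "bdd (\<lambda>i x. h (a i x) (b i x))"
proof -
  obtain r s where "r \<in> R" "\<forall>\<^sub>F i in F. \<forall>x\<in>X i. norm (a i x) \<le> r i x"
    "s \<in> R" "\<forall>\<^sub>F i in F. \<forall>x\<in>X i. norm (b i x) \<le> s i x"
    using assms by (auto simp: bdd_def)
  note rs = this
  obtain K where K: "K > 0" "\<And>a b. norm (h a b) \<le> norm a * norm b * K"
    using bounded_bilinear.pos_bounded[OF assms(1)] by blast
  show ?thesis unfolding bdd_def
  proof (rule bexI)
    show "(\<lambda>i x. K * (r i x * s i x)) \<in> R"
      using K rs gauge_const[of K] gauge_mult[of "\<lambda>_ _. K", OF _ gauge_mult[OF rs(1,3)]] by simp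
    show "\<forall>\<^sub>F i in F. \<forall>x\<in>X i. norm (h (a i x) (b i x)) \<le> K * (r i x * s i x)"
      using rs(2,4)
    proof eventually_elim
      case (elim i)
      show ?case
      proof
        fix x assume x: "x \<in> X i"
        have "norm (a i x) * norm (b i x) \<le> r i x * s i x"
          using elim x by (intro mult_mono) (auto intro: order_trans[OF norm_ge_zero])
        then show "norm (h (a i x) (b i x)) \<le> K * (r i x * s i x)"
          using K(1) K(2)[of "a i x" "b i x"]
          by (smt (verit) mult.commute mult_left_mono)
      qed
    qed
  qed
qed

lemma bdd_add:
  assumes "bdd a" "bdd b"
  shows "bdd (\<lambda>i x. a i x + b i x)"
proof -
  obtain r s where "r \<in> R" "\<forall>\<^sub>F i in F. \<forall>x\<in>X i. norm (a i x) \<le> r i x"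
    "s \<in> R" "\<forall>\<^sub>F i in F. \<forall>x\<in>X i. norm (b i x) \<le> s i x"
    using assms by (auto simp: bdd_def)
  note rs = this
  have "\<forall>\<^sub>F i in F. \<forall>x\<in>X i. norm (a i x + b i x) \<le> r i x + s i x"
    using rs(2,4) by eventually_elim (blast intro: order_trans[OF norm_triangle_ineq add_mono])
  with gauge_add[OF rs(1,3)] show ?thesis
    unfolding bdd_def by (intro bexI[of _ "\<lambda>i x. r i x + s i x"])
qed

lemma tame_ord_add:
  assumes "tame_ord n a" "tame_ord n b"
  shows "tame_ord n (\<lambda>i x. a i x + b i x)"
  using assms
proof (induction n arbitrary: a b)
  case (Suc n)
  have d: "evdiff a" "evdiff b" and t: "\<And>j. tame_ord n (\<lambda>i. partial_deriv j (a i))"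
      "\<And>j. tame_ord n (\<lambda>i. partial_deriv j (b i))"
    using Suc.prems by auto
  have "tame_ord n (\<lambda>i. partial_deriv j (\<lambda>x. a i x + b i x))" for j
  proof (rule tame_ord_cong)
    show "tame_ord n (\<lambda>i x. partial_deriv j (a i) x + partial_deriv j (b i) x)"
      using Suc.IH[OF t(1) t(2)] .
    show "\<forall>\<^sub>F i in F. \<forall>x\<in>X i. partial_deriv j (a i) x + partial_deriv j (b i) x =
        partial_deriv j (\<lambda>x. a i x + b i x) x"
      using d unfolding evdiff_def by eventually_elim (simp add: partial_deriv_add)
  qed
  moreover have "evdiff (\<lambda>i x. a i x + b i x)"
    using d unfolding evdiff_def by eventually_elim auto
  ultimately show ?case using Suc.prems by (auto intro: bdd_add)
qed (auto intro: bdd_add)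

lemma tame_add: "tame a \<Longrightarrow> tame b \<Longrightarrow> tame (\<lambda>i x. a i x + b i x)"
  by (simp add: tame_def tame_ord_add)

lemma differentiable_bilinear:
  assumes "bounded_bilinear h" "f differentiable (at x)" "g differentiable (at x)"
  shows "(\<lambda>y. h (f y) (g y)) differentiable (at x)"
  using bounded_bilinear.FDERIV[OF assms(1)] assms(2,3) unfolding differentiable_def by blast

lemma tame_ord_bilinear:
  assumes "bounded_bilinear h" "tame_ord n a" "tame_ord n b"
  shows "tame_ord n (\<lambda>i x. h (a i x) (b i x))"
  using assms(2,3)
proof (induction n arbitrary: a b)
  case (Suc n)
  have d: "evdiff a" "evdiff b" and t: "\<And>j. tame_ord n (\<lambda>i. partial_deriv j (a i))"
      "\<And>j. tame_ord n (\<lambda>i. partial_deriv j (b i))"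
    using Suc.prems by auto
  note ab = Suc.prems[THEN tame_ord_Suc]
  have "tame_ord n (\<lambda>i. partial_deriv j (\<lambda>x. h (a i x) (b i x)))" for j
  proof (rule tame_ord_cong)
    show "tame_ord n (\<lambda>i x. h (a i x) (partial_deriv j (b i) x) + h (partial_deriv j (a i) x) (b i x))"
      using tame_ord_add[OF Suc.IH[OF ab(1) t(2)] Suc.IH[OF t(1) ab(2)]] .
    show "\<forall>\<^sub>F i in F. \<forall>x\<in>X i. h (a i x) (partial_deriv j (b i) x) + h (partial_deriv j (a i) x) (b i x) =
        partial_deriv j (\<lambda>x. h (a i x) (b i x)) x"
      using d unfolding evdiff_def by eventually_elim (simp add: partial_deriv_bilinear[OF assms(1)])
  qed
  moreover have "evdiff (\<lambda>i x. h (a i x) (b i x))"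
    using d unfolding evdiff_def by eventually_elim (auto intro: differentiable_bilinear[OF assms(1)])
  ultimately show ?case using Suc.prems by (auto intro: bdd_bilinear[OF assms(1)])
qed (auto intro: bdd_bilinear[OF assms(1)])

lemma tame_bilinear:
  "bounded_bilinear h \<Longrightarrow> tame a \<Longrightarrow> tame b \<Longrightarrow> tame (\<lambda>i x. h (a i x) (b i x))"
  by (simp add: tame_def tame_ord_bilinear)

lemma tame_ord_mult:
  fixes a b :: "'i \<Rightarrow> real^'n \<Rightarrow> 'b::real_normed_algebra"
  shows "tame_ord n a \<Longrightarrow> tame_ord n b \<Longrightarrow> tame_ord n (\<lambda>i x. a i x * b i x)"
  by (rule tame_ord_bilinear[OF bounded_bilinear_mult])

lemma tame_mult:
  fixes a b :: "'i \<Rightarrow> real^'n \<Rightarrow> 'b::real_normed_algebra"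
  shows "tame a \<Longrightarrow> tame b \<Longrightarrow> tame (\<lambda>i x. a i x * b i x)"
  by (simp add: tame_def tame_ord_mult)

lemma bdd_zero: "bdd (\<lambda>i x. 0)"
  unfolding bdd_def by (rule bexI[OF _ gauge_const[of 0]]) auto

lemma tame_ord_const:
  fixes c :: "'i \<Rightarrow> 'b::real_normed_vector"
  assumes "bdd (\<lambda>i _. c i)"
  shows "tame_ord n (\<lambda>i _. c i)"
  using assms
proof (induction n arbitrary: c)
  case (Suc n)
  have "tame_ord n (\<lambda>i (x::real^'n). 0::'b)" by (intro Suc.IH[of "\<lambda>_. 0"] bdd_zero)
  then show ?case using Suc.prems by (auto simp: evdiff_def intro: tame_ord_cong)
qed auto

lemma tame_const: "bdd (\<lambda>i _. c i) \<Longrightarrow> tame (\<lambda>i _. c i)"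
  by (simp add: tame_def tame_ord_const)

lemma tame_fixed_const: "tame (\<lambda>i _. c)"
proof (rule tame_const)
  show "bdd (\<lambda>i _. c)"
    unfolding bdd_def by (rule bexI[OF _ gauge_const[of "norm c"]]) auto
qed

lemma tame_ord_sum:
  fixes a :: "'k \<Rightarrow> 'i \<Rightarrow> real^'n \<Rightarrow> 'b::real_normed_vector"
  assumes "\<And>k. k \<in> A \<Longrightarrow> tame_ord n (a k)"
  shows "tame_ord n (\<lambda>i x. \<Sum>k\<in>A. a k i x)"
proof -
  have z: "tame_ord n (\<lambda>i x. 0::'b)" using tame_fixed_const[of "0::'b"] by (simp add: tame_def)
  show ?thesis
    using assms by (induction A rule: infinite_finite_induct) (auto intro: tame_ord_add z)
qed

lemma tame_sum:
  assumes "\<And>k. k \<in> A \<Longrightarrow> tame (a k)"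
  shows "tame (\<lambda>i x. \<Sum>k\<in>A. a k i x)"
  using assms by (simp add: tame_def tame_ord_sum)

lemma tame_bounded_linear:
  assumes "bounded_linear h" "tame a"
  shows "tame (\<lambda>i x. h (a i x))"
proof -
  have "bounded_bilinear (\<lambda>(c::real) y. c *\<^sub>R h y)"
    using bounded_bilinear.comp[OF bounded_bilinear_scaleR bounded_linear_ident assms(1)] .
  from tame_bilinear[OF this tame_fixed_const[of "1::real"] assms(2)] show ?thesis by simp
qed

lemma tame_minus: "tame a \<Longrightarrow> tame (\<lambda>i x. - a i x)"
  by (rule tame_bounded_linear[OF bounded_linear_minus[OF bounded_linear_ident]])

lemma tame_diff: "tame a \<Longrightarrow> tame b \<Longrightarrow> tame (\<lambda>i x. a i x - b i x)"
  using tame_add[OF _ tame_minus, of a b] by simp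

text \<open>Only the reciprocal itself needs a bound; its derivatives are polynomials in it and in the
  derivatives of \<open>a\<close>.\<close>

lemma tame_ord_inverse:
  fixes a :: "'i \<Rightarrow> real^'n \<Rightarrow> complex"
  assumes "tame_ord n a" "bdd (\<lambda>i x. inverse (a i x))" "\<forall>\<^sub>F i in F. \<forall>x\<in>X i. a i x \<noteq> 0"
  shows "tame_ord n (\<lambda>i x. inverse (a i x))"
  using assms(1)
proof (induction n)
  case (Suc n)
  have d: "evdiff a" and t: "\<And>j. tame_ord n (\<lambda>i. partial_deriv j (a i))"
    using Suc.prems by auto
  have IH: "tame_ord n (\<lambda>i x. inverse (a i x))"
    using Suc.IH Suc.prems tame_ord_Suc by blast
  have "tame_ord n (\<lambda>i. partial_deriv j (\<lambda>x. inverse (a i x)))" for j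
  proof (rule tame_ord_cong)
    show "tame_ord n (\<lambda>i x. (- 1) * partial_deriv j (a i) x * (inverse (a i x) * inverse (a i x)))"
      using tame_ord_mult[OF tame_ord_mult[OF _ t] tame_ord_mult[OF IH IH], of "\<lambda>_ _. -1"]
        tame_fixed_const[of "-1::complex"] by (simp add: tame_def)
    show "\<forall>\<^sub>F i in F. \<forall>x\<in>X i. (- 1) * partial_deriv j (a i) x * (inverse (a i x) * inverse (a i x)) =
        partial_deriv j (\<lambda>x. inverse (a i x)) x"
      using d assms(3) unfolding evdiff_def by eventually_elim (simp add: partial_deriv_inverse)
  qed
  moreover have "evdiff (\<lambda>i x. inverse (a i x))"
    using d assms(3) unfolding evdiff_def by eventually_elim (auto intro: differentiable_inverse)
  ultimately show ?case using assms(2) by auto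
qed (use assms in auto)

lemma tame_inverse:
  fixes a :: "'i \<Rightarrow> real^'n \<Rightarrow> complex"
  assumes "tame a" "bdd (\<lambda>i x. inverse (a i x))" "\<forall>\<^sub>F i in F. \<forall>x\<in>X i. a i x \<noteq> 0"
  shows "tame (\<lambda>i x. inverse (a i x))"
  using assms by (simp add: tame_def tame_ord_inverse)

text \<open>The derivatives of \<open>u\<close> are only needed along \<open>f\<close>. This matters for nets, whose bounds hold on the
  compact sets that contain the values of \<open>f\<close> rather than on the whole domain of \<open>u\<close>.\<close>

lemma tame_compose:
  fixes f :: "'i \<Rightarrow> real^'n \<Rightarrow> real^'m::finite" and u :: "'i \<Rightarrow> real^'m \<Rightarrow> 'b::real_normed_vector"
  assumes f: "tame f"
    and b: "\<And>\<alpha>. bdd (\<lambda>i x. partial_derivs \<alpha> (u i) (f i x))"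
    and d: "\<And>\<alpha>. \<forall>\<^sub>F i in F. \<forall>x\<in>X i. partial_derivs \<alpha> (u i) differentiable (at (f i x))"
  shows "tame (\<lambda>i x. u i (f i x))"
proof -
  have "tame_ord n (\<lambda>i x. u i (f i x))" for n
    using b d
  proof (induction n arbitrary: u)
    case 0
    then show ?case using 0(1)[of "[]"] by simp
  next
    case (Suc n)
    have fd: "evdiff f" using f by (rule tame_evdiff)
    have ud: "\<forall>\<^sub>F i in F. \<forall>x\<in>X i. u i differentiable (at (f i x))"
      using Suc.prems(2)[of "[]"] by simp
    have IH: "tame_ord n (\<lambda>i x. partial_deriv k (u i) (f i x))" for k
      using Suc.prems[of "_ @ [k]"] by (intro Suc.IH) (simp_all add: partial_derivs_append)
    have "tame_ord n (\<lambda>i. partial_deriv j (\<lambda>x. u i (f i x)))" for j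
    proof (rule tame_ord_cong)
      have "tame_ord n (\<lambda>i x. partial_deriv j (f i) x $ k)" for k
        using tame_bounded_linear[OF bounded_linear_vec_nth tame_partial_deriv[OF f]]
        by (simp add: tame_def)
      then show "tame_ord n (\<lambda>i x. \<Sum>k\<in>UNIV. partial_deriv j (f i) x $ k *\<^sub>R partial_deriv k (u i) (f i x))"
        by (intro tame_ord_sum tame_ord_bilinear[OF bounded_bilinear_scaleR] IH)
      show "\<forall>\<^sub>F i in F. \<forall>x\<in>X i. (\<Sum>k\<in>UNIV. partial_deriv j (f i) x $ k *\<^sub>R partial_deriv k (u i) (f i x)) =
          partial_deriv j (\<lambda>x. u i (f i x)) x"
        using fd ud unfolding evdiff_def by eventually_elim (simp add: partial_deriv_compose)
    qed
    moreover have "evdiff (\<lambda>i x. u i (f i x))"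
      using fd ud unfolding evdiff_def
      by eventually_elim (metis differentiable_def has_derivative_compose)
    ultimately show ?case using Suc.prems(1)[of "[]"] by simp
  qed
  then show ?thesis by (simp add: tame_def)
qed

end

section \<open>Integration by parts and non-stationary phase\<close>

lemma set_integrable_compact_support:
  fixes g :: "real^'n::finite \<Rightarrow> complex"
  assumes "compact K" "K \<subseteq> U" "continuous_on U g" "\<And>x. x \<in> U - K \<Longrightarrow> g x = 0"
  shows "set_integrable lborel U g"
proof -
  have "integrable lborel (\<lambda>x. indicator K x *\<^sub>R g x)"
    using assms by (intro borel_integrable_compact continuous_on_subset[OF assms(3)])
  moreover have "(\<lambda>x. indicator K x *\<^sub>R g x) = (\<lambda>x. indicator U x *\<^sub>R g x)"
    using assms(2,4) by (auto simp: fun_eq_iff indicator_def)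
  ultimately show ?thesis by (simp add: set_integrable_def)
qed

lemma norm_integral_le_dominating:
  fixes g :: "'a \<Rightarrow> complex"
  assumes "integrable M h" "\<And>x. norm (g x) \<le> h x"
  shows "norm (\<integral>x. g x \<partial>M) \<le> (\<integral>x. h x \<partial>M)"
proof -
  have "norm (\<integral>x. g x \<partial>M) \<le> (\<integral>x. norm (g x) \<partial>M)" by (rule integral_norm_bound)
  also have "\<dots> \<le> (\<integral>x. h x \<partial>M)"
    using assms by (intro integral_mono_AE') (auto intro: order_trans[OF norm_ge_zero])
  finally show ?thesis .
qed

lemma norm_set_integral_compact_support:
  fixes g :: "real^'n::finite \<Rightarrow> complex"
  assumes "compact K" "K \<subseteq> U" "\<And>x. x \<in> U - K \<Longrightarrow> g x = 0" "\<And>x. x \<in> K \<Longrightarrow> norm (g x) \<le> B"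
  shows "norm (LINT x:U|lborel. g x) \<le> B * measure lborel K"
proof -
  have fin: "emeasure lborel K < \<infinity>" using assms(1) by (rule emeasure_compact_finite)
  have K[measurable]: "K \<in> sets lborel" using assms(1) by (simp add: borel_compact)
  have "norm (LINT x:U|lborel. g x) \<le> (\<integral>x. indicator K x * B \<partial>lborel)"
    unfolding set_lebesgue_integral_def
  proof (rule norm_integral_le_dominating)
    show "integrable lborel (\<lambda>x. indicator K x * B)"
      using fin assms(1) by (intro integrable_mult_left integrable_real_indicator) (auto simp: borel_compact)
    show "norm (indicat_real U x *\<^sub>R g x) \<le> indicator K x * B" for x
      using assms(2-4) by (auto simp: indicator_def)
  qed
  also have "\<dots> = B * measure lborel K" using assms(1) by (simp add: borel_compact)
  finally show ?thesis .
qed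

text \<open>Difference quotients have integral zero by translation invariance of Lebesgue measure; they are
  bounded by the supremum of the derivative and supported in a common compact set, so dominated
  convergence applies.\<close>

lemma integral_partial_deriv_eq_0:
  fixes b :: "real^'n::finite \<Rightarrow> complex"
  assumes diff: "\<And>x. b differentiable (at x)" and K: "compact K" and supp: "\<And>x. x \<notin> K \<Longrightarrow> b x = 0"
    and cont: "continuous_on UNIV (partial_deriv j b)"
  shows "(\<integral>x. partial_deriv j b x \<partial>lborel) = 0"
proof -
  define e :: "real^'n" where "e = axis j 1"
  have e1: "norm e = 1" by (simp add: e_def norm_axis_1)
  have contb: "continuous_on UNIV b"
    using diff by (simp add: differentiable_imp_continuous_within continuous_on_eq_continuous_within)
  have intb: "integrable lborel b"
    using set_integrable_compact_support[OF K subset_UNIV contb] supp by (simp add: set_integrable_def)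
  define h where "h k = 1 / real (Suc k)" for k
  have h: "h k > 0" "h k \<le> 1" for k by (auto simp: h_def)
  have h0: "h \<longlonglongrightarrow> 0" unfolding h_def by (rule LIMSEQ_Suc[OF lim_1_over_n])
  define s where "s k x = (b (x + h k *\<^sub>R e) - b x) /\<^sub>R h k" for k x
  have shift: "integrable lborel (\<lambda>x. b (x + v))" "(\<integral>x. b (x + v) \<partial>lborel) = (\<integral>x. b x \<partial>lborel)" for v
  proof -
    have [measurable]: "b \<in> borel_measurable borel"
      using contb by (rule borel_measurable_continuous_onI)
    have d: "distr lborel borel ((+) v) = (lborel :: (real^'n) measure)" by (rule lborel_distr_plus)
    have "integrable (distr lborel borel ((+) v)) b" using intb by (simp add: d)
    then show "integrable lborel (\<lambda>x. b (x + v))"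
      by (subst (asm) integrable_distr_eq) (auto simp: add.commute)
    have "(\<integral>x. b x \<partial>distr lborel borel ((+) v)) = (\<integral>x. b (v + x) \<partial>lborel)"
      by (rule integral_distr) auto
    then show "(\<integral>x. b (x + v) \<partial>lborel) = (\<integral>x. b x \<partial>lborel)" by (simp add: d add.commute)
  qed
  have int_s: "(\<integral>x. s k x \<partial>lborel) = 0" for k
    unfolding s_def using shift[of "h k *\<^sub>R e"] intb by simp
  have bline: "((\<lambda>t. b (x + t *\<^sub>R e)) has_vector_derivative partial_deriv j b (x + t *\<^sub>R e)) (at t within T)" for x t T
  proof -
    obtain b' where b': "(b has_derivative b') (at (x + t *\<^sub>R e))"
      using diff by (auto simp: differentiable_def)
    have "((\<lambda>t::real. x + t *\<^sub>R e) has_derivative (\<lambda>t. t *\<^sub>R e)) (at t within T)"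
      by (auto intro!: derivative_eq_intros)
    from has_derivative_compose[OF this b'] show ?thesis
      using has_derivative_linear[OF b'] partial_deriv_has_derivative[OF b']
      by (simp add: has_vector_derivative_def linear_scale e_def)
  qed
  have out: "partial_deriv j b x = 0" if "x \<notin> K" for x
    using partial_deriv_cong[of "- K" x b "\<lambda>_. 0" j] that supp K
    by (simp add: compact_imp_closed open_Compl)
  obtain M where M: "M > 0" "\<And>x. norm (partial_deriv j b x) \<le> M"
  proof -
    have "bounded (partial_deriv j b ` K)"
      using K cont by (intro compact_imp_bounded compact_continuous_image) (auto intro: continuous_on_subset)
    then obtain M where M: "M > 0" "\<And>x. x \<in> K \<Longrightarrow> norm (partial_deriv j b x) \<le> M"
      by (auto simp: bounded_pos)
    have "norm (partial_deriv j b x) \<le> M" for x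
      using M out[of x] by (cases "x \<in> K") auto
    with M(1) that show ?thesis by blast
  qed
  define K' where "K' = {x + y |x y. x \<in> K \<and> y \<in> cball 0 (1::real)}"
  have K': "compact K'" unfolding K'_def using K by (intro compact_sums) auto
  have sbound: "norm (s k x) \<le> indicator K' x * M" for k x
  proof (cases "x \<in> K'")
    case True
    have "norm (b (x + h k *\<^sub>R e) - b (x + 0 *\<^sub>R e)) \<le> M * norm (h k - 0)"
    proof (rule differentiable_bound[where S="{0..h k}" and f="\<lambda>t. b (x + t *\<^sub>R e)"
            and f'="\<lambda>t u. u *\<^sub>R partial_deriv j b (x + t *\<^sub>R e)"])
      show "onorm (\<lambda>u. u *\<^sub>R partial_deriv j b (x + t *\<^sub>R e)) \<le> M" for t
        using M by (intro onorm_le) (auto simp: mult.commute[of M] intro!: mult_left_mono)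
    qed (use bline h[of k] in \<open>auto simp: less_imp_le has_vector_derivative_def\<close>)
    then show ?thesis
      using True h[of k] by (simp add: s_def divide_inverse_commute[symmetric] pos_divide_le_eq)
  next
    case False
    have "x \<notin> K" using False unfolding K'_def by force
    moreover have "x + h k *\<^sub>R e \<notin> K"
    proof
      assume "x + h k *\<^sub>R e \<in> K"
      moreover have "x = (x + h k *\<^sub>R e) + (- (h k *\<^sub>R e))" "- (h k *\<^sub>R e) \<in> cball 0 1"
        using h[of k] e1 by auto
      ultimately have "x \<in> K'" unfolding K'_def by blast
      with False show False by simp
    qed
    ultimately show ?thesis using False supp by (simp add: s_def)
  qed
  have lim: "(\<lambda>k. s k x) \<longlonglongrightarrow> partial_deriv j b x" for x
  proof -
    have "((\<lambda>t. b (x + t *\<^sub>R e)) has_vector_derivative partial_deriv j b x) (at 0)"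
      using bline[of x 0 UNIV] by simp
    then have "((\<lambda>t. norm (b (x + t *\<^sub>R e) - b x - t *\<^sub>R partial_deriv j b x) / norm t) \<longlongrightarrow> 0) (at 0)"
      by (simp add: has_vector_derivative_def has_derivative_at)
    then have "((\<lambda>t. norm ((b (x + t *\<^sub>R e) - b x) /\<^sub>R t - partial_deriv j b x)) \<longlongrightarrow> 0) (at 0)"
    proof (rule Lim_transform_eventually)
      show "\<forall>\<^sub>F t in at 0. norm (b (x + t *\<^sub>R e) - b x - t *\<^sub>R partial_deriv j b x) / norm t =
          norm ((b (x + t *\<^sub>R e) - b x) /\<^sub>R t - partial_deriv j b x)"
        unfolding eventually_at_filter
      proof (intro always_eventually allI impI)
        fix t :: real assume t: "t \<noteq> 0"
        have "(b (x + t *\<^sub>R e) - b x) /\<^sub>R t - partial_deriv j b x =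
            (b (x + t *\<^sub>R e) - b x - t *\<^sub>R partial_deriv j b x) /\<^sub>R t"
          using t by (simp add: scaleR_diff_right)
        then show "norm (b (x + t *\<^sub>R e) - b x - t *\<^sub>R partial_deriv j b x) / norm t =
            norm ((b (x + t *\<^sub>R e) - b x) /\<^sub>R t - partial_deriv j b x)"
          by (simp add: divide_inverse mult.commute)
      qed
    qed
    then have "((\<lambda>t. (b (x + t *\<^sub>R e) - b x) /\<^sub>R t - partial_deriv j b x) \<longlongrightarrow> 0) (at 0)"
      by (rule tendsto_norm_zero_cancel)
    then have "((\<lambda>t. (b (x + t *\<^sub>R e) - b x) /\<^sub>R t) \<longlongrightarrow> partial_deriv j b x) (at 0)"
      by (rule LIM_zero_cancel)
    moreover have "filterlim h (at 0) sequentially"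
      using h0 h(1) by (simp add: filterlim_at less_imp_neq[THEN not_sym])
    ultimately show ?thesis
      unfolding s_def by (rule filterlim_compose)
  qed
  have [measurable]: "b \<in> borel_measurable borel" "partial_deriv j b \<in> borel_measurable borel"
    using contb cont by (auto intro: borel_measurable_continuous_onI)
  have [measurable]: "s k \<in> borel_measurable borel" for k
    unfolding s_def by measurable
  have "(\<lambda>k. \<integral>x. s k x \<partial>lborel) \<longlonglongrightarrow> (\<integral>x. partial_deriv j b x \<partial>lborel)"
  proof (rule integral_dominated_convergence[where w="\<lambda>x. indicator K' x * M"])
    have "emeasure lborel K' < \<infinity>" using K' by (rule emeasure_compact_finite)
    then show "integrable lborel (\<lambda>x. indicator K' x * M)"
      using K' by (intro integrable_mult_left integrable_real_indicator) (auto simp: borel_compact)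
  qed (use lim sbound in auto)
  then show ?thesis using int_s by (simp add: LIMSEQ_const_iff)
qed

lemma set_integral_partial_deriv_eq_0:
  fixes b :: "real^'n::finite \<Rightarrow> complex"
  assumes U: "open U" and K: "compact K" "K \<subseteq> U" and diff: "\<And>x. x \<in> U \<Longrightarrow> b differentiable (at x)"
    and cont: "continuous_on U (partial_deriv j b)" and supp: "\<And>x. x \<in> U - K \<Longrightarrow> b x = 0"
  shows "(LINT x:U|lborel. partial_deriv j b x) = 0" "set_integrable lborel U (partial_deriv j b)"
proof -
  define b' where "b' x = (if x \<in> U then b x else 0)" for x
  have oK: "open (- K)" using K(1) by (simp add: compact_imp_closed open_Compl)
  have eqU: "\<And>y. y \<in> U \<Longrightarrow> b y = b' y" and eqK: "\<And>y. y \<in> - K \<Longrightarrow> b' y = 0"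
    using supp by (auto simp: b'_def)
  have dU: "partial_deriv j b' x = partial_deriv j b x" if "x \<in> U" for x
    using partial_deriv_cong[OF U that eqU] by simp
  have dK: "partial_deriv j b' x = 0" if "x \<in> - K" for x
    using partial_deriv_cong[OF oK that eqK] by simp
  have "(\<integral>x. partial_deriv j b' x \<partial>lborel) = 0"
  proof (rule integral_partial_deriv_eq_0[OF _ K(1)])
    fix x
    show "b' differentiable (at x)"
    proof (cases "x \<in> U")
      case True
      show ?thesis by (rule differentiable_cong_open[OF U True eqU diff[OF True]])
    next
      case False
      then have "x \<in> - K" using K by blast
      show ?thesis
        by (rule differentiable_cong_open[OF oK \<open>x \<in> - K\<close> eqK[symmetric]]) simp_all
    qed
  next
    have "continuous_on (U \<union> - K) (partial_deriv j b')"
    proof (rule continuous_on_open_Un[OF U oK])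
      show "continuous_on U (partial_deriv j b')"
        using cont by (rule continuous_on_eq) (simp add: dU)
      show "continuous_on (- K) (partial_deriv j b')"
        by (rule continuous_on_eq[of _ "\<lambda>_. 0"]) (auto simp: dK)
    qed
    moreover have "U \<union> - K = UNIV" using K by auto
    ultimately show "continuous_on UNIV (partial_deriv j b')" by simp
  qed (simp add: eqK)
  moreover have "partial_deriv j b' = (\<lambda>x. indicator U x *\<^sub>R partial_deriv j b x)"
    using dU dK K(2) by (auto simp: fun_eq_iff indicator_def)
  ultimately show "(LINT x:U|lborel. partial_deriv j b x) = 0"
    by (simp add: set_lebesgue_integral_def)
  show "set_integrable lborel U (partial_deriv j b)"
    using set_integrable_compact_support[OF K cont] dU dK by (metis DiffE ComplI)
qed

text \<open>One integration by parts, with the operator \<open>a \<mapsto> \<i> \<Sum>\<^sub>j \<partial>\<^sub>j c\<^sub>j\<close> where \<open>a = \<Sum>\<^sub>j c\<^sub>j t\<^sub>j\<close> and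
  \<open>\<rho> t\<close> is the gradient of the phase; the divergence of \<open>c exp (\<i> \<theta>)\<close> integrates to zero.\<close>

lemma set_integral_phase_by_parts:
  fixes c :: "'n::finite \<Rightarrow> real^'n \<Rightarrow> complex"
  assumes U: "open U" and K: "compact K" "K \<subseteq> U" and \<rho>: "\<rho> \<noteq> 0"
    and \<theta>: "\<And>x. x \<in> U \<Longrightarrow> \<theta> differentiable (at x)"
      "\<And>x j. x \<in> U \<Longrightarrow> complex_of_real (partial_deriv j \<theta> x) = of_real \<rho> * t j x"
    and c: "\<And>x j. x \<in> U \<Longrightarrow> c j differentiable (at x)"
      "\<And>j. continuous_on U (partial_deriv j (c j))"
    and t: "\<And>j. continuous_on U (t j)"
    and supp: "\<And>x j. x \<in> U - K \<Longrightarrow> c j x = 0"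
    and sum: "\<And>x. x \<in> U \<Longrightarrow> (\<Sum>j\<in>UNIV. c j x * t j x) = a x"
  shows "(LINT x:U|lborel. a x * exp (\<i> * of_real (\<theta> x))) =
    of_real (1 / \<rho>) * (LINT x:U|lborel. (\<i> * (\<Sum>j\<in>UNIV. partial_deriv j (c j) x)) * exp (\<i> * of_real (\<theta> x)))"
proof -
  define E where "E x = exp (\<i> * complex_of_real (\<theta> x))" for x
  have Eder: "(E has_derivative (\<lambda>v. \<i> * of_real (\<theta>' v) * E x)) (at x)"
    if "(\<theta> has_derivative \<theta>') (at x)" for x \<theta>'
  proof -
    have "((\<lambda>x. \<i> * complex_of_real (\<theta> x)) has_derivative (\<lambda>v. \<i> * of_real (\<theta>' v))) (at x)"
      using that by (auto intro!: derivative_eq_intros)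
    from has_derivative_compose[OF this DERIV_exp[unfolded has_field_derivative_def]]
    show ?thesis unfolding E_def by (simp add: mult.commute)
  qed
  have Ed: "E differentiable (at x)" if "x \<in> U" for x
    using \<theta>(1)[OF that] Eder unfolding differentiable_def by blast
  have Ep: "partial_deriv j E x = \<i> * of_real \<rho> * t j x * E x" if x: "x \<in> U" for j x
  proof -
    obtain \<theta>' where \<theta>': "(\<theta> has_derivative \<theta>') (at x)"
      using \<theta>(1)[OF x] by (auto simp: differentiable_def)
    have "complex_of_real (\<theta>' (axis j 1)) = of_real \<rho> * t j x"
      using \<theta>(2)[OF x, of j] partial_deriv_has_derivative[OF \<theta>'] by simp
    then show ?thesis
      using partial_deriv_has_derivative[OF Eder[OF \<theta>'], of j] by (simp add: mult.assoc)
  qed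
  have prod: "partial_deriv j (\<lambda>x. c j x * E x) x =
      partial_deriv j (c j) x * E x + \<i> * of_real \<rho> * (c j x * t j x * E x)" if "x \<in> U" for j x
    using partial_deriv_bilinear[OF bounded_bilinear_mult c(1)[OF that, of j] Ed[OF that]] Ep[OF that]
    by (simp add: algebra_simps)
  have contE: "continuous_on U E"
    using Ed by (meson differentiable_imp_continuous_within continuous_at_imp_continuous_on)
  have contc: "continuous_on U (c j)" for j
    using c(1) by (meson differentiable_imp_continuous_within continuous_at_imp_continuous_on)
  have c0: "partial_deriv j (c j) x = 0" if "x \<in> U - K" for j x
  proof -
    have "open (U - K)" using U K(1) by (simp add: compact_imp_closed open_Diff)
    then show ?thesis
      using partial_deriv_cong[of "U - K" x "c j" "\<lambda>_. 0" j] that supp by simp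
  qed
  have i1: "set_integrable lborel U (\<lambda>x. partial_deriv j (c j) x * E x)" for j
    using c0 by (intro set_integrable_compact_support[OF K] continuous_intros c(2) contE) auto
  have i2: "set_integrable lborel U (\<lambda>x. c j x * t j x * E x)" for j
    using supp by (intro set_integrable_compact_support[OF K] continuous_intros contc t contE) auto
  have "(LINT x:U|lborel. partial_deriv j (\<lambda>x. c j x * E x) x) = 0" for j
  proof (rule set_integral_partial_deriv_eq_0(1)[OF U K])
    show "\<And>x. x \<in> U \<Longrightarrow> (\<lambda>x. c j x * E x) differentiable at x"
      using c(1) Ed by auto
    have "continuous_on U (\<lambda>x. partial_deriv j (c j) x * E x + \<i> * of_real \<rho> * (c j x * t j x * E x))"
      by (intro continuous_intros c(2) contE contc t)
    then show "continuous_on U (partial_deriv j (\<lambda>x. c j x * E x))"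
      by (rule continuous_on_eq) (simp add: prod)
  qed (use supp in auto)
  then have "(LINT x:U|lborel. partial_deriv j (c j) x * E x + \<i> * of_real \<rho> * (c j x * t j x * E x)) = 0" for j
    using set_lebesgue_integral_cong[of U lborel "partial_deriv j (\<lambda>x. c j x * E x)"] prod U
    by (metis (no_types, lifting) borel_open sets_lborel)
  then have eq: "(LINT x:U|lborel. partial_deriv j (c j) x * E x) = - (\<i> * of_real \<rho>) * (LINT x:U|lborel. c j x * t j x * E x)" for j
    using set_integral_add(2)[OF i1[of j] set_integrable_mult_right[OF i2[of j], of "\<i> * of_real \<rho>"]]
    by (simp add: add_eq_0_iff)
  have s1: "(LINT x:U|lborel. a x * E x) = (\<Sum>j\<in>UNIV. LINT x:U|lborel. c j x * t j x * E x)"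
  proof -
    have "(LINT x:U|lborel. a x * E x) = (LINT x:U|lborel. (\<Sum>j\<in>UNIV. c j x * t j x * E x))"
      using U by (intro set_lebesgue_integral_cong) (auto simp: sum[symmetric] sum_distrib_right)
    also have "\<dots> = (\<Sum>j\<in>UNIV. LINT x:U|lborel. c j x * t j x * E x)"
      using i2 unfolding set_lebesgue_integral_def set_integrable_def scaleR_sum_right
      by (rule Bochner_Integration.integral_sum)
    finally show ?thesis .
  qed
  have s2: "(LINT x:U|lborel. (\<i> * (\<Sum>j\<in>UNIV. partial_deriv j (c j) x)) * E x) =
      \<i> * (\<Sum>j\<in>UNIV. LINT x:U|lborel. partial_deriv j (c j) x * E x)"
  proof -
    have "(LINT x:U|lborel. (\<i> * (\<Sum>j\<in>UNIV. partial_deriv j (c j) x)) * E x) =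
        (LINT x:U|lborel. \<i> * (\<Sum>j\<in>UNIV. partial_deriv j (c j) x * E x))"
      by (simp add: sum_distrib_right mult.assoc)
    also have "\<dots> = \<i> * (LINT x:U|lborel. (\<Sum>j\<in>UNIV. partial_deriv j (c j) x * E x))"
      by (rule set_integral_mult_right)
    also have "(LINT x:U|lborel. (\<Sum>j\<in>UNIV. partial_deriv j (c j) x * E x)) =
        (\<Sum>j\<in>UNIV. LINT x:U|lborel. partial_deriv j (c j) x * E x)"
      using i1 unfolding set_lebesgue_integral_def set_integrable_def scaleR_sum_right
      by (rule Bochner_Integration.integral_sum)
    finally show ?thesis .
  qed
  show ?thesis
    using \<rho> unfolding E_def[symmetric] s1 s2 eq sum_distrib_left[symmetric] by simp
qed

context gauge
begin

text \<open>The phase \<open>\<theta>\<close> is rescaled by its size \<open>\<rho>\<close>, so that the rescaled gradient \<open>t\<close> belongs to the class of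
  tame families and so does \<open>c\<^sub>j = a t\<^sub>j / (t \<bullet> t)\<close>. Each integration by parts therefore reproduces an
  amplitude of the same kind and gains a factor \<open>1 / \<rho>\<close>. The condition on the gauges makes them
  constant in \<open>x\<close>, as is needed for a bound on the integral.\<close>

lemma nonstationary_phase:
  assumes unif: "\<And>r. r \<in> R \<Longrightarrow> \<exists>s. r = (\<lambda>i _. s i)"
    and a: "tame a" and t: "\<And>j. tame (t j)"
    and inv: "bdd (\<lambda>i x. inverse (\<Sum>j\<in>UNIV. t j i x * t j i x))"
      "\<forall>\<^sub>F i in F. \<forall>x\<in>X i. (\<Sum>j\<in>UNIV. t j i x * t j i x) \<noteq> (0::complex)"
    and K: "\<forall>\<^sub>F i in F. \<rho> i > 0 \<and> compact (K i) \<and> K i \<subseteq> X i \<and> measure lborel (K i) \<le> V"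
    and \<theta>: "\<forall>\<^sub>F i in F. \<forall>x\<in>X i. \<theta> i differentiable (at x) \<and>
        (\<forall>j. complex_of_real (partial_deriv j (\<theta> i) x) = of_real (\<rho> i) * t j i x)"
    and supp: "\<forall>\<^sub>F i in F. \<forall>x\<in>X i - K i. a i x = 0"
  shows "\<exists>r. (\<lambda>i _. r i) \<in> R \<and> (\<forall>\<^sub>F i in F.
      norm (LINT x:X i|lborel. a i x * exp (\<i> * of_real (\<theta> i x))) \<le> r i * V / \<rho> i ^ p)"
  using a supp
proof (induction p arbitrary: a)
  case 0
  obtain r where r: "(\<lambda>i (_::real^'n). r i) \<in> R" "\<forall>\<^sub>F i in F. \<forall>x\<in>X i. norm (a i x) \<le> r i"
    using tame_bdd[OF 0(1)] unif unfolding bdd_def by blast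
  have "\<forall>\<^sub>F i in F. norm (LINT x:X i|lborel. a i x * exp (\<i> * of_real (\<theta> i x))) \<le> \<bar>r i\<bar> * V"
    using r(2) K 0(2)
  proof eventually_elim
    case (elim i)
    have "norm (LINT x:X i|lborel. a i x * exp (\<i> * of_real (\<theta> i x))) \<le> \<bar>r i\<bar> * measure lborel (K i)"
      using elim by (intro norm_set_integral_compact_support)
          (auto simp: norm_mult subset_eq intro: order_trans[OF _ abs_ge_self])
    also have "\<dots> \<le> \<bar>r i\<bar> * V" using elim by (intro mult_left_mono) auto
    finally show ?case .
  qed
  moreover have "(\<lambda>i (_::real^'n). \<bar>r i\<bar>) \<in> R" using gauge_abs[OF r(1)] .
  ultimately show ?case by auto
next
  case (Suc p)
  define q where "q = (\<lambda>i x. inverse (\<Sum>j\<in>UNIV. t j i x * t j i x))"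
  have q: "tame q"
    unfolding q_def by (intro tame_inverse tame_sum tame_mult t inv)
  define c where "c j i x = a i x * t j i x * q i x" for j i x
  have c: "tame (c j)" for j
    unfolding c_def by (intro tame_mult Suc.prems t q)
  define b where "b i x = \<i> * (\<Sum>j\<in>UNIV. partial_deriv j (c j i) x)" for i x
  have b: "tame b"
    unfolding b_def by (intro tame_mult tame_sum tame_partial_deriv c tame_fixed_const)
  have bsupp: "\<forall>\<^sub>F i in F. \<forall>x\<in>X i - K i. b i x = 0"
    using Suc.prems(2) K open_dom
  proof eventually_elim
    case (elim i)
    then have "open (X i - K i)" by (simp add: compact_imp_closed open_Diff)
    then have "partial_deriv j (c j i) x = 0" if "x \<in> X i - K i" for j x
      using partial_deriv_cong[of "X i - K i" x "c j i" "\<lambda>_. 0" j] that elim by (simp add: c_def)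
    then show ?case by (simp add: b_def)
  qed
  obtain r where r: "(\<lambda>i (_::real^'n). r i) \<in> R"
    "\<forall>\<^sub>F i in F. norm (LINT x:X i|lborel. b i x * exp (\<i> * of_real (\<theta> i x))) \<le> r i * V / \<rho> i ^ p"
    using Suc.IH[OF b bsupp] by blast
  have ev: "\<forall>\<^sub>F i in F. \<forall>j. \<forall>x\<in>X i. c j i differentiable (at x) \<and>
      partial_deriv j (c j i) differentiable (at x) \<and> t j i differentiable (at x)"
    using tame_evdiff[OF c] tame_evdiff[OF tame_partial_deriv[OF c]] tame_evdiff[OF t]
    by (intro eventually_all_finite) (auto simp: evdiff_def eventually_conj_iff ball_conj_distrib)
  have "\<forall>\<^sub>F i in F. norm (LINT x:X i|lborel. a i x * exp (\<i> * of_real (\<theta> i x))) \<le> r i * V / \<rho> i ^ Suc p"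
    using r(2) K \<theta> Suc.prems(2) inv(2) ev open_dom
  proof eventually_elim
    case (elim i)
    have "(LINT x:X i|lborel. a i x * exp (\<i> * of_real (\<theta> i x))) =
      of_real (1 / \<rho> i) * (LINT x:X i|lborel. b i x * exp (\<i> * of_real (\<theta> i x)))"
      unfolding b_def
    proof (rule set_integral_phase_by_parts[where K="K i" and t="\<lambda>j. t j i"])
      show "(\<Sum>j\<in>UNIV. c j i x * t j i x) = a i x" if "x \<in> X i" for x
      proof -
        have "(\<Sum>j\<in>UNIV. c j i x * t j i x) = a i x * (q i x * (\<Sum>j\<in>UNIV. t j i x * t j i x))"
          by (simp add: c_def sum_distrib_left mult_ac)
        also have "\<dots> = a i x" using elim that by (simp add: q_def)
        finally show ?thesis .
      qed
      show "continuous_on (X i) (partial_deriv j (c j i))" for j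
        using elim by (meson differentiable_imp_continuous_within continuous_at_imp_continuous_on)
      show "continuous_on (X i) (t j i)" for j
        using elim by (meson differentiable_imp_continuous_within continuous_at_imp_continuous_on)
    qed (use elim in \<open>auto simp: c_def\<close>)
    then have "norm (LINT x:X i|lborel. a i x * exp (\<i> * of_real (\<theta> i x))) =
      norm (LINT x:X i|lborel. b i x * exp (\<i> * of_real (\<theta> i x))) / \<rho> i"
      using elim by (simp add: norm_mult norm_divide)
    also have "\<dots> \<le> (r i * V / \<rho> i ^ p) / \<rho> i"
      using elim by (intro divide_right_mono) auto
    finally show ?case by (simp add: mult.commute)
  qed
  with r(1) show ?case by blast
qed

end

section \<open>Fourier inversion by Gaussian regularization\<close>

definition ft :: "(real^'n::finite \<Rightarrow> complex) \<Rightarrow> real^'n \<Rightarrow> complex" where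
  "ft g \<xi> = (\<integral>x. g x * exp (- (\<i> * of_real (x \<bullet> \<xi>))) \<partial>lborel)"

lemma lborel_integral_prod:
  fixes f :: "'a::euclidean_space \<Rightarrow> real \<Rightarrow> 'c::{real_normed_field,banach,second_countable_topology}"
  assumes int: "\<And>b. b \<in> Basis \<Longrightarrow> integrable lborel (f b)"
  shows "integrable lborel (\<lambda>x. \<Prod>b\<in>Basis. f b (x \<bullet> b))"
    and "(\<integral>x. (\<Prod>b\<in>Basis. f b (x \<bullet> b)) \<partial>lborel) = (\<Prod>b\<in>Basis. \<integral>x. f b x \<partial>lborel)"
proof -
  interpret product_sigma_finite "\<lambda>_::'a. lborel :: real measure" by standard
  let ?P = "\<Pi>\<^sub>M b\<in>Basis. (lborel :: real measure)"
  let ?T = "\<lambda>f. \<Sum>b\<in>Basis. f b *\<^sub>R (b::'a)"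
  have T: "?T \<in> measurable ?P borel" by measurable
  have [measurable]: "f b \<in> borel_measurable borel" if "b \<in> Basis" for b
    using int[OF that] by (simp add: integrable_iff_bounded)
  have m: "(\<lambda>x. \<Prod>b\<in>Basis. f b (x \<bullet> b)) \<in> borel_measurable borel" by measurable
  have eq: "(\<Prod>b\<in>Basis. f b (?T g \<bullet> b)) = (\<Prod>b\<in>Basis. f b (g b))" for g
    by (intro prod.cong) auto
  show "integrable lborel (\<lambda>x. \<Prod>b\<in>Basis. f b (x \<bullet> b))"
    unfolding lborel_eq[where 'a='a] integrable_distr_eq[OF T m] eq
    by (rule product_integrable_prod) (auto intro: int)
  show "(\<integral>x. (\<Prod>b\<in>Basis. f b (x \<bullet> b)) \<partial>lborel) = (\<Prod>b\<in>Basis. \<integral>x. f b x \<partial>lborel)"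
    unfolding lborel_eq[where 'a='a] integral_distr[OF T m] eq
    by (rule product_integral_prod) (auto intro: int)
qed

text \<open>A product majorant is the only form in which integrability on the product space is met below.\<close>

lemma fubini_dominated:
  fixes h :: "'a::euclidean_space \<Rightarrow> 'b::euclidean_space \<Rightarrow> complex"
  assumes meas: "(\<lambda>(x, y). h x y) \<in> borel_measurable (lborel \<Otimes>\<^sub>M lborel)"
    and A: "integrable lborel A" and B: "integrable lborel B"
    and le: "\<And>x y. norm (h x y) \<le> A x * B y"
  shows "(\<integral>x. (\<integral>y. h x y \<partial>lborel) \<partial>lborel) = (\<integral>y. (\<integral>x. h x y \<partial>lborel) \<partial>lborel)"
proof -
  have [measurable]: "A \<in> borel_measurable borel" "B \<in> borel_measurable borel"
    using A B by (auto simp: integrable_iff_bounded)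
  have "integrable (lborel \<Otimes>\<^sub>M lborel) (\<lambda>(x, y). A x * B y)"
  proof (rule lborel_pair.Fubini_integrable)
    have "integrable lborel (\<lambda>x. \<bar>A x\<bar> * (\<integral>y. \<bar>B y\<bar> \<partial>lborel))"
      using A by (intro integrable_mult_left integrable_abs)
    then show "integrable lborel (\<lambda>x. LINT y|lborel. norm (case (x, y) of (x, y) \<Rightarrow> A x * B y))"
      by (simp add: abs_mult)
    show "AE x in lborel. integrable lborel (\<lambda>y. case (x, y) of (x, y) \<Rightarrow> A x * B y)"
      using B by auto
  qed measurable
  then have "integrable (lborel \<Otimes>\<^sub>M lborel) (\<lambda>(x, y). h x y)"
    using meas by (rule Bochner_Integration.integrable_bound)
      (auto intro!: AE_I2 order_trans[OF le] abs_ge_self)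
  from lborel_pair.Fubini_integral[OF this] show ?thesis by simp
qed

lemma gaussian_integrable: "integrable lborel (\<lambda>x::real. exp (- x\<^sup>2 / 2))"
  using integrable_mult_right[of "sqrt (2 * pi)", OF integrable_std_normal_moment[of 0]]
  by (simp add: std_normal_density_def)

lemma gaussian_ft_1D:
  "(\<integral>x. exp (\<i> * of_real (t * x)) * of_real (exp (- x\<^sup>2 / 2)) \<partial>lborel) =
    of_real (sqrt (2 * pi)) * of_real (exp (- t\<^sup>2 / 2))"
proof -
  have "of_real (exp (- t\<^sup>2 / 2)) = (\<integral>x. std_normal_density x *\<^sub>R iexp (t * x) \<partial>lborel)"
    using fun_cong[OF char_std_normal_distribution, of t] unfolding char_def
    by (subst (asm) integral_density) auto
  also have "\<dots> = (\<integral>x. of_real (1 / sqrt (2 * pi)) * (exp (\<i> * of_real (t * x)) * of_real (exp (- x\<^sup>2 / 2))) \<partial>lborel)"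
    by (intro Bochner_Integration.integral_cong) (auto simp: std_normal_density_def scaleR_conv_of_real)
  also have "\<dots> = of_real (1 / sqrt (2 * pi)) * (\<integral>x. exp (\<i> * of_real (t * x)) * of_real (exp (- x\<^sup>2 / 2)) \<partial>lborel)"
    by (rule integral_mult_right_zero)
  finally show ?thesis by (simp add: field_simps)
qed

lemma gaussian_scaled_integrable_1D:
  "\<delta> > 0 \<Longrightarrow> integrable lborel (\<lambda>x::real. exp (- (\<delta> * x)\<^sup>2 / 2))"
  using lborel_integrable_real_affine[OF gaussian_integrable, of \<delta> 0] by simp

lemma gaussian_scaled_ft_1D:
  assumes "\<delta> > 0"
  shows "(\<integral>x. exp (\<i> * of_real (v * x)) * of_real (exp (- (\<delta> * x)\<^sup>2 / 2)) \<partial>lborel) =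
    of_real (sqrt (2 * pi) / \<delta>) * of_real (exp (- (v / \<delta>)\<^sup>2 / 2))"
proof -
  have "(\<integral>x. exp (\<i> * of_real ((v / \<delta>) * x)) * of_real (exp (- x\<^sup>2 / 2)) \<partial>lborel) =
    \<bar>\<delta>\<bar> *\<^sub>R (\<integral>x. exp (\<i> * of_real ((v / \<delta>) * (0 + \<delta> * x))) * of_real (exp (- (0 + \<delta> * x)\<^sup>2 / 2)) \<partial>lborel)"
    using assms by (intro lborel_integral_real_affine) auto
  then have "of_real (sqrt (2 * pi)) * of_real (exp (- (v / \<delta>)\<^sup>2 / 2)) =
    \<delta> *\<^sub>R (\<integral>x. exp (\<i> * of_real (v * x)) * of_real (exp (- (\<delta> * x)\<^sup>2 / 2)) \<partial>lborel)"
    using assms by (simp only: gaussian_ft_1D) simp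
  then show ?thesis using assms by (simp add: scaleR_conv_of_real field_simps)
qed

lemma gaussian_prod:
  "exp (- (norm (\<delta> *\<^sub>R x))\<^sup>2 / 2) = (\<Prod>b\<in>Basis. exp (- (\<delta> * (x \<bullet> b))\<^sup>2 / 2))" for x :: "'a::euclidean_space"
proof -
  have "(norm (\<delta> *\<^sub>R x))\<^sup>2 = (\<Sum>b\<in>Basis. (\<delta> * (x \<bullet> b))\<^sup>2)"
    unfolding power2_norm_eq_inner by (subst euclidean_inner) (simp add: power2_eq_square)
  then show ?thesis
    by (simp add: exp_sum[symmetric] sum_negf sum_divide_distrib)
qed

lemma gaussian_scaled_integrable:
  "\<delta> > 0 \<Longrightarrow> integrable lborel (\<lambda>x::'a::euclidean_space. exp (- (norm (\<delta> *\<^sub>R x))\<^sup>2 / 2))"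
  unfolding gaussian_prod by (intro lborel_integral_prod(1) gaussian_scaled_integrable_1D)

lemma gaussian_scaled_ft:
  fixes v :: "'a::euclidean_space"
  assumes "\<delta> > 0"
  shows "(\<integral>x. exp (\<i> * of_real (v \<bullet> x)) * of_real (exp (- (norm (\<delta> *\<^sub>R x))\<^sup>2 / 2)) \<partial>lborel) =
    of_real ((sqrt (2 * pi) / \<delta>) ^ DIM('a)) * of_real (exp (- (norm ((1 / \<delta>) *\<^sub>R v))\<^sup>2 / 2))"
proof -
  define f where "f b x = exp (\<i> * of_real ((v \<bullet> b) * x)) * complex_of_real (exp (- (\<delta> * x)\<^sup>2 / 2))" for b x
  have "exp (\<i> * of_real (v \<bullet> x)) * complex_of_real (exp (- (norm (\<delta> *\<^sub>R x))\<^sup>2 / 2)) = (\<Prod>b\<in>Basis. f b (x \<bullet> b))" for x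
  proof -
    have "exp (\<i> * complex_of_real (v \<bullet> x)) = (\<Prod>b\<in>Basis. exp (\<i> * of_real ((v \<bullet> b) * (x \<bullet> b))))"
      by (subst euclidean_inner) (simp add: exp_sum[symmetric] sum_distrib_left)
    then show ?thesis unfolding gaussian_prod f_def by (simp add: prod.distrib)
  qed
  moreover have "integrable lborel (f b)" for b
    unfolding f_def by (rule Bochner_Integration.integrable_bound[OF gaussian_scaled_integrable_1D[OF assms]])
      (auto simp: norm_mult)
  ultimately have "(\<integral>x. exp (\<i> * of_real (v \<bullet> x)) * complex_of_real (exp (- (norm (\<delta> *\<^sub>R x))\<^sup>2 / 2)) \<partial>lborel)
      = (\<Prod>b\<in>Basis. \<integral>x. f b x \<partial>lborel)"
    by (simp add: lborel_integral_prod(2))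
  also have "\<dots> = (\<Prod>b\<in>Basis. of_real (sqrt (2 * pi) / \<delta>) * of_real (exp (- (v \<bullet> b / \<delta>)\<^sup>2 / 2)))"
    unfolding f_def gaussian_scaled_ft_1D[OF assms] ..
  also have "\<dots> = of_real ((sqrt (2 * pi) / \<delta>) ^ DIM('a)) * of_real (exp (- (norm ((1 / \<delta>) *\<^sub>R v))\<^sup>2 / 2))"
    unfolding gaussian_prod prod.distrib prod_constant by simp
  finally show ?thesis .
qed

lemma lborel_integral_affine:
  fixes g :: "'a::euclidean_space \<Rightarrow> complex"
  assumes [measurable]: "g \<in> borel_measurable borel" and c: "c > 0"
  shows "(\<integral>x. g x \<partial>lborel) = of_real (c ^ DIM('a)) * (\<integral>x. g (y + c *\<^sub>R x) \<partial>lborel)"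
proof -
  have "(\<integral>x. g x \<partial>lborel) = (\<integral>x. g x \<partial>density (distr lborel borel (\<lambda>x. y + c *\<^sub>R x)) (\<lambda>_. ennreal (c ^ DIM('a))))"
    using lborel_affine[of c y] c by simp
  also have "\<dots> = (\<integral>x. (c ^ DIM('a)) *\<^sub>R g x \<partial>distr lborel borel (\<lambda>x. y + c *\<^sub>R x))"
    using c by (intro integral_density) auto
  also have "\<dots> = (\<integral>x. (c ^ DIM('a)) *\<^sub>R g (y + c *\<^sub>R x) \<partial>lborel)"
    by (intro integral_distr) auto
  also have "\<dots> = of_real (c ^ DIM('a)) * (\<integral>x. g (y + c *\<^sub>R x) \<partial>lborel)"
    by (simp add: scaleR_conv_of_real)
  finally show ?thesis .
qed

text \<open>The inverse Fourier integral with a Gaussian convergence factor. It converges for every integrable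
  \<open>w\<close>, whereas the Fourier transform of \<open>w\<close> need not be integrable.\<close>

definition gauss_reg :: "(real^'m::finite \<Rightarrow> complex) \<Rightarrow> real \<Rightarrow> real^'m \<Rightarrow> complex" where
  "gauss_reg w \<delta> y = (\<integral>\<eta>. ft w \<eta> * exp (\<i> * of_real (y \<bullet> \<eta>)) * of_real (exp (- (norm (\<delta> *\<^sub>R \<eta>))\<^sup>2 / 2)) \<partial>lborel)"

text \<open>Fubini moves the Gaussian factor onto \<open>w\<close>: the regularized inverse transform is an average of
  translates of \<open>w\<close> against a Gaussian of width \<open>\<delta>\<close>.\<close>

lemma gauss_reg_eq:
  fixes w :: "real^'m::finite \<Rightarrow> complex"
  assumes w: "integrable lborel w" and \<delta>: "\<delta> > 0"
  shows "gauss_reg w \<delta> y = of_real (sqrt (2 * pi) ^ CARD('m)) *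
    (\<integral>v. w (y + \<delta> *\<^sub>R v) * of_real (exp (- (norm v)\<^sup>2 / 2)) \<partial>lborel)"
proof -
  have [measurable]: "w \<in> borel_measurable borel" using w by (auto simp: integrable_iff_bounded)
  define G where "G \<eta> = exp (- (norm (\<delta> *\<^sub>R \<eta>))\<^sup>2 / 2)" for \<eta> :: "real^'m"
  have G: "integrable lborel G" unfolding G_def using gaussian_scaled_integrable[OF \<delta>] .
  have [measurable]: "G \<in> borel_measurable borel" using G by (auto simp: integrable_iff_bounded)
  have "gauss_reg w \<delta> y =
      (\<integral>\<eta>. (\<integral>z. w z * exp (- (\<i> * of_real (z \<bullet> \<eta>))) * (exp (\<i> * of_real (y \<bullet> \<eta>)) * of_real (G \<eta>)) \<partial>lborel) \<partial>lborel)"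
    unfolding gauss_reg_def ft_def G_def[symmetric] integral_mult_left_zero by (simp add: mult.assoc)
  also have "\<dots> = (\<integral>z. (\<integral>\<eta>. w z * exp (- (\<i> * of_real (z \<bullet> \<eta>))) * (exp (\<i> * of_real (y \<bullet> \<eta>)) * of_real (G \<eta>)) \<partial>lborel) \<partial>lborel)"
  proof (rule fubini_dominated[where A=G and B="\<lambda>z. norm (w z)"])
    show "integrable lborel (\<lambda>z. norm (w z))" using w by simp
  qed (use G in \<open>auto simp: norm_mult G_def\<close>)
  also have "\<dots> = (\<integral>z. w z * (of_real ((sqrt (2 * pi) / \<delta>) ^ CARD('m)) * of_real (exp (- (norm ((1 / \<delta>) *\<^sub>R (y - z)))\<^sup>2 / 2))) \<partial>lborel)"
  proof (intro Bochner_Integration.integral_cong refl)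
    fix z
    have "(\<integral>\<eta>. w z * exp (- (\<i> * of_real (z \<bullet> \<eta>))) * (exp (\<i> * of_real (y \<bullet> \<eta>)) * of_real (G \<eta>)) \<partial>lborel) =
        (\<integral>\<eta>. w z * (exp (\<i> * of_real ((y - z) \<bullet> \<eta>)) * of_real (G \<eta>)) \<partial>lborel)"
      by (intro Bochner_Integration.integral_cong refl)
        (simp add: inner_diff_left right_diff_distrib exp_diff exp_minus divide_inverse mult_ac)
    also have "\<dots> = w z * (\<integral>\<eta>. exp (\<i> * of_real ((y - z) \<bullet> \<eta>)) * of_real (G \<eta>) \<partial>lborel)"
      by (rule integral_mult_right_zero)
    finally show "(\<integral>\<eta>. w z * exp (- (\<i> * of_real (z \<bullet> \<eta>))) * (exp (\<i> * of_real (y \<bullet> \<eta>)) * of_real (G \<eta>)) \<partial>lborel) =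
        w z * (of_real ((sqrt (2 * pi) / \<delta>) ^ CARD('m)) * of_real (exp (- (norm ((1 / \<delta>) *\<^sub>R (y - z)))\<^sup>2 / 2)))"
      unfolding G_def gaussian_scaled_ft[OF \<delta>] by simp
  qed
  also have "\<dots> = of_real (\<delta> ^ CARD('m)) * (\<integral>v. w (y + \<delta> *\<^sub>R v) *
      (of_real ((sqrt (2 * pi) / \<delta>) ^ CARD('m)) * of_real (exp (- (norm ((1 / \<delta>) *\<^sub>R (y - (y + \<delta> *\<^sub>R v))))\<^sup>2 / 2))) \<partial>lborel)"
    by (subst lborel_integral_affine[where c=\<delta> and y=y]) (use \<delta> in auto)
  also have "\<dots> = of_real (\<delta> ^ CARD('m)) * (\<integral>v. of_real ((sqrt (2 * pi) / \<delta>) ^ CARD('m)) *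
      (w (y + \<delta> *\<^sub>R v) * of_real (exp (- (norm v)\<^sup>2 / 2))) \<partial>lborel)"
    using \<delta> by (simp add: mult_ac)
  also have "\<dots> = of_real (\<delta> ^ CARD('m)) * (of_real ((sqrt (2 * pi) / \<delta>) ^ CARD('m)) *
      (\<integral>v. w (y + \<delta> *\<^sub>R v) * of_real (exp (- (norm v)\<^sup>2 / 2)) \<partial>lborel))"
    by (subst integral_mult_right_zero) rule
  also have "\<dots> = of_real (sqrt (2 * pi) ^ CARD('m)) *
      (\<integral>v. w (y + \<delta> *\<^sub>R v) * of_real (exp (- (norm v)\<^sup>2 / 2)) \<partial>lborel)"
    using \<delta> by (simp add: power_divide)
  finally show ?thesis .
qed

lemma gaussian_integral:
  "(\<integral>v. complex_of_real (exp (- (norm v)\<^sup>2 / 2)) \<partial>(lborel :: (real^'m::finite) measure)) = of_real (sqrt (2 * pi) ^ CARD('m))"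
  using gaussian_scaled_ft[of 1 "0::real^'m"] by simp

lemma gaussian_integrable_vec: "integrable lborel (\<lambda>v::real^'m::finite. exp (- (norm v)\<^sup>2 / 2))"
  using gaussian_scaled_integrable[of 1] by simp

lemma gauss_reg_tendsto:
  fixes w :: "real^'m::finite \<Rightarrow> complex"
  assumes w: "integrable lborel w" "continuous_on UNIV w" "\<And>y. norm (w y) \<le> S"
  shows "(\<lambda>k. gauss_reg w (1 / real (Suc k)) y) \<longlonglongrightarrow> of_real ((2 * pi) ^ CARD('m)) * w y"
proof -
  have [measurable]: "w \<in> borel_measurable borel" using w by (auto simp: integrable_iff_bounded)
  have lim: "(\<lambda>k. w (y + (1 / real (Suc k)) *\<^sub>R v)) \<longlonglongrightarrow> w y" for v
  proof -
    have "(\<lambda>k. 1 / real (Suc k)) \<longlonglongrightarrow> 0" by (rule LIMSEQ_Suc[OF lim_1_over_n])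
    then have "(\<lambda>k. y + (1 / real (Suc k)) *\<^sub>R v) \<longlonglongrightarrow> y + 0 *\<^sub>R v" by (intro tendsto_intros)
    then show ?thesis
      using w(2) by (intro isCont_tendsto_compose[of y w]) (auto simp: continuous_on_eq_continuous_at)
  qed
  have "(\<lambda>k. \<integral>v. w (y + (1 / real (Suc k)) *\<^sub>R v) * of_real (exp (- (norm v)\<^sup>2 / 2)) \<partial>lborel) \<longlonglongrightarrow>
      (\<integral>v. w y * of_real (exp (- (norm v)\<^sup>2 / 2)) \<partial>(lborel :: (real^'m) measure))"
  proof (rule integral_dominated_convergence[where w="\<lambda>v::real^'m. S * exp (- (norm v)\<^sup>2 / 2)"])
    show "integrable lborel (\<lambda>v::real^'m. S * exp (- (norm v)\<^sup>2 / 2))"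
      by (intro integrable_mult_right gaussian_integrable_vec)
    show "AE v in lborel. (\<lambda>k. w (y + (1 / real (Suc k)) *\<^sub>R v) * of_real (exp (- (norm v)\<^sup>2 / 2)))
        \<longlonglongrightarrow> w y * of_real (exp (- (norm v)\<^sup>2 / 2))"
      by (intro AE_I2 tendsto_intros lim)
    show "AE v in lborel. norm (w (y + (1 / real (Suc k)) *\<^sub>R v) * of_real (exp (- (norm v)\<^sup>2 / 2)))
        \<le> S * exp (- (norm v)\<^sup>2 / 2)" for k
      using w(3) by (intro AE_I2) (simp add: norm_mult mult_right_mono)
  qed auto
  also have "(\<integral>v. w y * of_real (exp (- (norm v)\<^sup>2 / 2)) \<partial>(lborel :: (real^'m) measure)) = w y * of_real (sqrt (2 * pi) ^ CARD('m))"
    by (subst integral_mult_right_zero) (simp only: gaussian_integral)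
  finally have "(\<lambda>k. of_real (sqrt (2 * pi) ^ CARD('m)) *
      (\<integral>v. w (y + (1 / real (Suc k)) *\<^sub>R v) * of_real (exp (- (norm v)\<^sup>2 / 2)) \<partial>lborel)) \<longlonglongrightarrow>
      of_real (sqrt (2 * pi) ^ CARD('m)) * (w y * of_real (sqrt (2 * pi) ^ CARD('m)))"
    by (intro tendsto_intros)
  moreover have "of_real (sqrt (2 * pi) ^ CARD('m)) * (w y * of_real (sqrt (2 * pi) ^ CARD('m))) =
      of_real ((2 * pi) ^ CARD('m)) * w y"
  proof -
    have "(sqrt (2 * pi) ^ CARD('m)) * (sqrt (2 * pi) ^ CARD('m)) = (sqrt (2 * pi) * sqrt (2 * pi)) ^ CARD('m)"
      by (simp only: power_mult_distrib)
    also have "\<dots> = (2 * pi) ^ CARD('m)" by (simp only: real_sqrt_mult_self) simp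
    finally have "(sqrt (2 * pi) ^ CARD('m)) * (sqrt (2 * pi) ^ CARD('m)) = (2 * pi) ^ CARD('m)" .
    then have "of_real (sqrt (2 * pi) ^ CARD('m)) * of_real (sqrt (2 * pi) ^ CARD('m)) = complex_of_real ((2 * pi) ^ CARD('m))"
      by (simp only: of_real_mult[symmetric])
    moreover have "of_real (sqrt (2 * pi) ^ CARD('m)) * (w y * of_real (sqrt (2 * pi) ^ CARD('m))) =
        (of_real (sqrt (2 * pi) ^ CARD('m)) * of_real (sqrt (2 * pi) ^ CARD('m))) * w y"
      by (simp only: mult_ac)
    ultimately show ?thesis by (simp only:)
  qed
  moreover have "gauss_reg w (1 / real (Suc k)) y = of_real (sqrt (2 * pi) ^ CARD('m)) *
      (\<integral>v. w (y + (1 / real (Suc k)) *\<^sub>R v) * of_real (exp (- (norm v)\<^sup>2 / 2)) \<partial>lborel)" for k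
    by (rule gauss_reg_eq[OF w(1)]) simp
  ultimately show ?thesis by (simp only:)
qed

lemma gauss_reg_bound:
  fixes w :: "real^'m::finite \<Rightarrow> complex"
  assumes w: "integrable lborel w" "\<And>y. norm (w y) \<le> S" and \<delta>: "\<delta> > 0"
  shows "norm (gauss_reg w \<delta> y) \<le> (2 * pi) ^ CARD('m) * S"
proof -
  let ?c = "sqrt (2 * pi) ^ CARD('m)"
  have "norm (\<integral>v. w (y + \<delta> *\<^sub>R v) * of_real (exp (- (norm v)\<^sup>2 / 2)) \<partial>lborel) \<le> (\<integral>v. S * exp (- (norm (v::real^'m))\<^sup>2 / 2) \<partial>lborel)"
    using w(2) by (intro norm_integral_le_dominating integrable_mult_right gaussian_integrable_vec)
      (simp add: norm_mult mult_right_mono)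
  also have "\<dots> = S * ?c"
  proof -
    have "complex_of_real (\<integral>v. exp (- (norm v)\<^sup>2 / 2) \<partial>(lborel :: (real^'m) measure)) = of_real ?c"
      unfolding gaussian_integral[symmetric] by (rule integral_complex_of_real[symmetric])
    then show ?thesis by (simp only: of_real_eq_iff) simp
  qed
  finally have "norm (gauss_reg w \<delta> y) \<le> ?c * (S * ?c)"
    unfolding gauss_reg_eq[OF w(1) \<delta>] by (simp add: norm_mult norm_power mult_left_mono)
  also have "\<dots> = (2 * pi) ^ CARD('m) * S"
  proof -
    have "?c * ?c = (sqrt (2 * pi) * sqrt (2 * pi)) ^ CARD('m)" by (simp only: power_mult_distrib)
    also have "\<dots> = (2 * pi) ^ CARD('m)" by (simp only: real_sqrt_mult_self) simp
    finally have "?c * ?c = (2 * pi) ^ CARD('m)" .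
    moreover have "?c * (S * ?c) = (?c * ?c) * S" by (simp only: mult_ac)
    ultimately show ?thesis by (simp only:)
  qed
  finally show ?thesis .
qed

lemma ft_measurable [measurable]:
  fixes w :: "real^'m::finite \<Rightarrow> complex"
  assumes [measurable]: "w \<in> borel_measurable borel"
  shows "ft w \<in> borel_measurable borel"
  unfolding ft_def by measurable

lemma norm_ft_le: "norm (ft w \<xi>) \<le> (\<integral>x. norm (w x) \<partial>lborel)" for w :: "real^'m::finite \<Rightarrow> complex"
proof -
  have "norm (ft w \<xi>) \<le> (\<integral>x. norm (w x * exp (- (\<i> * of_real (x \<bullet> \<xi>)))) \<partial>lborel)"
    unfolding ft_def by (rule integral_norm_bound)
  then show ?thesis by (simp add: norm_mult)
qed

text \<open>Fourier inversion in the form in which it is used. The superposition of the oscillating integrals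
  holds exactly for the regularized inverse transform, where Fubini is available; the bound is
  uniform in the regularization and passes to the limit. The factor \<open>(2 \<pi>)\<^bsup>-m\<^esup>\<close> of the inversion
  formula is at most \<open>1\<close> and is dropped.\<close>

lemma norm_fourier_integral_composition_le:
  fixes w :: "real^'m::finite \<Rightarrow> complex" and f :: "real^'n::finite \<Rightarrow> real^'m"
  assumes w: "integrable lborel w" "continuous_on UNIV w" "\<And>y. norm (w y) \<le> S"
    and U: "open U" and K: "compact K" "K \<subseteq> U"
    and a: "continuous_on U a" "\<And>x. x \<in> U - K \<Longrightarrow> a x = 0" and f: "continuous_on U f"
    and B: "integrable lborel B"
      "\<And>\<eta>. norm (ft w \<eta> * (LINT x:U|lborel. a x * exp (\<i> * of_real (f x \<bullet> \<eta> - x \<bullet> \<xi>)))) \<le> B \<eta>"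
  shows "norm (LINT x:U|lborel. a x * w (f x) * exp (- (\<i> * of_real (x \<bullet> \<xi>)))) \<le> (\<integral>\<eta>. B \<eta> \<partial>lborel)"
proof -
  define A where "A x = indicator U x *\<^sub>R a x" for x
  define F where "F x = indicator U x *\<^sub>R f x" for x
  have [measurable]: "A \<in> borel_measurable borel" "F \<in> borel_measurable borel"
    unfolding A_def F_def using U a(1) f by (auto intro!: borel_measurable_continuous_on_indicator)
  have [measurable]: "w \<in> borel_measurable borel" using w by (auto simp: integrable_iff_bounded)
  have A: "integrable lborel A"
    using set_integrable_compact_support[OF K a] by (simp add: A_def[abs_def] set_integrable_def)
  define e where "e x = exp (- (\<i> * complex_of_real (x \<bullet> \<xi>)))" for x :: "real^'n"
  have e1: "norm (e x) = 1" for x by (simp add: e_def)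
  have [measurable]: "e \<in> borel_measurable borel" unfolding e_def by measurable
  define W where "W = (\<integral>x. norm (w x) \<partial>lborel)"
  define d where "d k = 1 / real (Suc k)" for k
  have d: "d k > 0" for k by (simp add: d_def)
  define T where "T k = (\<integral>x. A x * gauss_reg w (d k) (F x) * e x \<partial>lborel)" for k
  have Tle: "norm (T k) \<le> (\<integral>\<eta>. B \<eta> \<partial>lborel)" for k
  proof -
    define G where "G \<eta> = exp (- (norm (d k *\<^sub>R \<eta>))\<^sup>2 / 2)" for \<eta> :: "real^'m"
    have G: "integrable lborel G" unfolding G_def by (rule gaussian_scaled_integrable[OF d])
    have [measurable]: "G \<in> borel_measurable borel" using G by (auto simp: integrable_iff_bounded)
    have "T k = (\<integral>x. (\<integral>\<eta>. A x * e x * (ft w \<eta> * exp (\<i> * of_real (F x \<bullet> \<eta>)) * of_real (G \<eta>)) \<partial>lborel) \<partial>lborel)"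
      unfolding T_def gauss_reg_def G_def[symmetric] integral_mult_right_zero by (simp add: mult_ac)
    also have "\<dots> = (\<integral>\<eta>. (\<integral>x. A x * e x * (ft w \<eta> * exp (\<i> * of_real (F x \<bullet> \<eta>)) * of_real (G \<eta>)) \<partial>lborel) \<partial>lborel)"
    proof (rule fubini_dominated[where A="\<lambda>x. norm (A x)" and B="\<lambda>\<eta>. W * G \<eta>"])
      show "norm (A x * e x * (ft w \<eta> * exp (\<i> * of_real (F x \<bullet> \<eta>)) * of_real (G \<eta>))) \<le> norm (A x) * (W * G \<eta>)" for x \<eta>
        using norm_ft_le[of w \<eta>] by (auto simp: norm_mult e1 W_def G_def intro!: mult_mono)
    qed (use A G in auto)
    also have "norm \<dots> \<le> (\<integral>\<eta>. B \<eta> \<partial>lborel)"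
    proof (rule norm_integral_le_dominating[OF B(1)])
      fix \<eta>
      have "(\<integral>x. A x * e x * (ft w \<eta> * exp (\<i> * of_real (F x \<bullet> \<eta>)) * of_real (G \<eta>)) \<partial>lborel) =
          (\<integral>x. of_real (G \<eta>) * ft w \<eta> * (indicator U x *\<^sub>R (a x * exp (\<i> * of_real (f x \<bullet> \<eta> - x \<bullet> \<xi>)))) \<partial>lborel)"
        by (intro Bochner_Integration.integral_cong refl)
          (auto simp: A_def F_def e_def indicator_def right_diff_distrib exp_diff exp_minus divide_inverse)
      also have "\<dots> = of_real (G \<eta>) * (ft w \<eta> * (LINT x:U|lborel. a x * exp (\<i> * of_real (f x \<bullet> \<eta> - x \<bullet> \<xi>))))"
        unfolding set_lebesgue_integral_def by (subst integral_mult_right_zero) (simp only: mult.assoc)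
      also have "norm \<dots> \<le> 1 * B \<eta>"
        unfolding norm_mult[of "of_real (G \<eta>)"] using B(2)[of \<eta>] by (intro mult_mono) (auto simp: G_def)
      finally show "norm (\<integral>x. A x * e x * (ft w \<eta> * exp (\<i> * of_real (F x \<bullet> \<eta>)) * of_real (G \<eta>)) \<partial>lborel) \<le> B \<eta>"
        by simp
    qed
    finally show ?thesis .
  qed
  have "T \<longlonglongrightarrow> (\<integral>x. A x * (of_real ((2 * pi) ^ CARD('m)) * w (F x)) * e x \<partial>lborel)"
    unfolding T_def
  proof (rule integral_dominated_convergence[where w="\<lambda>x. norm (A x) * ((2 * pi) ^ CARD('m) * S)"])
    show "integrable lborel (\<lambda>x. norm (A x) * ((2 * pi) ^ CARD('m) * S))"
      using A by (intro integrable_mult_left integrable_norm)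
    show "AE x in lborel. (\<lambda>k. A x * gauss_reg w (d k) (F x) * e x)
        \<longlonglongrightarrow> A x * (of_real ((2 * pi) ^ CARD('m)) * w (F x)) * e x"
      unfolding d_def by (intro AE_I2 tendsto_intros gauss_reg_tendsto[OF w])
    show "AE x in lborel. norm (A x * gauss_reg w (d k) (F x) * e x) \<le> norm (A x) * ((2 * pi) ^ CARD('m) * S)" for k
      using gauss_reg_bound[OF w(1,3) d]
      by (intro AE_I2) (simp add: norm_mult e1 mult_left_mono del: of_real_power)
  qed (simp_all add: gauss_reg_def)
  then have "norm (\<integral>x. A x * (of_real ((2 * pi) ^ CARD('m)) * w (F x)) * e x \<partial>lborel) \<le> (\<integral>\<eta>. B \<eta> \<partial>lborel)"
    by (intro LIMSEQ_le_const2[OF tendsto_norm]) (use Tle in auto)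
  moreover have "(\<integral>x. A x * (of_real ((2 * pi) ^ CARD('m)) * w (F x)) * e x \<partial>lborel) =
      of_real ((2 * pi) ^ CARD('m)) * (LINT x:U|lborel. a x * w (f x) * exp (- (\<i> * of_real (x \<bullet> \<xi>))))"
    unfolding set_lebesgue_integral_def
    by (subst integral_mult_right_zero[symmetric], intro Bochner_Integration.integral_cong refl)
      (auto simp: A_def F_def e_def indicator_def)
  moreover have "1 \<le> (2 * pi) ^ CARD('m)"
    using pi_gt3 by (intro one_le_power) simp
  ultimately have "(2 * pi) ^ CARD('m) * norm (LINT x:U|lborel. a x * w (f x) * exp (- (\<i> * of_real (x \<bullet> \<xi>)))) \<le> (\<integral>\<eta>. B \<eta> \<partial>lborel)"
    by (simp add: norm_mult norm_power)
  moreover have "1 * norm (LINT x:U|lborel. a x * w (f x) * exp (- (\<i> * of_real (x \<bullet> \<xi>)))) \<le>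
      (2 * pi) ^ CARD('m) * norm (LINT x:U|lborel. a x * w (f x) * exp (- (\<i> * of_real (x \<bullet> \<xi>))))"
    using \<open>1 \<le> (2 * pi) ^ CARD('m)\<close> by (intro mult_right_mono) auto
  ultimately show ?thesis by simp
qed

section \<open>Moderate and slow-scale nets of gauges\<close>

text \<open>A variant of slow scale in which the range of admissible \<open>\<epsilon>\<close> may depend on the power. It is
  implied by slow scale and is stable under all the operations that are needed, without any
  bookkeeping of thresholds.\<close>

definition slow_net :: "(real \<Rightarrow> real) \<Rightarrow> bool" where
  "slow_net g \<longleftrightarrow> (\<forall>t::nat. \<exists>C. \<forall>\<^sub>F \<epsilon> in at_right 0. \<bar>g \<epsilon>\<bar> ^ t \<le> C / \<epsilon>)"

definition moderate_net :: "(real \<Rightarrow> real) \<Rightarrow> bool" where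
  "moderate_net g \<longleftrightarrow> (\<exists>p C. \<forall>\<^sub>F \<epsilon> in at_right 0. \<bar>g \<epsilon>\<bar> \<le> C * \<epsilon> powr (- p))"

lemma eventually_at_right_0: "\<forall>\<^sub>F \<epsilon> in at_right 0. (0::real) < \<epsilon> \<and> \<epsilon> \<le> 1"
  unfolding eventually_at_right_field by (rule exI[of _ 1]) auto

lemma slow_netD: "slow_net g \<Longrightarrow> \<exists>C. \<forall>\<^sub>F \<epsilon> in at_right 0. \<bar>g \<epsilon>\<bar> \<le> C / \<epsilon>"
  unfolding slow_net_def by (drule spec[of _ 1]) simp

lemma slow_net_const: "slow_net (\<lambda>_. c)"
  unfolding slow_net_def
proof
  fix t :: nat
  have "\<forall>\<^sub>F \<epsilon> in at_right 0. \<bar>c\<bar> ^ t \<le> \<bar>c\<bar> ^ t / \<epsilon>"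
    using eventually_at_right_0
    by eventually_elim (simp add: field_simps mult_left_le_one_le)
  then show "\<exists>C. \<forall>\<^sub>F \<epsilon> in at_right 0. \<bar>c\<bar> ^ t \<le> C / \<epsilon>" by blast
qed

text \<open>\<open>(g h)\<^sup>t\<close> is controlled by the powers \<open>2 t\<close> of both factors, since \<open>x y \<le> (x\<^sup>2 + y\<^sup>2) / 2\<close>.\<close>

lemma slow_net_mult:
  assumes "slow_net g" "slow_net h"
  shows "slow_net (\<lambda>\<epsilon>. g \<epsilon> * h \<epsilon>)"
  unfolding slow_net_def
proof
  fix t :: nat
  obtain C D where "\<forall>\<^sub>F \<epsilon> in at_right 0. \<bar>g \<epsilon>\<bar> ^ (2 * t) \<le> C / \<epsilon>" "\<forall>\<^sub>F \<epsilon> in at_right 0. \<bar>h \<epsilon>\<bar> ^ (2 * t) \<le> D / \<epsilon>"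
    using assms unfolding slow_net_def by meson
  then have "\<forall>\<^sub>F \<epsilon> in at_right 0. \<bar>g \<epsilon> * h \<epsilon>\<bar> ^ t \<le> (C + D) / \<epsilon>"
  proof eventually_elim
    case (elim \<epsilon>)
    have "2 * (\<bar>g \<epsilon>\<bar> ^ t * \<bar>h \<epsilon>\<bar> ^ t) \<le> (\<bar>g \<epsilon>\<bar> ^ t)\<^sup>2 + (\<bar>h \<epsilon>\<bar> ^ t)\<^sup>2"
      using sum_squares_bound[of "\<bar>g \<epsilon>\<bar> ^ t" "\<bar>h \<epsilon>\<bar> ^ t"] by simp
    moreover have "(\<bar>g \<epsilon>\<bar> ^ t)\<^sup>2 = \<bar>g \<epsilon>\<bar> ^ (2 * t)" "(\<bar>h \<epsilon>\<bar> ^ t)\<^sup>2 = \<bar>h \<epsilon>\<bar> ^ (2 * t)"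
      by (simp_all add: power_mult[symmetric] mult.commute)
    moreover have "0 \<le> \<bar>g \<epsilon>\<bar> ^ t * \<bar>h \<epsilon>\<bar> ^ t" by simp
    ultimately have "\<bar>g \<epsilon>\<bar> ^ t * \<bar>h \<epsilon>\<bar> ^ t \<le> C / \<epsilon> + D / \<epsilon>" using elim by linarith
    then show ?case by (simp add: abs_mult power_mult_distrib add_divide_distrib)
  qed
  then show "\<exists>C. \<forall>\<^sub>F \<epsilon> in at_right 0. \<bar>g \<epsilon> * h \<epsilon>\<bar> ^ t \<le> C / \<epsilon>" by blast
qed

lemma slow_net_add:
  assumes "slow_net g" "slow_net h"
  shows "slow_net (\<lambda>\<epsilon>. g \<epsilon> + h \<epsilon>)"
  unfolding slow_net_def
proof
  fix t :: nat
  obtain C D where "\<forall>\<^sub>F \<epsilon> in at_right 0. \<bar>g \<epsilon>\<bar> ^ t \<le> C / \<epsilon>" "\<forall>\<^sub>F \<epsilon> in at_right 0. \<bar>h \<epsilon>\<bar> ^ t \<le> D / \<epsilon>"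
    using assms unfolding slow_net_def by meson
  then have "\<forall>\<^sub>F \<epsilon> in at_right 0. \<bar>g \<epsilon> + h \<epsilon>\<bar> ^ t \<le> (2 ^ t * (C + D)) / \<epsilon>"
  proof eventually_elim
    case (elim \<epsilon>)
    let ?m = "max \<bar>g \<epsilon>\<bar> \<bar>h \<epsilon>\<bar>"
    have "\<bar>g \<epsilon> + h \<epsilon>\<bar> ^ t \<le> (2 * ?m) ^ t" by (intro power_mono) auto
    also have "\<dots> = 2 ^ t * ?m ^ t" by (simp add: power_mult_distrib)
    also have "?m ^ t \<le> \<bar>g \<epsilon>\<bar> ^ t + \<bar>h \<epsilon>\<bar> ^ t" by (auto simp: max_def)
    also have "\<dots> \<le> C / \<epsilon> + D / \<epsilon>" using elim by linarith
    finally show ?case by (simp add: add_divide_distrib distrib_left)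
  qed
  then show "\<exists>C. \<forall>\<^sub>F \<epsilon> in at_right 0. \<bar>g \<epsilon> + h \<epsilon>\<bar> ^ t \<le> C / \<epsilon>" by blast
qed

lemma slow_net_abs: "slow_net g \<Longrightarrow> slow_net (\<lambda>\<epsilon>. \<bar>g \<epsilon>\<bar>)"
  by (simp add: slow_net_def)

lemma slow_scale_slow_net:
  assumes "slow_scale l"
  shows "slow_net l"
  unfolding slow_net_def
proof
  fix t :: nat
  obtain e where e: "e \<in> {0<..1}" "\<forall>t\<ge>0. \<exists>C>0. \<forall>\<epsilon>. 0 < \<epsilon> \<and> \<epsilon> < e \<longrightarrow> \<bar>l \<epsilon>\<bar> powr t \<le> C * inverse \<epsilon>"
    using assms unfolding slow_scale_def by blast
  obtain C where C: "\<And>\<epsilon>. 0 < \<epsilon> \<Longrightarrow> \<epsilon> < e \<Longrightarrow> \<bar>l \<epsilon>\<bar> powr real t \<le> C * inverse \<epsilon>"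
    using e(2)[rule_format, of "real t"] by auto
  have ev: "\<forall>\<^sub>F \<epsilon> in at_right 0. 0 < \<epsilon> \<and> \<epsilon> < e"
    unfolding eventually_at_right_field using e(1) by auto
  show "\<exists>C. \<forall>\<^sub>F \<epsilon> in at_right 0. \<bar>l \<epsilon>\<bar> ^ t \<le> C / \<epsilon>"
  proof (cases "t = 0")
    case True
    then show ?thesis using slow_net_const[of 1] unfolding slow_net_def by simp
  next
    case False
    then have "\<bar>l \<epsilon>\<bar> ^ t = \<bar>l \<epsilon>\<bar> powr real t" for \<epsilon>
      by (cases "l \<epsilon> = 0") (auto simp: powr_realpow)
    then have "\<forall>\<^sub>F \<epsilon> in at_right 0. \<bar>l \<epsilon>\<bar> ^ t \<le> C / \<epsilon>"
      using ev by (auto simp: divide_inverse C elim: eventually_mono)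
    then show ?thesis by blast
  qed
qed

lemma moderate_net_const: "moderate_net (\<lambda>_. c)"
proof -
  have "\<forall>\<^sub>F \<epsilon> in at_right 0. \<bar>c\<bar> \<le> \<bar>c\<bar> * \<epsilon> powr (- 0)"
    using eventually_at_right_0 by eventually_elim auto
  then show ?thesis unfolding moderate_net_def by blast
qed

lemma moderate_net_mult:
  assumes "moderate_net g" "moderate_net h"
  shows "moderate_net (\<lambda>\<epsilon>. g \<epsilon> * h \<epsilon>)"
proof -
  obtain p C q D where "\<forall>\<^sub>F \<epsilon> in at_right 0. \<bar>g \<epsilon>\<bar> \<le> C * \<epsilon> powr (- p)" "\<forall>\<^sub>F \<epsilon> in at_right 0. \<bar>h \<epsilon>\<bar> \<le> D * \<epsilon> powr (- q)"
    using assms unfolding moderate_net_def by meson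
  then have "\<forall>\<^sub>F \<epsilon> in at_right 0. \<bar>g \<epsilon> * h \<epsilon>\<bar> \<le> (C * D) * \<epsilon> powr (- (p + q))"
    using eventually_at_right_0
  proof eventually_elim
    case (elim \<epsilon>)
    have "\<bar>g \<epsilon>\<bar> * \<bar>h \<epsilon>\<bar> \<le> (C * \<epsilon> powr (- p)) * (D * \<epsilon> powr (- q))"
      using elim by (intro mult_mono) auto
    then show ?case by (simp add: abs_mult powr_add[symmetric] mult_ac)
  qed
  then show ?thesis unfolding moderate_net_def by blast
qed

lemma powr_neg_mono: "0 < \<epsilon> \<Longrightarrow> \<epsilon> \<le> 1 \<Longrightarrow> p \<le> q \<Longrightarrow> \<epsilon> powr (- p) \<le> (\<epsilon>::real) powr (- q)"
  by (intro powr_mono') auto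

lemma moderate_net_add:
  assumes "moderate_net g" "moderate_net h"
  shows "moderate_net (\<lambda>\<epsilon>. g \<epsilon> + h \<epsilon>)"
proof -
  obtain p C q D where "\<forall>\<^sub>F \<epsilon> in at_right 0. \<bar>g \<epsilon>\<bar> \<le> C * \<epsilon> powr (- p)" "\<forall>\<^sub>F \<epsilon> in at_right 0. \<bar>h \<epsilon>\<bar> \<le> D * \<epsilon> powr (- q)"
    using assms unfolding moderate_net_def by meson
  then have "\<forall>\<^sub>F \<epsilon> in at_right 0. \<bar>g \<epsilon> + h \<epsilon>\<bar> \<le> (\<bar>C\<bar> + \<bar>D\<bar>) * \<epsilon> powr (- max p q)"
    using eventually_at_right_0
  proof eventually_elim
    case (elim \<epsilon>)
    have "C * \<epsilon> powr (- p) \<le> \<bar>C\<bar> * \<epsilon> powr (- max p q)" "D * \<epsilon> powr (- q) \<le> \<bar>D\<bar> * \<epsilon> powr (- max p q)"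
      using elim by (auto intro!: mult_mono powr_neg_mono)
    then have "\<bar>g \<epsilon>\<bar> + \<bar>h \<epsilon>\<bar> \<le> (\<bar>C\<bar> + \<bar>D\<bar>) * \<epsilon> powr (- max p q)"
      using elim unfolding distrib_right by linarith
    then show ?case using abs_triangle_ineq[of "g \<epsilon>" "h \<epsilon>"] by linarith
  qed
  then show ?thesis unfolding moderate_net_def by blast
qed

lemma moderate_net_abs: "moderate_net g \<Longrightarrow> moderate_net (\<lambda>\<epsilon>. \<bar>g \<epsilon>\<bar>)"
  by (simp add: moderate_net_def)

text \<open>Gauges that depend on the index only through \<open>\<epsilon>\<close>, extracted from an index \<open>i\<close> by \<open>e\<close>. Bounds are
  thereby uniform in \<open>x\<close> and in any further parameter contained in \<open>i\<close>.\<close>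

definition net_gauges :: "((real \<Rightarrow> real) \<Rightarrow> bool) \<Rightarrow> ('i \<Rightarrow> real) \<Rightarrow> ('i \<Rightarrow> real^'n::finite \<Rightarrow> real) set" where
  "net_gauges P e = {r. \<exists>g. P g \<and> r = (\<lambda>i _. g (e i))}"

lemma net_gauges_iff: "(\<lambda>i _. g (e i)) \<in> net_gauges P e" if "P g"
  using that by (auto simp: net_gauges_def)

lemma bex_net_gauges: "(\<exists>r\<in>net_gauges P e. Q r) \<longleftrightarrow> (\<exists>g. P g \<and> Q (\<lambda>i _. g (e i)))"
  by (auto simp: net_gauges_def)

definition net_class :: "((real \<Rightarrow> real) \<Rightarrow> bool) \<Rightarrow> bool" where
  "net_class P \<longleftrightarrow> (\<forall>c. P (\<lambda>_. c)) \<and> (\<forall>g. P g \<longrightarrow> P (\<lambda>\<epsilon>. \<bar>g \<epsilon>\<bar>)) \<and>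
     (\<forall>g h. P g \<longrightarrow> P h \<longrightarrow> P (\<lambda>\<epsilon>. g \<epsilon> + h \<epsilon>) \<and> P (\<lambda>\<epsilon>. g \<epsilon> * h \<epsilon>))"

lemma net_class_slow: "net_class slow_net"
  unfolding net_class_def using slow_net_const slow_net_abs slow_net_add slow_net_mult by blast

lemma net_class_moderate: "net_class moderate_net"
  unfolding net_class_def
  using moderate_net_const moderate_net_abs moderate_net_add moderate_net_mult by blast

lemma net_classD:
  assumes "net_class P"
  shows "P (\<lambda>_. c)" "P g \<Longrightarrow> P (\<lambda>\<epsilon>. \<bar>g \<epsilon>\<bar>)" "P g \<Longrightarrow> P h \<Longrightarrow> P (\<lambda>\<epsilon>. g \<epsilon> + h \<epsilon>)"
    "P g \<Longrightarrow> P h \<Longrightarrow> P (\<lambda>\<epsilon>. g \<epsilon> * h \<epsilon>)" "P g \<Longrightarrow> P (\<lambda>\<epsilon>. g \<epsilon> ^ n)"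
proof -
  note P = assms[unfolded net_class_def]
  show "P (\<lambda>_. c)" "P g \<Longrightarrow> P (\<lambda>\<epsilon>. \<bar>g \<epsilon>\<bar>)" "P g \<Longrightarrow> P h \<Longrightarrow> P (\<lambda>\<epsilon>. g \<epsilon> + h \<epsilon>)"
    "P g \<Longrightarrow> P h \<Longrightarrow> P (\<lambda>\<epsilon>. g \<epsilon> * h \<epsilon>)"
    using P by blast+
  show "P g \<Longrightarrow> P (\<lambda>\<epsilon>. g \<epsilon> ^ n)"
    using P by (induction n) auto
qed

lemma gauge_nets:
  assumes P: "net_class P" and "\<forall>\<^sub>F i in F. open (X i)"
  shows "gauge F X (net_gauges P e)"
proof
  show "(\<lambda>i x. r i x + s i x) \<in> net_gauges P e" "(\<lambda>i x. r i x * s i x) \<in> net_gauges P e"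
    if "r \<in> net_gauges P e" "s \<in> net_gauges P e" for r s :: "'a \<Rightarrow> real^'b \<Rightarrow> real"
    using that net_gauges_iff[of P, OF net_classD(3)[OF P]] net_gauges_iff[of P, OF net_classD(4)[OF P]]
    unfolding net_gauges_def by blast+
  show "(\<lambda>i x. \<bar>r i x\<bar>) \<in> net_gauges P e"
    if "r \<in> net_gauges P e" for r :: "'a \<Rightarrow> real^'b \<Rightarrow> real"
    using that net_gauges_iff[of P, OF net_classD(2)[OF P]] unfolding net_gauges_def by blast
  show "(\<lambda>_ _. c) \<in> net_gauges P e" for c
    using net_gauges_iff[of P, OF net_classD(1)[OF P, of c]] .
qed (rule assms)

lemma gauge_UNIV:
  assumes "\<forall>\<^sub>F i in F. open (X i)"
  shows "gauge F X UNIV"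
  using assms by unfold_locales auto

lemma (in gauge) tame_iff:
  "tame a \<longleftrightarrow> (\<forall>\<alpha>. (\<exists>r\<in>R. \<forall>\<^sub>F i in F. \<forall>x\<in>X i. norm (partial_derivs \<alpha> (a i) x) \<le> r i x) \<and>
     (\<forall>\<^sub>F i in F. \<forall>x\<in>X i. partial_derivs \<alpha> (a i) differentiable (at x)))"
proof
  assume a: "tame a"
  show "\<forall>\<alpha>. (\<exists>r\<in>R. \<forall>\<^sub>F i in F. \<forall>x\<in>X i. norm (partial_derivs \<alpha> (a i) x) \<le> r i x) \<and>
     (\<forall>\<^sub>F i in F. \<forall>x\<in>X i. partial_derivs \<alpha> (a i) differentiable (at x))"
    using tame_bdd[OF tame_partial_derivs[OF a]] tame_evdiff[OF tame_partial_derivs[OF a]]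
    unfolding bdd_def evdiff_def by blast
qed (intro tameI, auto simp: bdd_def evdiff_def)

lemma tame_net_iff:
  assumes "net_class P" "\<forall>\<^sub>F \<epsilon> in at_right 0. open (X \<epsilon>)"
  shows "gauge.tame (at_right 0) X (net_gauges P (\<lambda>\<epsilon>. \<epsilon>)) a \<longleftrightarrow>
    (\<forall>\<alpha>. (\<exists>r. P r \<and> (\<forall>\<^sub>F \<epsilon> in at_right 0. \<forall>x\<in>X \<epsilon>. norm (partial_derivs \<alpha> (a \<epsilon>) x) \<le> r \<epsilon>)) \<and>
     (\<forall>\<^sub>F \<epsilon> in at_right 0. \<forall>x\<in>X \<epsilon>. partial_derivs \<alpha> (a \<epsilon>) differentiable (at x)))"
  unfolding gauge.tame_iff[OF gauge_nets[OF assms]] bex_net_gauges ..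

text \<open>Families indexed by \<open>\<epsilon>\<close> and by further parameters ranging over a set depending on \<open>\<epsilon>\<close>.\<close>

definition param_filter :: "(real \<times> 'p) set \<Rightarrow> (real \<times> 'p) filter" where
  "param_filter S = inf (filtercomap fst (at_right 0)) (principal S)"

lemma eventually_param_filter:
  "eventually Q (param_filter S) \<longleftrightarrow> (\<forall>\<^sub>F \<epsilon> in at_right 0. \<forall>p. (\<epsilon>, p) \<in> S \<longrightarrow> Q (\<epsilon>, p))"
  unfolding param_filter_def eventually_inf_principal eventually_filtercomap
  by (auto elim: eventually_mono)

lemma eventually_param_filterI:
  "\<forall>\<^sub>F \<epsilon> in at_right 0. P \<epsilon> \<Longrightarrow> (\<And>\<epsilon> p. P \<epsilon> \<Longrightarrow> (\<epsilon>, p) \<in> S \<Longrightarrow> Q (\<epsilon>, p)) \<Longrightarrow> eventually Q (param_filter S)"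
  unfolding eventually_param_filter by (auto elim: eventually_mono)

abbreviation tame_net :: "((real \<Rightarrow> real) \<Rightarrow> bool) \<Rightarrow> (real \<Rightarrow> (real^'n::finite) set) \<Rightarrow> (real \<Rightarrow> real^'n \<Rightarrow> 'b::real_normed_vector) \<Rightarrow> bool" where
  "tame_net P X a \<equiv> gauge.tame (at_right 0) X (net_gauges P (\<lambda>\<epsilon>. \<epsilon>)) a"

text \<open>The set \<open>S\<close> singles out the admissible parameters for each \<open>\<epsilon>\<close>. With \<open>(\<zeta>, \<eta>)\<close> as parameter, a
  single application of the method of non-stationary phase yields an estimate uniform in both
  frequencies.\<close>

abbreviation tame_param :: "((real \<Rightarrow> real) \<Rightarrow> bool) \<Rightarrow> (real \<times> 'p) set \<Rightarrow> (real \<Rightarrow> (real^'n::finite) set) \<Rightarrow> (real \<times> 'p \<Rightarrow> real^'n \<Rightarrow> 'b::real_normed_vector) \<Rightarrow> bool" where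
  "tame_param P S X a \<equiv> gauge.tame (param_filter S) (\<lambda>i. X (fst i)) (net_gauges P fst) a"

lemma gauge_net:
  "net_class P \<Longrightarrow> \<forall>\<^sub>F \<epsilon> in at_right 0. open (X \<epsilon>) \<Longrightarrow> gauge (at_right 0) X (net_gauges P (\<lambda>\<epsilon>. \<epsilon>))"
  by (rule gauge_nets)

lemma gauge_param:
  "net_class P \<Longrightarrow> \<forall>\<^sub>F \<epsilon> in at_right 0. open (X \<epsilon>) \<Longrightarrow>
    gauge (param_filter S) (\<lambda>i. X (fst i)) (net_gauges P fst)"
  by (rule gauge_nets) (auto intro: eventually_param_filterI)

lemma tame_param_lift:
  assumes "gauge (at_right 0) X (net_gauges P (\<lambda>\<epsilon>. \<epsilon>))" "gauge (param_filter S) (\<lambda>i. X (fst i)) (net_gauges P fst)"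
    and "tame_net P X a"
  shows "tame_param P S X (\<lambda>i. a (fst i))"
  unfolding gauge.tame_iff[OF assms(2)]
proof (intro allI conjI)
  fix \<alpha>
  obtain g where g: "P g" "\<forall>\<^sub>F \<epsilon> in at_right 0. \<forall>x\<in>X \<epsilon>. norm (partial_derivs \<alpha> (a \<epsilon>) x) \<le> g \<epsilon>"
    using assms(3)[unfolded gauge.tame_iff[OF assms(1)] bex_net_gauges] by blast
  show "\<exists>r\<in>net_gauges P fst. \<forall>\<^sub>F i in param_filter S. \<forall>x\<in>X (fst i). norm (partial_derivs \<alpha> (a (fst i)) x) \<le> r i x"
    unfolding bex_net_gauges
    by (intro exI[of _ g] conjI g(1)) (rule eventually_param_filterI[OF g(2)], simp)
  have "\<forall>\<^sub>F \<epsilon> in at_right 0. \<forall>x\<in>X \<epsilon>. partial_derivs \<alpha> (a \<epsilon>) differentiable (at x)"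
    using assms(3)[unfolded gauge.tame_iff[OF assms(1)]] by blast
  then show "\<forall>\<^sub>F i in param_filter S. \<forall>x\<in>X (fst i). partial_derivs \<alpha> (a (fst i)) differentiable (at x)"
    by (rule eventually_param_filterI) simp
qed

section \<open>The microlocal estimate\<close>

lemma transp_jacobian_nth:
  assumes "f \<epsilon> differentiable (at x)"
  shows "transp_jacobian f \<epsilon> x \<eta> $ j = partial_deriv j (f \<epsilon>) x \<bullet> \<eta>"
proof -
  have "transp_jacobian f \<epsilon> x \<eta> $ j = (\<Sum>k\<in>UNIV. (jacobian (f \<epsilon>) (at x) $ k $ j) * \<eta> $ k)"
    by (simp add: transp_jacobian_def matrix_vector_mult_def transpose_def)
  also have "\<dots> = (\<Sum>k\<in>UNIV. partial_deriv j (f \<epsilon>) x $ k * \<eta> $ k)"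
    by (simp add: jacobian_def matrix_def partial_deriv_frechet[OF assms])
  finally show ?thesis by (simp add: inner_vec_def)
qed

lemma transp_jacobian_scaleR: "transp_jacobian f \<epsilon> x (c *\<^sub>R \<eta>) = c *\<^sub>R transp_jacobian f \<epsilon> x \<eta>"
  by (simp add: transp_jacobian_def matrix_vector_mult_scaleR)

text \<open>The phase \<open>f\<^sub>\<epsilon>(x) \<bullet> \<eta> - x \<bullet> \<zeta>\<close> is rescaled by \<open>|\<zeta>| + |\<eta>|\<close>. Its gradient is then
  linear in parameters of norm at most \<open>1\<close>, so that it is as tame as \<open>f\<close>, and it is bounded away from zero by
  \<open>1 / \<tau>\<^sub>\<epsilon>\<close>. The pairs \<open>(\<zeta>, \<eta>)\<close> with this property serve as further parameters.\<close>

lemma nonstationary_phase_composition: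
  fixes f :: "real \<Rightarrow> real^'n::finite \<Rightarrow> real^'m::finite" and a :: "real \<Rightarrow> real^'n \<Rightarrow> complex"
  assumes P: "net_class P" and U: "\<forall>\<^sub>F \<epsilon> in at_right 0. open (U \<epsilon>)"
    and K: "\<forall>\<^sub>F \<epsilon> in at_right 0. compact (K \<epsilon>) \<and> K \<epsilon> \<subseteq> U \<epsilon> \<and> measure lborel (K \<epsilon>) \<le> V"
    and a: "tame_net P U a" "\<forall>\<^sub>F \<epsilon> in at_right 0. \<forall>x\<in>U \<epsilon> - K \<epsilon>. a \<epsilon> x = 0"
    and f: "tame_net P U f"
    and \<tau>: "P \<tau>"
  shows "\<exists>r. P r \<and> (\<forall>\<^sub>F \<epsilon> in at_right 0. \<forall>\<zeta> \<eta>. norm \<zeta> + norm \<eta> > 0 \<longrightarrow>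
      (\<forall>x\<in>U \<epsilon>. norm \<zeta> + norm \<eta> \<le> \<tau> \<epsilon> * norm (transp_jacobian f \<epsilon> x \<eta> - \<zeta>)) \<longrightarrow>
      (norm \<zeta> + norm \<eta>) ^ p * norm (LINT x:U \<epsilon>|lborel. a \<epsilon> x * exp (\<i> * of_real (f \<epsilon> x \<bullet> \<eta> - x \<bullet> \<zeta>))) \<le> r \<epsilon>)"
proof -
  define S where "S = {(\<epsilon>, \<zeta>, \<eta>). norm \<zeta> + norm \<eta> > 0 \<and>
      (\<forall>x\<in>U \<epsilon>. norm \<zeta> + norm \<eta> \<le> \<tau> \<epsilon> * norm (transp_jacobian f \<epsilon> x \<eta> - \<zeta>))}"
  define \<rho> where "\<rho> = (\<lambda>(\<epsilon>::real, \<zeta>::real^'n, \<eta>::real^'m). norm \<zeta> + norm \<eta>)"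
  define \<theta> where "\<theta> = (\<lambda>(\<epsilon>, \<zeta>, \<eta>) x. f \<epsilon> x \<bullet> \<eta> - x \<bullet> \<zeta>)"
  define t where "t j i x = complex_of_real (partial_deriv j (f (fst i)) x \<bullet> (snd (snd i) /\<^sub>R \<rho> i) - (fst (snd i) $ j) / \<rho> i)"
    for j i x
  interpret g: gauge "at_right 0" U "net_gauges P (\<lambda>\<epsilon>. \<epsilon>)"
    by (rule gauge_net[OF P U])
  interpret G: gauge "param_filter S" "\<lambda>i. U (fst i)" "net_gauges P fst"
    by (rule gauge_param[OF P U])
  have lift: "G.tame (\<lambda>i. b (fst i))" if "g.tame b" for b :: "real \<Rightarrow> real^'n \<Rightarrow> 'b::real_normed_vector"
    by (rule tame_param_lift[OF g.gauge_axioms G.gauge_axioms that])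
  have inS: "eventually (\<lambda>i. i \<in> S) (param_filter S)"
    unfolding eventually_param_filter by simp
  have bdd1: "G.bdd (\<lambda>i _. c i)" if "\<And>i. i \<in> S \<Longrightarrow> norm (c i) \<le> 1" for c :: "real \<times> (real^'n) \<times> (real^'m) \<Rightarrow> 'b::real_normed_vector"
  proof -
    have "eventually (\<lambda>i. \<forall>x\<in>U (fst i). norm (c i) \<le> 1) (param_filter S)"
      using inS by eventually_elim (simp add: that)
    then show ?thesis unfolding G.bdd_def using G.gauge_const[of 1] by (intro bexI[of _ "\<lambda>_ _. 1"]) auto
  qed
  have t: "G.tame (t j)" for j
    unfolding t_def
  proof (intro G.tame_bounded_linear[OF bounded_linear_of_real] G.tame_diff
      G.tame_bilinear[OF bounded_bilinear_inner] G.tame_const bdd1)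
    show "G.tame (\<lambda>i. partial_deriv j (f (fst i)))"
      using lift[OF g.tame_partial_deriv[OF f]] .
    show "norm (snd (snd i) /\<^sub>R \<rho> i) \<le> 1" if "i \<in> S" for i
    proof -
      obtain \<epsilon> \<zeta> \<eta> where i: "i = (\<epsilon>, \<zeta>, \<eta>)" by (cases i) auto
      show ?thesis using that by (simp add: i S_def \<rho>_def divide_inverse_commute[symmetric])
    qed
    show "norm (fst (snd i) $ j / \<rho> i) \<le> 1" if "i \<in> S" for i
    proof -
      obtain \<epsilon> \<zeta> \<eta> where i: "i = (\<epsilon>, \<zeta>, \<eta>)" by (cases i) auto
      have "\<bar>\<zeta> $ j\<bar> \<le> norm \<zeta> + norm \<eta>"
        using component_le_norm_cart[of \<zeta> j] norm_ge_zero[of \<eta>] by linarith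
      then show ?thesis using that by (simp add: i S_def \<rho>_def)
    qed
  qed
  have fd: "\<forall>\<^sub>F \<epsilon> in at_right 0. \<forall>x\<in>U \<epsilon>. f \<epsilon> differentiable (at x)"
    using g.tame_evdiff[OF f] by (simp add: g.evdiff_def)
  have fdi: "eventually (\<lambda>i. \<forall>x\<in>U (fst i). f (fst i) differentiable (at x)) (param_filter S)"
    by (rule eventually_param_filterI[OF fd]) simp
  have tsum: "(\<Sum>j\<in>UNIV. t j i x * t j i x) =
      of_real ((norm (transp_jacobian f (fst i) x (snd (snd i)) - fst (snd i)) / \<rho> i)\<^sup>2)"
    if d: "f (fst i) differentiable (at x)" for i x
  proof -
    have "partial_deriv j (f (fst i)) x \<bullet> (snd (snd i) /\<^sub>R \<rho> i) - (fst (snd i) $ j) / \<rho> i =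
        (transp_jacobian f (fst i) x (snd (snd i)) - fst (snd i)) $ j / \<rho> i" for j
      using transp_jacobian_nth[of f "fst i" x "snd (snd i)" j] d
      by (simp add: inner_scaleR_right divide_inverse algebra_simps)
    then have "(\<Sum>j\<in>UNIV. t j i x * t j i x) =
        of_real (\<Sum>j\<in>UNIV. ((transp_jacobian f (fst i) x (snd (snd i)) - fst (snd i)) $ j / \<rho> i)\<^sup>2)"
      by (simp add: t_def power2_eq_square)
    also have "(\<Sum>j\<in>UNIV. ((transp_jacobian f (fst i) x (snd (snd i)) - fst (snd i)) $ j / \<rho> i)\<^sup>2) =
        (norm (transp_jacobian f (fst i) x (snd (snd i)) - fst (snd i)) / \<rho> i)\<^sup>2"
      unfolding power_divide power2_norm_eq_inner inner_vec_def sum_divide_distrib[symmetric]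
      by (simp add: power2_eq_square)
    finally show ?thesis .
  qed
  have lower: "1 \<le> \<tau> (fst i) * (norm (transp_jacobian f (fst i) x (snd (snd i)) - fst (snd i)) / \<rho> i)"
    if "i \<in> S" "x \<in> U (fst i)" for i x
    using that by (auto simp: S_def \<rho>_def field_simps split: prod.splits)
  have inv: "G.bdd (\<lambda>i x. inverse (\<Sum>j\<in>UNIV. t j i x * t j i x))"
    and nz: "\<forall>\<^sub>F i in param_filter S. \<forall>x\<in>U (fst i). (\<Sum>j\<in>UNIV. t j i x * t j i x) \<noteq> 0"
  proof -
    have "\<forall>\<^sub>F i in param_filter S. \<forall>x\<in>U (fst i). norm (inverse (\<Sum>j\<in>UNIV. t j i x * t j i x)) \<le> (\<tau> (fst i))\<^sup>2
        \<and> (\<Sum>j\<in>UNIV. t j i x * t j i x) \<noteq> 0"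
      using inS fdi
    proof eventually_elim
      case (elim i)
      show ?case
      proof
        fix x assume x: "x \<in> U (fst i)"
        define n where "n = norm (transp_jacobian f (fst i) x (snd (snd i)) - fst (snd i)) / \<rho> i"
        have l: "1 \<le> \<tau> (fst i) * n" using lower[OF elim(1) x] by (simp add: n_def)
        have "n \<noteq> 0" using l by auto
        have "1\<^sup>2 \<le> (\<tau> (fst i) * n)\<^sup>2" by (rule power_mono[OF l]) simp
        then have "inverse (n\<^sup>2) \<le> (\<tau> (fst i))\<^sup>2"
          using \<open>n \<noteq> 0\<close> by (simp add: field_simps power_mult_distrib)
        moreover have "(\<Sum>j\<in>UNIV. t j i x * t j i x) = of_real (n\<^sup>2)"
          unfolding n_def by (rule tsum) (use elim x in auto)
        ultimately show "norm (inverse (\<Sum>j\<in>UNIV. t j i x * t j i x)) \<le> (\<tau> (fst i))\<^sup>2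
            \<and> (\<Sum>j\<in>UNIV. t j i x * t j i x) \<noteq> 0"
          using \<open>n \<noteq> 0\<close> by (simp add: norm_inverse norm_power)
      qed
    qed
    then have A: "\<forall>\<^sub>F i in param_filter S. \<forall>x\<in>U (fst i). norm (inverse (\<Sum>j\<in>UNIV. t j i x * t j i x)) \<le> (\<tau> (fst i))\<^sup>2"
      and B: "\<forall>\<^sub>F i in param_filter S. \<forall>x\<in>U (fst i). (\<Sum>j\<in>UNIV. t j i x * t j i x) \<noteq> 0"
      by (auto elim: eventually_mono)
    show "\<forall>\<^sub>F i in param_filter S. \<forall>x\<in>U (fst i). (\<Sum>j\<in>UNIV. t j i x * t j i x) \<noteq> 0" by (rule B)
    show "G.bdd (\<lambda>i x. inverse (\<Sum>j\<in>UNIV. t j i x * t j i x))"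
      unfolding G.bdd_def bex_net_gauges
      by (intro exI[of _ "\<lambda>\<epsilon>. (\<tau> \<epsilon>)\<^sup>2"] conjI A net_classD(5)[OF P \<tau>])
  qed
  have "\<exists>r. (\<lambda>i (_::real^'n). r i) \<in> net_gauges P fst \<and> (\<forall>\<^sub>F i in param_filter S.
      norm (LINT x:U (fst i)|lborel. a (fst i) x * exp (\<i> * of_real (\<theta> i x))) \<le> r i * V / \<rho> i ^ p)"
  proof (rule G.nonstationary_phase[OF _ lift[OF a(1)] t inv nz, where K="\<lambda>i. K (fst i)"])
    show "\<exists>s. r = (\<lambda>i _. s i)" if "r \<in> net_gauges P fst" for r :: "real \<times> (real^'n) \<times> (real^'m) \<Rightarrow> real^'n \<Rightarrow> real"
      using that by (auto simp: net_gauges_def)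
    show "\<forall>\<^sub>F i in param_filter S. 0 < \<rho> i \<and> compact (K (fst i)) \<and> K (fst i) \<subseteq> U (fst i) \<and> measure lborel (K (fst i)) \<le> V"
      by (rule eventually_param_filterI[OF K]) (auto simp: S_def \<rho>_def)
    show "\<forall>\<^sub>F i in param_filter S. \<forall>x\<in>U (fst i) - K (fst i). a (fst i) x = 0"
      by (rule eventually_param_filterI[OF a(2)]) auto
    show "\<forall>\<^sub>F i in param_filter S. \<forall>x\<in>U (fst i). \<theta> i differentiable (at x) \<and>
        (\<forall>j. complex_of_real (partial_deriv j (\<theta> i) x) = of_real (\<rho> i) * t j i x)"
      using fdi inS
    proof eventually_elim
      case (elim i)
      obtain \<epsilon> \<zeta> \<eta> where i: "i = (\<epsilon>, \<zeta>, \<eta>)" by (cases i) auto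
      have \<rho>0: "\<rho> i > 0" using elim(2) by (auto simp: S_def \<rho>_def i)
      show ?case
      proof
        fix x assume x: "x \<in> U (fst i)"
        then obtain f' where f': "(f \<epsilon> has_derivative f') (at x)"
          using elim(1) by (auto simp: differentiable_def i)
        have th: "(\<theta> i has_derivative (\<lambda>v. f' v \<bullet> \<eta> - v \<bullet> \<zeta>)) (at x)"
          unfolding \<theta>_def i by (auto intro!: derivative_eq_intros f')
        have "complex_of_real (partial_deriv j (\<theta> i) x) = of_real (\<rho> i) * t j i x" for j
        proof -
          have "partial_deriv j (\<theta> i) x = partial_deriv j (f \<epsilon>) x \<bullet> \<eta> - \<zeta> $ j"
            using partial_deriv_has_derivative[OF th] partial_deriv_has_derivative[OF f']
            by (simp add: inner_commute inner_axis)
          also have "\<dots> = \<rho> i * (partial_deriv j (f (fst i)) x \<bullet> (snd (snd i) /\<^sub>R \<rho> i) - (fst (snd i) $ j) / \<rho> i)"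
            using \<rho>0 by (simp add: i field_simps inner_scaleR_right)
          finally show ?thesis by (simp add: t_def)
        qed
        then show "\<theta> i differentiable (at x) \<and>
            (\<forall>j. complex_of_real (partial_deriv j (\<theta> i) x) = of_real (\<rho> i) * t j i x)"
          using th by (auto simp: differentiable_def)
      qed
    qed
  qed
  then obtain r where rg: "(\<lambda>i (_::real^'n). r i) \<in> net_gauges P fst" and r: "\<forall>\<^sub>F i in param_filter S.
      norm (LINT x:U (fst i)|lborel. a (fst i) x * exp (\<i> * of_real (\<theta> i x))) \<le> r i * V / \<rho> i ^ p"
    by blast
  obtain h where h0: "P h" "(\<lambda>i (_::real^'n). r i) = (\<lambda>i _. h (fst i))"
    using rg unfolding net_gauges_def by blast
  have h: "P h" "r i = h (fst i)" for i
    using h0(1) fun_cong[OF fun_cong[OF h0(2), of i]] by simp_all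
  have "\<forall>\<^sub>F \<epsilon> in at_right 0. \<forall>\<zeta> \<eta>. norm \<zeta> + norm \<eta> > 0 \<longrightarrow>
      (\<forall>x\<in>U \<epsilon>. norm \<zeta> + norm \<eta> \<le> \<tau> \<epsilon> * norm (transp_jacobian f \<epsilon> x \<eta> - \<zeta>)) \<longrightarrow>
      (norm \<zeta> + norm \<eta>) ^ p * norm (LINT x:U \<epsilon>|lborel. a \<epsilon> x * exp (\<i> * of_real (f \<epsilon> x \<bullet> \<eta> - x \<bullet> \<zeta>))) \<le> h \<epsilon> * V"
    using r unfolding eventually_param_filter
  proof eventually_elim
    case (elim \<epsilon>)
    show ?case
    proof (intro allI impI)
      fix \<zeta> :: "real^'n" and \<eta> :: "real^'m"
      assume pos: "norm \<zeta> + norm \<eta> > 0"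
        and *: "\<forall>x\<in>U \<epsilon>. norm \<zeta> + norm \<eta> \<le> \<tau> \<epsilon> * norm (transp_jacobian f \<epsilon> x \<eta> - \<zeta>)"
      then have "(\<epsilon>, \<zeta>, \<eta>) \<in> S" by (simp add: S_def)
      with elim have "norm (LINT x:U \<epsilon>|lborel. a \<epsilon> x * exp (\<i> * of_real (f \<epsilon> x \<bullet> \<eta> - x \<bullet> \<zeta>))) \<le> h \<epsilon> * V / (norm \<zeta> + norm \<eta>) ^ p"
        by (auto simp: \<theta>_def \<rho>_def h(2))
      then show "(norm \<zeta> + norm \<eta>) ^ p * norm (LINT x:U \<epsilon>|lborel. a \<epsilon> x * exp (\<i> * of_real (f \<epsilon> x \<bullet> \<eta> - x \<bullet> \<zeta>))) \<le> h \<epsilon> * V"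
        using pos by (simp add: pos_le_divide_eq mult.commute)
    qed
  qed
  moreover have "P (\<lambda>\<epsilon>. h \<epsilon> * V)" by (intro net_classD[OF P] h)
  ultimately show ?thesis by blast
qed

text \<open>A fixed integrable weight on frequency space that is a product over the coordinates and is
  bounded below by a negative power of \<open>1 + |\<eta>|\<close>.\<close>

definition decay_weight :: "real^'m::finite \<Rightarrow> real" where
  "decay_weight \<eta> = (\<Prod>b\<in>Basis. inverse (1 + (\<eta> \<bullet> b)\<^sup>2))"

lemma decay_weight_integrable: "integrable lborel (decay_weight :: real^'m::finite \<Rightarrow> real)"
proof -
  have "integrable lborel (\<lambda>x::real. inverse (1 + x\<^sup>2))"
    using integrable_inverse_1_plus_square by (simp add: set_integrable_def)
  from lborel_integral_prod(1)[OF this] show ?thesis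
    unfolding decay_weight_def[abs_def] by simp
qed

lemma decay_weight_ge: "1 \<le> (1 + norm \<eta>) ^ (2 * CARD('m)) * decay_weight (\<eta> :: real^'m::finite)"
proof -
  have "(\<Prod>b\<in>(Basis :: (real^'m) set). 1) \<le> (\<Prod>b\<in>Basis. (1 + norm \<eta>)\<^sup>2 * inverse (1 + (\<eta> \<bullet> b)\<^sup>2))"
  proof (intro prod_mono conjI)
    fix b :: "real^'m" assume b: "b \<in> Basis"
    have "\<bar>\<eta> \<bullet> b\<bar> \<le> norm \<eta>" by (rule Basis_le_norm[OF b])
    then have "(\<eta> \<bullet> b)\<^sup>2 \<le> (norm \<eta>)\<^sup>2" using power_mono[of "\<bar>\<eta> \<bullet> b\<bar>" "norm \<eta>" 2] by simp
    then have "1 + (\<eta> \<bullet> b)\<^sup>2 \<le> (1 + norm \<eta>)\<^sup>2" 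
      using norm_ge_zero[of \<eta>] unfolding power2_sum by (simp add: add_increasing2)
    moreover have "0 < 1 + (\<eta> \<bullet> b)\<^sup>2" by (simp add: add_pos_nonneg)
    ultimately show "1 \<le> (1 + norm \<eta>)\<^sup>2 * inverse (1 + (\<eta> \<bullet> b)\<^sup>2)" by (simp add: field_simps)
  qed simp
  then show ?thesis
    by (simp add: prod.distrib decay_weight_def power_mult)
qed

lemma decay_weight_nonneg: "0 \<le> decay_weight \<eta>"
  unfolding decay_weight_def by (intro prod_nonneg) simp

lemma one_plus_power_le: "0 \<le> x \<Longrightarrow> (1 + x) ^ p \<le> 2 ^ p * (1 + x ^ p)" for x :: real
proof -
  assume x: "0 \<le> x"
  have "(1 + x) ^ p \<le> (2 * max 1 x) ^ p" using x by (intro power_mono) auto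
  also have "\<dots> = 2 ^ p * max 1 x ^ p" by (simp add: power_mult_distrib)
  also have "max 1 x ^ p \<le> 1 + x ^ p" using x by (auto simp: max_def)
  finally show ?thesis by simp
qed

text \<open>For each frequency \<open>\<eta>\<close> either the oscillating integral or \<open>F(w\<^sub>\<epsilon>)(\<eta>)\<close> decays, where \<open>F\<close> is the
  Fourier transform. In the first case the decay is in \<open>|\<zeta>| + |\<eta>|\<close>, in the second it is in \<open>|\<eta>|\<close> and
  is transferred to \<open>|\<zeta>|\<close> through \<open>|\<zeta>| \<le> \<tau>\<^sub>\<epsilon> |\<eta>|\<close>. The constants lost on the way are nets of slow
  scale, all together \<open>O(1/\<epsilon>)\<close>. Hence the exponent \<open>N + 1\<close> in the conclusion is independent of
  \<open>p\<close>, which is the crux of rapid decrease in the sense of generalized functions.\<close>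

theorem microlocal_estimate:
  fixes f :: "real \<Rightarrow> real^'n::finite \<Rightarrow> real^'m::finite" and a :: "real \<Rightarrow> real^'n \<Rightarrow> complex"
    and w :: "real \<Rightarrow> real^'m \<Rightarrow> complex" and N :: real
  assumes U: "\<forall>\<^sub>F \<epsilon> in at_right 0. open (U \<epsilon>)"
    and K: "\<forall>\<^sub>F \<epsilon> in at_right 0. compact (K \<epsilon>) \<and> K \<epsilon> \<subseteq> U \<epsilon> \<and> measure lborel (K \<epsilon>) \<le> V"
    and a: "tame_net slow_net U a" "\<forall>\<^sub>F \<epsilon> in at_right 0. \<forall>x\<in>U \<epsilon> - K \<epsilon>. a \<epsilon> x = 0"
    and f: "tame_net slow_net U f"
    and \<tau>: "slow_net \<tau>" "\<forall>\<^sub>F \<epsilon> in at_right 0. 1 \<le> \<tau> \<epsilon>"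
    and w: "\<forall>\<^sub>F \<epsilon> in at_right 0. integrable lborel (w \<epsilon>) \<and> continuous_on UNIV (w \<epsilon>) \<and> (\<exists>S. \<forall>y. norm (w \<epsilon> y) \<le> S)"
    and w0: "\<forall>\<^sub>F \<epsilon> in at_right 0. \<forall>\<eta>. norm (ft (w \<epsilon>) \<eta>) \<le> C0 * \<epsilon> powr (- N)"
    and rapid: "\<And>q::nat. \<exists>C. \<forall>\<^sub>F \<epsilon> in at_right 0. \<forall>\<eta>\<in>A. (1 + norm \<eta>) ^ q * norm (ft (w \<epsilon>) \<eta>) \<le> C * \<epsilon> powr (- N)"
    and Z: "0 \<notin> Z"
    and split: "\<forall>\<^sub>F \<epsilon> in at_right 0. \<forall>\<zeta>\<in>Z. \<forall>\<eta>.
        (\<forall>x\<in>U \<epsilon>. norm \<zeta> + norm \<eta> \<le> \<tau> \<epsilon> * norm (transp_jacobian f \<epsilon> x \<eta> - \<zeta>)) \<or>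
        (\<eta> \<in> A \<and> norm \<zeta> \<le> \<tau> \<epsilon> * norm \<eta>)"
  shows "\<exists>C. \<forall>\<^sub>F \<epsilon> in at_right 0. \<forall>\<zeta>\<in>Z. (1 + norm \<zeta>) ^ p *
      norm (LINT x:U \<epsilon>|lborel. a \<epsilon> x * w \<epsilon> (f \<epsilon> x) * exp (- (\<i> * of_real (x \<bullet> \<zeta>)))) \<le> C * \<epsilon> powr (- (N + 1))"
proof -
  let ?m = "2 * CARD('m)"
  let ?I = "\<lambda>\<epsilon> \<zeta> \<eta>. LINT x:U \<epsilon>|lborel. a \<epsilon> x * exp (\<i> * of_real (f \<epsilon> x \<bullet> \<eta> - x \<bullet> \<zeta>))"
  let ?nonchar = "\<lambda>\<epsilon> \<zeta> \<eta>. \<forall>x\<in>U \<epsilon>. norm \<zeta> + norm \<eta> \<le> \<tau> \<epsilon> * norm (transp_jacobian f \<epsilon> x \<eta> - \<zeta>)"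
  \<comment> \<open>the weight \<open>(1 + |\<eta>|)^(2m)\<close> is spent on integrability in \<open>\<eta>\<close>\<close>
  define q where "q = p + ?m"
  note phase = nonstationary_phase_composition[OF net_class_slow U K a f \<tau>(1)]
  obtain r0 where r0: "slow_net r0" "\<forall>\<^sub>F \<epsilon> in at_right 0. \<forall>\<zeta> \<eta>. norm (?I \<epsilon> \<zeta> \<eta>) \<le> r0 \<epsilon>"
  proof -
    interpret g: gauge "at_right 0" U "net_gauges slow_net (\<lambda>\<epsilon>. \<epsilon>)"
      by (rule gauge_net[OF net_class_slow U])
    obtain r where r: "slow_net r" "\<forall>\<^sub>F \<epsilon> in at_right 0. \<forall>x\<in>U \<epsilon>. norm (a \<epsilon> x) \<le> r \<epsilon>"
      using g.tame_bdd[OF a(1)] unfolding g.bdd_def bex_net_gauges by blast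
    have "\<forall>\<^sub>F \<epsilon> in at_right 0. \<forall>\<zeta> \<eta>. norm (?I \<epsilon> \<zeta> \<eta>) \<le> \<bar>r \<epsilon>\<bar> * V"
      using r(2) K a(2)
    proof eventually_elim
      case (elim \<epsilon>)
      show ?case
      proof (intro allI)
        fix \<zeta> \<eta>
        have "norm (?I \<epsilon> \<zeta> \<eta>) \<le> \<bar>r \<epsilon>\<bar> * measure lborel (K \<epsilon>)"
          using elim by (intro norm_set_integral_compact_support)
            (auto simp: norm_mult subset_eq simp del: of_real_diff intro: order_trans[OF _ abs_ge_self])
        also have "\<dots> \<le> \<bar>r \<epsilon>\<bar> * V" using elim by (intro mult_left_mono) auto
        finally show "norm (?I \<epsilon> \<zeta> \<eta>) \<le> \<bar>r \<epsilon>\<bar> * V" .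
      qed
    qed
    moreover have "slow_net (\<lambda>\<epsilon>. \<bar>r \<epsilon>\<bar> * V)" by (intro net_classD[OF net_class_slow] r)
    ultimately show ?thesis using that by blast
  qed
  obtain rq where rq: "slow_net rq" "\<forall>\<^sub>F \<epsilon> in at_right 0. \<forall>\<zeta> \<eta>. norm \<zeta> + norm \<eta> > 0 \<longrightarrow>
      ?nonchar \<epsilon> \<zeta> \<eta> \<longrightarrow> (norm \<zeta> + norm \<eta>) ^ q * norm (?I \<epsilon> \<zeta> \<eta>) \<le> rq \<epsilon>"
    using phase[of q] by blast
  obtain C1 where C1: "\<forall>\<^sub>F \<epsilon> in at_right 0. \<forall>\<eta>\<in>A. (1 + norm \<eta>) ^ q * norm (ft (w \<epsilon>) \<eta>) \<le> C1 * \<epsilon> powr (- N)"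
    using rapid[of q] by blast
  \<comment> \<open>all losses of both cases; being of slow scale, they amount to one factor \<open>1/\<epsilon>\<close>\<close>
  define g where "g \<epsilon> = 2 ^ q * (r0 \<epsilon> + \<bar>rq \<epsilon>\<bar>) + \<tau> \<epsilon> ^ p * r0 \<epsilon>" for \<epsilon>
  have "slow_net g" unfolding g_def by (intro net_classD[OF net_class_slow] r0 rq \<tau>)
  then obtain Cg where Cg: "\<forall>\<^sub>F \<epsilon> in at_right 0. \<bar>g \<epsilon>\<bar> \<le> Cg / \<epsilon>"
    using slow_netD by blast
  define D where "D = \<bar>C0\<bar> + \<bar>C1\<bar>"
  define c where "c = (\<integral>\<eta>. decay_weight (\<eta> :: real^'m) \<partial>lborel)"
  have c: "0 \<le> c" unfolding c_def by (rule Bochner_Integration.integral_nonneg) (rule decay_weight_nonneg)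
  have "\<forall>\<^sub>F \<epsilon> in at_right 0. \<forall>\<zeta>\<in>Z. (1 + norm \<zeta>) ^ p *
      norm (LINT x:U \<epsilon>|lborel. a \<epsilon> x * w \<epsilon> (f \<epsilon> x) * exp (- (\<i> * of_real (x \<bullet> \<zeta>)))) \<le> (D * Cg * c) * \<epsilon> powr (- (N + 1))"
  proof -
    have cont: "\<forall>\<^sub>F \<epsilon> in at_right 0. continuous_on (U \<epsilon>) (a \<epsilon>) \<and> continuous_on (U \<epsilon>) (f \<epsilon>)"
    proof -
      interpret g: gauge "at_right 0" U "net_gauges slow_net (\<lambda>\<epsilon>. \<epsilon>)"
        by (rule gauge_net[OF net_class_slow U])
      show ?thesis
        using g.tame_evdiff[OF a(1)] g.tame_evdiff[OF f] unfolding g.evdiff_def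
        by eventually_elim
          (meson differentiable_imp_continuous_within continuous_at_imp_continuous_on)
    qed
    show ?thesis
      using U K a(2) \<tau>(2) w w0 split r0(2) rq(2) C1 Cg cont eventually_at_right_0
    proof eventually_elim
      case (elim \<epsilon>)
      have r0p: "0 \<le> r0 \<epsilon>" using elim(8) norm_ge_zero order_trans by blast
      show ?case
      proof
        fix \<zeta> assume \<zeta>: "\<zeta> \<in> Z"
        then have \<zeta>0: "0 < norm \<zeta>" using Z by auto
        define B where "B \<eta> = (D * Cg * \<epsilon> powr (- (N + 1)) / (1 + norm \<zeta>) ^ p) * decay_weight \<eta>" for \<eta> :: "real^'m"
        have key: "norm (ft (w \<epsilon>) \<eta> * ?I \<epsilon> \<zeta> \<eta>) \<le> B \<eta>" for \<eta>
        proof -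
          let ?F = "norm (ft (w \<epsilon>) \<eta>)" and ?J = "norm (?I \<epsilon> \<zeta> \<eta>)"
          have J0: "?J \<le> r0 \<epsilon>" using elim(8) by blast
          have F0: "?F \<le> C0 * \<epsilon> powr (- N)" using elim(6) by blast
          have "(1 + norm \<zeta>) ^ p * (1 + norm \<eta>) ^ ?m * (?F * ?J) \<le> (D * \<epsilon> powr (- N)) * g \<epsilon>"
            using elim(7)[rule_format, OF \<zeta>, of \<eta>]
          proof
            assume nc: "?nonchar \<epsilon> \<zeta> \<eta>"
            let ?\<rho> = "norm \<zeta> + norm \<eta>"
            have Jq: "?\<rho> ^ q * ?J \<le> rq \<epsilon>" using elim(9) nc \<zeta>0 by (meson add_pos_nonneg norm_ge_zero)
            have "(1 + norm \<zeta>) ^ p * (1 + norm \<eta>) ^ ?m \<le> (1 + ?\<rho>) ^ p * (1 + ?\<rho>) ^ ?m"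
              by (intro mult_mono power_mono) auto
            also have "\<dots> = (1 + ?\<rho>) ^ q" by (simp add: q_def power_add)
            also have "\<dots> \<le> 2 ^ q * (1 + ?\<rho> ^ q)" by (rule one_plus_power_le) simp
            finally have "(1 + norm \<zeta>) ^ p * (1 + norm \<eta>) ^ ?m * ?J \<le> 2 ^ q * (1 + ?\<rho> ^ q) * ?J"
              by (rule mult_right_mono) simp
            also have "\<dots> = 2 ^ q * (?J + ?\<rho> ^ q * ?J)" by (simp add: algebra_simps)
            also have "\<dots> \<le> 2 ^ q * (r0 \<epsilon> + \<bar>rq \<epsilon>\<bar>)" using J0 Jq by (intro mult_left_mono add_mono) auto
            also have "\<dots> \<le> g \<epsilon>" using r0p elim(4) by (simp add: g_def)
            finally have *: "(1 + norm \<zeta>) ^ p * (1 + norm \<eta>) ^ ?m * ?J \<le> g \<epsilon>" .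
            have "(1 + norm \<zeta>) ^ p * (1 + norm \<eta>) ^ ?m * (?F * ?J) = ?F * ((1 + norm \<zeta>) ^ p * (1 + norm \<eta>) ^ ?m * ?J)"
              by (simp only: mult_ac)
            also have "\<dots> \<le> (D * \<epsilon> powr (- N)) * g \<epsilon>"
            proof (intro mult_mono *)
              show "?F \<le> D * \<epsilon> powr (- N)"
                by (rule order_trans[OF F0]) (auto simp: D_def intro!: mult_right_mono)
            qed (auto simp: D_def)
            finally show ?thesis .
          next
            assume A: "\<eta> \<in> A \<and> norm \<zeta> \<le> \<tau> \<epsilon> * norm \<eta>"
            have "1 + norm \<zeta> \<le> \<tau> \<epsilon> * (1 + norm \<eta>)" using A elim(4) by (simp add: distrib_left)
            then have "(1 + norm \<zeta>) ^ p \<le> (\<tau> \<epsilon> * (1 + norm \<eta>)) ^ p" by (intro power_mono) auto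
            then have "(1 + norm \<zeta>) ^ p * ((1 + norm \<eta>) ^ ?m * (?F * ?J)) \<le>
                (\<tau> \<epsilon> * (1 + norm \<eta>)) ^ p * ((1 + norm \<eta>) ^ ?m * (?F * ?J))"
              by (rule mult_right_mono) simp
            also have "\<dots> = ((1 + norm \<eta>) ^ q * ?F) * (\<tau> \<epsilon> ^ p * ?J)"
              by (simp add: q_def power_add power_mult_distrib)
            also have "\<dots> \<le> (D * \<epsilon> powr (- N)) * g \<epsilon>"
            proof (rule mult_mono)
              have "(1 + norm \<eta>) ^ q * ?F \<le> C1 * \<epsilon> powr (- N)" using A elim(10) by blast
              also have "\<dots> \<le> D * \<epsilon> powr (- N)" by (auto simp: D_def intro!: mult_right_mono)
              finally show "(1 + norm \<eta>) ^ q * ?F \<le> D * \<epsilon> powr (- N)" .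
              have "\<tau> \<epsilon> ^ p * ?J \<le> \<tau> \<epsilon> ^ p * r0 \<epsilon>" using J0 elim(4) by (intro mult_left_mono) auto
              then show "\<tau> \<epsilon> ^ p * ?J \<le> g \<epsilon>" using r0p by (simp add: g_def add_increasing)
            qed (use elim(4) in \<open>auto simp: D_def\<close>)
            finally show ?thesis by (simp only: mult.assoc)
          qed
          also have "\<dots> \<le> (D * \<epsilon> powr (- N)) * (Cg / \<epsilon>)"
            using elim(11) by (intro mult_left_mono) (auto simp: D_def)
          also have "\<dots> = D * Cg * \<epsilon> powr (- (N + 1))"
            using elim(13) by (simp add: powr_diff)
          finally have *: "(1 + norm \<zeta>) ^ p * (1 + norm \<eta>) ^ ?m * (?F * ?J) \<le> D * Cg * \<epsilon> powr (- (N + 1))" .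
          have "(1 + norm \<zeta>) ^ p * (?F * ?J) * 1 \<le> (1 + norm \<zeta>) ^ p * (?F * ?J) * ((1 + norm \<eta>) ^ ?m * decay_weight \<eta>)"
            by (intro mult_left_mono decay_weight_ge) simp
          also have "\<dots> = ((1 + norm \<zeta>) ^ p * (1 + norm \<eta>) ^ ?m * (?F * ?J)) * decay_weight \<eta>"
            by (simp only: mult_ac)
          also have "\<dots> \<le> (D * Cg * \<epsilon> powr (- (N + 1))) * decay_weight \<eta>"
            by (rule mult_right_mono[OF * decay_weight_nonneg])
          finally have "?F * ?J \<le> (D * Cg * \<epsilon> powr (- (N + 1))) * decay_weight \<eta> / (1 + norm \<zeta>) ^ p"
            by (subst pos_le_divide_eq) (auto simp: mult_ac add_pos_nonneg)
          then show ?thesis by (simp add: B_def norm_mult)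
        qed
        obtain S where S: "\<And>y. norm (w \<epsilon> y) \<le> S" using elim(5) by blast
        have "norm (LINT x:U \<epsilon>|lborel. a \<epsilon> x * w \<epsilon> (f \<epsilon> x) * exp (- (\<i> * of_real (x \<bullet> \<zeta>)))) \<le> (\<integral>\<eta>. B \<eta> \<partial>lborel)"
        proof (rule norm_fourier_integral_composition_le[where S=S and K="K \<epsilon>"])
          show "integrable lborel B" unfolding B_def by (intro integrable_mult_right decay_weight_integrable)
        qed (use elim S key in auto)
        also have "\<dots> = (D * Cg * \<epsilon> powr (- (N + 1)) / (1 + norm \<zeta>) ^ p) * c"
          unfolding B_def c_def by (rule integral_mult_right_zero)
        finally show "(1 + norm \<zeta>) ^ p * norm (LINT x:U \<epsilon>|lborel. a \<epsilon> x * w \<epsilon> (f \<epsilon> x) * exp (- (\<i> * of_real (x \<bullet> \<zeta>)))) \<le> (D * Cg * c) * \<epsilon> powr (- (N + 1))"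
          by (simp add: pos_le_divide_eq add_pos_nonneg mult_ac)
      qed
    qed
  qed
  then show ?thesis by blast
qed

section \<open>Smooth functions and cut-offs\<close>

lemma (in gauge) tame_ident:
  assumes "bdd (\<lambda>i x. x)"
  shows "tame (\<lambda>i x. x)"
proof -
  have p: "partial_deriv j (\<lambda>x::real^'n. x) x = axis j 1" for j x
    by (rule partial_deriv_has_derivative[OF has_derivative_ident])
  have c: "tame_ord n (\<lambda>i (x::real^'n). axis j (1::real) :: real^'n)" for n j
    using tame_fixed_const[of "axis j (1::real) :: real^'n"] by (simp add: tame_def)
  have "tame_ord n (\<lambda>i x. x)" for n
  proof (cases n)
    case (Suc k)
    have "tame_ord k (\<lambda>i. partial_deriv j (\<lambda>x. x))" for j
      using c[of k j] unfolding p[abs_def] .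
    then show ?thesis using assms Suc by (simp add: evdiff_def)
  qed (use assms in simp)
  then show ?thesis by (simp add: tame_def)
qed

text \<open>The outer function is given together with all its derivatives, so that the induction can pass from
  \<open>D k\<close> to \<open>D (Suc k)\<close>.\<close>

lemma (in gauge) tame_chain:
  fixes D :: "nat \<Rightarrow> real \<Rightarrow> real" and b :: "'i \<Rightarrow> real^'n \<Rightarrow> real"
  assumes D: "\<And>k t. (D k has_real_derivative D (Suc k) t) (at t)"
    and b: "tame b" and bd: "\<And>k. bdd (\<lambda>i x. D k (b i x))"
  shows "tame (\<lambda>i x. D k (b i x))"
proof -
  have "tame_ord n (\<lambda>i x. D k (b i x))" for n
  proof (induction n arbitrary: k)
    case (Suc n)
    have der: "((\<lambda>x. D k (b i x)) has_derivative (\<lambda>v. b' v * D (Suc k) (b i x))) (at x)"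
      if "(b i has_derivative b') (at x)" for i x b'
      using has_derivative_compose[OF that D[unfolded has_field_derivative_def]] by (simp add: mult.commute)
    have bd': "evdiff b" using b by (rule tame_evdiff)
    have "tame_ord n (\<lambda>i. partial_deriv j (\<lambda>x. D k (b i x)))" for j
    proof (rule tame_ord_cong)
      show "tame_ord n (\<lambda>i x. partial_deriv j (b i) x * D (Suc k) (b i x))"
        using tame_partial_deriv[OF b] Suc.IH by (intro tame_ord_mult) (auto simp: tame_def)
      show "\<forall>\<^sub>F i in F. \<forall>x\<in>X i. partial_deriv j (b i) x * D (Suc k) (b i x) =
          partial_deriv j (\<lambda>x. D k (b i x)) x"
        using bd' unfolding evdiff_def
      proof eventually_elim
        case (elim i)
        show ?case
        proof
          fix x assume "x \<in> X i"
          then obtain b' where b': "(b i has_derivative b') (at x)"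
            using elim by (auto simp: differentiable_def)
          show "partial_deriv j (b i) x * D (Suc k) (b i x) = partial_deriv j (\<lambda>x. D k (b i x)) x"
            using partial_deriv_has_derivative[OF der[OF b']] partial_deriv_has_derivative[OF b'] by simp
        qed
      qed
    qed
    moreover have "evdiff (\<lambda>i x. D k (b i x))"
      using bd' unfolding evdiff_def
    proof eventually_elim
      case (elim i)
      then show ?case using der unfolding differentiable_def by blast
    qed
    ultimately show ?case using bd by simp
  qed (use bd in simp)
  then show ?thesis by (simp add: tame_def)
qed

lemma gauge_smooth: "open \<Omega> \<Longrightarrow> gauge (top :: unit filter) (\<lambda>_. \<Omega>) UNIV"
  by (rule gauge_UNIV) simp

lemma bdd_smooth: "open \<Omega> \<Longrightarrow> gauge.bdd (top :: unit filter) (\<lambda>_. \<Omega>) UNIV a"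
  unfolding gauge.bdd_def[OF gauge_smooth] by (rule bexI[of _ "\<lambda>i x. norm (a i x)"]) auto

text \<open>With one index and all functions as gauges, tameness is smoothness; the calculus of smooth
  functions is thus an instance of the calculus of tame families.\<close>

lemma smooth_on_tame:
  assumes "open \<Omega>"
  shows "smooth_on \<Omega> f \<longleftrightarrow> gauge.tame (top :: unit filter) (\<lambda>_. \<Omega>) UNIV (\<lambda>_. f)"
proof -
  interpret gauge "top :: unit filter" "\<lambda>_. \<Omega>" UNIV by (rule gauge_smooth[OF assms])
  have "\<exists>r\<in>UNIV. \<forall>\<^sub>F i in (top :: unit filter). \<forall>x\<in>\<Omega>. norm (partial_derivs \<alpha> f x) \<le> r i x" for \<alpha>
    by (rule bexI[of _ "\<lambda>i x. norm (partial_derivs \<alpha> f x)"]) auto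
  then show ?thesis unfolding tame_iff smooth_on_def by (simp add: eventually_top)
qed

context
  fixes \<Omega> :: "(real^'n::finite) set"
  assumes \<Omega>: "open \<Omega>"
begin

interpretation S: gauge "top :: unit filter" "\<lambda>_. \<Omega>" UNIV by (rule gauge_smooth[OF \<Omega>])

lemma smooth_on_bilinear:
  "bounded_bilinear h \<Longrightarrow> smooth_on \<Omega> f \<Longrightarrow> smooth_on \<Omega> g \<Longrightarrow> smooth_on \<Omega> (\<lambda>x. h (f x) (g x))"
  unfolding smooth_on_tame[OF \<Omega>] by (rule S.tame_bilinear)

lemma smooth_on_mult:
  fixes f g :: "real^'n \<Rightarrow> 'a::real_normed_algebra"
  shows "smooth_on \<Omega> f \<Longrightarrow> smooth_on \<Omega> g \<Longrightarrow> smooth_on \<Omega> (\<lambda>x. f x * g x)"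
  unfolding smooth_on_tame[OF \<Omega>] by (rule S.tame_mult)

lemma smooth_on_add: "smooth_on \<Omega> f \<Longrightarrow> smooth_on \<Omega> g \<Longrightarrow> smooth_on \<Omega> (\<lambda>x. f x + g x)"
  unfolding smooth_on_tame[OF \<Omega>] by (rule S.tame_add)

lemma smooth_on_diff: "smooth_on \<Omega> f \<Longrightarrow> smooth_on \<Omega> g \<Longrightarrow> smooth_on \<Omega> (\<lambda>x. f x - g x)"
  unfolding smooth_on_tame[OF \<Omega>] by (rule S.tame_diff)

lemma smooth_on_sum: "(\<And>k. k \<in> A \<Longrightarrow> smooth_on \<Omega> (f k)) \<Longrightarrow> smooth_on \<Omega> (\<lambda>x. \<Sum>k\<in>A. f k x)"
  unfolding smooth_on_tame[OF \<Omega>] using S.tame_sum[of A "\<lambda>k _. f k"] by blast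

lemma smooth_on_const: "smooth_on \<Omega> (\<lambda>_. c)"
  unfolding smooth_on_tame[OF \<Omega>] by (rule S.tame_fixed_const)

lemma smooth_on_ident: "smooth_on \<Omega> (\<lambda>x. x)"
  unfolding smooth_on_tame[OF \<Omega>] by (intro S.tame_ident bdd_smooth[OF \<Omega>])

lemma smooth_on_bounded_linear: "bounded_linear h \<Longrightarrow> smooth_on \<Omega> f \<Longrightarrow> smooth_on \<Omega> (\<lambda>x. h (f x))"
  unfolding smooth_on_tame[OF \<Omega>] by (rule S.tame_bounded_linear)

lemma smooth_on_chain:
  assumes "\<And>k t. (D k has_real_derivative D (Suc k) t) (at t)" "smooth_on \<Omega> b"
  shows "smooth_on \<Omega> (\<lambda>x. D k (b x) :: real)"
  unfolding smooth_on_tame[OF \<Omega>]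
  by (rule S.tame_chain[where D=D and b="\<lambda>_. b", OF assms(1) assms(2)[unfolded smooth_on_tame[OF \<Omega>]]
      bdd_smooth[OF \<Omega>]])

lemma smooth_on_inverse:
  fixes f :: "real^'n \<Rightarrow> complex"
  assumes "smooth_on \<Omega> f" "\<And>x. x \<in> \<Omega> \<Longrightarrow> f x \<noteq> 0"
  shows "smooth_on \<Omega> (\<lambda>x. inverse (f x))"
  using assms unfolding smooth_on_tame[OF \<Omega>]
  by (intro S.tame_inverse bdd_smooth[OF \<Omega>]) (auto simp: eventually_top)

lemma smooth_on_compose:
  fixes f :: "real^'n \<Rightarrow> real^'m::finite"
  assumes "smooth_on \<Omega> f" "smooth_on V u" "f ` \<Omega> \<subseteq> V"
  shows "smooth_on \<Omega> (\<lambda>x. u (f x))"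
  unfolding smooth_on_tame[OF \<Omega>]
  by (rule S.tame_compose[where u="\<lambda>_. u" and f="\<lambda>_. f",
        OF assms(1)[unfolded smooth_on_tame[OF \<Omega>]] bdd_smooth[OF \<Omega>]])
    (use assms(2,3) in \<open>auto simp: eventually_top smooth_on_def\<close>)

lemma smooth_on_cong:
  "smooth_on \<Omega> f \<Longrightarrow> (\<And>x. x \<in> \<Omega> \<Longrightarrow> f x = g x) \<Longrightarrow> smooth_on \<Omega> g"
  unfolding smooth_on_tame[OF \<Omega>] by (rule S.tame_cong[of "\<lambda>_. f"]) (auto simp: eventually_top)

end

lemma smooth_on_subset: "smooth_on \<Omega> f \<Longrightarrow> S \<subseteq> \<Omega> \<Longrightarrow> smooth_on S f"
  unfolding smooth_on_def by blast

lemma smooth_on_Un: "smooth_on S f \<Longrightarrow> smooth_on T f \<Longrightarrow> smooth_on (S \<union> T) f"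
  unfolding smooth_on_def by blast

lemma smooth_on_continuous: "smooth_on \<Omega> f \<Longrightarrow> continuous_on \<Omega> (partial_derivs \<alpha> f)"
  unfolding smooth_on_def
  by (meson differentiable_imp_continuous_within continuous_at_imp_continuous_on)

text \<open>The classical flat function \<open>exp (- 1 / t)\<close>: the functions \<open>p (1 / t) exp (- 1 / t)\<close> for
  polynomials \<open>p\<close>, extended by \<open>0\<close>, form a class closed under differentiation.\<close>

definition flat_poly :: "real poly \<Rightarrow> real \<Rightarrow> real" where
  "flat_poly P t = (if t > 0 then poly P (1 / t) * exp (- (1 / t)) else 0)"

lemma poly_exp_tendsto_0: "((\<lambda>s. poly P s * exp (- s)) \<longlongrightarrow> 0) (at_top :: real filter)"
proof -
  have "((\<lambda>s. \<Sum>i\<le>degree P. coeff P i * (s ^ i / exp s)) \<longlongrightarrow> (\<Sum>i\<le>degree P. coeff P i * 0)) at_top"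
    by (intro tendsto_intros tendsto_power_div_exp_0)
  then show ?thesis
    by (simp add: poly_altdef exp_minus divide_inverse sum_distrib_left mult_ac)
qed

lemma flat_poly_deriv:
  "(flat_poly P has_real_derivative flat_poly ([:0, 0, 1:] * (P - pderiv P)) t) (at t)"
proof (cases t "0::real" rule: linorder_cases)
  case less
  have "((\<lambda>_. 0) has_real_derivative 0) (at t)" by simp
  then have "(flat_poly P has_real_derivative 0) (at t)"
    by (rule has_field_derivative_transform_within_open[of _ _ _ "{..<0}"]) (use less in \<open>auto simp: flat_poly_def\<close>)
  then show ?thesis using less by (simp add: flat_poly_def)
next
  case greater
  have "((\<lambda>t. poly P (1 / t) * exp (- (1 / t))) has_real_derivative
      (- (1 / t\<^sup>2) * poly (pderiv P) (1 / t)) * exp (- (1 / t)) + poly P (1 / t) * ((1 / t\<^sup>2) * exp (- (1 / t)))) (at t)"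
    using greater
    by (auto intro!: derivative_eq_intros DERIV_chain2[OF poly_DERIV] simp: power2_eq_square)
  then have "(flat_poly P has_real_derivative
      (- (1 / t\<^sup>2) * poly (pderiv P) (1 / t)) * exp (- (1 / t)) + poly P (1 / t) * ((1 / t\<^sup>2) * exp (- (1 / t)))) (at t)"
    by (rule has_field_derivative_transform_within_open[of _ _ _ "{0<..}"]) (use greater in \<open>auto simp: flat_poly_def\<close>)
  then show ?thesis using greater by (simp add: flat_poly_def power2_eq_square algebra_simps)
next
  case equal
  have "((\<lambda>h. flat_poly P h / h) \<longlongrightarrow> 0) (at 0)"
    unfolding filterlim_split_at
  proof (intro filterlim_split_at)
    show "((\<lambda>h. flat_poly P h / h) \<longlongrightarrow> 0) (at_left 0)"
    proof (rule Lim_transform_eventually[OF tendsto_const])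
      show "\<forall>\<^sub>F h in at_left 0. 0 = flat_poly P h / h"
        by (auto simp: eventually_at_left_field flat_poly_def intro!: exI[of _ "-1"])
    qed
    have "((\<lambda>h. poly (pCons 0 P) (inverse h) * exp (- inverse h)) \<longlongrightarrow> 0) (at_right 0)"
      by (rule filterlim_compose[OF poly_exp_tendsto_0 filterlim_inverse_at_top_right])
    then show "((\<lambda>h. flat_poly P h / h) \<longlongrightarrow> 0) (at_right 0)"
    proof (rule Lim_transform_eventually)
      show "\<forall>\<^sub>F h in at_right 0. poly (pCons 0 P) (inverse h) * exp (- inverse h) = flat_poly P h / h"
        by (auto simp: eventually_at_right_field flat_poly_def field_simps intro!: exI[of _ 1])
    qed
  qed
  then show ?thesis using equal by (simp add: has_field_derivative_iff flat_poly_def)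
qed

definition flat :: "real \<Rightarrow> real" where "flat = flat_poly 1"

lemma flat_pos: "t > 0 \<Longrightarrow> flat t > 0" and flat_nonpos: "t \<le> 0 \<Longrightarrow> flat t = 0" and flat_nonneg: "0 \<le> flat t"
  by (auto simp: flat_def flat_poly_def)

lemma smooth_on_flat:
  fixes b :: "real^'n::finite \<Rightarrow> real"
  assumes "open \<Omega>" "smooth_on \<Omega> b"
  shows "smooth_on \<Omega> (\<lambda>x. flat (b x))"
proof -
  define D where "D k = flat_poly (((\<lambda>P. [:0, 0, 1:] * (P - pderiv P)) ^^ k) 1)" for k
  have "(D k has_real_derivative D (Suc k) t) (at t)" for k t
    unfolding D_def by (simp only: funpow.simps o_apply flat_poly_deriv)
  from smooth_on_chain[where D=D and k=0, OF assms(1) this assms(2)] show ?thesis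
    by (simp add: D_def flat_def)
qed

text \<open>A smooth function that is positive exactly on the ball of radius \<open>r\<close> around \<open>c\<close>.\<close>

definition bump :: "real^'n::finite \<Rightarrow> real \<Rightarrow> real^'n \<Rightarrow> real" where
  "bump c r x = flat (r\<^sup>2 - (x - c) \<bullet> (x - c))"

lemma bump_smooth: "smooth_on UNIV (bump c r)"
  unfolding bump_def[abs_def]
  by (intro smooth_on_flat smooth_on_diff smooth_on_const smooth_on_ident open_UNIV
      smooth_on_bilinear[OF _ bounded_bilinear_inner])

lemma bump_nonneg: "0 \<le> bump c r x" by (simp add: bump_def flat_nonneg)

lemma bump_pos_iff: "r > 0 \<Longrightarrow> bump c r x > 0 \<longleftrightarrow> x \<in> ball c r"
proof -
  assume r: "r > 0"
  have "(x - c) \<bullet> (x - c) = (dist c x)\<^sup>2" 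
    unfolding power2_norm_eq_inner[symmetric] dist_norm by (simp add: norm_minus_commute)
  then have "r\<^sup>2 - (x - c) \<bullet> (x - c) > 0 \<longleftrightarrow> dist c x < r"
    using r power_mono_iff[of r "dist c x" 2] by (simp add: not_le[symmetric] del: not_le)
  then show ?thesis
    unfolding bump_def using flat_pos flat_nonpos by (metis less_irrefl mem_ball not_less)
qed

lemma test_functionsI:
  assumes "smooth_on UNIV \<phi>" "compact K" "K \<subseteq> \<Omega>" "\<And>x. x \<notin> K \<Longrightarrow> \<phi> x = 0"
  shows "\<phi> \<in> test_functions \<Omega>"
proof -
  have "closure {x. \<phi> x \<noteq> 0} \<subseteq> K"
    using assms(2,4) by (intro closure_minimal compact_imp_closed) auto
  then show ?thesis
    using assms by (auto simp: test_functions_def compact_eq_bounded_closed intro: bounded_subset)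
qed

lemma test_functionsD:
  assumes "\<phi> \<in> test_functions \<Omega>"
  obtains K where "compact K" "K \<subseteq> \<Omega>" "\<And>x. x \<notin> K \<Longrightarrow> \<phi> x = 0" "smooth_on UNIV \<phi>"
proof (rule that[of "closure {x. \<phi> x \<noteq> 0}"])
  show "\<phi> x = 0" if "x \<notin> closure {x. \<phi> x \<noteq> 0}" for x
    using that closure_subset[of "{x. \<phi> x \<noteq> 0}"] by auto
qed (use assms in \<open>auto simp: test_functions_def\<close>)

lemma bump_test_function:
  assumes "r > 0" "cball c r \<subseteq> \<Omega>"
  shows "(\<lambda>x. complex_of_real (bump c r x)) \<in> test_functions \<Omega>"
proof (rule test_functionsI[OF _ compact_cball assms(2)])
  show "smooth_on UNIV (\<lambda>x. complex_of_real (bump c r x))"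
    by (intro smooth_on_bounded_linear[OF _ bounded_linear_of_real] bump_smooth) simp
  show "complex_of_real (bump c r x) = 0" if "x \<notin> cball c r" for x
    using that bump_pos_iff[OF assms(1), of c x] bump_nonneg[of c r x] by (auto simp: less_eq_real_def)
qed

lemma smooth_on_extend_zero:
  assumes "open \<Omega>" "compact K" "K \<subseteq> \<Omega>" "\<And>x. x \<notin> K \<Longrightarrow> g x = 0" "smooth_on \<Omega> g"
  shows "smooth_on UNIV g"
proof -
  have o: "open (- K)" using assms(2) by (simp add: compact_imp_closed open_Compl)
  have "smooth_on (- K) g"
    by (rule smooth_on_cong[OF o smooth_on_const[OF o, of 0]]) (use assms in auto)
  with assms(5) have "smooth_on (\<Omega> \<union> - K) g" by (rule smooth_on_Un)
  moreover have "\<Omega> \<union> - K = UNIV" using assms(3) by blast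
  ultimately show ?thesis by simp
qed

text \<open>A finite sum \<open>b\<close> of bumps is at least some \<open>m > 0\<close> on \<open>K\<close>, and the smooth step
  \<open>flat b / (flat b + flat (m - b))\<close> turns it into a function that is \<open>1\<close> on \<open>K\<close>.\<close>

lemma test_function_cutoff:
  fixes K :: "(real^'n::finite) set"
  assumes \<Omega>: "open \<Omega>" and K: "compact K" "K \<subseteq> \<Omega>"
  obtains \<kappa> where "\<kappa> \<in> test_functions \<Omega>" "\<And>x. x \<in> K \<Longrightarrow> \<kappa> x = 1"
proof -
  have "\<exists>r>0. cball x r \<subseteq> \<Omega>" if "x \<in> K" for x
    using that \<Omega> K open_contains_cball by blast
  then obtain r where r: "\<And>x. x \<in> K \<Longrightarrow> r x > 0" "\<And>x. x \<in> K \<Longrightarrow> cball x (r x) \<subseteq> \<Omega>"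
    by metis
  have "K \<subseteq> (\<Union>x\<in>K. ball x (r x))" using r(1) by auto
  then obtain A where A: "A \<subseteq> K" "finite A" "K \<subseteq> (\<Union>x\<in>A. ball x (r x))"
    by (rule compactE_image[OF K(1) open_ball])
  define b where "b x = (\<Sum>c\<in>A. bump c (r c) x)" for x
  have b: "smooth_on UNIV b" unfolding b_def by (intro smooth_on_sum bump_smooth) simp
  have bpos: "b x > 0" if xK: "x \<in> K" for x
  proof -
    obtain c where c: "c \<in> A" "x \<in> ball c (r c)" using A(3) xK by blast
    then have "0 < bump c (r c) x" using bump_pos_iff[of "r c" c x] r A by blast
    also have "\<dots> \<le> b x" unfolding b_def by (rule member_le_sum[OF c(1)]) (auto simp: bump_nonneg A)
    finally show ?thesis .
  qed
  obtain m where m: "m > 0" "\<And>x. x \<in> K \<Longrightarrow> b x \<ge> m"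
  proof (cases "K = {}")
    case False
    have "continuous_on K b" using smooth_on_continuous[OF b, of "[]"] by (auto intro: continuous_on_subset)
    then obtain x where "x \<in> K" "\<And>y. y \<in> K \<Longrightarrow> b x \<le> b y" using continuous_attains_inf[OF K(1) False] by blast
    then show ?thesis using that[of "b x"] bpos by blast
  qed (use that[of 1] in auto)
  define d where "d x = flat (b x) + flat (m - b x)" for x
  have d: "d x > 0" for x
    using flat_pos[of "b x"] flat_pos[of "m - b x"] flat_nonneg[of "b x"] flat_nonneg[of "m - b x"] m(1)
    unfolding d_def by (cases "b x > 0") auto
  have sd: "smooth_on UNIV (\<lambda>x. complex_of_real (d x))"
    unfolding d_def
    by (intro smooth_on_bounded_linear[OF _ bounded_linear_of_real] smooth_on_add smooth_on_flat smooth_on_diff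
        smooth_on_const b) simp_all
  define \<kappa> where "\<kappa> x = complex_of_real (flat (b x)) * inverse (complex_of_real (d x))" for x
  have s: "smooth_on UNIV \<kappa>"
    unfolding \<kappa>_def
    using d by (intro smooth_on_mult smooth_on_bounded_linear[OF _ bounded_linear_of_real] smooth_on_flat
        smooth_on_inverse sd b) (auto simp: less_imp_neq[THEN not_sym])
  show ?thesis
  proof (rule that)
    show "\<kappa> \<in> test_functions \<Omega>"
    proof (rule test_functionsI[OF s, of "\<Union>c\<in>A. cball c (r c)"])
      show "\<kappa> x = 0" if "x \<notin> (\<Union>c\<in>A. cball c (r c))" for x
      proof -
        have "bump c (r c) x = 0" if "c \<in> A" for c
        proof -
          have "x \<notin> ball c (r c)" using \<open>x \<notin> _\<close> that by auto
          then show ?thesis using bump_pos_iff[of "r c" c x] bump_nonneg[of c "r c" x] r(1) A(1) that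
            by (metis less_eq_real_def subsetD)
        qed
        then have "b x = 0" by (simp add: b_def)
        then show ?thesis by (simp add: \<kappa>_def flat_nonpos)
      qed
      show "(\<Union>c\<in>A. cball c (r c)) \<subseteq> \<Omega>" using A(1) r(2) by blast
    qed (use A in auto)
    show "\<kappa> x = 1" if "x \<in> K" for x
    proof -
      have "flat (m - b x) = 0" using m(2)[OF that] by (intro flat_nonpos) simp
      then have "d x = flat (b x)" by (simp add: d_def)
      then show ?thesis using d[of x] by (simp add: \<kappa>_def)
    qed
  qed
qed

lemma compact_open_neighbourhood:
  fixes K :: "(real^'n::finite) set"
  assumes "open \<Omega>" "compact K" "K \<subseteq> \<Omega>"
  obtains U L where "open U" "compact L" "K \<subseteq> U" "U \<subseteq> L" "L \<subseteq> \<Omega>"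
proof -
  obtain e where e: "e > 0" "(\<Union>x\<in>K. cball x e) \<subseteq> \<Omega>"
    using compact_subset_open_imp_cball_epsilon_subset[OF assms(2,1,3)] by blast
  have "(\<Union>x\<in>K. cball x e) = {x + y |x y. x \<in> K \<and> y \<in> cball 0 e}"
  proof (intro set_eqI iffI)
    fix z assume "z \<in> (\<Union>x\<in>K. cball x e)"
    then obtain x where "x \<in> K" "dist x z \<le> e" by auto
    then have "z = x + (z - x)" "z - x \<in> cball 0 e" by (auto simp: dist_norm norm_minus_commute)
    then show "z \<in> {x + y |x y. x \<in> K \<and> y \<in> cball 0 e}" using \<open>x \<in> K\<close> by blast
  next
    fix z assume "z \<in> {x + y |x y. x \<in> K \<and> y \<in> cball 0 e}"
    then obtain x y where "z = x + y" "x \<in> K" "norm y \<le> e" by auto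
    then have "z \<in> cball x e" by (simp add: dist_norm)
    then show "z \<in> (\<Union>x\<in>K. cball x e)" using \<open>x \<in> K\<close> by blast
  qed
  then have "compact (\<Union>x\<in>K. cball x e)" using compact_sums[OF assms(2) compact_cball, of 0 e] by simp
  moreover have "open (\<Union>x\<in>K. ball x e)" by auto
  moreover have "K \<subseteq> (\<Union>x\<in>K. ball x e)" using e(1) by force
  moreover have "(\<Union>x\<in>K. ball x e) \<subseteq> (\<Union>x\<in>K. cball x e)" using ball_subset_cball by blast
  ultimately show ?thesis using that e(2) by blast
qed

section \<open>Moderate nets and the pullback\<close>

lemma moderate_netsD_smooth:
  "u \<in> moderate_nets \<Omega> \<Longrightarrow> 0 < \<epsilon> \<Longrightarrow> \<epsilon> \<le> 1 \<Longrightarrow> smooth_on \<Omega> (u \<epsilon>)"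
  by (simp add: moderate_nets_def)

lemma moderate_netsD_bound:
  assumes "u \<in> moderate_nets \<Omega>" "compact K" "K \<subseteq> \<Omega>"
  shows "\<exists>r. moderate_net r \<and> (\<forall>\<^sub>F \<epsilon> in at_right 0. \<forall>x\<in>K. norm (partial_derivs \<alpha> (u \<epsilon>) x) \<le> r \<epsilon>)"
proof -
  obtain p C where C: "\<forall>\<^sub>F \<epsilon> in at_right 0. \<forall>x\<in>K. norm (partial_derivs \<alpha> (u \<epsilon>) x) \<le> C * \<epsilon> powr (- p)"
    using assms unfolding moderate_nets_def sup_bigo_def by blast
  have "moderate_net (\<lambda>\<epsilon>. C * \<epsilon> powr (- p))"
    unfolding moderate_net_def
    by (rule exI[of _ p], rule exI[of _ "\<bar>C\<bar>"]) (simp add: abs_mult)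
  with C show ?thesis by blast
qed

text \<open>Moderate bounds are uniform on compact sets only, hence the passage to an open set inside a
  compact one.\<close>

lemma moderate_nets_tame:
  assumes u: "u \<in> moderate_nets \<Omega>" and U: "open U" "U \<subseteq> L" "compact L" "L \<subseteq> \<Omega>"
  shows "tame_net moderate_net (\<lambda>_. U) u"
proof (subst tame_net_iff[OF net_class_moderate])
  show "\<forall>\<^sub>F \<epsilon> in at_right (0::real). open U" using U(1) by simp
  show "\<forall>\<alpha>. (\<exists>r. moderate_net r \<and> (\<forall>\<^sub>F \<epsilon> in at_right 0. \<forall>x\<in>U. norm (partial_derivs \<alpha> (u \<epsilon>) x) \<le> r \<epsilon>)) \<and>
      (\<forall>\<^sub>F \<epsilon> in at_right 0. \<forall>x\<in>U. partial_derivs \<alpha> (u \<epsilon>) differentiable (at x))"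
  proof (intro allI conjI)
    fix \<alpha>
    obtain r where r: "moderate_net r" "\<forall>\<^sub>F \<epsilon> in at_right 0. \<forall>x\<in>L. norm (partial_derivs \<alpha> (u \<epsilon>) x) \<le> r \<epsilon>"
      using moderate_netsD_bound[OF u U(3,4)] by blast
    have "\<forall>\<^sub>F \<epsilon> in at_right 0. \<forall>x\<in>U. norm (partial_derivs \<alpha> (u \<epsilon>) x) \<le> r \<epsilon>"
      using r(2) by eventually_elim (use U(2) in blast)
    with r(1) show "\<exists>r. moderate_net r \<and> (\<forall>\<^sub>F \<epsilon> in at_right 0. \<forall>x\<in>U. norm (partial_derivs \<alpha> (u \<epsilon>) x) \<le> r \<epsilon>)"
      by blast
    show "\<forall>\<^sub>F \<epsilon> in at_right 0. \<forall>x\<in>U. partial_derivs \<alpha> (u \<epsilon>) differentiable (at x)"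
      using eventually_at_right_0
    proof eventually_elim
      case (elim \<epsilon>)
      then have "smooth_on \<Omega> (u \<epsilon>)" using u moderate_netsD_smooth by blast
      then show ?case using U unfolding smooth_on_def by blast
    qed
  qed
qed

lemma moderate_netsI:
  assumes "\<And>\<epsilon>. 0 < \<epsilon> \<Longrightarrow> \<epsilon> \<le> 1 \<Longrightarrow> smooth_on \<Omega> (w \<epsilon>)"
    and "\<And>K. compact K \<Longrightarrow> K \<subseteq> \<Omega> \<Longrightarrow> \<exists>U. open U \<and> K \<subseteq> U \<and> tame_net moderate_net (\<lambda>_. U) w"
  shows "w \<in> moderate_nets \<Omega>"
  unfolding moderate_nets_def mem_Collect_eq
proof (intro conjI allI impI)
  fix K and \<alpha> :: "'a list" assume "compact K \<and> K \<subseteq> \<Omega>"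
  then obtain U where U: "open U" "K \<subseteq> U" "tame_net moderate_net (\<lambda>_. U) w" using assms(2) by blast
  have "\<forall>\<^sub>F \<epsilon> in at_right (0::real). open U" using U(1) by simp
  from U(3)[unfolded tame_net_iff[OF net_class_moderate this]]
  obtain r where r: "moderate_net r" "\<forall>\<^sub>F \<epsilon> in at_right 0. \<forall>x\<in>U. norm (partial_derivs \<alpha> (w \<epsilon>) x) \<le> r \<epsilon>" by blast
  then obtain p C where "\<forall>\<^sub>F \<epsilon> in at_right 0. \<bar>r \<epsilon>\<bar> \<le> C * \<epsilon> powr (- p)" unfolding moderate_net_def by blast
  with r(2) have "\<forall>\<^sub>F \<epsilon> in at_right 0. \<forall>x\<in>K. norm (partial_derivs \<alpha> (w \<epsilon>) x) \<le> C * \<epsilon> powr (- p)"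
    by eventually_elim (use U(2) in force)
  then show "\<exists>p. sup_bigo K (\<lambda>\<epsilon>. partial_derivs \<alpha> (w \<epsilon>)) (\<lambda>\<epsilon>. \<epsilon> powr (- p))"
    unfolding sup_bigo_def by blast
qed (use assms(1) in auto)

lemma tame_fixed_function:
  assumes P: "net_class P" and \<phi>: "smooth_on \<Omega> \<phi>" and U: "open U" "U \<subseteq> L" "compact L" "L \<subseteq> \<Omega>"
  shows "tame_net P (\<lambda>_. U) (\<lambda>_. \<phi>)"
proof (subst tame_net_iff[OF P])
  show "\<forall>\<^sub>F \<epsilon> in at_right (0::real). open U" using U(1) by simp
  have "\<exists>r. P r \<and> (\<forall>\<^sub>F \<epsilon> in at_right 0. \<forall>x\<in>U. norm (partial_derivs \<alpha> \<phi> x) \<le> r \<epsilon>)" for \<alpha>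
  proof -
    have "compact (partial_derivs \<alpha> \<phi> ` L)"
      by (intro compact_continuous_image continuous_on_subset[OF smooth_on_continuous[OF \<phi>] U(4)] U(3))
    then have "bounded (partial_derivs \<alpha> \<phi> ` L)" by (rule compact_imp_bounded)
    then obtain B where "\<And>x. x \<in> L \<Longrightarrow> norm (partial_derivs \<alpha> \<phi> x) \<le> B"
      by (auto simp: bounded_iff)
    then show ?thesis using U(2) net_classD(1)[OF P, of B] by (intro exI[of _ "\<lambda>_. B"]) auto
  qed
  then show "\<forall>\<alpha>. (\<exists>r. P r \<and> (\<forall>\<^sub>F \<epsilon> in at_right 0. \<forall>x\<in>U. norm (partial_derivs \<alpha> \<phi> x) \<le> r \<epsilon>)) \<and>
      (\<forall>\<^sub>F \<epsilon> in at_right (0::real). \<forall>x\<in>U. partial_derivs \<alpha> \<phi> differentiable (at x))"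
    using \<phi> U(2,4) unfolding smooth_on_def by (intro allI conjI always_eventually) auto
qed

context
  fixes \<Omega> :: "(real^'n::finite) set"
  assumes \<Omega>: "open \<Omega>"
begin

lemma moderate_nets_closed:
  assumes "\<And>\<epsilon>. 0 < \<epsilon> \<Longrightarrow> \<epsilon> \<le> 1 \<Longrightarrow> smooth_on \<Omega> (w \<epsilon>)"
    and "\<And>U L. open U \<Longrightarrow> U \<subseteq> L \<Longrightarrow> compact L \<Longrightarrow> L \<subseteq> \<Omega> \<Longrightarrow> tame_net moderate_net (\<lambda>_. U) w"
  shows "w \<in> moderate_nets \<Omega>"
proof (rule moderate_netsI[OF assms(1)])
  fix K assume "compact K" "K \<subseteq> \<Omega>"
  then obtain U L where "open U" "compact L" "K \<subseteq> U" "U \<subseteq> L" "L \<subseteq> \<Omega>"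
    using compact_open_neighbourhood[OF \<Omega>] by metis
  then show "\<exists>U. open U \<and> K \<subseteq> U \<and> tame_net moderate_net (\<lambda>_. U) w" using assms(2) by blast
qed

lemma gauge_mod: "open U \<Longrightarrow> gauge (at_right 0) (\<lambda>_. U) (net_gauges moderate_net (\<lambda>\<epsilon>. \<epsilon>))"
  by (rule gauge_net[OF net_class_moderate]) simp

lemma moderate_nets_diff:
  assumes "r \<in> moderate_nets \<Omega>" "s \<in> moderate_nets \<Omega>"
  shows "(\<lambda>\<epsilon> x. r \<epsilon> x - s \<epsilon> x) \<in> moderate_nets \<Omega>"
proof (rule moderate_nets_closed)
  show "smooth_on \<Omega> (\<lambda>x. r \<epsilon> x - s \<epsilon> x)" if "0 < \<epsilon>" "\<epsilon> \<le> 1" for \<epsilon>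
    by (intro smooth_on_diff[OF \<Omega>] moderate_netsD_smooth[OF _ that] assms)
  show "tame_net moderate_net (\<lambda>_. U) (\<lambda>\<epsilon> x. r \<epsilon> x - s \<epsilon> x)"
    if U: "open U" "U \<subseteq> L" "compact L" "L \<subseteq> \<Omega>" for U L
    by (intro gauge.tame_diff[OF gauge_mod[OF U(1)]] moderate_nets_tame[OF _ U] assms)
qed

lemma moderate_nets_mult_fixed:
  fixes r :: "('n, complex) net"
  assumes "smooth_on \<Omega> \<phi>" "r \<in> moderate_nets \<Omega>"
  shows "(\<lambda>\<epsilon> x. \<phi> x * r \<epsilon> x) \<in> moderate_nets \<Omega>"
proof (rule moderate_nets_closed)
  show "smooth_on \<Omega> (\<lambda>x. \<phi> x * r \<epsilon> x)" if "0 < \<epsilon>" "\<epsilon> \<le> 1" for \<epsilon>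
    by (intro smooth_on_mult[OF \<Omega>] moderate_netsD_smooth[OF _ that] assms)
  show "tame_net moderate_net (\<lambda>_. U) (\<lambda>\<epsilon> x. \<phi> x * r \<epsilon> x)"
    if U: "open U" "U \<subseteq> L" "compact L" "L \<subseteq> \<Omega>" for U L
    by (intro gauge.tame_mult[OF gauge_mod[OF U(1)]] moderate_nets_tame[OF _ U]
        tame_fixed_function[OF net_class_moderate _ U] assms)
qed

lemma moderate_nets_const:
  fixes c :: "real \<Rightarrow> 'b::real_normed_vector"
  assumes "moderate_net (\<lambda>\<epsilon>. norm (c \<epsilon>))"
  shows "(\<lambda>\<epsilon> _. c \<epsilon>) \<in> moderate_nets \<Omega>"
proof (intro moderate_nets_closed smooth_on_const[OF \<Omega>])
  fix U L :: "(real^'n) set" assume U: "open U"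
  interpret gauge "at_right 0" "\<lambda>_. U" "net_gauges moderate_net (\<lambda>\<epsilon>. \<epsilon>)" by (rule gauge_mod[OF U])
  have "bdd (\<lambda>\<epsilon> _. c \<epsilon>)" unfolding bdd_def bex_net_gauges using assms by (intro exI[of _ "\<lambda>\<epsilon>. norm (c \<epsilon>)"]) auto
  then show "tame_net moderate_net (\<lambda>_. U) (\<lambda>\<epsilon> _. c \<epsilon>)" by (rule tame_const)
qed

lemma sup_bigo_add:
  assumes "sup_bigo K r b" "sup_bigo K s b"
  shows "sup_bigo K (\<lambda>\<epsilon> x. r \<epsilon> x + s \<epsilon> x) b"
proof -
  obtain C D where "\<forall>\<^sub>F \<epsilon> in at_right 0. \<forall>x\<in>K. norm (r \<epsilon> x) \<le> C * b \<epsilon>" "\<forall>\<^sub>F \<epsilon> in at_right 0. \<forall>x\<in>K. norm (s \<epsilon> x) \<le> D * b \<epsilon>"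
    using assms unfolding sup_bigo_def by blast
  then have "\<forall>\<^sub>F \<epsilon> in at_right 0. \<forall>x\<in>K. norm (r \<epsilon> x + s \<epsilon> x) \<le> (C + D) * b \<epsilon>"
    by eventually_elim (force simp: distrib_right intro: order_trans[OF norm_triangle_ineq] add_mono)
  then show ?thesis unfolding sup_bigo_def by blast
qed

lemma sup_bigo_uminus: "sup_bigo K r b \<Longrightarrow> sup_bigo K (\<lambda>\<epsilon> x. - r \<epsilon> x) b"
  by (simp add: sup_bigo_def)

lemma negligible_netsI:
  assumes "r \<in> moderate_nets \<Omega>" "\<And>K q. compact K \<Longrightarrow> K \<subseteq> \<Omega> \<Longrightarrow> sup_bigo K r (\<lambda>\<epsilon>. \<epsilon> powr q)"
  shows "r \<in> negligible_nets \<Omega>"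
  using assms by (simp add: negligible_nets_def)

lemma negligible_netsD:
  "r \<in> negligible_nets \<Omega> \<Longrightarrow> compact K \<Longrightarrow> K \<subseteq> \<Omega> \<Longrightarrow> sup_bigo K r (\<lambda>\<epsilon>. \<epsilon> powr q)"
  "r \<in> negligible_nets \<Omega> \<Longrightarrow> r \<in> moderate_nets \<Omega>"
  by (auto simp: negligible_nets_def)

lemma colombeau_relI:
  assumes "r \<in> moderate_nets \<Omega>" "s \<in> moderate_nets \<Omega>"
    and "\<And>K q. compact K \<Longrightarrow> K \<subseteq> \<Omega> \<Longrightarrow> sup_bigo K (\<lambda>\<epsilon> x. r \<epsilon> x - s \<epsilon> x) (\<lambda>\<epsilon>. \<epsilon> powr q)"
  shows "(r, s) \<in> colombeau_rel \<Omega>"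
  using assms by (simp add: colombeau_rel_def negligible_netsI moderate_nets_diff)

lemma colombeau_relD:
  assumes "(r, s) \<in> colombeau_rel \<Omega>"
  shows "r \<in> moderate_nets \<Omega>" "s \<in> moderate_nets \<Omega>"
    "compact K \<Longrightarrow> K \<subseteq> \<Omega> \<Longrightarrow> sup_bigo K (\<lambda>\<epsilon> x. r \<epsilon> x - s \<epsilon> x) (\<lambda>\<epsilon>. \<epsilon> powr q)"
    "(\<lambda>\<epsilon> x. r \<epsilon> x - s \<epsilon> x) \<in> negligible_nets \<Omega>"
  using assms by (auto simp: colombeau_rel_def negligible_nets_def)

lemma equiv_colombeau_rel: "equiv (moderate_nets \<Omega>) (colombeau_rel \<Omega> :: (('n, 'b::real_normed_vector) net \<times> _) set)"
proof (rule equivI)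
  show "colombeau_rel \<Omega> \<subseteq> moderate_nets \<Omega> \<times> (moderate_nets \<Omega> :: ('n, 'b) net set)"
    by (auto simp: colombeau_rel_def)
  have z: "sup_bigo K (\<lambda>\<epsilon> (x::real^'n). 0::'b) (\<lambda>\<epsilon>. \<epsilon> powr q)" for K q
    unfolding sup_bigo_def by (rule exI[of _ 0]) simp
  show "refl_on (moderate_nets \<Omega>) (colombeau_rel \<Omega> :: (('n, 'b) net \<times> _) set)"
    by (rule refl_onI) (auto intro!: colombeau_relI simp: z)
  show "sym (colombeau_rel \<Omega> :: (('n, 'b) net \<times> _) set)"
  proof (rule symI)
    fix r s :: "('n, 'b) net" assume a: "(r, s) \<in> colombeau_rel \<Omega>"
    show "(s, r) \<in> colombeau_rel \<Omega>"
    proof (rule colombeau_relI[OF colombeau_relD(2,1)[OF a]])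
      show "sup_bigo K (\<lambda>\<epsilon> x. s \<epsilon> x - r \<epsilon> x) (\<lambda>\<epsilon>. \<epsilon> powr q)" if "compact K" "K \<subseteq> \<Omega>" for K q
        using sup_bigo_uminus[OF colombeau_relD(3)[OF a that]] by simp
    qed
  qed
  show "trans (colombeau_rel \<Omega> :: (('n, 'b) net \<times> _) set)"
  proof (rule transI)
    fix r s t :: "('n, 'b) net" assume a: "(r, s) \<in> colombeau_rel \<Omega>" "(s, t) \<in> colombeau_rel \<Omega>"
    show "(r, t) \<in> colombeau_rel \<Omega>"
    proof (rule colombeau_relI[OF colombeau_relD(1)[OF a(1)] colombeau_relD(2)[OF a(2)]])
      show "sup_bigo K (\<lambda>\<epsilon> x. r \<epsilon> x - t \<epsilon> x) (\<lambda>\<epsilon>. \<epsilon> powr q)" if "compact K" "K \<subseteq> \<Omega>" for K q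
        using sup_bigo_add[OF colombeau_relD(3)[OF a(1) that] colombeau_relD(3)[OF a(2) that]] by simp
    qed
  qed
qed

lemma gclass_eq_iff:
  "r \<in> moderate_nets \<Omega> \<Longrightarrow> s \<in> moderate_nets \<Omega> \<Longrightarrow> gclass \<Omega> r = gclass \<Omega> s \<longleftrightarrow> (r, s) \<in> colombeau_rel \<Omega>"
  unfolding gclass_def using eq_equiv_class_iff[OF equiv_colombeau_rel] by blast

lemma mem_gclass_self: "r \<in> moderate_nets \<Omega> \<Longrightarrow> r \<in> gclass \<Omega> r"
  unfolding gclass_def using equiv_class_self[OF equiv_colombeau_rel] by blast

lemma gclass_colombeau: "r \<in> moderate_nets \<Omega> \<Longrightarrow> gclass \<Omega> r \<in> colombeau \<Omega>"
  unfolding gclass_def colombeau_def by (rule quotientI)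

lemma colombeau_eq_gclass:
  assumes "u \<in> colombeau \<Omega>" "r \<in> u"
  shows "r \<in> moderate_nets \<Omega>" "u = gclass \<Omega> r"
proof -
  obtain s where s: "s \<in> moderate_nets \<Omega>" "u = colombeau_rel \<Omega> `` {s}"
    using assms(1) unfolding colombeau_def by (rule quotientE)
  then have sr: "(s, r) \<in> colombeau_rel \<Omega>" using assms(2) by simp
  then show "r \<in> moderate_nets \<Omega>" by (rule colombeau_relD)
  then show "u = gclass \<Omega> r" using gclass_eq_iff[OF s(1)] sr s(2) unfolding gclass_def by blast
qed

end

lemma tame_moderate_compose:
  fixes f :: "('n::finite, real^'m::finite) net" and u :: "('m, 'b::real_normed_vector) net"
  assumes \<Omega>2: "open \<Omega>2" and u: "u \<in> moderate_nets \<Omega>2" and U: "open U"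
    and f: "tame_net moderate_net (\<lambda>_. U) f"
    and K': "compact K'" "K' \<subseteq> \<Omega>2" "\<forall>\<^sub>F \<epsilon> in at_right 0. \<forall>x\<in>U. f \<epsilon> x \<in> K'"
  shows "tame_net moderate_net (\<lambda>_. U) (\<lambda>\<epsilon> x. u \<epsilon> (f \<epsilon> x))"
proof -
  interpret gauge "at_right 0" "\<lambda>_. U" "net_gauges moderate_net (\<lambda>\<epsilon>. \<epsilon>)"
    by (rule gauge_net[OF net_class_moderate]) (use U in simp)
  show ?thesis
  proof (rule tame_compose[OF f])
    fix \<alpha>
    obtain r where r: "moderate_net r" "\<forall>\<^sub>F \<epsilon> in at_right 0. \<forall>y\<in>K'. norm (partial_derivs \<alpha> (u \<epsilon>) y) \<le> r \<epsilon>"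
      using moderate_netsD_bound[OF u K'(1,2)] by blast
    have "\<forall>\<^sub>F \<epsilon> in at_right 0. \<forall>x\<in>U. norm (partial_derivs \<alpha> (u \<epsilon>) (f \<epsilon> x)) \<le> r \<epsilon>"
      using r(2) K'(3) by eventually_elim blast
    then show "bdd (\<lambda>\<epsilon> x. partial_derivs \<alpha> (u \<epsilon>) (f \<epsilon> x))"
      unfolding bdd_def bex_net_gauges using r(1) by blast
    show "\<forall>\<^sub>F \<epsilon> in at_right 0. \<forall>x\<in>U. partial_derivs \<alpha> (u \<epsilon>) differentiable (at (f \<epsilon> x))"
      using K'(3) eventually_at_right_0
    proof eventually_elim
      case (elim \<epsilon>)
      then have "smooth_on \<Omega>2 (u \<epsilon>)" using u moderate_netsD_smooth by blast
      then show ?case using elim K' unfolding smooth_on_def by blast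
    qed
  qed
qed

lemma cbounded_netD:
  assumes "cbounded_net \<Omega>1 \<Omega>2 f" "compact K" "K \<subseteq> \<Omega>1"
  obtains K' where "compact K'" "K' \<subseteq> \<Omega>2" "\<forall>\<^sub>F \<epsilon> in at_right 0. \<forall>x\<in>K. f \<epsilon> x \<in> K'"
proof -
  obtain K' e where K': "compact K'" "K' \<subseteq> \<Omega>2" "e > 0" "\<forall>\<epsilon>\<in>{0<..1}. \<epsilon> \<le> e \<longrightarrow> f \<epsilon> ` K \<subseteq> K'"
    using assms(1)[unfolded cbounded_net_def, THEN spec, THEN mp, OF conjI[OF assms(2,3)]] by (elim exE conjE)
  have "\<forall>\<^sub>F \<epsilon> in at_right 0. \<epsilon> < e" unfolding eventually_at_right_field using K'(3) by auto
  then have "\<forall>\<^sub>F \<epsilon> in at_right 0. \<forall>x\<in>K. f \<epsilon> x \<in> K'"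
    using eventually_at_right_0
  proof eventually_elim
    case (elim \<epsilon>)
    then have "f \<epsilon> ` K \<subseteq> K'" using K'(4) by simp
    then show ?case by blast
  qed
  with K'(1,2) show ?thesis by (rule that)
qed

text \<open>The nets over which the union in the definition of \<open>pullback\<close> runs.\<close>

definition pullback_rep :: "(real^'n::finite) set \<Rightarrow> ('n, real^'m::finite) net \<Rightarrow> ('m, complex) net \<Rightarrow> ('n, complex) net \<Rightarrow> bool" where
  "pullback_rep \<Omega>1 f u w \<longleftrightarrow> w \<in> moderate_nets \<Omega>1 \<and>
     (\<forall>K. compact K \<and> K \<subseteq> \<Omega>1 \<longrightarrow> (\<forall>\<^sub>F \<epsilon> in at_right 0. \<forall>x\<in>K. w \<epsilon> x = u \<epsilon> (f \<epsilon> x)))"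

text \<open>For a single \<open>\<epsilon>\<close>, the values of \<open>f\<^sub>\<epsilon>\<close> may leave \<open>\<Omega>2\<close>. Cutting \<open>u\<^sub>\<epsilon>\<close> off to a compact set makes it
  smooth on the whole space and the composition smooth on \<open>\<Omega>1\<close>; since the compact sets exhaust \<open>\<Omega>2\<close>
  as \<open>\<epsilon> \<rightarrow> 0\<close>, c-boundedness makes the cut-off invisible on every compact set for small \<open>\<epsilon>\<close>.\<close>

lemma pullback_rep_exists:
  fixes f :: "('n::finite, real^'m::finite) net" and u :: "('m, complex) net"
  assumes \<Omega>: "open \<Omega>1" "open \<Omega>2" and f: "f \<in> moderate_nets \<Omega>1" "cbounded_net \<Omega>1 \<Omega>2 f"
    and u: "u \<in> moderate_nets \<Omega>2"
  shows "\<exists>w. pullback_rep \<Omega>1 f u w"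
proof -
  obtain C where C: "\<And>n. compact (C n)" "\<And>n. C n \<subseteq> \<Omega>2"
      and "\<And>n. C n \<subseteq> interior (C (Suc n))" "\<Union> (range C) = \<Omega>2"
      and C_exhausts: "\<And>K. compact K \<Longrightarrow> K \<subseteq> \<Omega>2 \<Longrightarrow> \<exists>N. \<forall>n\<ge>N. K \<subseteq> C n"
    by (rule open_Union_compact_subsets[OF \<Omega>(2)], rule that) assumption+
  have "\<exists>\<kappa>. \<kappa> \<in> test_functions \<Omega>2 \<and> (\<forall>x\<in>C n. \<kappa> x = 1)" for n
    using test_function_cutoff[OF \<Omega>(2) C(1,2)] by metis
  then obtain \<kappa> where \<kappa>: "\<And>n. \<kappa> n \<in> test_functions \<Omega>2" "\<And>n x. x \<in> C n \<Longrightarrow> \<kappa> n x = 1" by metis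
  \<comment> \<open>any index tending to infinity as \<open>\<epsilon> \<rightarrow> 0\<close> would do\<close>
  define n where "n \<epsilon> = nat \<lceil>1 / \<epsilon>\<rceil>" for \<epsilon> :: real
  define w where "w \<epsilon> x = \<kappa> (n \<epsilon>) (f \<epsilon> x) * u \<epsilon> (f \<epsilon> x)" for \<epsilon> x
  have n: "\<forall>\<^sub>F \<epsilon> in at_right 0. N \<le> n \<epsilon>" for N
  proof -
    have "\<forall>\<^sub>F \<epsilon> in at_right (0::real). \<epsilon> < 1 / (real N + 1)"
      unfolding eventually_at_right_field by (rule exI[of _ "1 / (real N + 1)"]) auto
    then show ?thesis
      using eventually_at_right_0
    proof eventually_elim
      case (elim \<epsilon>)
      then have "real N \<le> 1 / \<epsilon>" by (simp add: field_simps)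
      also have "\<dots> \<le> of_int \<lceil>1 / \<epsilon>\<rceil>" by (rule le_of_int_ceiling)
      finally show ?case unfolding n_def by linarith
    qed
  qed
  have weq: "\<forall>\<^sub>F \<epsilon> in at_right 0. \<forall>x\<in>K. w \<epsilon> x = u \<epsilon> (f \<epsilon> x)" if K: "compact K" "K \<subseteq> \<Omega>1" for K
  proof -
    obtain K' where K': "compact K'" "K' \<subseteq> \<Omega>2" "\<forall>\<^sub>F \<epsilon> in at_right 0. \<forall>x\<in>K. f \<epsilon> x \<in> K'"
      by (rule cbounded_netD[OF f(2) K])
    obtain N where N: "\<forall>n\<ge>N. K' \<subseteq> C n" using C_exhausts[OF K'(1,2)] by blast
    show ?thesis
      using K'(3) n[of N] by eventually_elim (use N \<kappa>(2) in \<open>auto simp: w_def subset_eq\<close>)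
  qed
  have "w \<in> moderate_nets \<Omega>1"
  proof (rule moderate_netsI)
    fix \<epsilon> :: real assume \<epsilon>: "0 < \<epsilon>" "\<epsilon> \<le> 1"
    obtain K where K: "compact K" "K \<subseteq> \<Omega>2" "\<And>x. x \<notin> K \<Longrightarrow> \<kappa> (n \<epsilon>) x = 0" "smooth_on UNIV (\<kappa> (n \<epsilon>))"
      by (rule test_functionsD[OF \<kappa>(1)[of "n \<epsilon>"]], rule that) assumption+
    have "smooth_on UNIV (\<lambda>y. \<kappa> (n \<epsilon>) y * u \<epsilon> y)"
      by (rule smooth_on_extend_zero[OF \<Omega>(2) K(1,2)])
        (use K(3) in \<open>auto intro!: smooth_on_mult[OF \<Omega>(2)] smooth_on_subset[OF K(4)] moderate_netsD_smooth[OF u \<epsilon>]\<close>)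
    from smooth_on_compose[OF \<Omega>(1) moderate_netsD_smooth[OF f(1) \<epsilon>] this]
    show "smooth_on \<Omega>1 (w \<epsilon>)" by (simp add: w_def[abs_def])
  next
    fix K assume "compact K" "K \<subseteq> \<Omega>1"
    then obtain U L where U: "open U" "compact L" "K \<subseteq> U" "U \<subseteq> L" "L \<subseteq> \<Omega>1"
      using compact_open_neighbourhood[OF \<Omega>(1)] by metis
    interpret gauge "at_right 0" "\<lambda>_. U" "net_gauges moderate_net (\<lambda>\<epsilon>. \<epsilon>)"
      by (rule gauge_net[OF net_class_moderate]) (use U in simp)
    obtain K' where K': "compact K'" "K' \<subseteq> \<Omega>2" "\<forall>\<^sub>F \<epsilon> in at_right 0. \<forall>x\<in>L. f \<epsilon> x \<in> K'"
      by (rule cbounded_netD[OF f(2) U(2,5)])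
    have "\<forall>\<^sub>F \<epsilon> in at_right 0. \<forall>x\<in>U. f \<epsilon> x \<in> K'"
      using K'(3) by eventually_elim (use U(4) in blast)
    then have "tame (\<lambda>\<epsilon> x. u \<epsilon> (f \<epsilon> x))"
      by (rule tame_moderate_compose[OF \<Omega>(2) u U(1) moderate_nets_tame[OF f(1) U(1,4,2,5)] K'(1,2)])
    moreover have "\<forall>\<^sub>F \<epsilon> in at_right 0. \<forall>x\<in>U. u \<epsilon> (f \<epsilon> x) = w \<epsilon> x"
      using weq[OF U(2,5)] by eventually_elim (use U(4) in auto)
    ultimately have "tame w" by (rule tame_cong)
    then show "\<exists>U. open U \<and> K \<subseteq> U \<and> tame_net moderate_net (\<lambda>_. U) w" using U by blast
  qed
  then show ?thesis using weq unfolding pullback_rep_def by blast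
qed

lemma norm_derivative_le_sum_partial:
  fixes u :: "real^'m::finite \<Rightarrow> 'b::real_normed_vector"
  shows "onorm (\<lambda>v. \<Sum>j\<in>UNIV. v $ j *\<^sub>R partial_deriv j u y) \<le> (\<Sum>j\<in>UNIV. norm (partial_deriv j u y))"
proof (rule onorm_le)
  fix v :: "real^'m"
  have "norm (\<Sum>j\<in>UNIV. v $ j *\<^sub>R partial_deriv j u y) \<le> (\<Sum>j\<in>UNIV. norm v * norm (partial_deriv j u y))"
    by (rule sum_norm_le) (auto intro!: mult_right_mono component_le_norm_cart)
  then show "norm (\<Sum>j\<in>UNIV. v $ j *\<^sub>R partial_deriv j u y) \<le> (\<Sum>j\<in>UNIV. norm (partial_deriv j u y)) * norm v"
    by (simp add: sum_distrib_left mult.commute)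
qed

text \<open>The change of \<open>u\<close> is negligible on the compact set containing the values of \<open>f'\<^sub>\<epsilon>\<close>. For the change
  of \<open>f\<close>, the mean value theorem is applied on a ball around \<open>f'\<^sub>\<epsilon>(x)\<close> inside \<open>\<Omega>2\<close>; the moderate bound for
  the gradient of \<open>u\<^sub>\<epsilon>\<close> is outweighed by the negligible difference \<open>f\<^sub>\<epsilon> - f'\<^sub>\<epsilon>\<close>.\<close>

lemma composition_negligible:
  fixes f f' :: "('n::finite, real^'m::finite) net" and u u' :: "('m, complex) net"
  assumes \<Omega>: "open \<Omega>1" "open \<Omega>2"
    and f: "(f, f') \<in> colombeau_rel \<Omega>1" "cbounded_net \<Omega>1 \<Omega>2 f" "cbounded_net \<Omega>1 \<Omega>2 f'"
    and u: "(u, u') \<in> colombeau_rel \<Omega>2" and K: "compact K" "K \<subseteq> \<Omega>1"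
  shows "sup_bigo K (\<lambda>\<epsilon> x. u \<epsilon> (f \<epsilon> x) - u' \<epsilon> (f' \<epsilon> x)) (\<lambda>\<epsilon>. \<epsilon> powr q)"
proof -
  obtain J where J: "compact J" "J \<subseteq> \<Omega>2" "\<forall>\<^sub>F \<epsilon> in at_right 0. \<forall>x\<in>K. f' \<epsilon> x \<in> J"
    by (rule cbounded_netD[OF f(3) K])
  obtain \<delta> where \<delta>: "\<delta> > 0" "(\<Union>y\<in>J. cball y \<delta>) \<subseteq> \<Omega>2"
    using compact_subset_open_imp_cball_epsilon_subset[OF J(1) \<Omega>(2) J(2)] by blast
  define J' where "J' = {y + z |y z. y \<in> J \<and> z \<in> cball (0::real^'m) \<delta>}"
  have J': "compact J'" unfolding J'_def by (rule compact_sums[OF J(1) compact_cball])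
  have ball_J': "cball y \<delta> \<subseteq> J'" if "y \<in> J" for y
  proof
    fix z assume "z \<in> cball y \<delta>"
    then have "z = y + (z - y)" "z - y \<in> cball 0 \<delta>" by (auto simp: dist_norm norm_minus_commute)
    then show "z \<in> J'" unfolding J'_def using that by blast
  qed
  have J'\<Omega>: "J' \<subseteq> \<Omega>2"
  proof
    fix z assume "z \<in> J'"
    then obtain y v where "z = y + v" "y \<in> J" "norm v \<le> \<delta>" unfolding J'_def by auto
    then have "z \<in> cball y \<delta>" by (simp add: dist_norm)
    then show "z \<in> \<Omega>2" using \<delta>(2) \<open>y \<in> J\<close> by blast
  qed
  have um: "u \<in> moderate_nets \<Omega>2" using u by (rule colombeau_relD[OF \<Omega>(2)])
  have "\<exists>r. \<forall>j. moderate_net (r j) \<and> (\<forall>\<^sub>F \<epsilon> in at_right 0. \<forall>y\<in>J'. norm (partial_deriv j (u \<epsilon>) y) \<le> r j \<epsilon>)"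
    using moderate_netsD_bound[OF um J' J'\<Omega>, of "[_]"] by (intro choice) auto
  then obtain r where r: "\<And>j. moderate_net (r j)"
      "\<And>j. \<forall>\<^sub>F \<epsilon> in at_right 0. \<forall>y\<in>J'. norm (partial_deriv j (u \<epsilon>) y) \<le> r j \<epsilon>" by blast
  have "moderate_net (\<lambda>\<epsilon>. \<Sum>j\<in>A. r j \<epsilon>)" for A
    by (induction A rule: infinite_finite_induct) (auto intro: net_classD[OF net_class_moderate] r)
  then obtain p M where M: "\<forall>\<^sub>F \<epsilon> in at_right 0. \<bar>\<Sum>j\<in>UNIV. r j \<epsilon>\<bar> \<le> M * \<epsilon> powr (- p)"
    unfolding moderate_net_def by blast
  \<comment> \<open>the exponent \<open>p\<close> compensates the growth of the gradient of \<open>u\<^sub>\<epsilon>\<close>\<close>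
  obtain C1 where C1: "\<forall>\<^sub>F \<epsilon> in at_right 0. \<forall>x\<in>K. norm (f \<epsilon> x - f' \<epsilon> x) \<le> C1 * \<epsilon> powr (p + q)"
    using colombeau_relD(3)[OF \<Omega>(1) f(1) K] unfolding sup_bigo_def by blast
  obtain C2 where C2: "\<forall>\<^sub>F \<epsilon> in at_right 0. \<forall>x\<in>K. norm (f \<epsilon> x - f' \<epsilon> x) \<le> C2 * \<epsilon> powr 1"
    using colombeau_relD(3)[OF \<Omega>(1) f(1) K] unfolding sup_bigo_def by blast
  obtain C3 where C3: "\<forall>\<^sub>F \<epsilon> in at_right 0. \<forall>y\<in>J. norm (u \<epsilon> y - u' \<epsilon> y) \<le> C3 * \<epsilon> powr q"
    using colombeau_relD(3)[OF \<Omega>(2) u J(1,2)] unfolding sup_bigo_def by blast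
  have small: "\<forall>\<^sub>F \<epsilon> in at_right 0. C2 * \<epsilon> powr 1 \<le> \<delta>"
  proof -
    have "\<forall>\<^sub>F \<epsilon> in at_right (0::real). \<epsilon> < \<delta> / (\<bar>C2\<bar> + 1)"
      unfolding eventually_at_right_field using \<delta>(1) by (intro exI[of _ "\<delta> / (\<bar>C2\<bar> + 1)"]) auto
    then show ?thesis
      using eventually_at_right_0
    proof eventually_elim
      case (elim \<epsilon>)
      have "C2 * \<epsilon> \<le> (\<bar>C2\<bar> + 1) * \<epsilon>" using elim by (intro mult_right_mono) auto
      also have "\<dots> \<le> \<delta>" using elim by (simp add: field_simps)
      finally show ?case using elim by simp
    qed
  qed
  have rall: "\<forall>\<^sub>F \<epsilon> in at_right 0. \<forall>j. \<forall>y\<in>J'. norm (partial_deriv j (u \<epsilon>) y) \<le> r j \<epsilon>"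
    using r(2) by (rule eventually_all_finite)
  have "\<forall>\<^sub>F \<epsilon> in at_right 0. \<forall>x\<in>K. norm (u \<epsilon> (f \<epsilon> x) - u' \<epsilon> (f' \<epsilon> x)) \<le> (\<bar>M\<bar> * \<bar>C1\<bar> + C3) * \<epsilon> powr q"
    using J(3) M C1 C2 C3 small rall eventually_at_right_0
  proof eventually_elim
    case (elim \<epsilon>)
    show ?case
    proof
      fix x assume x: "x \<in> K"
      have sm: "smooth_on \<Omega>2 (u \<epsilon>)" using moderate_netsD_smooth[OF um] elim by blast
      have y: "f' \<epsilon> x \<in> J" using elim x by blast
      have "norm (f \<epsilon> x - f' \<epsilon> x) \<le> \<delta>" using elim x by fastforce
      then have y': "f \<epsilon> x \<in> cball (f' \<epsilon> x) \<delta>" by (simp add: dist_norm norm_minus_commute)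
      have "norm (u \<epsilon> (f \<epsilon> x) - u \<epsilon> (f' \<epsilon> x)) \<le> (\<bar>M\<bar> * \<epsilon> powr (- p)) * norm (f \<epsilon> x - f' \<epsilon> x)"
      proof (rule differentiable_bound[where S="cball (f' \<epsilon> x) \<delta>"
            and f'="\<lambda>y v. \<Sum>j\<in>UNIV. v $ j *\<^sub>R partial_deriv j (u \<epsilon>) y"])
        fix y assume "y \<in> cball (f' \<epsilon> x) \<delta>"
        then have yJ: "y \<in> J'" using ball_J'[OF \<open>f' \<epsilon> x \<in> J\<close>] by blast
        then have "u \<epsilon> differentiable (at y)" 
          using sm[unfolded smooth_on_def, THEN spec[of _ "[]"]] J'\<Omega> by auto
        then show "(u \<epsilon> has_derivative (\<lambda>v. \<Sum>j\<in>UNIV. v $ j *\<^sub>R partial_deriv j (u \<epsilon>) y)) (at y within cball (f' \<epsilon> x) \<delta>)"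
          by (rule has_derivative_at_withinI[OF has_derivative_partial_derivs])
        have "onorm (\<lambda>v. \<Sum>j\<in>UNIV. v $ j *\<^sub>R partial_deriv j (u \<epsilon>) y) \<le> (\<Sum>j\<in>UNIV. norm (partial_deriv j (u \<epsilon>) y))"
          by (rule norm_derivative_le_sum_partial)
        also have "\<dots> \<le> (\<Sum>j\<in>UNIV. r j \<epsilon>)" using elim yJ by (intro sum_mono) blast
        also have "\<dots> \<le> M * \<epsilon> powr (- p)" using elim by linarith
        also have "\<dots> \<le> \<bar>M\<bar> * \<epsilon> powr (- p)" by (intro mult_right_mono) auto
        finally show "onorm (\<lambda>v. \<Sum>j\<in>UNIV. v $ j *\<^sub>R partial_deriv j (u \<epsilon>) y) \<le> \<bar>M\<bar> * \<epsilon> powr (- p)" .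
      qed (use y' \<delta>(1) in auto)
      also have "\<dots> \<le> (\<bar>M\<bar> * \<epsilon> powr (- p)) * (\<bar>C1\<bar> * \<epsilon> powr (p + q))"
      proof (rule mult_left_mono)
        have "norm (f \<epsilon> x - f' \<epsilon> x) \<le> C1 * \<epsilon> powr (p + q)" using elim x by blast
        also have "\<dots> \<le> \<bar>C1\<bar> * \<epsilon> powr (p + q)" by (intro mult_right_mono) auto
        finally show "norm (f \<epsilon> x - f' \<epsilon> x) \<le> \<bar>C1\<bar> * \<epsilon> powr (p + q)" .
      qed simp
      also have "\<dots> = \<bar>M\<bar> * \<bar>C1\<bar> * \<epsilon> powr q"
        using elim by (simp add: powr_add powr_minus field_simps)
      finally have 1: "norm (u \<epsilon> (f \<epsilon> x) - u \<epsilon> (f' \<epsilon> x)) \<le> \<bar>M\<bar> * \<bar>C1\<bar> * \<epsilon> powr q" .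
      have 2: "norm (u \<epsilon> (f' \<epsilon> x) - u' \<epsilon> (f' \<epsilon> x)) \<le> C3 * \<epsilon> powr q" using elim y by blast
      have "norm (u \<epsilon> (f \<epsilon> x) - u' \<epsilon> (f' \<epsilon> x)) \<le>
          norm (u \<epsilon> (f \<epsilon> x) - u \<epsilon> (f' \<epsilon> x)) + norm (u \<epsilon> (f' \<epsilon> x) - u' \<epsilon> (f' \<epsilon> x))"
        using norm_triangle_ineq[of "u \<epsilon> (f \<epsilon> x) - u \<epsilon> (f' \<epsilon> x)" "u \<epsilon> (f' \<epsilon> x) - u' \<epsilon> (f' \<epsilon> x)"] by simp
      with 1 2 show "norm (u \<epsilon> (f \<epsilon> x) - u' \<epsilon> (f' \<epsilon> x)) \<le> (\<bar>M\<bar> * \<bar>C1\<bar> + C3) * \<epsilon> powr q"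
        unfolding distrib_right by linarith
    qed
  qed
  then show ?thesis unfolding sup_bigo_def by blast
qed

lemma pullback_rep_rel:
  fixes f f' :: "('n::finite, real^'m::finite) net" and u u' :: "('m, complex) net"
  assumes \<Omega>: "open \<Omega>1" "open \<Omega>2"
    and f: "(f, f') \<in> colombeau_rel \<Omega>1" "cbounded_net \<Omega>1 \<Omega>2 f" "cbounded_net \<Omega>1 \<Omega>2 f'"
    and u: "(u, u') \<in> colombeau_rel \<Omega>2" and w: "pullback_rep \<Omega>1 f u w" "pullback_rep \<Omega>1 f' u' w'"
  shows "(w, w') \<in> colombeau_rel \<Omega>1"
proof (rule colombeau_relI[OF \<Omega>(1)])
  fix K q assume K: "compact K" "K \<subseteq> \<Omega>1"
  obtain C where C: "\<forall>\<^sub>F \<epsilon> in at_right 0. \<forall>x\<in>K. norm (u \<epsilon> (f \<epsilon> x) - u' \<epsilon> (f' \<epsilon> x)) \<le> C * \<epsilon> powr q"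
    using composition_negligible[OF \<Omega> f u K] unfolding sup_bigo_def by blast
  have "\<forall>\<^sub>F \<epsilon> in at_right 0. \<forall>x\<in>K. w \<epsilon> x = u \<epsilon> (f \<epsilon> x)" "\<forall>\<^sub>F \<epsilon> in at_right 0. \<forall>x\<in>K. w' \<epsilon> x = u' \<epsilon> (f' \<epsilon> x)"
    using w K unfolding pullback_rep_def by blast+
  with C have "\<forall>\<^sub>F \<epsilon> in at_right 0. \<forall>x\<in>K. norm (w \<epsilon> x - w' \<epsilon> x) \<le> C * \<epsilon> powr q"
    by eventually_elim simp
  then show "sup_bigo K (\<lambda>\<epsilon> x. w \<epsilon> x - w' \<epsilon> x) (\<lambda>\<epsilon>. \<epsilon> powr q)" unfolding sup_bigo_def by blast
qed (use w in \<open>auto simp: pullback_rep_def\<close>)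

lemma pullback_eq_gclass:
  fixes f :: "('n::finite, real^'m::finite) net" and u :: "('m, complex) net"
  assumes \<Omega>: "open \<Omega>1" "open \<Omega>2" and f: "f \<in> moderate_nets \<Omega>1" "cbounded_net \<Omega>1 \<Omega>2 f"
    and u: "u \<in> moderate_nets \<Omega>2" and w: "pullback_rep \<Omega>1 f u w"
  shows "pullback \<Omega>1 f u = gclass \<Omega>1 w"
proof -
  have ff: "(f, f) \<in> colombeau_rel \<Omega>1" "(u, u) \<in> colombeau_rel \<Omega>2"
    using equiv_colombeau_rel[OF \<Omega>(1)] equiv_colombeau_rel[OF \<Omega>(2)] f u unfolding equiv_def refl_on_def by blast+
  have same: "gclass \<Omega>1 w' = gclass \<Omega>1 w" if w': "pullback_rep \<Omega>1 f u w'" for w'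
  proof -
    have "w' \<in> moderate_nets \<Omega>1" "w \<in> moderate_nets \<Omega>1" using w w' by (simp_all add: pullback_rep_def)
    then show ?thesis
      using pullback_rep_rel[OF \<Omega> ff(1) f(2) f(2) ff(2) w' w] by (simp add: gclass_eq_iff[OF \<Omega>(1)])
  qed
  have "pullback \<Omega>1 f u = (\<Union>w'\<in>{w'. pullback_rep \<Omega>1 f u w'}. gclass \<Omega>1 w')"
    unfolding pullback_def pullback_rep_def ..
  also have "\<dots> = (\<Union>w'\<in>{w'. pullback_rep \<Omega>1 f u w'}. gclass \<Omega>1 w)"
    by (rule SUP_cong[OF refl]) (simp add: same)
  also have "\<dots> = gclass \<Omega>1 w" using w by (intro SUP_const) auto
  finally show ?thesis .
qed

section \<open>Directions of rapid decrease\<close>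

text \<open>Rapid decrease as a property of a single net instead of a class of Fourier transforms, so that nets can
  be cut into pieces, estimated and reassembled.\<close>

definition rapid_on :: "(real \<Rightarrow> real^'m::finite \<Rightarrow> complex) \<Rightarrow> (real^'m) set \<Rightarrow> bool" where
  "rapid_on v \<Gamma> \<longleftrightarrow> (\<exists>N. \<forall>q::nat. \<exists>C. \<forall>\<^sub>F \<epsilon> in at_right 0. \<forall>\<xi>\<in>\<Gamma>. \<forall>t>0.
     (1 + t) ^ q * norm (ft (v \<epsilon>) (t *\<^sub>R \<xi>)) \<le> C * \<epsilon> powr (- N))"

lemma rapid_on_subset: "rapid_on v \<Gamma> \<Longrightarrow> \<Gamma>' \<subseteq> \<Gamma> \<Longrightarrow> rapid_on v \<Gamma>'"
  unfolding rapid_on_def by (fast elim: eventually_mono)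

lemma bigo_weaken:
  fixes N C :: real
  assumes "\<forall>\<^sub>F \<epsilon> in at_right 0. \<forall>x\<in>K. h \<epsilon> x \<le> C * \<epsilon> powr (- N)" "N \<le> N'"
  shows "\<forall>\<^sub>F \<epsilon> in at_right 0. \<forall>x\<in>K. h \<epsilon> x \<le> \<bar>C\<bar> * \<epsilon> powr (- N')"
  using assms(1) eventually_at_right_0
proof eventually_elim
  case (elim \<epsilon>)
  have "C * \<epsilon> powr (- N) \<le> \<bar>C\<bar> * \<epsilon> powr (- N')"
    using elim assms(2) by (intro mult_mono powr_neg_mono) auto
  then show ?case using elim by fastforce
qed

lemma rapid_on_iff:
  "rapid_on v \<Gamma> \<longleftrightarrow> (\<exists>N. \<forall>q::nat. \<exists>C. \<forall>\<^sub>F \<epsilon> in at_right 0. \<forall>x\<in>\<Gamma> \<times> {0<..}.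
     (1 + snd x) ^ q * norm (ft (v \<epsilon>) (snd x *\<^sub>R fst x)) \<le> C * \<epsilon> powr (- N))"
proof -
  have "(\<forall>\<xi>\<in>\<Gamma>. \<forall>t>0. (1 + t) ^ q * norm (ft (v \<epsilon>) (t *\<^sub>R \<xi>)) \<le> B) \<longleftrightarrow>
      (\<forall>x\<in>\<Gamma> \<times> {0<..}. (1 + snd x) ^ q * norm (ft (v \<epsilon>) (snd x *\<^sub>R fst x)) \<le> B)" for q \<epsilon> B
    by auto
  then show ?thesis unfolding rapid_on_def by presburger
qed

lemma rapid_on_Un:
  assumes "rapid_on v \<Gamma>" "rapid_on v \<Gamma>'"
  shows "rapid_on v (\<Gamma> \<union> \<Gamma>')"
proof -
  obtain N where N: "\<And>q::nat. \<exists>C. \<forall>\<^sub>F \<epsilon> in at_right 0. \<forall>x\<in>\<Gamma> \<times> {0<..}.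
     (1 + snd x) ^ q * norm (ft (v \<epsilon>) (snd x *\<^sub>R fst x)) \<le> C * \<epsilon> powr (- N)"
    using assms(1) unfolding rapid_on_iff by blast
  obtain N' where N': "\<And>q::nat. \<exists>C. \<forall>\<^sub>F \<epsilon> in at_right 0. \<forall>x\<in>\<Gamma>' \<times> {0<..}.
     (1 + snd x) ^ q * norm (ft (v \<epsilon>) (snd x *\<^sub>R fst x)) \<le> C * \<epsilon> powr (- N')"
    using assms(2) unfolding rapid_on_iff by blast
  show ?thesis unfolding rapid_on_iff
  proof (rule exI[of _ "max N N'"], rule allI)
    fix q :: nat
    obtain C C' where "\<forall>\<^sub>F \<epsilon> in at_right 0. \<forall>x\<in>\<Gamma> \<times> {0<..}. (1 + snd x) ^ q * norm (ft (v \<epsilon>) (snd x *\<^sub>R fst x)) \<le> C * \<epsilon> powr (- N)"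
      "\<forall>\<^sub>F \<epsilon> in at_right 0. \<forall>x\<in>\<Gamma>' \<times> {0<..}. (1 + snd x) ^ q * norm (ft (v \<epsilon>) (snd x *\<^sub>R fst x)) \<le> C' * \<epsilon> powr (- N')"
      using N[of q] N'[of q] by blast
    note C = this[THEN bigo_weaken, of "max N N'"]
    have "\<forall>\<^sub>F \<epsilon> in at_right 0. \<forall>x\<in>(\<Gamma> \<union> \<Gamma>') \<times> {0<..}.
        (1 + snd x) ^ q * norm (ft (v \<epsilon>) (snd x *\<^sub>R fst x)) \<le> max \<bar>C\<bar> \<bar>C'\<bar> * \<epsilon> powr (- max N N')"
      using C(1)[OF max.cobounded1] C(2)[OF max.cobounded2]
    proof eventually_elim
      case (elim \<epsilon>)
      have le: "\<bar>C\<bar> * \<epsilon> powr (- max N N') \<le> max \<bar>C\<bar> \<bar>C'\<bar> * \<epsilon> powr (- max N N')"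
        "\<bar>C'\<bar> * \<epsilon> powr (- max N N') \<le> max \<bar>C\<bar> \<bar>C'\<bar> * \<epsilon> powr (- max N N')"
        by (intro mult_right_mono; simp)+
      show ?case using elim by (fastforce intro: order_trans[OF _ le(1)] order_trans[OF _ le(2)])
    qed
    then show "\<exists>C. \<forall>\<^sub>F \<epsilon> in at_right 0. \<forall>x\<in>(\<Gamma> \<union> \<Gamma>') \<times> {0<..}.
        (1 + snd x) ^ q * norm (ft (v \<epsilon>) (snd x *\<^sub>R fst x)) \<le> C * \<epsilon> powr (- max N N')" by blast
  qed
qed

lemma rapid_on_empty: "rapid_on v {}"
  unfolding rapid_on_def by simp

lemma rapid_on_Union: "finite I \<Longrightarrow> (\<And>i. i \<in> I \<Longrightarrow> rapid_on v (\<Gamma> i)) \<Longrightarrow> rapid_on v (\<Union>i\<in>I. \<Gamma> i)"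
  by (induction I rule: finite_induct) (auto intro: rapid_on_empty rapid_on_Un)

lemma rapid_on_add:
  assumes "rapid_on v \<Gamma>" "rapid_on v' \<Gamma>"
    and eq: "\<forall>\<^sub>F \<epsilon> in at_right 0. \<forall>\<xi>. ft (w \<epsilon>) \<xi> = ft (v \<epsilon>) \<xi> + ft (v' \<epsilon>) \<xi>"
  shows "rapid_on w \<Gamma>"
proof -
  obtain N where N: "\<And>q::nat. \<exists>C. \<forall>\<^sub>F \<epsilon> in at_right 0. \<forall>x\<in>\<Gamma> \<times> {0<..}.
     (1 + snd x) ^ q * norm (ft (v \<epsilon>) (snd x *\<^sub>R fst x)) \<le> C * \<epsilon> powr (- N)"
    using assms(1) unfolding rapid_on_iff by blast
  obtain N' where N': "\<And>q::nat. \<exists>C. \<forall>\<^sub>F \<epsilon> in at_right 0. \<forall>x\<in>\<Gamma> \<times> {0<..}.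
     (1 + snd x) ^ q * norm (ft (v' \<epsilon>) (snd x *\<^sub>R fst x)) \<le> C * \<epsilon> powr (- N')"
    using assms(2) unfolding rapid_on_iff by blast
  show ?thesis unfolding rapid_on_iff
  proof (rule exI[of _ "max N N'"], rule allI)
    fix q :: nat
    obtain C C' where "\<forall>\<^sub>F \<epsilon> in at_right 0. \<forall>x\<in>\<Gamma> \<times> {0<..}. (1 + snd x) ^ q * norm (ft (v \<epsilon>) (snd x *\<^sub>R fst x)) \<le> C * \<epsilon> powr (- N)"
      "\<forall>\<^sub>F \<epsilon> in at_right 0. \<forall>x\<in>\<Gamma> \<times> {0<..}. (1 + snd x) ^ q * norm (ft (v' \<epsilon>) (snd x *\<^sub>R fst x)) \<le> C' * \<epsilon> powr (- N')"
      using N[of q] N'[of q] by blast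
    note C0 = this[THEN bigo_weaken, of "max N N'"]
    note C = C0(1)[OF max.cobounded1] C0(2)[OF max.cobounded2]
    have "\<forall>\<^sub>F \<epsilon> in at_right 0. \<forall>x\<in>\<Gamma> \<times> {0<..}.
        (1 + snd x) ^ q * norm (ft (w \<epsilon>) (snd x *\<^sub>R fst x)) \<le> (\<bar>C\<bar> + \<bar>C'\<bar>) * \<epsilon> powr (- max N N')"
      using C eq
    proof eventually_elim
      case (elim \<epsilon>)
      show ?case
      proof
        fix x assume x: "x \<in> \<Gamma> \<times> {0::real<..}"
        have "(1 + snd x) ^ q * norm (ft (w \<epsilon>) (snd x *\<^sub>R fst x)) \<le>
            (1 + snd x) ^ q * (norm (ft (v \<epsilon>) (snd x *\<^sub>R fst x)) + norm (ft (v' \<epsilon>) (snd x *\<^sub>R fst x)))"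
          using x elim(3) by (intro mult_left_mono) (auto simp: norm_triangle_ineq)
        also have "\<dots> \<le> \<bar>C\<bar> * \<epsilon> powr (- max N N') + \<bar>C'\<bar> * \<epsilon> powr (- max N N')"
          unfolding distrib_left using elim(1,2) x by (intro add_mono) auto
        finally show "(1 + snd x) ^ q * norm (ft (w \<epsilon>) (snd x *\<^sub>R fst x)) \<le> (\<bar>C\<bar> + \<bar>C'\<bar>) * \<epsilon> powr (- max N N')"
          by (simp add: distrib_right)
      qed
    qed
    then show "\<exists>C. \<forall>\<^sub>F \<epsilon> in at_right 0. \<forall>x\<in>\<Gamma> \<times> {0<..}.
        (1 + snd x) ^ q * norm (ft (w \<epsilon>) (snd x *\<^sub>R fst x)) \<le> C * \<epsilon> powr (- max N N')" by blast
  qed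
qed

text \<open>The weights \<open>(1 + l)^p\<close> and \<open>(1 + l^2)^(p/2)\<close> are equivalent.\<close>

lemma power2_powr_half: "0 < x \<Longrightarrow> (x\<^sup>2) powr (real p / 2) = x ^ p" for x :: real
proof -
  assume x: "0 < x"
  have "x\<^sup>2 = x powr 2" using x by (simp add: powr_numeral)
  then have "(x\<^sup>2) powr (real p / 2) = x powr real p" by (simp only: powr_powr) simp
  then show ?thesis using x by (simp add: powr_realpow)
qed

lemma weight_le: "0 < l \<Longrightarrow> (1 + l\<^sup>2) powr (real p / 2) \<le> (1 + l) ^ p"
proof -
  assume l: "0 < l"
  have "(1 + l\<^sup>2) powr (real p / 2) \<le> ((1 + l)\<^sup>2) powr (real p / 2)"
    using l by (intro powr_mono2) (auto simp: power2_sum add_nonneg_nonneg)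
  also have "\<dots> = (1 + l) ^ p" using l by (intro power2_powr_half) simp
  finally show ?thesis .
qed

lemma weight_ge: "0 < l \<Longrightarrow> (1 + l) ^ p \<le> 4 powr (real p / 2) * (1 + l\<^sup>2) powr (real p / 2)"
proof -
  assume l: "0 < l"
  have "(1 + l) ^ p = ((1 + l)\<^sup>2) powr (real p / 2)" using l by (intro power2_powr_half[symmetric]) simp
  also have "((1 + l)\<^sup>2) powr (real p / 2) \<le> (4 * (1 + l\<^sup>2)) powr (real p / 2)"
  proof (intro powr_mono2)
    show "(1 + l)\<^sup>2 \<le> 4 * (1 + l\<^sup>2)"
    proof -
      have "2 * l \<le> 1 + l\<^sup>2" using sum_squares_bound[of 1 l] by simp
      moreover have "0 \<le> l\<^sup>2" by simp
      ultimately have "1 + l\<^sup>2 + 2 * l \<le> 4 * (1 + l\<^sup>2)" unfolding distrib_left by linarith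
      then show ?thesis by (simp add: power2_sum)
    qed
  qed auto
  also have "\<dots> = 4 powr (real p / 2) * (1 + l\<^sup>2) powr (real p / 2)"
    by (rule powr_mult)
  finally show ?thesis .
qed

lemma set_integral_eq_ft:
  assumes "\<And>x. x \<notin> \<Omega> \<Longrightarrow> v x = 0"
  shows "(LINT x:\<Omega>|lborel. v x * exp (- (\<i> * of_real (x \<bullet> \<xi>)))) = ft v \<xi>"
  unfolding ft_def set_lebesgue_integral_def
  by (intro Bochner_Integration.integral_cong) (auto simp: indicator_def assms)

lemma rapidly_decreasingI:
  assumes "v \<in> V" "joint_compact_support \<Omega> v" "\<And>\<epsilon> x. x \<notin> \<Omega> \<Longrightarrow> v \<epsilon> x = 0" "rapid_on v \<Gamma>"
  shows "rapidly_decreasing \<Gamma> (fourier_nets \<Omega> V)"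
proof -
  obtain N where N: "\<And>q::nat. \<exists>C. \<forall>\<^sub>F \<epsilon> in at_right 0. \<forall>x\<in>\<Gamma> \<times> {0<..}.
     (1 + snd x) ^ q * norm (ft (v \<epsilon>) (snd x *\<^sub>R fst x)) \<le> C * \<epsilon> powr (- N)"
    using assms(4) unfolding rapid_on_iff by blast
  let ?F = "\<lambda>\<epsilon> \<xi>. LINT x:\<Omega>|lborel. v \<epsilon> x * exp (- (\<i> * of_real (x \<bullet> \<xi>)))"
  have F_eq: "?F \<epsilon> \<xi> = ft (v \<epsilon>) \<xi>" for \<epsilon> \<xi> by (rule set_integral_eq_ft[OF assms(3)])
  have F: "?F \<in> fourier_nets \<Omega> V" unfolding fourier_nets_def using assms(1,2) by blast
  show ?thesis unfolding rapidly_decreasing_def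
  proof (intro bexI[OF _ F] exI[of _ "nat \<lceil>N\<rceil>"] allI)
    fix p :: nat
    obtain C where "\<forall>\<^sub>F \<epsilon> in at_right 0. \<forall>x\<in>\<Gamma> \<times> {0<..}.
        (1 + snd x) ^ p * norm (ft (v \<epsilon>) (snd x *\<^sub>R fst x)) \<le> C * \<epsilon> powr (- N)" using N by blast
    from bigo_weaken[OF this, of "real (nat \<lceil>N\<rceil>)"]
    have "\<forall>\<^sub>F \<epsilon> in at_right 0. \<forall>x\<in>\<Gamma> \<times> {0<..}.
        (1 + snd x) ^ p * norm (ft (v \<epsilon>) (snd x *\<^sub>R fst x)) \<le> \<bar>C\<bar> * \<epsilon> powr (- real (nat \<lceil>N\<rceil>))"
      by (simp add: real_nat_ceiling_ge)
    then have "\<forall>\<^sub>F \<epsilon> in at_right 0. \<forall>x\<in>{0<..} \<times> \<Gamma>.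
        norm (case x of (l, \<xi>) \<Rightarrow> (1 + l\<^sup>2) powr (real p / 2) * norm (?F \<epsilon> (l *\<^sub>R \<xi>))) \<le> \<bar>C\<bar> * \<epsilon> powr (- real (nat \<lceil>N\<rceil>))"
    proof eventually_elim
      case (elim \<epsilon>)
      have "(1 + l\<^sup>2) powr (real p / 2) * norm (ft (v \<epsilon>) (l *\<^sub>R \<xi>)) \<le> \<bar>C\<bar> * \<epsilon> powr (- real (nat \<lceil>N\<rceil>))"
        if "0 < l" "\<xi> \<in> \<Gamma>" for l \<xi>
      proof -
        have "(1 + l\<^sup>2) powr (real p / 2) * norm (ft (v \<epsilon>) (l *\<^sub>R \<xi>)) \<le> (1 + l) ^ p * norm (ft (v \<epsilon>) (l *\<^sub>R \<xi>))"
          using weight_le[OF that(1)] by (rule mult_right_mono) simp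
        also have "\<dots> \<le> \<bar>C\<bar> * \<epsilon> powr (- real (nat \<lceil>N\<rceil>))" using elim that by force
        finally show ?thesis .
      qed
      then show ?case unfolding F_eq by (auto simp: abs_mult)
    qed
    then show "sup_bigo ({0<..} \<times> \<Gamma>) (\<lambda>\<epsilon> (l, \<xi>). (1 + l\<^sup>2) powr (real p / 2) * norm (?F \<epsilon> (l *\<^sub>R \<xi>))) (\<lambda>\<epsilon>. \<epsilon> powr (- real (nat \<lceil>N\<rceil>)))"
      unfolding sup_bigo_def by blast
  qed
qed

text \<open>The representative found here is extended by zero, since its values outside \<open>\<Omega>\<close> are arbitrary.\<close>

lemma rapidly_decreasingD:
  assumes "rapidly_decreasing \<Gamma> (fourier_nets \<Omega> V)"
  obtains w where "w \<in> V" "joint_compact_support \<Omega> w" "rapid_on (\<lambda>\<epsilon> x. indicator \<Omega> x *\<^sub>R w \<epsilon> x) \<Gamma>"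
proof -
  obtain w N where w: "w \<in> V" "joint_compact_support \<Omega> w" and N: "\<And>p::nat.
     sup_bigo ({0<..} \<times> \<Gamma>) (\<lambda>\<epsilon> (l, \<xi>). (1 + l\<^sup>2) powr (real p / 2) * norm (LINT x:\<Omega>|lborel. w \<epsilon> x * exp (- (\<i> * of_real (x \<bullet> (l *\<^sub>R \<xi>))))))
              (\<lambda>\<epsilon>. \<epsilon> powr (- real (N::nat)))"
    using assms unfolding rapidly_decreasing_def fourier_nets_def by blast
  let ?v = "\<lambda>\<epsilon> x. indicator \<Omega> x *\<^sub>R w \<epsilon> x"
  have eq: "(LINT x:\<Omega>|lborel. w \<epsilon> x * exp (- (\<i> * of_real (x \<bullet> \<xi>)))) = ft (?v \<epsilon>) \<xi>" for \<epsilon> \<xi>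
    unfolding ft_def set_lebesgue_integral_def by simp
  have "rapid_on ?v \<Gamma>" unfolding rapid_on_iff
  proof (rule exI[of _ "real N"], rule allI)
    fix q :: nat
    obtain C where C: "\<forall>\<^sub>F \<epsilon> in at_right 0. \<forall>x\<in>{0<..} \<times> \<Gamma>.
        norm (case x of (l, \<xi>) \<Rightarrow> (1 + l\<^sup>2) powr (real q / 2) * norm (ft (?v \<epsilon>) (l *\<^sub>R \<xi>))) \<le> C * \<epsilon> powr (- real N)"
      using N[of q] unfolding sup_bigo_def eq by blast
    then have "\<forall>\<^sub>F \<epsilon> in at_right 0. \<forall>x\<in>\<Gamma> \<times> {0<..}.
        (1 + snd x) ^ q * norm (ft (?v \<epsilon>) (snd x *\<^sub>R fst x)) \<le> (4 powr (real q / 2) * C) * \<epsilon> powr (- real N)"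
    proof eventually_elim
      case (elim \<epsilon>)
      show ?case
      proof
        fix x assume "x \<in> \<Gamma> \<times> {0::real<..}"
        then obtain l \<xi> where x: "x = (\<xi>, l)" "\<xi> \<in> \<Gamma>" "0 < l" by auto
        have "(1 + l) ^ q * norm (ft (?v \<epsilon>) (l *\<^sub>R \<xi>)) \<le>
            4 powr (real q / 2) * (1 + l\<^sup>2) powr (real q / 2) * norm (ft (?v \<epsilon>) (l *\<^sub>R \<xi>))"
          using weight_ge[OF x(3)] by (rule mult_right_mono) simp
        also have "\<dots> = 4 powr (real q / 2) * ((1 + l\<^sup>2) powr (real q / 2) * norm (ft (?v \<epsilon>) (l *\<^sub>R \<xi>)))"
          by (rule mult.assoc)
        also have "\<dots> \<le> 4 powr (real q / 2) * (C * \<epsilon> powr (- real N))"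
          using elim x by (intro mult_left_mono) (force simp: abs_mult)+
        finally show "(1 + snd x) ^ q * norm (ft (?v \<epsilon>) (snd x *\<^sub>R fst x)) \<le> (4 powr (real q / 2) * C) * \<epsilon> powr (- real N)"
          by (simp add: x)
      qed
    qed
    then show "\<exists>C. \<forall>\<^sub>F \<epsilon> in at_right 0. \<forall>x\<in>\<Gamma> \<times> {0<..}.
        (1 + snd x) ^ q * norm (ft (?v \<epsilon>) (snd x *\<^sub>R fst x)) \<le> C * \<epsilon> powr (- real N)" by blast
  qed
  with w show ?thesis by (rule that)
qed

lemma transp_jacobian_zero: "transp_jacobian f \<epsilon> x 0 = 0"
  by (simp add: transp_jacobian_def)

text \<open>Non-stationary phase for \<open>f = 0\<close>, whose phase \<open>- x \<bullet> \<zeta>\<close> has constant gradient.\<close>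

lemma fourier_decay:
  fixes a :: "real \<Rightarrow> real^'n::finite \<Rightarrow> complex"
  assumes P: "net_class P" and U: "open U" and a: "tame_net P (\<lambda>_. U) a"
    and L: "compact L" "L \<subseteq> U" and supp: "\<forall>\<^sub>F \<epsilon> in at_right 0. \<forall>x\<in>U - L. a \<epsilon> x = 0"
  shows "\<exists>r. P r \<and> (\<forall>\<^sub>F \<epsilon> in at_right 0. \<forall>\<zeta>. \<zeta> \<noteq> 0 \<longrightarrow>
      norm \<zeta> ^ p * norm (LINT x:U|lborel. a \<epsilon> x * exp (- (\<i> * of_real (x \<bullet> \<zeta>)))) \<le> r \<epsilon>)"
proof -
  interpret gauge "at_right 0" "\<lambda>_. U" "net_gauges P (\<lambda>\<epsilon>. \<epsilon>)"
    by (rule gauge_net[OF P]) (use U in simp)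
  obtain r where r: "P r" "\<forall>\<^sub>F \<epsilon> in at_right 0. \<forall>\<zeta> \<eta>. norm \<zeta> + norm (\<eta>::real^'n) > 0 \<longrightarrow>
    (\<forall>x\<in>U. norm \<zeta> + norm \<eta> \<le> 1 * norm (transp_jacobian (\<lambda>_ _. 0) \<epsilon> x \<eta> - \<zeta>)) \<longrightarrow>
    (norm \<zeta> + norm \<eta>) ^ p * norm (LINT x:U|lborel. a \<epsilon> x * exp (\<i> * of_real ((0::real^'n) \<bullet> \<eta> - x \<bullet> \<zeta>))) \<le> r \<epsilon>"
    by (atomize_elim, rule nonstationary_phase_composition[OF P _ _ a supp, where V="measure lborel L" and \<tau>="\<lambda>_. 1"])
      (use U L net_classD(1)[OF P] in \<open>auto intro: tame_fixed_const\<close>)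
  have "\<forall>\<^sub>F \<epsilon> in at_right 0. \<forall>\<zeta>. \<zeta> \<noteq> 0 \<longrightarrow>
      norm \<zeta> ^ p * norm (LINT x:U|lborel. a \<epsilon> x * exp (- (\<i> * of_real (x \<bullet> \<zeta>)))) \<le> r \<epsilon>"
    using r(2)
  proof eventually_elim
    case (elim \<epsilon>)
    show ?case
    proof (intro allI impI)
      fix \<zeta> :: "real^'n" assume "\<zeta> \<noteq> 0"
      then show "norm \<zeta> ^ p * norm (LINT x:U|lborel. a \<epsilon> x * exp (- (\<i> * of_real (x \<bullet> \<zeta>)))) \<le> r \<epsilon>"
        using elim[rule_format, of \<zeta> 0] by (simp add: transp_jacobian_zero)
    qed
  qed
  with r(1) show ?thesis by blast
qed

text \<open>The Fourier transform \<open>F\<close> of such a net is negligible uniformly in the frequency, and it decays to any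
  order with moderate constants. Interpolating through \<open>|F|\<^sup>2 = |F| |F|\<close>, with one estimate for each factor,
  gives decay to any order with constants independent of \<open>\<epsilon>\<close>.\<close>

lemma rapid_on_negligible:
  fixes n :: "('n::finite, complex) net"
  assumes \<Omega>: "open \<Omega>" and n: "n \<in> negligible_nets \<Omega>" and L: "compact L" "L \<subseteq> \<Omega>"
    and supp: "\<And>\<epsilon> x. 0 < \<epsilon> \<Longrightarrow> \<epsilon> \<le> 1 \<Longrightarrow> x \<in> \<Omega> - L \<Longrightarrow> n \<epsilon> x = 0"
  shows "rapid_on (\<lambda>\<epsilon> x. indicator \<Omega> x *\<^sub>R n \<epsilon> x) (sphere 0 1)"
proof -
  obtain U L' where U: "open U" "compact L'" "L \<subseteq> U" "U \<subseteq> L'" "L' \<subseteq> \<Omega>"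
    using compact_open_neighbourhood[OF \<Omega> L] by metis
  let ?v = "\<lambda>\<epsilon> x. indicator \<Omega> x *\<^sub>R n \<epsilon> x"
  define I where "I \<epsilon> \<zeta> = (LINT x:U|lborel. n \<epsilon> x * exp (- (\<i> * of_real (x \<bullet> \<zeta>))))" for \<epsilon> \<zeta>
  have ftI: "\<forall>\<^sub>F \<epsilon> in at_right 0. \<forall>\<zeta>. ft (?v \<epsilon>) \<zeta> = I \<epsilon> \<zeta>"
    using eventually_at_right_0
  proof eventually_elim
    case (elim \<epsilon>)
    show ?case
      unfolding ft_def I_def set_lebesgue_integral_def
      using supp[of \<epsilon>] elim U by (auto intro!: Bochner_Integration.integral_cong simp: indicator_def subset_eq)
  qed
  have supI: "\<exists>C. \<forall>\<^sub>F \<epsilon> in at_right 0. \<forall>\<zeta>. norm (I \<epsilon> \<zeta>) \<le> C * \<epsilon> powr k" for k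
  proof -
    obtain C where "\<forall>\<^sub>F \<epsilon> in at_right 0. \<forall>x\<in>L. norm (n \<epsilon> x) \<le> C * \<epsilon> powr k"
      using negligible_netsD(1)[OF \<Omega> n L] unfolding sup_bigo_def by blast
    then have "\<forall>\<^sub>F \<epsilon> in at_right 0. \<forall>\<zeta>. norm (I \<epsilon> \<zeta>) \<le> (C * measure lborel L) * \<epsilon> powr k"
      using eventually_at_right_0
    proof eventually_elim
      case (elim \<epsilon>)
      have "norm (I \<epsilon> \<zeta>) \<le> (C * \<epsilon> powr k) * measure lborel L" for \<zeta>
        unfolding I_def
        by (rule norm_set_integral_compact_support[OF L(1) U(3)])
          (use elim supp[of \<epsilon>] U in \<open>auto simp: norm_mult subset_eq\<close>)
      then show ?case by (simp add: mult_ac)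
    qed
    then show ?thesis by blast
  qed
  have nm: "n \<in> moderate_nets \<Omega>" by (rule negligible_netsD(2)[OF \<Omega> n])
  have decay: "\<exists>r. moderate_net r \<and> (\<forall>\<^sub>F \<epsilon> in at_right 0. \<forall>\<zeta>. \<zeta> \<noteq> 0 \<longrightarrow> norm \<zeta> ^ p * norm (I \<epsilon> \<zeta>) \<le> r \<epsilon>)" for p
  proof -
    have "\<forall>\<^sub>F \<epsilon> in at_right 0. \<forall>x\<in>U - L. n \<epsilon> x = 0"
      using eventually_at_right_0 by eventually_elim (use supp U in \<open>auto simp: subset_eq\<close>)
    then show ?thesis
      unfolding I_def by (rule fourier_decay[OF net_class_moderate U(1) moderate_nets_tame[OF nm U(1,4,2,5)] L(1) U(3)])
  qed
  show ?thesis unfolding rapid_on_def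
  proof (rule exI[of _ 0], rule allI)
    fix q :: nat
    obtain r where r: "moderate_net r" "\<forall>\<^sub>F \<epsilon> in at_right 0. \<forall>\<zeta>. \<zeta> \<noteq> 0 \<longrightarrow> norm \<zeta> ^ (2 * q) * norm (I \<epsilon> \<zeta>) \<le> r \<epsilon>"
      using decay by blast
    obtain k C where k: "\<forall>\<^sub>F \<epsilon> in at_right 0. \<bar>r \<epsilon>\<bar> \<le> C * \<epsilon> powr (- k)"
      using r(1) unfolding moderate_net_def by blast
    \<comment> \<open>negligibility with exactly the exponent of the moderate bound, so that the two cancel\<close>
    obtain D where D: "\<forall>\<^sub>F \<epsilon> in at_right 0. \<forall>\<zeta>. norm (I \<epsilon> \<zeta>) \<le> D * \<epsilon> powr k" using supI by blast
    obtain E where E: "\<forall>\<^sub>F \<epsilon> in at_right 0. \<forall>\<zeta>. norm (I \<epsilon> \<zeta>) \<le> E * \<epsilon> powr 0" using supI by blast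
    have "\<forall>\<^sub>F \<epsilon> in at_right 0. \<forall>\<xi>\<in>sphere 0 1. \<forall>t>0. (1 + t) ^ q * norm (ft (?v \<epsilon>) (t *\<^sub>R \<xi>)) \<le> (2 ^ q * (E + sqrt (\<bar>C\<bar> * \<bar>D\<bar>))) * \<epsilon> powr (- 0)"
      using ftI r(2) k D E eventually_at_right_0
    proof eventually_elim
      case (elim \<epsilon>)
      show ?case
      proof (intro ballI allI impI)
        fix \<xi> :: "real^'n" and t :: real assume \<xi>: "\<xi> \<in> sphere 0 1" and t: "0 < t"
        define J where "J = norm (I \<epsilon> (t *\<^sub>R \<xi>))"
        have nt: "norm (t *\<^sub>R \<xi>) = t" "t *\<^sub>R \<xi> \<noteq> 0" using \<xi> t by auto
        have "t ^ (2 * q) * J \<le> \<bar>C\<bar> * \<epsilon> powr (- k)"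
        proof -
          have "t ^ (2 * q) * J \<le> r \<epsilon>" using elim(2) nt unfolding J_def by metis
          also have "\<dots> \<le> C * \<epsilon> powr (- k)" using elim(3) by linarith
          also have "\<dots> \<le> \<bar>C\<bar> * \<epsilon> powr (- k)" by (intro mult_right_mono) auto
          finally show ?thesis .
        qed
        moreover have "J \<le> \<bar>D\<bar> * \<epsilon> powr k"
        proof -
          have "J \<le> D * \<epsilon> powr k" using elim(4) unfolding J_def by blast
          also have "\<dots> \<le> \<bar>D\<bar> * \<epsilon> powr k" by (intro mult_right_mono) auto
          finally show ?thesis .
        qed
        ultimately have "(t ^ (2 * q) * J) * J \<le> (\<bar>C\<bar> * \<epsilon> powr (- k)) * (\<bar>D\<bar> * \<epsilon> powr k)"
          by (rule mult_mono) (auto simp: J_def)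
        also have "\<dots> = \<bar>C\<bar> * \<bar>D\<bar>" using elim(6) by (simp add: powr_minus field_simps)
        finally have "(t ^ q * J)\<^sup>2 \<le> \<bar>C\<bar> * \<bar>D\<bar>"
          by (simp add: power2_eq_square mult_2 mult_2_right power_add mult_ac)
        then have h: "t ^ q * J \<le> sqrt (\<bar>C\<bar> * \<bar>D\<bar>)" by (rule real_le_rsqrt)
        have e: "J \<le> E" using elim(5,6) unfolding J_def by simp
        have "(1 + t) ^ q * J \<le> 2 ^ q * (1 + t ^ q) * J"
          using t by (intro mult_right_mono one_plus_power_le) (auto simp: J_def)
        also have "\<dots> = 2 ^ q * (J + t ^ q * J)" by (simp add: algebra_simps)
        also have "\<dots> \<le> 2 ^ q * (E + sqrt (\<bar>C\<bar> * \<bar>D\<bar>))" using h e by (intro mult_left_mono add_mono) auto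
        finally have "(1 + t) ^ q * J \<le> 2 ^ q * (E + sqrt (\<bar>C\<bar> * \<bar>D\<bar>))" .
        then show "(1 + t) ^ q * norm (ft (?v \<epsilon>) (t *\<^sub>R \<xi>)) \<le> (2 ^ q * (E + sqrt (\<bar>C\<bar> * \<bar>D\<bar>))) * \<epsilon> powr (- 0)"
          using elim(1,6) by (simp add: J_def)
      qed
    qed
    then show "\<exists>C. \<forall>\<^sub>F \<epsilon> in at_right 0. \<forall>\<xi>\<in>sphere 0 1. \<forall>t>0. (1 + t) ^ q * norm (ft (?v \<epsilon>) (t *\<^sub>R \<xi>)) \<le> C * \<epsilon> powr (- 0)"
      by blast
  qed
qed

section \<open>Multiplication by test functions and localization\<close>

text \<open>Two vectors whose directions differ by at least \<open>\<rho>\<close> cannot nearly cancel: with \<open>c = |a - b|\<close>, the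
  square of the right-hand side is \<open>(s - t)\<^sup>2 + s t c\<^sup>2\<close>.\<close>

lemma angle_bound:
  fixes a b :: "'a::real_inner"
  assumes "norm a = 1" "norm b = 1" "\<rho> \<le> norm (a - b)" "0 \<le> \<rho>" "0 \<le> s" "0 \<le> t"
  shows "(\<rho> / 2) * (s + t) \<le> norm (s *\<^sub>R a - t *\<^sub>R b)"
proof -
  define c where "c = norm (a - b)"
  have aa: "a \<bullet> a = 1" "b \<bullet> b = 1" using assms(1,2) by (simp_all add: power2_norm_eq_inner[symmetric])
  have c: "c\<^sup>2 = 2 - 2 * (a \<bullet> b)"
    unfolding c_def power2_norm_eq_inner by (simp add: inner_diff_left inner_diff_right aa inner_commute)
  have c2: "c \<le> 2" using norm_triangle_ineq4[of a b] assms(1,2) by (simp add: c_def)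
  have c0: "0 \<le> c" by (simp add: c_def)
  have eq: "(norm (s *\<^sub>R a - t *\<^sub>R b))\<^sup>2 = (s - t)\<^sup>2 + s * t * c\<^sup>2"
    unfolding power2_norm_eq_inner c
    by (simp add: inner_diff_left inner_diff_right aa inner_commute power2_eq_square algebra_simps)
  have "((\<rho> / 2) * (s + t))\<^sup>2 \<le> ((c / 2) * (s + t))\<^sup>2"
    using assms by (intro power_mono mult_right_mono) (auto simp: c_def)
  also have "\<dots> = (c / 2)\<^sup>2 * (s - t)\<^sup>2 + s * t * c\<^sup>2" by (simp add: power2_eq_square field_simps)
  also have "\<dots> \<le> 1 * (s - t)\<^sup>2 + s * t * c\<^sup>2"
    using c2 c0 by (intro add_right_mono mult_right_mono power_le_one) auto
  also have "\<dots> = (norm (s *\<^sub>R a - t *\<^sub>R b))\<^sup>2" by (simp add: eq)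
  finally show ?thesis by (rule power2_le_imp_le) simp
qed

text \<open>Moderate nets of continuous functions supported in a common compact set.\<close>

definition test_net :: "(real \<Rightarrow> real^'m::finite \<Rightarrow> complex) \<Rightarrow> bool" where
  "test_net v \<longleftrightarrow> (\<exists>L N C. compact L \<and> (\<forall>\<^sub>F \<epsilon> in at_right 0. continuous_on UNIV (v \<epsilon>) \<and>
     (\<forall>x. x \<notin> L \<longrightarrow> v \<epsilon> x = 0) \<and> (\<forall>x. norm (v \<epsilon> x) \<le> C * \<epsilon> powr (- N))))"

lemma test_net_props:
  assumes "test_net v"
  shows "\<forall>\<^sub>F \<epsilon> in at_right 0. integrable lborel (v \<epsilon>) \<and> continuous_on UNIV (v \<epsilon>) \<and> (\<exists>S. \<forall>y. norm (v \<epsilon> y) \<le> S)"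
    and "\<exists>N C. \<forall>\<^sub>F \<epsilon> in at_right 0. \<forall>\<xi>. norm (ft (v \<epsilon>) \<xi>) \<le> C * \<epsilon> powr (- N)"
proof -
  obtain L N C where L: "compact L" and v: "\<forall>\<^sub>F \<epsilon> in at_right 0. continuous_on UNIV (v \<epsilon>) \<and>
     (\<forall>x. x \<notin> L \<longrightarrow> v \<epsilon> x = 0) \<and> (\<forall>x. norm (v \<epsilon> x) \<le> C * \<epsilon> powr (- N))"
    using assms unfolding test_net_def by blast
  show "\<forall>\<^sub>F \<epsilon> in at_right 0. integrable lborel (v \<epsilon>) \<and> continuous_on UNIV (v \<epsilon>) \<and> (\<exists>S. \<forall>y. norm (v \<epsilon> y) \<le> S)"
    using v
  proof eventually_elim
    case (elim \<epsilon>)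
    then have "set_integrable lborel UNIV (v \<epsilon>)"
      by (intro set_integrable_compact_support[OF L]) auto
    then show ?case using elim by (auto simp: set_integrable_def)
  qed
  have "\<forall>\<^sub>F \<epsilon> in at_right 0. \<forall>\<xi>. norm (ft (v \<epsilon>) \<xi>) \<le> (C * measure lborel L) * \<epsilon> powr (- N)"
    using v
  proof eventually_elim
    case (elim \<epsilon>)
    show ?case
    proof
      fix \<xi>
      have "norm (LINT x:UNIV|lborel. v \<epsilon> x * exp (- (\<i> * of_real (x \<bullet> \<xi>)))) \<le> (C * \<epsilon> powr (- N)) * measure lborel L"
        using elim by (intro norm_set_integral_compact_support[OF L]) (auto simp: norm_mult)
      then show "norm (ft (v \<epsilon>) \<xi>) \<le> (C * measure lborel L) * \<epsilon> powr (- N)"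
        using set_integral_eq_ft[of UNIV "v \<epsilon>" \<xi>] by (simp add: mult_ac)
    qed
  qed
  then show "\<exists>N C. \<forall>\<^sub>F \<epsilon> in at_right 0. \<forall>\<xi>. norm (ft (v \<epsilon>) \<xi>) \<le> C * \<epsilon> powr (- N)" by blast
qed

lemma test_function_mult_smooth:
  assumes \<Omega>: "open \<Omega>" and \<phi>: "\<phi> \<in> test_functions \<Omega>" and g: "smooth_on \<Omega> g"
  shows "smooth_on UNIV (\<lambda>x. \<phi> x * g x)"
proof -
  obtain K where K: "compact K" "K \<subseteq> \<Omega>" "\<And>x. x \<notin> K \<Longrightarrow> \<phi> x = 0" "smooth_on UNIV \<phi>"
    by (rule test_functionsD[OF \<phi>], rule that) assumption+
  show ?thesis
    by (rule smooth_on_extend_zero[OF \<Omega> K(1,2)])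
      (use K(3) in \<open>auto intro!: smooth_on_mult[OF \<Omega>] smooth_on_subset[OF K(4)] g\<close>)
qed

lemma test_functions_mult:
  assumes "\<phi> \<in> test_functions \<Omega>" "smooth_on UNIV \<psi>"
  shows "(\<lambda>x. \<phi> x * \<psi> x) \<in> test_functions \<Omega>"
proof -
  obtain K where K: "compact K" "K \<subseteq> \<Omega>" "\<And>x. x \<notin> K \<Longrightarrow> \<phi> x = 0" "smooth_on UNIV \<phi>"
    by (rule test_functionsD[OF assms(1)], rule that) assumption+
  show ?thesis
    by (rule test_functionsI[OF smooth_on_mult[OF open_UNIV K(4) assms(2)] K(1,2)]) (simp add: K(3))
qed

lemma test_net_moderate:
  fixes r :: "('m::finite, complex) net"
  assumes \<Omega>: "open \<Omega>" and \<phi>: "\<phi> \<in> test_functions \<Omega>" and r: "r \<in> moderate_nets \<Omega>"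
  shows "test_net (\<lambda>\<epsilon> x. \<phi> x * r \<epsilon> x)"
proof -
  obtain K where K: "compact K" "K \<subseteq> \<Omega>" "\<And>x. x \<notin> K \<Longrightarrow> \<phi> x = 0" "smooth_on UNIV \<phi>"
    by (rule test_functionsD[OF \<phi>], rule that) assumption+
  have "(\<lambda>\<epsilon> x. \<phi> x * r \<epsilon> x) \<in> moderate_nets \<Omega>"
    by (intro moderate_nets_mult_fixed[OF \<Omega> _ r] smooth_on_subset[OF K(4)]) simp
  from moderate_netsD_bound[OF this K(1,2), of "[]"]
  obtain g where "moderate_net g" and g: "\<forall>\<^sub>F \<epsilon> in at_right 0. \<forall>x\<in>K. norm (\<phi> x * r \<epsilon> x) \<le> g \<epsilon>" by auto
  then obtain N C where C: "\<forall>\<^sub>F \<epsilon> in at_right 0. \<bar>g \<epsilon>\<bar> \<le> C * \<epsilon> powr (- N)" unfolding moderate_net_def by blast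
  have "\<forall>\<^sub>F \<epsilon> in at_right 0. continuous_on UNIV (\<lambda>x. \<phi> x * r \<epsilon> x) \<and>
     (\<forall>x. x \<notin> K \<longrightarrow> \<phi> x * r \<epsilon> x = 0) \<and> (\<forall>x. norm (\<phi> x * r \<epsilon> x) \<le> \<bar>C\<bar> * \<epsilon> powr (- N))"
    using g C eventually_at_right_0
  proof eventually_elim
    case (elim \<epsilon>)
    have "smooth_on UNIV (\<lambda>x. \<phi> x * r \<epsilon> x)"
      using elim by (intro test_function_mult_smooth[OF \<Omega> \<phi>] moderate_netsD_smooth[OF r]) auto
    from smooth_on_continuous[OF this, of "[]"] have "continuous_on UNIV (\<lambda>x. \<phi> x * r \<epsilon> x)" by simp
    moreover have "norm (\<phi> x * r \<epsilon> x) \<le> \<bar>C\<bar> * \<epsilon> powr (- N)" for x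
    proof (cases "x \<in> K")
      case True
      then have "norm (\<phi> x * r \<epsilon> x) \<le> g \<epsilon>" using elim by blast
      also have "\<dots> \<le> C * \<epsilon> powr (- N)" using elim by linarith
      also have "\<dots> \<le> \<bar>C\<bar> * \<epsilon> powr (- N)" by (intro mult_right_mono) auto
      finally show ?thesis .
    qed (simp add: K(3))
    ultimately show ?case using K(3) by simp
  qed
  then show ?thesis unfolding test_net_def using K(1) by blast
qed

lemma transp_jacobian_ident: "transp_jacobian (\<lambda>_ x. x) \<epsilon> x \<eta> = \<eta>"
proof (rule vec_eq_iff[THEN iffD2], rule allI)
  fix j
  have "partial_deriv j (\<lambda>x::real^'a. x) x = axis j 1"
    by (rule partial_deriv_has_derivative[OF has_derivative_ident])
  then show "transp_jacobian (\<lambda>_ x. x) \<epsilon> x \<eta> $ j = \<eta> $ j"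
    using transp_jacobian_nth[of "\<lambda>_ x. x" \<epsilon> x \<eta> j] by (simp add: inner_axis inner_commute)
qed

text \<open>Passage from a set of directions to the cone over it.\<close>

lemma rapid_on_as_cone:
  fixes v :: "real \<Rightarrow> real^'m::finite \<Rightarrow> complex"
  assumes "rapid_on v \<Gamma>" "\<Gamma> \<subseteq> sphere 0 1"
  obtains N where "\<And>q::nat. \<exists>C. \<forall>\<^sub>F \<epsilon> in at_right 0. \<forall>\<eta>\<in>{t *\<^sub>R \<xi> |t \<xi>. 0 < t \<and> \<xi> \<in> \<Gamma>}.
      (1 + norm \<eta>) ^ q * norm (ft (v \<epsilon>) \<eta>) \<le> C * \<epsilon> powr (- N)"
proof -
  obtain N where N: "\<And>q::nat. \<exists>C. \<forall>\<^sub>F \<epsilon> in at_right 0. \<forall>\<xi>\<in>\<Gamma>. \<forall>t>0.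
     (1 + t) ^ q * norm (ft (v \<epsilon>) (t *\<^sub>R \<xi>)) \<le> C * \<epsilon> powr (- N)"
    using assms(1) unfolding rapid_on_def by blast
  show ?thesis
  proof (rule that[of N])
    fix q :: nat
    obtain C where C: "\<forall>\<^sub>F \<epsilon> in at_right 0. \<forall>\<xi>\<in>\<Gamma>. \<forall>t>0.
     (1 + t) ^ q * norm (ft (v \<epsilon>) (t *\<^sub>R \<xi>)) \<le> C * \<epsilon> powr (- N)" using N by blast
    have nrm: "norm (t *\<^sub>R \<xi>) = t" if "0 < t" "\<xi> \<in> \<Gamma>" for t \<xi> using assms(2) that by auto
    have "\<forall>\<^sub>F \<epsilon> in at_right 0. \<forall>\<eta>\<in>{t *\<^sub>R \<xi> |t \<xi>. 0 < t \<and> \<xi> \<in> \<Gamma>}.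
      (1 + norm \<eta>) ^ q * norm (ft (v \<epsilon>) \<eta>) \<le> C * \<epsilon> powr (- N)"
      using C
    proof eventually_elim
      case (elim \<epsilon>)
      show ?case
      proof
        fix \<eta> assume "\<eta> \<in> {t *\<^sub>R \<xi> |t \<xi>. 0 < t \<and> \<xi> \<in> \<Gamma>}"
        then obtain t \<xi> where t: "\<eta> = t *\<^sub>R \<xi>" "0 < t" "\<xi> \<in> \<Gamma>" by blast
        then show "(1 + norm \<eta>) ^ q * norm (ft (v \<epsilon>) \<eta>) \<le> C * \<epsilon> powr (- N)"
          using elim nrm[OF t(2,3)] by simp
      qed
    qed
    then show "\<exists>C. \<forall>\<^sub>F \<epsilon> in at_right 0. \<forall>\<eta>\<in>{t *\<^sub>R \<xi> |t \<xi>. 0 < t \<and> \<xi> \<in> \<Gamma>}.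
      (1 + norm \<eta>) ^ q * norm (ft (v \<epsilon>) \<eta>) \<le> C * \<epsilon> powr (- N)" by blast
  qed
qed

lemma rapid_onI_cone:
  fixes v :: "real \<Rightarrow> real^'m::finite \<Rightarrow> complex"
  assumes "\<Gamma> \<subseteq> sphere 0 1"
    and "\<And>q::nat. \<exists>C. \<forall>\<^sub>F \<epsilon> in at_right 0. \<forall>\<eta>\<in>{t *\<^sub>R \<xi> |t \<xi>. 0 < t \<and> \<xi> \<in> \<Gamma>}.
      (1 + norm \<eta>) ^ q * norm (ft (v \<epsilon>) \<eta>) \<le> C * \<epsilon> powr (- N)"
  shows "rapid_on v \<Gamma>"
  unfolding rapid_on_def
proof (rule exI[of _ N], rule allI)
  fix q :: nat
  obtain C where "\<forall>\<^sub>F \<epsilon> in at_right 0. \<forall>\<eta>\<in>{t *\<^sub>R \<xi> |t \<xi>. 0 < t \<and> \<xi> \<in> \<Gamma>}.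
      (1 + norm \<eta>) ^ q * norm (ft (v \<epsilon>) \<eta>) \<le> C * \<epsilon> powr (- N)" using assms(2) by blast
  then have "\<forall>\<^sub>F \<epsilon> in at_right 0. \<forall>\<xi>\<in>\<Gamma>. \<forall>t>0. (1 + t) ^ q * norm (ft (v \<epsilon>) (t *\<^sub>R \<xi>)) \<le> C * \<epsilon> powr (- N)"
  proof eventually_elim
    case (elim \<epsilon>)
    show ?case
    proof (intro ballI allI impI)
      fix \<xi> t assume t: "\<xi> \<in> \<Gamma>" "0 < (t::real)"
      then have n: "norm (t *\<^sub>R \<xi>) = t" using assms(1) by auto
      have "t *\<^sub>R \<xi> \<in> {t *\<^sub>R \<xi> |t \<xi>. 0 < t \<and> \<xi> \<in> \<Gamma>}" using t by blast
      from bspec[OF elim this] show "(1 + t) ^ q * norm (ft (v \<epsilon>) (t *\<^sub>R \<xi>)) \<le> C * \<epsilon> powr (- N)"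
        unfolding n .
    qed
  qed
  then show "\<exists>C. \<forall>\<^sub>F \<epsilon> in at_right 0. \<forall>\<xi>\<in>\<Gamma>. \<forall>t>0. (1 + t) ^ q * norm (ft (v \<epsilon>) (t *\<^sub>R \<xi>)) \<le> C * \<epsilon> powr (- N)" by blast
qed

text \<open>The microlocal estimate for the identity map. The gradient of the phase is \<open>\<eta> - \<zeta>\<close>, which
  dominates \<open>|\<zeta>| + |\<eta>|\<close> unless \<open>\<eta>\<close> has a direction close to that of \<open>\<zeta>\<close> and a length that is
  not much smaller; in that case \<open>\<eta>\<close> lies in the larger cone where \<open>v\<close> decreases rapidly.\<close>

lemma rapid_on_mult:
  fixes v :: "real \<Rightarrow> real^'m::finite \<Rightarrow> complex"
  assumes v: "test_net v" and g: "g \<in> test_functions UNIV" and r: "0 < r"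
    and rap: "rapid_on v (sphere 0 1 \<inter> ball \<xi>0 (2 * r))"
  shows "rapid_on (\<lambda>\<epsilon> x. g x * v \<epsilon> x) (sphere 0 1 \<inter> ball \<xi>0 r)"
proof -
  obtain K where K: "compact K" "\<And>x. x \<notin> K \<Longrightarrow> g x = 0" "smooth_on UNIV g"
    by (rule test_functionsD[OF g], rule that) assumption+
  obtain B where B: "K \<subseteq> ball 0 B"
    using compact_imp_bounded[OF K(1)] bounded_subset_ballD[of K 0] by blast
  define U where "U = ball (0::real^'m) B"
  have U: "open U" "K \<subseteq> U" "U \<subseteq> cball 0 B" using B by (auto simp: U_def)
  obtain N1 where N1: "\<And>q::nat. \<exists>C. \<forall>\<^sub>F \<epsilon> in at_right 0. \<forall>\<eta>\<in>{t *\<^sub>R \<xi> |t \<xi>. 0 < t \<and> \<xi> \<in> sphere 0 1 \<inter> ball \<xi>0 (2 * r)}.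
      (1 + norm \<eta>) ^ q * norm (ft (v \<epsilon>) \<eta>) \<le> C * \<epsilon> powr (- N1)"
    by (rule rapid_on_as_cone[OF rap]) auto
  obtain N2 C2 where N2: "\<forall>\<^sub>F \<epsilon> in at_right 0. \<forall>\<xi>. norm (ft (v \<epsilon>) \<xi>) \<le> C2 * \<epsilon> powr (- N2)"
    using test_net_props(2)[OF v] by blast
  define N where "N = max N1 N2"
  define A where "A = {t *\<^sub>R \<xi> |t \<xi>. 0 < t \<and> \<xi> \<in> sphere 0 1 \<inter> ball \<xi>0 (2 * r)}"
  define Z where "Z = {t *\<^sub>R \<xi> |t \<xi>. 0 < t \<and> \<xi> \<in> sphere 0 1 \<inter> ball \<xi>0 r}"
  \<comment> \<open>\<open>3\<close> serves \<open>|\<zeta>| > 2 |\<eta>|\<close>, and \<open>2 / r\<close> serves directions of \<open>\<eta>\<close> at distance at least \<open>r\<close> from that of \<open>\<zeta>\<close>\<close>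
  define \<tau> where "\<tau> = 3 + 2 / r"
  have \<tau>: "3 \<le> \<tau>" "2 / r \<le> \<tau>" using r by (auto simp: \<tau>_def)
  interpret gauge "at_right 0" "\<lambda>_. U" "net_gauges slow_net (\<lambda>\<epsilon>. \<epsilon>)"
    by (rule gauge_net[OF net_class_slow]) (use U in simp)
  have idt: "tame (\<lambda>_ x. x)"
    by (rule tame_fixed_function[OF net_class_slow smooth_on_ident[OF open_UNIV] U(1,3)]) auto
  have gt: "tame (\<lambda>_. g)"
    by (rule tame_fixed_function[OF net_class_slow K(3) U(1,3)]) auto
  have "\<exists>C. \<forall>\<^sub>F \<epsilon> in at_right 0. \<forall>\<zeta>\<in>Z. (1 + norm \<zeta>) ^ p *
      norm (LINT x:U|lborel. g x * v \<epsilon> x * exp (- (\<i> * of_real (x \<bullet> \<zeta>)))) \<le> C * \<epsilon> powr (- (N + 1))" for p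
  proof (rule microlocal_estimate[where K="\<lambda>_. K" and V="measure lborel K" and \<tau>="\<lambda>_. \<tau>" and f="\<lambda>_ x. x"
        and a="\<lambda>_. g" and A=A and N=N and w=v and ?C0.0="\<bar>C2\<bar>"])
    show "\<forall>\<^sub>F \<epsilon> in at_right 0. \<forall>\<eta>. norm (ft (v \<epsilon>) \<eta>) \<le> \<bar>C2\<bar> * \<epsilon> powr (- N)"
      using bigo_weaken[of UNIV "\<lambda>\<epsilon> \<eta>. norm (ft (v \<epsilon>) \<eta>)" C2 N2 N] N2 by (simp add: N_def)
    show "\<exists>C. \<forall>\<^sub>F \<epsilon> in at_right 0. \<forall>\<eta>\<in>A. (1 + norm \<eta>) ^ q * norm (ft (v \<epsilon>) \<eta>) \<le> C * \<epsilon> powr (- N)" for q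
    proof -
      obtain C where C: "\<forall>\<^sub>F \<epsilon> in at_right 0. \<forall>\<eta>\<in>A. (1 + norm \<eta>) ^ q * norm (ft (v \<epsilon>) \<eta>) \<le> C * \<epsilon> powr (- N1)"
        using N1[of q] unfolding A_def by blast
      have "N1 \<le> N" by (simp add: N_def)
      from bigo_weaken[OF C this] show ?thesis by blast
    qed
    show "0 \<notin> Z" using norm_zero by (auto simp: Z_def)
    have "(norm \<zeta> + norm \<eta> \<le> \<tau> * norm (\<eta> - \<zeta>)) \<or> (\<eta> \<in> A \<and> norm \<zeta> \<le> \<tau> * norm \<eta>)" if z: "\<zeta> \<in> Z" for \<zeta> \<eta>
    proof -
      obtain t \<xi> where \<zeta>: "\<zeta> = t *\<^sub>R \<xi>" "0 < t" "norm \<xi> = 1" "dist \<xi>0 \<xi> < r" using z by (auto simp: Z_def)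
      have n\<zeta>: "norm \<zeta> = t" using \<zeta> by simp
      show ?thesis
      proof (cases "\<eta> = 0")
        case True
        then show ?thesis using \<tau> \<zeta> n\<zeta> by (simp add: mult_le_cancel_right1)
      next
        case False
        define s \<xi>' where "s = norm \<eta>" and "\<xi>' = \<eta> /\<^sub>R s"
        have s: "0 < s" "\<eta> = s *\<^sub>R \<xi>'" "norm \<xi>' = 1" using False by (auto simp: s_def \<xi>'_def)
        show ?thesis
        proof (cases "dist \<xi>0 \<xi>' < 2 * r")
          case True
          then have "\<eta> \<in> A" unfolding A_def using s by (auto intro!: exI[of _ s] exI[of _ \<xi>'])
          show ?thesis
          proof (cases "t \<le> 2 * s")
            case True
            also have "2 * s \<le> \<tau> * s" using \<tau> s by (intro mult_right_mono) auto
            finally show ?thesis using \<open>\<eta> \<in> A\<close> n\<zeta> by (simp add: s_def)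
          next
            case False
            have "t - s \<le> norm (\<eta> - \<zeta>)" using norm_triangle_ineq3[of \<eta> \<zeta>] n\<zeta> by (simp add: s_def)
            then have "t + s \<le> 3 * norm (\<eta> - \<zeta>)" using False by linarith
            also have "\<dots> \<le> \<tau> * norm (\<eta> - \<zeta>)" using \<tau> by (intro mult_right_mono) auto
            finally show ?thesis using n\<zeta> by (simp add: s_def)
          qed
        next
          case False
          have "dist \<xi>0 \<xi>' \<le> dist \<xi>0 \<xi> + norm (\<xi>' - \<xi>)"
            using dist_triangle[of \<xi>0 \<xi>' \<xi>] by (simp add: dist_norm norm_minus_commute)
          then have "r \<le> norm (\<xi>' - \<xi>)" using False \<zeta>(4) by linarith
          from angle_bound[OF s(3) \<zeta>(3) this, of s t] have "(r / 2) * (s + t) \<le> norm (\<eta> - \<zeta>)"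
            using s \<zeta> r by simp
          then have "s + t \<le> (2 / r) * norm (\<eta> - \<zeta>)" using r by (simp add: field_simps)
          also have "\<dots> \<le> \<tau> * norm (\<eta> - \<zeta>)" using \<tau> by (intro mult_right_mono) auto
          finally show ?thesis using n\<zeta> by (simp add: s_def)
        qed
      qed
    qed
    then show "\<forall>\<^sub>F \<epsilon> in at_right (0::real). \<forall>\<zeta>\<in>Z. \<forall>\<eta>.
        (\<forall>x\<in>U. norm \<zeta> + norm \<eta> \<le> \<tau> * norm (transp_jacobian (\<lambda>_ x. x) \<epsilon> x \<eta> - \<zeta>)) \<or>
        (\<eta> \<in> A \<and> norm \<zeta> \<le> \<tau> * norm \<eta>)"
      by (simp add: transp_jacobian_ident)
  qed (use U K \<tau> idt gt test_net_props(1)[OF v] in \<open>auto intro: slow_net_const\<close>)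
  then have *: "\<exists>C. \<forall>\<^sub>F \<epsilon> in at_right 0. \<forall>\<zeta>\<in>Z. (1 + norm \<zeta>) ^ p *
      norm (ft (\<lambda>x. g x * v \<epsilon> x) \<zeta>) \<le> C * \<epsilon> powr (- (N + 1))" for p
  proof -
    have "(LINT x:U|lborel. g x * v \<epsilon> x * exp (- (\<i> * of_real (x \<bullet> \<zeta>)))) = ft (\<lambda>x. g x * v \<epsilon> x) \<zeta>" for \<epsilon> \<zeta>
      by (rule set_integral_eq_ft) (use U K in auto)
    with \<open>\<And>p. \<exists>C. \<forall>\<^sub>F \<epsilon> in at_right 0. \<forall>\<zeta>\<in>Z. (1 + norm \<zeta>) ^ p *
      norm (LINT x:U|lborel. g x * v \<epsilon> x * exp (- (\<i> * of_real (x \<bullet> \<zeta>)))) \<le> C * \<epsilon> powr (- (N + 1))\<close>[of p]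
    show ?thesis by simp
  qed
  show ?thesis
    by (rule rapid_onI_cone[where N="N + 1"]) (use * in \<open>auto simp: Z_def\<close>)
qed

definition regular_at :: "(real \<Rightarrow> real^'m::finite \<Rightarrow> complex) \<Rightarrow> real^'m \<Rightarrow> bool" where
  "regular_at v \<xi> \<longleftrightarrow> (\<exists>r>0. rapid_on v (sphere 0 1 \<inter> ball \<xi> r))"

lemma regular_at_mult:
  assumes "test_net v" "g \<in> test_functions UNIV" "regular_at v \<xi>"
  shows "regular_at (\<lambda>\<epsilon> x. g x * v \<epsilon> x) \<xi>"
proof -
  obtain r where r: "r > 0" "rapid_on v (sphere 0 1 \<inter> ball \<xi> r)" using assms(3) unfolding regular_at_def by blast
  then have "rapid_on (\<lambda>\<epsilon> x. g x * v \<epsilon> x) (sphere 0 1 \<inter> ball \<xi> (r / 2))"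
    by (intro rapid_on_mult[OF assms(1,2)]) auto
  then show ?thesis unfolding regular_at_def using r(1) half_gt_zero by blast
qed

lemma regular_at_nearby:
  assumes "rapid_on v (sphere 0 1 \<inter> ball \<xi> r)" "\<xi>' \<in> ball \<xi> r"
  shows "regular_at v \<xi>'"
proof -
  obtain e where e: "e > 0" "ball \<xi>' e \<subseteq> ball \<xi> r"
    using assms(2) open_ball open_contains_ball by metis
  then have "rapid_on v (sphere 0 1 \<inter> ball \<xi>' e)" by (intro rapid_on_subset[OF assms(1)]) blast
  then show ?thesis unfolding regular_at_def using e(1) by blast
qed

lemma rapid_on_compact:
  assumes "compact E" "E \<subseteq> sphere 0 1" "\<And>\<xi>. \<xi> \<in> E \<Longrightarrow> regular_at v \<xi>"
  shows "rapid_on v E"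
proof -
  obtain r where r: "\<And>\<xi>. \<xi> \<in> E \<Longrightarrow> r \<xi> > 0" "\<And>\<xi>. \<xi> \<in> E \<Longrightarrow> rapid_on v (sphere 0 1 \<inter> ball \<xi> (r \<xi>))"
    using assms(3) unfolding regular_at_def by metis
  have "E \<subseteq> (\<Union>\<xi>\<in>E. ball \<xi> (r \<xi>))" using r(1) by auto
  then obtain T where T: "T \<subseteq> E" "finite T" "E \<subseteq> (\<Union>\<xi>\<in>T. ball \<xi> (r \<xi>))"
    by (rule compactE_image[OF assms(1) open_ball])
  have "rapid_on v (\<Union>\<xi>\<in>T. sphere 0 1 \<inter> ball \<xi> (r \<xi>))"
    by (rule rapid_on_Union[OF T(2)]) (use r(2) T(1) in blast)
  then show ?thesis by (rule rapid_on_subset) (use T(3) assms(2) in blast)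
qed

lemma colombeau_rel_mult_fixed:
  fixes r s :: "('n::finite, complex) net"
  assumes \<Omega>: "open \<Omega>" and \<phi>: "smooth_on \<Omega> \<phi>" and rs: "(r, s) \<in> colombeau_rel \<Omega>"
  shows "((\<lambda>\<epsilon> x. \<phi> x * r \<epsilon> x), (\<lambda>\<epsilon> x. \<phi> x * s \<epsilon> x)) \<in> colombeau_rel \<Omega>"
proof (rule colombeau_relI[OF \<Omega>])
  fix K q assume K: "compact K" "K \<subseteq> \<Omega>"
  have "continuous_on K \<phi>" using continuous_on_subset[OF smooth_on_continuous[OF \<phi>, of "[]"] K(2)] by simp
  then have "bounded (\<phi> ` K)" by (intro compact_imp_bounded compact_continuous_image K)
  then obtain B where B: "\<And>x. x \<in> K \<Longrightarrow> norm (\<phi> x) \<le> B" by (auto simp: bounded_iff)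
  obtain C where C: "\<forall>\<^sub>F \<epsilon> in at_right 0. \<forall>x\<in>K. norm (r \<epsilon> x - s \<epsilon> x) \<le> C * \<epsilon> powr q"
    using colombeau_relD(3)[OF \<Omega> rs K] unfolding sup_bigo_def by blast
  have "\<forall>\<^sub>F \<epsilon> in at_right 0. \<forall>x\<in>K. norm (\<phi> x * r \<epsilon> x - \<phi> x * s \<epsilon> x) \<le> (\<bar>B\<bar> * C) * \<epsilon> powr q"
    using C
  proof eventually_elim
    case (elim \<epsilon>)
    show ?case
    proof
      fix x assume x: "x \<in> K"
      have "norm (\<phi> x * r \<epsilon> x - \<phi> x * s \<epsilon> x) = norm (\<phi> x) * norm (r \<epsilon> x - s \<epsilon> x)"
        by (simp add: norm_mult[symmetric] right_diff_distrib)
      also have "\<dots> \<le> \<bar>B\<bar> * (C * \<epsilon> powr q)" using elim x B[OF x] by (intro mult_mono) auto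
      finally show "norm (\<phi> x * r \<epsilon> x - \<phi> x * s \<epsilon> x) \<le> (\<bar>B\<bar> * C) * \<epsilon> powr q" by simp
    qed
  qed
  then show "sup_bigo K (\<lambda>\<epsilon> x. \<phi> x * r \<epsilon> x - \<phi> x * s \<epsilon> x) (\<lambda>\<epsilon>. \<epsilon> powr q)" unfolding sup_bigo_def by blast
qed (intro moderate_nets_mult_fixed[OF \<Omega> \<phi>] colombeau_relD(1,2)[OF \<Omega> rs])+

lemma gmult_eq_gclass:
  fixes r :: "('n::finite, complex) net"
  assumes \<Omega>: "open \<Omega>" and \<phi>: "smooth_on \<Omega> \<phi>" and r: "r \<in> moderate_nets \<Omega>"
  shows "gmult \<Omega> \<phi> (gclass \<Omega> r) = gclass \<Omega> (\<lambda>\<epsilon> x. \<phi> x * r \<epsilon> x)"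
proof -
  have "gclass \<Omega> (\<lambda>\<epsilon> x. \<phi> x * s \<epsilon> x) = gclass \<Omega> (\<lambda>\<epsilon> x. \<phi> x * r \<epsilon> x)" if "s \<in> gclass \<Omega> r" for s
  proof -
    have rs: "(r, s) \<in> colombeau_rel \<Omega>" using that by (simp add: gclass_def)
    have "gclass \<Omega> (\<lambda>\<epsilon> x. \<phi> x * r \<epsilon> x) = gclass \<Omega> (\<lambda>\<epsilon> x. \<phi> x * s \<epsilon> x)"
      using colombeau_rel_mult_fixed[OF \<Omega> \<phi> rs] colombeau_relD(1,2)[OF \<Omega> rs]
      by (subst gclass_eq_iff[OF \<Omega>]) (auto intro: moderate_nets_mult_fixed[OF \<Omega> \<phi>])
    then show ?thesis ..
  qed
  then have "gmult \<Omega> \<phi> (gclass \<Omega> r) = (\<Union>s\<in>gclass \<Omega> r. gclass \<Omega> (\<lambda>\<epsilon> x. \<phi> x * r \<epsilon> x))"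
    unfolding gmult_def by (intro SUP_cong) auto
  also have "\<dots> = gclass \<Omega> (\<lambda>\<epsilon> x. \<phi> x * r \<epsilon> x)"
    using mem_gclass_self[OF \<Omega> r] by (intro SUP_const) blast
  finally show ?thesis .
qed

text \<open>The definition of \<open>Sigma_at\<close> provides rapid decrease for some representative with joint compact
  support. It differs from \<open>\<phi> r\<close> by a negligible net of joint compact support, which is rapidly
  decreasing in all directions.\<close>

lemma regular_at_of_not_Sigma_at:
  fixes r :: "('n::finite, complex) net"
  assumes \<Omega>: "open \<Omega>" and r: "r \<in> moderate_nets \<Omega>" and \<xi>: "\<xi> \<in> sphere 0 1" "\<xi> \<notin> Sigma_at \<Omega> (gclass \<Omega> r) y"
  shows "\<exists>\<phi>\<in>test_functions \<Omega>. \<phi> y \<noteq> 0 \<and> regular_at (\<lambda>\<epsilon> x. \<phi> x * r \<epsilon> x) \<xi>"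
proof -
  obtain \<phi> \<Gamma> where \<phi>: "\<phi> \<in> test_functions \<Omega>" "\<phi> y \<noteq> 0"
    and \<Gamma>: "openin (top_of_set (sphere 0 1)) \<Gamma>" "\<xi> \<in> \<Gamma>"
      "rapidly_decreasing \<Gamma> (fourier_nets \<Omega> (gmult \<Omega> \<phi> (gclass \<Omega> r)))"
    using \<xi> unfolding Sigma_at_def Sigma_dirs_def by auto
  obtain K where K: "compact K" "K \<subseteq> \<Omega>" "\<And>x. x \<notin> K \<Longrightarrow> \<phi> x = 0" "smooth_on UNIV \<phi>"
    by (rule test_functionsD[OF \<phi>(1)], rule that) assumption+
  have s\<phi>: "smooth_on \<Omega> \<phi>" by (rule smooth_on_subset[OF K(4)]) simp
  obtain w where w: "w \<in> gclass \<Omega> (\<lambda>\<epsilon> x. \<phi> x * r \<epsilon> x)" "joint_compact_support \<Omega> w"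
    "rapid_on (\<lambda>\<epsilon> x. indicator \<Omega> x *\<^sub>R w \<epsilon> x) \<Gamma>"
    using rapidly_decreasingD[OF \<Gamma>(3)] unfolding gmult_eq_gclass[OF \<Omega> s\<phi> r] by metis
  have rel: "((\<lambda>\<epsilon> x. \<phi> x * r \<epsilon> x), w) \<in> colombeau_rel \<Omega>" using w(1) by (simp add: gclass_def)
  define n where "n \<epsilon> x = \<phi> x * r \<epsilon> x - w \<epsilon> x" for \<epsilon> x
  have n: "n \<in> negligible_nets \<Omega>" unfolding n_def[abs_def] by (rule colombeau_relD(4)[OF \<Omega> rel])
  obtain L where L: "compact L" "L \<subseteq> \<Omega>" "\<And>\<epsilon> x. 0 < \<epsilon> \<Longrightarrow> \<epsilon> \<le> 1 \<Longrightarrow> x \<in> \<Omega> - L \<Longrightarrow> w \<epsilon> x = 0"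
    using w(2) unfolding joint_compact_support_def by auto
  have neg: "rapid_on (\<lambda>\<epsilon> x. indicator \<Omega> x *\<^sub>R n \<epsilon> x) (sphere 0 1)"
  proof (rule rapid_on_negligible[OF \<Omega> n, of "K \<union> L"])
    show "n \<epsilon> x = 0" if "0 < \<epsilon>" "\<epsilon> \<le> 1" "x \<in> \<Omega> - (K \<union> L)" for \<epsilon> x
      using K(3)[of x] L(3)[OF that(1,2), of x] that(3) by (simp add: n_def)
  qed (use K L in auto)
  have \<Gamma>s: "\<Gamma> \<subseteq> sphere 0 1" using openin_imp_subset[OF \<Gamma>(1)] .
  have "rapid_on (\<lambda>\<epsilon> x. \<phi> x * r \<epsilon> x) \<Gamma>"
  proof (rule rapid_on_add[OF w(3) rapid_on_subset[OF neg \<Gamma>s]])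
    show "\<forall>\<^sub>F \<epsilon> in at_right 0. \<forall>\<xi>. ft (\<lambda>x. \<phi> x * r \<epsilon> x) \<xi> =
        ft (\<lambda>x. indicator \<Omega> x *\<^sub>R w \<epsilon> x) \<xi> + ft (\<lambda>x. indicator \<Omega> x *\<^sub>R n \<epsilon> x) \<xi>"
      using eventually_at_right_0
    proof eventually_elim
      case (elim \<epsilon>)
      then have \<epsilon>: "0 < \<epsilon>" "\<epsilon> \<le> 1" by auto
      have cw: "continuous_on \<Omega> (w \<epsilon>)"
        using smooth_on_continuous[OF moderate_netsD_smooth[OF colombeau_relD(2)[OF \<Omega> rel] \<epsilon>], of "[]"] by simp
      have cn: "continuous_on \<Omega> (n \<epsilon>)"
        using smooth_on_continuous[OF moderate_netsD_smooth[OF negligible_netsD(2)[OF \<Omega> n] \<epsilon>], of "[]"] by simp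
      show ?case
      proof
        fix \<xi>
        let ?e = "\<lambda>x::real^'n. exp (- (\<i> * complex_of_real (x \<bullet> \<xi>)))"
        have "set_integrable lborel \<Omega> (\<lambda>x. w \<epsilon> x * ?e x)"
          by (rule set_integrable_compact_support[OF L(1,2)]) (use L(3)[OF \<epsilon>] in \<open>auto intro!: continuous_intros cw\<close>)
        moreover have "set_integrable lborel \<Omega> (\<lambda>x. n \<epsilon> x * ?e x)"
        proof (rule set_integrable_compact_support[of "K \<union> L"])
          show "continuous_on \<Omega> (\<lambda>x. n \<epsilon> x * ?e x)" by (intro continuous_intros cn)
          show "n \<epsilon> x * ?e x = 0" if "x \<in> \<Omega> - (K \<union> L)" for x
            using K(3)[of x] L(3)[OF \<epsilon>, of x] that by (simp add: n_def)
        qed (use L K in auto)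
        ultimately have "(\<integral>x. indicator \<Omega> x *\<^sub>R (w \<epsilon> x * ?e x) + indicator \<Omega> x *\<^sub>R (n \<epsilon> x * ?e x) \<partial>lborel) =
            (\<integral>x. indicator \<Omega> x *\<^sub>R (w \<epsilon> x * ?e x) \<partial>lborel) + (\<integral>x. indicator \<Omega> x *\<^sub>R (n \<epsilon> x * ?e x) \<partial>lborel)"
          unfolding set_integrable_def by (rule Bochner_Integration.integral_add)
        moreover have "(\<lambda>x. indicator \<Omega> x *\<^sub>R (w \<epsilon> x * ?e x) + indicator \<Omega> x *\<^sub>R (n \<epsilon> x * ?e x)) = (\<lambda>x. \<phi> x * r \<epsilon> x * ?e x)"
          using K(2,3) by (auto simp: fun_eq_iff indicator_def n_def left_diff_distrib)
        ultimately show "ft (\<lambda>x. \<phi> x * r \<epsilon> x) \<xi> =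
            ft (\<lambda>x. indicator \<Omega> x *\<^sub>R w \<epsilon> x) \<xi> + ft (\<lambda>x. indicator \<Omega> x *\<^sub>R n \<epsilon> x) \<xi>"
          unfolding ft_def by simp
      qed
    qed
  qed
  moreover obtain e where "e > 0" "ball \<xi> e \<inter> sphere 0 1 \<subseteq> \<Gamma>"
    using \<Gamma>(1,2) unfolding openin_contains_ball by blast
  ultimately have "regular_at (\<lambda>\<epsilon> x. \<phi> x * r \<epsilon> x) \<xi>"
    unfolding regular_at_def by (intro exI[of _ e]) (auto intro: rapid_on_subset)
  with \<phi> show ?thesis by blast
qed

lemma test_functions_mono: "\<phi> \<in> test_functions A \<Longrightarrow> A \<subseteq> B \<Longrightarrow> \<phi> \<in> test_functions B"
  by (auto simp: test_functions_def)

text \<open>By compactness finitely many cut-offs, each good for a neighbourhood of one direction, suffice.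
  Their product is good for all directions in \<open>E\<close>, because multiplication by a test function
  preserves regular directions; a further factor makes the support small.\<close>

lemma microlocalization:
  fixes r :: "('n::finite, complex) net"
  assumes \<Omega>: "open \<Omega>" and r: "r \<in> moderate_nets \<Omega>" and y: "y \<in> \<Omega>" and \<delta>: "0 < \<delta>"
    and E: "compact E" "E \<subseteq> sphere 0 1" "\<And>\<xi>. \<xi> \<in> E \<Longrightarrow> \<xi> \<notin> Sigma_at \<Omega> (gclass \<Omega> r) y"
  shows "\<exists>\<psi>\<in>test_functions (\<Omega> \<inter> ball y \<delta>). \<psi> y \<noteq> 0 \<and> rapid_on (\<lambda>\<epsilon> x. \<psi> x * r \<epsilon> x) E"
proof -
  have "\<forall>\<xi>\<in>E. \<exists>p. fst p \<in> test_functions \<Omega> \<and> fst p y \<noteq> 0 \<and> snd p > 0 \<and>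
      rapid_on (\<lambda>\<epsilon> x. fst p x * r \<epsilon> x) (sphere 0 1 \<inter> ball \<xi> (snd p))"
  proof
    fix \<xi> assume \<xi>: "\<xi> \<in> E"
    then have "\<xi> \<in> sphere 0 1" using E(2) by blast
    from regular_at_of_not_Sigma_at[OF \<Omega> r this E(3)[OF \<xi>]]
    obtain \<phi> e where "\<phi> \<in> test_functions \<Omega>" "\<phi> y \<noteq> 0" "e > 0"
      "rapid_on (\<lambda>\<epsilon> x. \<phi> x * r \<epsilon> x) (sphere 0 1 \<inter> ball \<xi> e)" unfolding regular_at_def by blast
    then show "\<exists>p. fst p \<in> test_functions \<Omega> \<and> fst p y \<noteq> 0 \<and> snd p > 0 \<and>
      rapid_on (\<lambda>\<epsilon> x. fst p x * r \<epsilon> x) (sphere 0 1 \<inter> ball \<xi> (snd p))"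
      by (intro exI[of _ "(\<phi>, e)"]) simp
  qed
  from bchoice[OF this] obtain g where g: "\<forall>\<xi>\<in>E. fst (g \<xi>) \<in> test_functions \<Omega> \<and> fst (g \<xi>) y \<noteq> 0 \<and> snd (g \<xi>) > 0 \<and>
      rapid_on (\<lambda>\<epsilon> x. fst (g \<xi>) x * r \<epsilon> x) (sphere 0 1 \<inter> ball \<xi> (snd (g \<xi>)))" by blast
  define \<phi> e where "\<phi> \<xi> = fst (g \<xi>)" and "e \<xi> = snd (g \<xi>)" for \<xi>
  have \<phi>: "\<phi> \<xi> \<in> test_functions \<Omega>" "\<phi> \<xi> y \<noteq> 0"
    and e: "e \<xi> > 0" "rapid_on (\<lambda>\<epsilon> x. \<phi> \<xi> x * r \<epsilon> x) (sphere 0 1 \<inter> ball \<xi> (e \<xi>))" if "\<xi> \<in> E" for \<xi>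
    using bspec[OF g that] by (simp_all add: \<phi>_def e_def)
  have "E \<subseteq> (\<Union>\<xi>\<in>E. ball \<xi> (e \<xi>))" using e(1) by auto
  then obtain T where T: "T \<subseteq> E" "finite T" "E \<subseteq> (\<Union>\<xi>\<in>T. ball \<xi> (e \<xi>))"
    by (rule compactE_image[OF E(1) open_ball])
  have "\<exists>\<psi>\<in>test_functions (\<Omega> \<inter> ball y \<delta>). \<psi> y \<noteq> 0 \<and>
      (\<forall>\<xi>\<in>T. \<forall>\<xi>'\<in>ball \<xi> (e \<xi>). regular_at (\<lambda>\<epsilon> x. \<psi> x * r \<epsilon> x) \<xi>')"
    using T(2,1)
  proof (induction T rule: finite_induct)
    case empty
    have "open (\<Omega> \<inter> ball y \<delta>)" "y \<in> \<Omega> \<inter> ball y \<delta>" using \<Omega> y \<delta> by auto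
    then obtain d where d: "d > 0" "cball y d \<subseteq> \<Omega> \<inter> ball y \<delta>" using open_contains_cball by metis
    have "bump y d y \<noteq> 0" using bump_pos_iff[OF d(1), of y y] d(1) by simp
    then show ?case using bump_test_function[OF d] by (intro bexI[of _ "\<lambda>x. complex_of_real (bump y d x)"]) auto
  next
    case (insert \<xi> T)
    then obtain \<psi> where \<psi>: "\<psi> \<in> test_functions (\<Omega> \<inter> ball y \<delta>)" "\<psi> y \<noteq> 0"
      "\<And>\<xi> \<xi>'. \<xi> \<in> T \<Longrightarrow> \<xi>' \<in> ball \<xi> (e \<xi>) \<Longrightarrow> regular_at (\<lambda>\<epsilon> x. \<psi> x * r \<epsilon> x) \<xi>'" by auto
    have \<xi>: "\<xi> \<in> E" using insert by simp
    have \<psi>\<Omega>: "\<psi> \<in> test_functions \<Omega>" "\<psi> \<in> test_functions UNIV" "\<phi> \<xi> \<in> test_functions UNIV"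
      using test_functions_mono[OF \<psi>(1)] test_functions_mono[OF \<phi>(1)[OF \<xi>]] by auto
    have s: "smooth_on UNIV (\<phi> \<xi>)" using \<psi>\<Omega>(3) by (simp add: test_functions_def)
    have "regular_at (\<lambda>\<epsilon> x. \<psi> x * \<phi> \<xi> x * r \<epsilon> x) \<xi>'" if "\<xi>0 \<in> insert \<xi> T" "\<xi>' \<in> ball \<xi>0 (e \<xi>0)" for \<xi>0 \<xi>'
    proof (cases "\<xi>0 = \<xi>")
      case True
      then have "regular_at (\<lambda>\<epsilon> x. \<phi> \<xi> x * r \<epsilon> x) \<xi>'" using regular_at_nearby[OF e(2)[OF \<xi>]] that by blast
      from regular_at_mult[OF test_net_moderate[OF \<Omega> \<phi>(1)[OF \<xi>] r] \<psi>\<Omega>(2) this]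
      show ?thesis by (simp add: mult.assoc)
    next
      case False
      then have "regular_at (\<lambda>\<epsilon> x. \<psi> x * r \<epsilon> x) \<xi>'" using \<psi>(3) that by blast
      from regular_at_mult[OF test_net_moderate[OF \<Omega> \<psi>\<Omega>(1) r] \<psi>\<Omega>(3) this]
      show ?thesis by (simp add: mult.assoc mult.left_commute)
    qed
    then show ?case
      using test_functions_mult[OF \<psi>(1) s] \<psi>(2) \<phi>(2)[OF \<xi>] by (intro bexI[of _ "\<lambda>x. \<psi> x * \<phi> \<xi> x"]) auto
  qed
  then obtain \<psi> where \<psi>: "\<psi> \<in> test_functions (\<Omega> \<inter> ball y \<delta>)" "\<psi> y \<noteq> 0"
      "\<forall>\<xi>\<in>T. \<forall>\<xi>'\<in>ball \<xi> (e \<xi>). regular_at (\<lambda>\<epsilon> x. \<psi> x * r \<epsilon> x) \<xi>'" by blast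
  have "rapid_on (\<lambda>\<epsilon> x. \<psi> x * r \<epsilon> x) E"
    by (rule rapid_on_compact[OF E(1,2)]) (use T(3) \<psi>(3) in blast)
  with \<psi> show ?thesis by blast
qed

section \<open>Generalized graphs\<close>

text \<open>If every \<open>d\<close> failed, a violating point \<open>x\<^sub>d\<close> and parameter \<open>\<tau>(d) < d\<close> could be chosen for each \<open>d > 0\<close>.
  Reading \<open>d\<close> as \<open>\<epsilon>\<close>, these are the nets that place \<open>(x, y)\<close> in the generalized graph. The freedom
  \<open>\<tau>(\<epsilon>) \<le> \<epsilon>\<close> in the definition of the graph is what makes this work.\<close>

lemma gen_graph_separation:
  fixes F :: "real \<Rightarrow> 'a::metric_space \<Rightarrow> 'b::metric_space"
  assumes "x \<in> A" "y \<in> B" "(x, y) \<notin> gen_graph A B F"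
  obtains d where "d > 0" "\<forall>\<^sub>F \<epsilon> in at_right 0. \<forall>x'\<in>A. dist x' x < d \<longrightarrow> \<not> dist (F \<epsilon> x') y < d"
proof (rule ccontr)
  assume "\<not> thesis"
  with that have neg: "\<not> (\<forall>\<^sub>F \<epsilon> in at_right 0. \<forall>x'\<in>A. dist x' x < d \<longrightarrow> \<not> dist (F \<epsilon> x') y < d)" if "d > 0" for d
    using \<open>d > 0\<close> by blast
  have "\<exists>p. 0 < d \<longrightarrow> fst p \<in> A \<and> 0 < snd p \<and> snd p < d \<and> dist (fst p) x < d \<and> dist (F (snd p) (fst p)) y < d" for d :: real
  proof (cases "0 < d")
    case True
    have "\<exists>\<^sub>F \<epsilon> in at_right 0. \<exists>x'\<in>A. dist x' x < d \<and> dist (F \<epsilon> x') y < d"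
      using neg[OF True] unfolding frequently_def by simp
    moreover have "\<forall>\<^sub>F \<epsilon> in at_right 0. 0 < \<epsilon> \<and> \<epsilon> < d" unfolding eventually_at_right_field using True by auto
    ultimately have "\<exists>\<^sub>F \<epsilon> in at_right 0. (\<exists>x'\<in>A. dist x' x < d \<and> dist (F \<epsilon> x') y < d) \<and> (0 < \<epsilon> \<and> \<epsilon> < d)"
      by (rule frequently_eventually_frequently)
    then obtain \<epsilon> x' where "x' \<in> A" "dist x' x < d" "dist (F \<epsilon> x') y < d" "0 < \<epsilon>" "\<epsilon> < d"
      using frequently_ex by blast
    then show ?thesis by (intro exI[of _ "(x', \<epsilon>)"]) simp
  qed simp
  then have "\<exists>p. \<forall>d. 0 < d \<longrightarrow> fst (p d) \<in> A \<and> 0 < snd (p d) \<and> snd (p d) < d \<and> dist (fst (p d)) x < d \<and> dist (F (snd (p d)) (fst (p d))) y < d"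
    by (intro choice allI)
  then obtain p where p: "\<And>d. 0 < d \<Longrightarrow> fst (p d) \<in> A" "\<And>d. 0 < d \<Longrightarrow> 0 < snd (p d)" "\<And>d. 0 < d \<Longrightarrow> snd (p d) < d"
      "\<And>d. 0 < d \<Longrightarrow> dist (fst (p d)) x < d" "\<And>d. 0 < d \<Longrightarrow> dist (F (snd (p d)) (fst (p d))) y < d" by blast
  have small: "\<forall>\<^sub>F \<epsilon> in at_right 0. 0 < \<epsilon> \<and> \<epsilon> < e" if "e > 0" for e :: real
    unfolding eventually_at_right_field using that by auto
  have "((\<lambda>\<epsilon>. fst (p \<epsilon>)) \<longlongrightarrow> x) (at_right 0)"
  proof (rule tendstoI)
    fix e :: real assume "e > 0"
    show "\<forall>\<^sub>F \<epsilon> in at_right 0. dist (fst (p \<epsilon>)) x < e"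
      using small[OF \<open>e > 0\<close>] by eventually_elim (use p(4) in \<open>auto intro: less_trans\<close>)
  qed
  moreover have "cluster_point (\<lambda>\<epsilon>. F (snd (p \<epsilon>)) (fst (p \<epsilon>))) y"
    unfolding cluster_point_def
  proof (intro allI impI)
    fix U assume "open U \<and> y \<in> U"
    then obtain e where e: "e > 0" "ball y e \<subseteq> U" using open_contains_ball by metis
    have "\<forall>\<^sub>F \<epsilon> in at_right 0. F (snd (p \<epsilon>)) (fst (p \<epsilon>)) \<in> U"
      using small[OF e(1)]
    proof eventually_elim
      case (elim \<epsilon>)
      then have "dist (F (snd (p \<epsilon>)) (fst (p \<epsilon>))) y < e" using p(5)[of \<epsilon>] by linarith
      then show ?case using e(2) by (auto simp: dist_commute subset_eq)
    qed
    then show "\<exists>\<^sub>F \<epsilon> in at_right 0. F (snd (p \<epsilon>)) (fst (p \<epsilon>)) \<in> U"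
      by (intro eventually_frequently) (auto simp: trivial_limit_at_right_real)
  qed
  moreover have "\<forall>\<epsilon>\<in>{0<..1}. fst (p \<epsilon>) \<in> A \<and> snd (p \<epsilon>) \<in> {0<..1} \<and> snd (p \<epsilon>) \<le> \<epsilon>"
  proof
    fix \<epsilon> :: real assume "\<epsilon> \<in> {0<..1}"
    then show "fst (p \<epsilon>) \<in> A \<and> snd (p \<epsilon>) \<in> {0<..1} \<and> snd (p \<epsilon>) \<le> \<epsilon>"
      using p(1-3)[of \<epsilon>] by simp
  qed
  ultimately have "(x, y) \<in> gen_graph A B F"
    unfolding gen_graph_def using assms(1,2)
    by (auto intro!: exI[of _ "\<lambda>\<epsilon>. fst (p \<epsilon>)"] exI[of _ "\<lambda>\<epsilon>. snd (p \<epsilon>)"])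
  with assms(3) show False by simp
qed

text \<open>Compactness as an induction principle for local properties \<open>Q d V\<close> with a size parameter \<open>d\<close> that
  may be shrunk.\<close>

lemma compact_cover_induct:
  fixes K :: "'a::metric_space set" and Q :: "real \<Rightarrow> 'a set \<Rightarrow> bool"
  assumes K: "compact K"
    and empty: "\<And>d. Q d {}"
    and antimono: "\<And>d d' V. Q d V \<Longrightarrow> d' \<le> d \<Longrightarrow> Q d' V"
    and union: "\<And>d V V'. Q d V \<Longrightarrow> Q d V' \<Longrightarrow> Q d (V \<union> V')"
    and local: "\<And>y. y \<in> K \<Longrightarrow> \<exists>d>0. Q d (ball y d)"
  obtains d W where "d > 0" "open W" "K \<subseteq> W" "Q d W"
proof -
  obtain r where r: "\<And>y. y \<in> K \<Longrightarrow> r y > 0" "\<And>y. y \<in> K \<Longrightarrow> Q (r y) (ball y (r y))"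
    using local by metis
  have "K \<subseteq> (\<Union>y\<in>K. ball y (r y))" using r(1) by auto
  then obtain T where T: "T \<subseteq> K" "finite T" "K \<subseteq> (\<Union>y\<in>T. ball y (r y))"
    by (rule compactE_image[OF K open_ball])
  have "\<exists>d>0. Q d (\<Union>y\<in>T. ball y (r y))"
    using T(2,1)
  proof (induction T rule: finite_induct)
    case empty
    then show ?case using assms(2) by (intro exI[of _ 1]) simp
  next
    case (insert y T)
    then obtain d where d: "d > 0" "Q d (\<Union>y\<in>T. ball y (r y))" by auto
    have "Q (min d (r y)) (ball y (r y) \<union> (\<Union>y\<in>T. ball y (r y)))"
      using antimono[OF d(2)] antimono[OF r(2)] insert.prems by (intro union) auto
    then show ?case using d(1) r(1) insert.prems by (intro exI[of _ "min d (r y)"]) auto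
  qed
  then obtain d where d: "d > 0" "Q d (\<Union>y\<in>T. ball y (r y))" by blast
  show ?thesis by (rule that[OF d(1) _ T(3) d(2)]) auto
qed

section \<open>Points outside \<open>K_f(u)\<close>\<close>

text \<open>To prove regularity it suffices to exhibit one good net: one cut-off at \<open>x\<close> and one
  representative of the product.\<close>

lemma not_in_WF:
  assumes "\<phi> \<in> test_functions \<Omega>" "\<phi> x \<noteq> 0" "d > 0"
    and "v \<in> gmult \<Omega> \<phi> u" "joint_compact_support \<Omega> v" "\<And>\<epsilon> x. x \<notin> \<Omega> \<Longrightarrow> v \<epsilon> x = 0"
    and "rapid_on v (sphere 0 1 \<inter> ball \<xi> d)"
  shows "(x, \<xi>) \<notin> WF \<Omega> u"
proof
  assume WF: "(x, \<xi>) \<in> WF \<Omega> u"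
  then have "\<xi> \<in> Sigma_dirs \<Omega> (gmult \<Omega> \<phi> u)" using assms(1,2) unfolding WF_def Sigma_at_def by blast
  moreover have "rapidly_decreasing (sphere 0 1 \<inter> ball \<xi> d) (fourier_nets \<Omega> (gmult \<Omega> \<phi> u))"
    by (rule rapidly_decreasingI[OF assms(4-7)])
  moreover have "openin (top_of_set (sphere 0 1)) (sphere 0 1 \<inter> ball \<xi> d)" by (rule openin_open_Int) simp
  moreover have "\<xi> \<in> sphere 0 1 \<inter> ball \<xi> d" using WF assms(3) by (simp add: WF_def)
  ultimately show False unfolding Sigma_dirs_def by blast
qed

text \<open>The transform of \<open>\<phi>\<close> decays to any order with constants independent of \<open>\<epsilon>\<close>, and \<open>c\<^sub>\<epsilon>\<close> costs
  a fixed power of \<open>1/\<epsilon>\<close>.\<close>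

lemma rapid_on_constant_net:
  fixes \<phi> :: "real^'n::finite \<Rightarrow> complex" and c :: "real \<Rightarrow> complex"
  assumes \<phi>: "\<phi> \<in> test_functions UNIV" and c: "moderate_net (\<lambda>\<epsilon>. norm (c \<epsilon>))"
  shows "rapid_on (\<lambda>\<epsilon> x. \<phi> x * c \<epsilon>) (sphere 0 1)"
proof -
  obtain K where K: "compact K" "\<And>x. x \<notin> K \<Longrightarrow> \<phi> x = 0" "smooth_on UNIV \<phi>"
    by (rule test_functionsD[OF \<phi>], rule that) assumption+
  obtain B where B: "K \<subseteq> ball 0 B"
    using compact_imp_bounded[OF K(1)] bounded_subset_ballD[of K 0] by blast
  have t: "tame_net slow_net (\<lambda>_. ball 0 B) (\<lambda>_. \<phi>)"
    by (rule tame_fixed_function[OF net_class_slow K(3) open_ball ball_subset_cball]) auto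
  have eq: "ft (\<lambda>x. \<phi> x * c \<epsilon>) \<zeta> = c \<epsilon> * (LINT x:ball 0 B|lborel. \<phi> x * exp (- (\<i> * of_real (x \<bullet> \<zeta>))))" for \<epsilon> \<zeta>
  proof -
    have "ft (\<lambda>x. \<phi> x * c \<epsilon>) \<zeta> = (\<integral>x. c \<epsilon> * (indicator (ball 0 B) x *\<^sub>R (\<phi> x * exp (- (\<i> * of_real (x \<bullet> \<zeta>))))) \<partial>lborel)"
      unfolding ft_def using K(2) B by (intro Bochner_Integration.integral_cong) (auto simp: indicator_def subset_eq)
    then show ?thesis unfolding set_lebesgue_integral_def by (simp only: integral_mult_right_zero)
  qed
  have decay: "\<exists>C. \<forall>\<^sub>F \<epsilon> in at_right 0. \<forall>\<zeta>. \<zeta> \<noteq> 0 \<longrightarrow>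
      norm \<zeta> ^ p * norm (LINT x:ball 0 B|lborel. \<phi> x * exp (- (\<i> * of_real (x \<bullet> \<zeta>)))) \<le> C / \<epsilon>" for p
  proof -
    obtain r where r: "slow_net r" "\<forall>\<^sub>F \<epsilon> in at_right 0. \<forall>\<zeta>. \<zeta> \<noteq> 0 \<longrightarrow>
      norm \<zeta> ^ p * norm (LINT x:ball 0 B|lborel. \<phi> x * exp (- (\<i> * of_real (x \<bullet> \<zeta>)))) \<le> r \<epsilon>"
      using fourier_decay[OF net_class_slow open_ball t K(1) B, of p] K(2) by auto
    obtain C where "\<forall>\<^sub>F \<epsilon> in at_right 0. \<bar>r \<epsilon>\<bar> \<le> C / \<epsilon>" using slow_netD[OF r(1)] by blast
    with r(2) have "\<forall>\<^sub>F \<epsilon> in at_right 0. \<forall>\<zeta>. \<zeta> \<noteq> 0 \<longrightarrow>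
      norm \<zeta> ^ p * norm (LINT x:ball 0 B|lborel. \<phi> x * exp (- (\<i> * of_real (x \<bullet> \<zeta>)))) \<le> C / \<epsilon>"
      by eventually_elim (meson abs_ge_self order_trans)
    then show ?thesis by blast
  qed
  obtain p D where D: "\<forall>\<^sub>F \<epsilon> in at_right 0. norm (c \<epsilon>) \<le> D * \<epsilon> powr (- p)"
    using c unfolding moderate_net_def by auto
  show ?thesis unfolding rapid_on_def
  proof (rule exI[of _ "p + 1"], rule allI)
    fix q :: nat
    obtain C0 where C0: "\<forall>\<^sub>F \<epsilon> in at_right 0. \<forall>\<zeta>. \<zeta> \<noteq> 0 \<longrightarrow>
      norm \<zeta> ^ 0 * norm (LINT x:ball 0 B|lborel. \<phi> x * exp (- (\<i> * of_real (x \<bullet> \<zeta>)))) \<le> C0 / \<epsilon>" using decay by blast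
    obtain Cq where Cq: "\<forall>\<^sub>F \<epsilon> in at_right 0. \<forall>\<zeta>. \<zeta> \<noteq> 0 \<longrightarrow>
      norm \<zeta> ^ q * norm (LINT x:ball 0 B|lborel. \<phi> x * exp (- (\<i> * of_real (x \<bullet> \<zeta>)))) \<le> Cq / \<epsilon>" using decay by blast
    have "\<forall>\<^sub>F \<epsilon> in at_right 0. \<forall>\<xi>\<in>sphere 0 1. \<forall>t>0. (1 + t) ^ q * norm (ft (\<lambda>x. \<phi> x * c \<epsilon>) (t *\<^sub>R \<xi>)) \<le>
        (D * (2 ^ q * (C0 + Cq))) * \<epsilon> powr (- (p + 1))"
      using C0 Cq D eventually_at_right_0
    proof eventually_elim
      case (elim \<epsilon>)
      show ?case
      proof (intro ballI allI impI)
        fix \<xi> :: "real^'n" and t :: real assume \<xi>: "\<xi> \<in> sphere 0 1" and t: "0 < t"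
        define J where "J = norm (LINT x:ball 0 B|lborel. \<phi> x * exp (- (\<i> * of_real (x \<bullet> (t *\<^sub>R \<xi>)))))"
        have n: "norm (t *\<^sub>R \<xi>) = t" "t *\<^sub>R \<xi> \<noteq> 0" using \<xi> t by auto
        have J0: "J \<le> C0 / \<epsilon>" using elim(1)[rule_format, OF n(2)] by (simp add: J_def)
        have Jq: "t ^ q * J \<le> Cq / \<epsilon>" using elim(2)[rule_format, OF n(2)] unfolding n(1) J_def .
        have "(1 + t) ^ q * J \<le> 2 ^ q * (1 + t ^ q) * J"
          using t by (intro mult_right_mono one_plus_power_le) (auto simp: J_def)
        also have "\<dots> = 2 ^ q * (J + t ^ q * J)" by (simp add: algebra_simps)
        also have "\<dots> \<le> 2 ^ q * (C0 / \<epsilon> + Cq / \<epsilon>)" using J0 Jq by (intro mult_left_mono add_mono) auto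
        finally have J: "(1 + t) ^ q * J \<le> 2 ^ q * (C0 / \<epsilon> + Cq / \<epsilon>)" .
        have "(1 + t) ^ q * norm (ft (\<lambda>x. \<phi> x * c \<epsilon>) (t *\<^sub>R \<xi>)) = norm (c \<epsilon>) * ((1 + t) ^ q * J)"
          unfolding eq J_def norm_mult by (simp only: mult_ac)
        also have "\<dots> \<le> (D * \<epsilon> powr (- p)) * (2 ^ q * (C0 / \<epsilon> + Cq / \<epsilon>))"
        proof (rule mult_mono[OF elim(3) J])
          show "0 \<le> D * \<epsilon> powr (- p)" using elim(3) norm_ge_zero order_trans by blast
          show "0 \<le> (1 + t) ^ q * J" using t by (simp add: J_def)
        qed
        also have "\<dots> = (D * (2 ^ q * (C0 + Cq))) * \<epsilon> powr (- (p + 1))"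
        proof -
          have "\<epsilon> powr (- (p + 1)) = \<epsilon> powr (- p) / \<epsilon>" using elim(4) by (simp add: powr_diff)
          then show ?thesis by (simp add: add_divide_distrib[symmetric])
        qed
        finally show "(1 + t) ^ q * norm (ft (\<lambda>x. \<phi> x * c \<epsilon>) (t *\<^sub>R \<xi>)) \<le> (D * (2 ^ q * (C0 + Cq))) * \<epsilon> powr (- (p + 1))" .
      qed
    qed
    then show "\<exists>C. \<forall>\<^sub>F \<epsilon> in at_right 0. \<forall>\<xi>\<in>sphere 0 1. \<forall>t>0. (1 + t) ^ q * norm (ft (\<lambda>x. \<phi> x * c \<epsilon>) (t *\<^sub>R \<xi>)) \<le> C * \<epsilon> powr (- (p + 1))"
      by blast
  qed
qed

lemma generalized_real_rep:
  assumes "k \<in> generalized_reals"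
  obtains c where "c \<in> k" "moderate_net c"
proof -
  let ?rel = "{(c, d). c \<in> moderate_numbers \<and> d \<in> moderate_numbers \<and> (\<lambda>\<epsilon>. c \<epsilon> - d \<epsilon>) \<in> negligible_numbers}"
  obtain c where c: "c \<in> moderate_numbers" "k = ?rel `` {c}"
    using assms unfolding generalized_reals_def by (rule quotientE)
  have "(\<lambda>\<epsilon>. c \<epsilon> - c \<epsilon>) \<in> negligible_numbers" unfolding negligible_numbers_def by simp
  then have ck: "c \<in> k" using c by simp
  obtain p where "c \<in> O[at_right 0](\<lambda>\<epsilon>. \<epsilon> powr (- p))" using c(1) unfolding moderate_numbers_def by blast
  then obtain C where "\<forall>\<^sub>F \<epsilon> in at_right 0. norm (c \<epsilon>) \<le> C * norm (\<epsilon> powr (- p))" by (elim landau_o.bigE)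
  then have "moderate_net c" unfolding moderate_net_def by auto
  with ck show ?thesis by (rule that)
qed

lemma moderate_nets_mono: "r \<in> moderate_nets \<Omega> \<Longrightarrow> W \<subseteq> \<Omega> \<Longrightarrow> r \<in> moderate_nets W"
  unfolding moderate_nets_def mem_Collect_eq by (metis smooth_on_subset subset_trans)

lemma not_gsupport_negligible:
  fixes r :: "('n::finite, complex) net"
  assumes \<Omega>: "open \<Omega>" and r: "r \<in> moderate_nets \<Omega>" and c: "c \<in> k" "moderate_net c"
    and y: "y \<in> \<Omega>" "y \<notin> gsupport \<Omega> (gminus_const \<Omega> (gclass \<Omega> r) k)"
  obtains d where "d > 0" "cball y d \<subseteq> \<Omega>" "\<And>q. sup_bigo (cball y d) (\<lambda>\<epsilon> x. r \<epsilon> x - of_real (c \<epsilon>)) (\<lambda>\<epsilon>. \<epsilon> powr q)"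
proof -
  define s where "s \<epsilon> x = r \<epsilon> x - of_real (c \<epsilon>)" for \<epsilon> x
  obtain W where W: "open W" "y \<in> W" "W \<subseteq> \<Omega>"
      "grestrict W (gminus_const \<Omega> (gclass \<Omega> r) k) = gclass W (\<lambda>_ _. 0)"
    using y unfolding gsupport_def by blast
  have "(\<lambda>\<epsilon> _. complex_of_real (c \<epsilon>)) \<in> moderate_nets \<Omega>"
    using c(2) by (intro moderate_nets_const[OF \<Omega>]) (simp add: moderate_net_abs)
  then have s: "s \<in> moderate_nets \<Omega>" unfolding s_def[abs_def] by (rule moderate_nets_diff[OF \<Omega> r])
  have "s \<in> gclass \<Omega> s" by (rule mem_gclass_self[OF \<Omega> s])
  then have "s \<in> gminus_const \<Omega> (gclass \<Omega> r) k"
    unfolding gminus_const_def using mem_gclass_self[OF \<Omega> r] c(1) unfolding s_def[abs_def] by blast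
  moreover have "s \<in> gclass W s" by (rule mem_gclass_self[OF W(1) moderate_nets_mono[OF s W(3)]])
  ultimately have "s \<in> gclass W (\<lambda>_ _. 0)" unfolding W(4)[symmetric] grestrict_def by blast
  then have rel: "((\<lambda>_ _. 0), s) \<in> colombeau_rel W" by (simp add: gclass_def)
  obtain d where d: "d > 0" "cball y d \<subseteq> W" using W(1,2) open_contains_cball by metis
  show ?thesis
  proof (rule that[OF d(1)])
    show "sup_bigo (cball y d) (\<lambda>\<epsilon> x. r \<epsilon> x - of_real (c \<epsilon>)) (\<lambda>\<epsilon>. \<epsilon> powr q)" for q
      using colombeau_relD(3)[OF W(1) rel compact_cball d(2), of q] unfolding sup_bigo_def by (simp add: s_def norm_minus_commute)
  qed (use d W in auto)
qed

text \<open>The property covered by compactness is that \<open>r\<^sub>\<epsilon> \<circ> f\<^sub>\<epsilon>\<close> differs from the constant net \<open>c\<^sub>\<epsilon>\<close> by a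
  negligible amount wherever \<open>f\<^sub>\<epsilon>\<close> takes values in \<open>V\<close>, for \<open>x\<close> close to \<open>x0\<close>. Near a point \<open>y\<close> of
  the fibre of \<open>C\<^sub>f\<close> over \<open>x0\<close> this holds because \<open>y\<close> is outside the support of \<open>u - k\<close>; near any other \<open>y\<close> it holds
  vacuously.\<close>

theorem WF_pullback_outside_K_set:
  fixes f :: "('n::finite, real^'m::finite) net" and r :: "('m, complex) net"
  assumes \<Omega>: "open \<Omega>1" "open \<Omega>2" and f: "cbounded_net \<Omega>1 \<Omega>2 f"
    and r: "r \<in> moderate_nets \<Omega>2" and w: "pullback_rep \<Omega>1 f r w"
    and x0: "x0 \<in> \<Omega>1" "x0 \<notin> K_set \<Omega>1 \<Omega>2 f (gclass \<Omega>2 r)"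
  shows "(x0, \<xi>0) \<notin> WF \<Omega>1 (gclass \<Omega>1 w)"
proof -
  obtain k where k: "k \<in> generalized_reals"
      "x0 \<notin> fst ` (gen_graph \<Omega>1 \<Omega>2 f \<inter> (\<Omega>1 \<times> gsupport \<Omega>2 (gminus_const \<Omega>2 (gclass \<Omega>2 r) k)))"
    using x0(2) unfolding K_set_def by blast
  obtain c where c: "c \<in> k" "moderate_net c" by (rule generalized_real_rep[OF k(1)])
  obtain \<rho> where \<rho>: "\<rho> > 0" "cball x0 \<rho> \<subseteq> \<Omega>1" using \<Omega>(1) x0(1) open_contains_cball by metis
  obtain J where J: "compact J" "J \<subseteq> \<Omega>2" "\<forall>\<^sub>F \<epsilon> in at_right 0. \<forall>x\<in>cball x0 \<rho>. f \<epsilon> x \<in> J"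
    by (rule cbounded_netD[OF f compact_cball \<rho>(2)])
  define Q where "Q d V \<longleftrightarrow> (\<forall>q. \<exists>C. \<forall>\<^sub>F \<epsilon> in at_right 0. \<forall>x\<in>ball x0 d \<inter> \<Omega>1. f \<epsilon> x \<in> V \<longrightarrow>
      norm (r \<epsilon> (f \<epsilon> x) - of_real (c \<epsilon>)) \<le> C * \<epsilon> powr q)" for d V
  obtain d W where d: "d > 0" "open W" "J \<subseteq> W" "Q d W"
  proof (rule compact_cover_induct[OF J(1), of Q])
    show "Q d {}" for d unfolding Q_def by simp
    show "Q d' V" if "Q d V" "d' \<le> d" for d d' V
      using that unfolding Q_def by (fast elim!: eventually_mono dest: subsetD[OF subset_ball])
    show "Q d (V \<union> V')" if Q: "Q d V" "Q d V'" for d V V'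
      unfolding Q_def
    proof
      fix q
      obtain C C' where "\<forall>\<^sub>F \<epsilon> in at_right 0. \<forall>x\<in>ball x0 d \<inter> \<Omega>1. f \<epsilon> x \<in> V \<longrightarrow> norm (r \<epsilon> (f \<epsilon> x) - of_real (c \<epsilon>)) \<le> C * \<epsilon> powr q"
        "\<forall>\<^sub>F \<epsilon> in at_right 0. \<forall>x\<in>ball x0 d \<inter> \<Omega>1. f \<epsilon> x \<in> V' \<longrightarrow> norm (r \<epsilon> (f \<epsilon> x) - of_real (c \<epsilon>)) \<le> C' * \<epsilon> powr q"
        using Q unfolding Q_def by blast
      then have "\<forall>\<^sub>F \<epsilon> in at_right 0. \<forall>x\<in>ball x0 d \<inter> \<Omega>1. f \<epsilon> x \<in> V \<union> V' \<longrightarrow> norm (r \<epsilon> (f \<epsilon> x) - of_real (c \<epsilon>)) \<le> max C C' * \<epsilon> powr q"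
      proof eventually_elim
        case (elim \<epsilon>)
        have "C * \<epsilon> powr q \<le> max C C' * \<epsilon> powr q" "C' * \<epsilon> powr q \<le> max C C' * \<epsilon> powr q"
          by (auto intro!: mult_right_mono)
        then show ?case using elim by fastforce
      qed
      then show "\<exists>C. \<forall>\<^sub>F \<epsilon> in at_right 0. \<forall>x\<in>ball x0 d \<inter> \<Omega>1. f \<epsilon> x \<in> V \<union> V' \<longrightarrow> norm (r \<epsilon> (f \<epsilon> x) - of_real (c \<epsilon>)) \<le> C * \<epsilon> powr q" by blast
    qed
    show "\<exists>d>0. Q d (ball y d)" if y: "y \<in> J" for y
    proof (cases "(x0, y) \<in> gen_graph \<Omega>1 \<Omega>2 f")
      case True
      then have ns: "y \<notin> gsupport \<Omega>2 (gminus_const \<Omega>2 (gclass \<Omega>2 r) k)" using k(2) x0(1) by force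
      have "y \<in> \<Omega>2" using y J(2) by blast
      then obtain d where d: "d > 0" "\<And>q. sup_bigo (cball y d) (\<lambda>\<epsilon> x. r \<epsilon> x - of_real (c \<epsilon>)) (\<lambda>\<epsilon>. \<epsilon> powr q)"
        by (rule not_gsupport_negligible[OF \<Omega>(2) r c _ ns]) blast
      have "Q d (ball y d)" unfolding Q_def
      proof
        fix q
        obtain C where "\<forall>\<^sub>F \<epsilon> in at_right 0. \<forall>z\<in>cball y d. norm (r \<epsilon> z - of_real (c \<epsilon>)) \<le> C * \<epsilon> powr q"
          using d(2) unfolding sup_bigo_def by blast
        then have "\<forall>\<^sub>F \<epsilon> in at_right 0. \<forall>x\<in>ball x0 d \<inter> \<Omega>1. f \<epsilon> x \<in> ball y d \<longrightarrow> norm (r \<epsilon> (f \<epsilon> x) - of_real (c \<epsilon>)) \<le> C * \<epsilon> powr q"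
          by eventually_elim auto
        then show "\<exists>C. \<forall>\<^sub>F \<epsilon> in at_right 0. \<forall>x\<in>ball x0 d \<inter> \<Omega>1. f \<epsilon> x \<in> ball y d \<longrightarrow> norm (r \<epsilon> (f \<epsilon> x) - of_real (c \<epsilon>)) \<le> C * \<epsilon> powr q" by blast
      qed
      with d(1) show ?thesis by blast
    next
      case False
      have "y \<in> \<Omega>2" using y J(2) by blast
      obtain d where d: "d > 0" "\<forall>\<^sub>F \<epsilon> in at_right 0. \<forall>x'\<in>\<Omega>1. dist x' x0 < d \<longrightarrow> \<not> dist (f \<epsilon> x') y < d"
        by (rule gen_graph_separation[OF x0(1) \<open>y \<in> \<Omega>2\<close> False])
      have "\<forall>\<^sub>F \<epsilon> in at_right 0. \<forall>x\<in>ball x0 d \<inter> \<Omega>1. f \<epsilon> x \<notin> ball y d"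
        using d(2) by eventually_elim (auto simp: dist_commute)
      then have "\<forall>\<^sub>F \<epsilon> in at_right 0. \<forall>x\<in>ball x0 d \<inter> \<Omega>1. f \<epsilon> x \<in> ball y d \<longrightarrow>
          norm (r \<epsilon> (f \<epsilon> x) - of_real (c \<epsilon>)) \<le> 0 * \<epsilon> powr q" for q
        by eventually_elim blast
      then have "Q d (ball y d)" unfolding Q_def by blast
      with d(1) show ?thesis by blast
    qed
  qed
  define e where "e = min \<rho> d / 2"
  have e: "e > 0" "cball x0 e \<subseteq> ball x0 d \<inter> \<Omega>1" "cball x0 e \<subseteq> cball x0 \<rho>"
    using \<rho> d(1) by (auto simp: e_def subset_eq)
  have near: "\<exists>C. \<forall>\<^sub>F \<epsilon> in at_right 0. \<forall>x\<in>cball x0 e. norm (w \<epsilon> x - of_real (c \<epsilon>)) \<le> C * \<epsilon> powr q" for q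
  proof -
    obtain C where "\<forall>\<^sub>F \<epsilon> in at_right 0. \<forall>x\<in>ball x0 d \<inter> \<Omega>1. f \<epsilon> x \<in> W \<longrightarrow> norm (r \<epsilon> (f \<epsilon> x) - of_real (c \<epsilon>)) \<le> C * \<epsilon> powr q"
      using d(4) unfolding Q_def by blast
    moreover have "\<forall>\<^sub>F \<epsilon> in at_right 0. \<forall>x\<in>cball x0 e. w \<epsilon> x = r \<epsilon> (f \<epsilon> x)"
      using w e(2) unfolding pullback_rep_def by auto
    ultimately have "\<forall>\<^sub>F \<epsilon> in at_right 0. \<forall>x\<in>cball x0 e. norm (w \<epsilon> x - of_real (c \<epsilon>)) \<le> C * \<epsilon> powr q"
      using J(3)
    proof eventually_elim
      case (elim \<epsilon>)
      show ?case
      proof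
        fix x assume x: "x \<in> cball x0 e"
        then have "f \<epsilon> x \<in> W" "x \<in> ball x0 d \<inter> \<Omega>1" using elim(3) d(3) e by blast+
        then show "norm (w \<epsilon> x - of_real (c \<epsilon>)) \<le> C * \<epsilon> powr q" using elim(1,2) x by simp
      qed
    qed
    then show ?thesis by blast
  qed
  define \<phi> where "\<phi> x = complex_of_real (bump x0 e x)" for x
  have \<phi>: "\<phi> \<in> test_functions \<Omega>1" unfolding \<phi>_def[abs_def] using e by (intro bump_test_function) auto
  have \<phi>0: "\<phi> x = 0" if "x \<notin> cball x0 e" for x
    using that bump_pos_iff[OF e(1), of x0 x] bump_nonneg[of x0 e x] by (auto simp: \<phi>_def less_eq_real_def)
  have s\<phi>: "smooth_on \<Omega>1 \<phi>" using \<phi> by (auto simp: test_functions_def intro: smooth_on_subset)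
  have wm: "w \<in> moderate_nets \<Omega>1" using w by (simp add: pullback_rep_def)
  have cm: "(\<lambda>\<epsilon> _. complex_of_real (c \<epsilon>)) \<in> moderate_nets \<Omega>1"
    using c(2) by (intro moderate_nets_const[OF \<Omega>(1)]) (simp add: moderate_net_abs)
  define v where "v \<epsilon> x = \<phi> x * complex_of_real (c \<epsilon>)" for \<epsilon> x
  have "continuous_on UNIV \<phi>"
    using \<phi> smooth_on_continuous[of UNIV \<phi> "[]"] by (simp add: test_functions_def)
  then have "bounded (\<phi> ` cball x0 e)" by (intro compact_imp_bounded compact_continuous_image) (auto intro: continuous_on_subset)
  then obtain B where "\<forall>x\<in>cball x0 e. norm (\<phi> x) \<le> B" unfolding bounded_iff ball_simps by blast
  then have B: "norm (\<phi> x) \<le> B" if "x \<in> cball x0 e" for x using that by blast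
  have "((\<lambda>\<epsilon> x. \<phi> x * w \<epsilon> x), v) \<in> colombeau_rel \<Omega>1"
  proof (rule colombeau_relI[OF \<Omega>(1) moderate_nets_mult_fixed[OF \<Omega>(1) s\<phi> wm]])
    show "v \<in> moderate_nets \<Omega>1" unfolding v_def[abs_def] by (rule moderate_nets_mult_fixed[OF \<Omega>(1) s\<phi> cm])
    fix K q
    obtain C where C: "\<forall>\<^sub>F \<epsilon> in at_right 0. \<forall>x\<in>cball x0 e. norm (w \<epsilon> x - of_real (c \<epsilon>)) \<le> C * \<epsilon> powr q" using near by blast
    then have "\<forall>\<^sub>F \<epsilon> in at_right 0. \<forall>x\<in>K. norm (\<phi> x * w \<epsilon> x - v \<epsilon> x) \<le> (\<bar>B\<bar> * \<bar>C\<bar>) * \<epsilon> powr q"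
    proof eventually_elim
      case (elim \<epsilon>)
      show ?case
      proof
        fix x
        show "norm (\<phi> x * w \<epsilon> x - v \<epsilon> x) \<le> (\<bar>B\<bar> * \<bar>C\<bar>) * \<epsilon> powr q"
        proof (cases "x \<in> cball x0 e")
          case True
          have "norm (\<phi> x * w \<epsilon> x - v \<epsilon> x) = norm (\<phi> x) * norm (w \<epsilon> x - of_real (c \<epsilon>))"
            by (simp add: v_def norm_mult[symmetric] right_diff_distrib)
          also have "\<dots> \<le> \<bar>B\<bar> * (C * \<epsilon> powr q)" using elim True B[OF True] by (intro mult_mono) auto
          also have "\<dots> \<le> \<bar>B\<bar> * (\<bar>C\<bar> * \<epsilon> powr q)" by (intro mult_left_mono mult_right_mono) auto
          finally show ?thesis by simp
        qed (simp add: \<phi>0 v_def)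
      qed
    qed
    then show "sup_bigo K (\<lambda>\<epsilon> x. \<phi> x * w \<epsilon> x - v \<epsilon> x) (\<lambda>\<epsilon>. \<epsilon> powr q)" unfolding sup_bigo_def by blast
  qed
  then have v: "v \<in> gmult \<Omega>1 \<phi> (gclass \<Omega>1 w)"
    unfolding gmult_eq_gclass[OF \<Omega>(1) s\<phi> wm] by (simp add: gclass_def)
  show ?thesis
  proof (rule not_in_WF[OF \<phi> _ zero_less_one v])
    show "\<phi> x0 \<noteq> 0" using bump_pos_iff[OF e(1), of x0 x0] e(1) by (simp add: \<phi>_def)
    show "joint_compact_support \<Omega>1 v"
      unfolding joint_compact_support_def using e \<phi>0 by (intro exI[of _ "cball x0 e"]) (auto simp: v_def)
    show "v \<epsilon> x = 0" if "x \<notin> \<Omega>1" for \<epsilon> x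
    proof -
      have "x \<notin> cball x0 e" using that e(2) by blast
      from \<phi>0[OF this] show ?thesis by (simp add: v_def)
    qed
    have "rapid_on v (sphere 0 1)"
      unfolding v_def[abs_def] using c(2)
      by (intro rapid_on_constant_net test_functions_mono[OF \<phi>]) (auto simp: moderate_net_abs)
    then show "rapid_on v (sphere 0 1 \<inter> ball \<xi>0 1)" by (rule rapid_on_subset) simp
  qed
qed

section \<open>Propagation of regularity through the pullback\<close>

lemma tame_net_subset:
  assumes P: "net_class P" and X: "\<forall>\<^sub>F \<epsilon> in at_right 0. open (X \<epsilon>)" "\<forall>\<^sub>F \<epsilon> in at_right 0. open (Y \<epsilon>)"
    and sub: "\<forall>\<^sub>F \<epsilon> in at_right 0. Y \<epsilon> \<subseteq> X \<epsilon>" and a: "tame_net P X a"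
  shows "tame_net P Y a"
  unfolding tame_net_iff[OF P X(2)]
proof (intro allI conjI)
  fix \<alpha>
  obtain r where r: "P r" "\<forall>\<^sub>F \<epsilon> in at_right 0. \<forall>x\<in>X \<epsilon>. norm (partial_derivs \<alpha> (a \<epsilon>) x) \<le> r \<epsilon>"
    and d: "\<forall>\<^sub>F \<epsilon> in at_right 0. \<forall>x\<in>X \<epsilon>. partial_derivs \<alpha> (a \<epsilon>) differentiable (at x)"
    using a[unfolded tame_net_iff[OF P X(1)]] by blast
  have "\<forall>\<^sub>F \<epsilon> in at_right 0. \<forall>x\<in>Y \<epsilon>. norm (partial_derivs \<alpha> (a \<epsilon>) x) \<le> r \<epsilon>"
    using r(2) sub by eventually_elim blast
  with r(1) show "\<exists>r. P r \<and> (\<forall>\<^sub>F \<epsilon> in at_right 0. \<forall>x\<in>Y \<epsilon>. norm (partial_derivs \<alpha> (a \<epsilon>) x) \<le> r \<epsilon>)" by blast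
  show "\<forall>\<^sub>F \<epsilon> in at_right 0. \<forall>x\<in>Y \<epsilon>. partial_derivs \<alpha> (a \<epsilon>) differentiable (at x)"
    using d sub by eventually_elim blast
qed

text \<open>\<open>noncharacteristic\<close>: over the points where \<open>f\<^sub>\<epsilon>\<close> is close to \<open>y\<close>, the phase
  \<open>f\<^sub>\<epsilon>(x) \<bullet> \<eta> - x \<bullet> \<zeta>\<close> has no stationary point for \<open>\<eta>\<close> in the cone over \<open>V\<close> and \<open>\<zeta>\<close> in a cone around \<open>\<xi>0\<close>.\<close>

definition noncharacteristic :: "(real^'n::finite) set \<Rightarrow> ('n, real^'m::finite) net \<Rightarrow> real^'n \<Rightarrow> real^'n \<Rightarrow>
    real^'m \<Rightarrow> real \<Rightarrow> real \<Rightarrow> (real^'m) set \<Rightarrow> bool" where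
  "noncharacteristic \<Omega>1 f x0 \<xi>0 y \<delta> d V \<longleftrightarrow> (\<exists>\<tau>. slow_net \<tau> \<and> (\<forall>\<^sub>F \<epsilon> in at_right 0.
     \<forall>x\<in>ball x0 d \<inter> \<Omega>1. f \<epsilon> x \<in> ball y \<delta> \<longrightarrow> (\<forall>\<eta>\<in>V \<inter> sphere 0 1. \<forall>\<xi>\<in>sphere 0 1 \<inter> ball \<xi>0 d.
       \<forall>s\<ge>0. \<forall>t\<ge>0. s + t \<le> \<tau> \<epsilon> * norm (s *\<^sub>R transp_jacobian f \<epsilon> x \<eta> - t *\<^sub>R \<xi>))))"

lemma noncharacteristic_mono:
  assumes "noncharacteristic \<Omega>1 f x0 \<xi>0 y \<delta> d V" "\<delta>' \<le> \<delta>" "d' \<le> d"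
  shows "noncharacteristic \<Omega>1 f x0 \<xi>0 y \<delta>' d' V"
proof -
  have b: "ball x0 d' \<subseteq> ball x0 d" "ball \<xi>0 d' \<subseteq> ball \<xi>0 d" "ball y \<delta>' \<subseteq> ball y \<delta>"
    using assms(2,3) by (simp_all add: subset_ball)
  obtain \<tau> where \<tau>: "slow_net \<tau>" "\<forall>\<^sub>F \<epsilon> in at_right 0.
     \<forall>x\<in>ball x0 d \<inter> \<Omega>1. f \<epsilon> x \<in> ball y \<delta> \<longrightarrow> (\<forall>\<eta>\<in>V \<inter> sphere 0 1. \<forall>\<xi>\<in>sphere 0 1 \<inter> ball \<xi>0 d.
       \<forall>s\<ge>0. \<forall>t\<ge>0. s + t \<le> \<tau> \<epsilon> * norm (s *\<^sub>R transp_jacobian f \<epsilon> x \<eta> - t *\<^sub>R \<xi>))"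
    using assms(1) unfolding noncharacteristic_def by blast
  have "\<forall>\<^sub>F \<epsilon> in at_right 0.
     \<forall>x\<in>ball x0 d' \<inter> \<Omega>1. f \<epsilon> x \<in> ball y \<delta>' \<longrightarrow> (\<forall>\<eta>\<in>V \<inter> sphere 0 1. \<forall>\<xi>\<in>sphere 0 1 \<inter> ball \<xi>0 d'.
       \<forall>s\<ge>0. \<forall>t\<ge>0. s + t \<le> \<tau> \<epsilon> * norm (s *\<^sub>R transp_jacobian f \<epsilon> x \<eta> - t *\<^sub>R \<xi>))"
    using \<tau>(2) by eventually_elim (use b in blast)
  with \<tau>(1) show ?thesis unfolding noncharacteristic_def by blast
qed

lemma noncharacteristic_Un:
  assumes "noncharacteristic \<Omega>1 f x0 \<xi>0 y \<delta> d V" "noncharacteristic \<Omega>1 f x0 \<xi>0 y \<delta> d V'"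
  shows "noncharacteristic \<Omega>1 f x0 \<xi>0 y \<delta> d (V \<union> V')"
proof -
  obtain \<tau> where \<tau>: "slow_net \<tau>" "\<forall>\<^sub>F \<epsilon> in at_right 0.
     \<forall>x\<in>ball x0 d \<inter> \<Omega>1. f \<epsilon> x \<in> ball y \<delta> \<longrightarrow> (\<forall>\<eta>\<in>V \<inter> sphere 0 1. \<forall>\<xi>\<in>sphere 0 1 \<inter> ball \<xi>0 d.
       \<forall>s\<ge>0. \<forall>t\<ge>0. s + t \<le> \<tau> \<epsilon> * norm (s *\<^sub>R transp_jacobian f \<epsilon> x \<eta> - t *\<^sub>R \<xi>))"
    using assms(1) unfolding noncharacteristic_def by blast
  obtain \<tau>' where \<tau>': "slow_net \<tau>'" "\<forall>\<^sub>F \<epsilon> in at_right 0.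
     \<forall>x\<in>ball x0 d \<inter> \<Omega>1. f \<epsilon> x \<in> ball y \<delta> \<longrightarrow> (\<forall>\<eta>\<in>V' \<inter> sphere 0 1. \<forall>\<xi>\<in>sphere 0 1 \<inter> ball \<xi>0 d.
       \<forall>s\<ge>0. \<forall>t\<ge>0. s + t \<le> \<tau>' \<epsilon> * norm (s *\<^sub>R transp_jacobian f \<epsilon> x \<eta> - t *\<^sub>R \<xi>))"
    using assms(2) unfolding noncharacteristic_def by blast
  have "\<forall>\<^sub>F \<epsilon> in at_right 0.
     \<forall>x\<in>ball x0 d \<inter> \<Omega>1. f \<epsilon> x \<in> ball y \<delta> \<longrightarrow> (\<forall>\<eta>\<in>(V \<union> V') \<inter> sphere 0 1. \<forall>\<xi>\<in>sphere 0 1 \<inter> ball \<xi>0 d.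
       \<forall>s\<ge>0. \<forall>t\<ge>0. s + t \<le> (\<bar>\<tau> \<epsilon>\<bar> + \<bar>\<tau>' \<epsilon>\<bar>) * norm (s *\<^sub>R transp_jacobian f \<epsilon> x \<eta> - t *\<^sub>R \<xi>))"
    using \<tau>(2) \<tau>'(2)
  proof eventually_elim
    case (elim \<epsilon>)
    show ?case
    proof (intro ballI allI impI)
      fix x \<eta> \<xi> and s t :: real
      assume a: "x \<in> ball x0 d \<inter> \<Omega>1" "f \<epsilon> x \<in> ball y \<delta>" "\<eta> \<in> (V \<union> V') \<inter> sphere 0 1" "\<xi> \<in> sphere 0 1 \<inter> ball \<xi>0 d" "0 \<le> s" "0 \<le> t"
      let ?n = "norm (s *\<^sub>R transp_jacobian f \<epsilon> x \<eta> - t *\<^sub>R \<xi>)"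
      have "s + t \<le> \<tau> \<epsilon> * ?n \<or> s + t \<le> \<tau>' \<epsilon> * ?n" using elim a by blast
      moreover have "\<tau> \<epsilon> * ?n \<le> (\<bar>\<tau> \<epsilon>\<bar> + \<bar>\<tau>' \<epsilon>\<bar>) * ?n" "\<tau>' \<epsilon> * ?n \<le> (\<bar>\<tau> \<epsilon>\<bar> + \<bar>\<tau>' \<epsilon>\<bar>) * ?n"
        by (intro mult_right_mono; simp)+
      ultimately show "s + t \<le> (\<bar>\<tau> \<epsilon>\<bar> + \<bar>\<tau>' \<epsilon>\<bar>) * ?n" by linarith
    qed
  qed
  moreover have "slow_net (\<lambda>\<epsilon>. \<bar>\<tau> \<epsilon>\<bar> + \<bar>\<tau>' \<epsilon>\<bar>)" by (intro net_classD[OF net_class_slow] \<tau>(1) \<tau>'(1))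
  ultimately show ?thesis unfolding noncharacteristic_def by blast
qed

lemma noncharacteristic_empty: "noncharacteristic \<Omega>1 f x0 \<xi>0 y \<delta> d {}"
  unfolding noncharacteristic_def using slow_net_const by (intro exI[of _ "\<lambda>_. 0"]) simp

text \<open>The separation from the graph of \<open>\<Phi>\<^sub>f\<close> keeps the unit vector along \<open>df\<^sub>\<epsilon>(x)\<^sup>T \<eta>\<close> away from \<open>\<xi>0\<close>, so
  that \<open>angle_bound\<close> applies to \<open>s df\<^sub>\<epsilon>(x)\<^sup>T \<eta> - t \<xi>\<close>; the net \<open>\<sigma>\<close> from the definition of \<open>D\<^sub>f\<close>
  compares \<open>s |df\<^sub>\<epsilon>(x)\<^sup>T \<eta>|\<close> with \<open>s\<close>.\<close>

lemma noncharacteristic_direction: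
  fixes f :: "('n::finite, real^'m::finite) net"
  assumes D: "(x0, \<eta>0) \<in> D_set \<Omega>1 f" and y: "y \<in> \<Omega>2" and \<xi>0: "\<xi>0 \<in> sphere 0 1"
    and notin: "((x0, \<eta>0), (y, \<xi>0)) \<notin> gen_graph (D_set \<Omega>1 f) (\<Omega>2 \<times> sphere 0 1) (Phi_net f)"
  shows "\<exists>d>0. noncharacteristic \<Omega>1 f x0 \<xi>0 y d d (ball \<eta>0 d)"
proof -
  obtain X V \<sigma> e where X: "open X" "X \<subseteq> \<Omega>1" "x0 \<in> X" and V: "openin (top_of_set (sphere 0 1)) V" "\<eta>0 \<in> V"
    and \<sigma>: "slow_scale \<sigma>" "\<forall>\<epsilon>\<in>{0<..1}. \<sigma> \<epsilon> > 0" and e: "e \<in> {0<..1}"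
    and bound: "\<forall>\<epsilon>. 0 < \<epsilon> \<and> \<epsilon> < e \<longrightarrow> (\<forall>x\<in>X. \<forall>\<eta>\<in>V. norm (\<sigma> \<epsilon> *\<^sub>R transp_jacobian f \<epsilon> x \<eta>) \<ge> 1) \<and>
           (\<forall>x\<in>X. \<forall>\<eta>\<in>perp_dirs V. norm (\<sigma> \<epsilon> *\<^sub>R transp_jacobian f \<epsilon> x \<eta>) \<le> 1)"
    by (insert D[unfolded D_set_def mem_Collect_eq prod.case], elim conjE exE bexE, rule that) assumption+
  have XV: "(x, \<eta>) \<in> D_set \<Omega>1 f" if "x \<in> X" "\<eta> \<in> V" for x \<eta>
  proof -
    have "x \<in> \<Omega>1" "\<eta> \<in> sphere 0 1" using that X(2) openin_imp_subset[OF V(1)] by blast+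
    moreover have "\<exists>\<epsilon>'\<in>{0<..1}. \<forall>\<epsilon>. 0 < \<epsilon> \<and> \<epsilon> < \<epsilon>' \<longrightarrow>
           (\<forall>x\<in>X. \<forall>\<eta>\<in>V. norm (\<sigma> \<epsilon> *\<^sub>R transp_jacobian f \<epsilon> x \<eta>) \<ge> 1) \<and>
           (\<forall>x\<in>X. \<forall>\<eta>\<in>perp_dirs V. norm (\<sigma> \<epsilon> *\<^sub>R transp_jacobian f \<epsilon> x \<eta>) \<le> 1)"
      using bound by (intro bexI[of _ e] e)
    ultimately show ?thesis
      unfolding D_set_def mem_Collect_eq prod.case
      by (intro conjI exI[of _ X] exI[of _ V] exI[of _ \<sigma>] X(1,2) V(1) \<sigma> that)
  qed
  obtain d1 where d1: "d1 > 0" "\<forall>\<^sub>F \<epsilon> in at_right 0. \<forall>p\<in>D_set \<Omega>1 f. dist p (x0, \<eta>0) < d1 \<longrightarrow> \<not> dist (Phi_net f \<epsilon> p) (y, \<xi>0) < d1"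
    by (rule gen_graph_separation[OF D _ notin]) (use y \<xi>0 in auto)
  obtain d2 where d2: "d2 > 0" "ball x0 d2 \<subseteq> X" using X open_contains_ball by metis
  obtain d3 where d3: "d3 > 0" "ball \<eta>0 d3 \<inter> sphere 0 1 \<subseteq> V" using V unfolding openin_contains_ball by blast
  \<comment> \<open>a quarter of \<open>d1\<close>: the variations of \<open>f \<epsilon> x\<close> and \<open>\<xi>\<close> together use up at most half of the separation\<close>
  define d where "d = min (min d2 d3) (d1 / 4)"
  have d: "d > 0" "d \<le> d2" "d \<le> d3" "d \<le> d1 / 4" using d1(1) d2(1) d3(1) by (auto simp: d_def)
  \<comment> \<open>\<open>4 / d1\<close> comes from \<open>angle_bound\<close>; \<open>\<sigma> + 1\<close> covers the coefficients of \<open>s\<close> and of \<open>t\<close>\<close>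
  define \<tau> where "\<tau> \<epsilon> = (\<sigma> \<epsilon> + 1) * (4 / d1)" for \<epsilon>
  have small: "\<forall>\<^sub>F \<epsilon> in at_right 0. 0 < \<epsilon> \<and> \<epsilon> < e" unfolding eventually_at_right_field using e by auto
  have "\<forall>\<^sub>F \<epsilon> in at_right 0. \<forall>x\<in>ball x0 d \<inter> \<Omega>1. f \<epsilon> x \<in> ball y d \<longrightarrow> (\<forall>\<eta>\<in>ball \<eta>0 d \<inter> sphere 0 1. \<forall>\<xi>\<in>sphere 0 1 \<inter> ball \<xi>0 d.
       \<forall>s\<ge>0. \<forall>t\<ge>0. s + t \<le> \<tau> \<epsilon> * norm (s *\<^sub>R transp_jacobian f \<epsilon> x \<eta> - t *\<^sub>R \<xi>))"
    using d1(2) small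
  proof eventually_elim
    case (elim \<epsilon>)
    show ?case
    proof (intro ballI allI impI)
      fix x \<eta> \<xi> and s t :: real
      assume x: "x \<in> ball x0 d \<inter> \<Omega>1" and fx: "f \<epsilon> x \<in> ball y d" and \<eta>: "\<eta> \<in> ball \<eta>0 d \<inter> sphere 0 1"
        and \<xi>: "\<xi> \<in> sphere 0 1 \<inter> ball \<xi>0 d" and s: "0 \<le> s" and t: "0 \<le> t"
      define v where "v = transp_jacobian f \<epsilon> x \<eta>"
      define n where "n = norm v"
      have xX: "x \<in> X" using x d2(2) d(2) by auto
      have \<eta>V: "\<eta> \<in> V" using \<eta> d3(2) d(3) by auto
      have \<sigma>0: "\<sigma> \<epsilon> > 0" using \<sigma>(2) elim(2) e by auto
      have "norm (\<sigma> \<epsilon> *\<^sub>R v) \<ge> 1" using bound elim(2) xX \<eta>V unfolding v_def by blast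
      then have n: "\<sigma> \<epsilon> * n \<ge> 1" using \<sigma>0 by (simp add: n_def)
      then have n0: "n > 0" using \<sigma>0 by (smt (verit) mult_nonneg_nonpos)
      have Phi: "Phi_net f \<epsilon> (x, \<eta>) = (f \<epsilon> x, v /\<^sub>R n)" by (simp add: Phi_net_def v_def n_def)
      have "dist (x, \<eta>) (x0, \<eta>0) \<le> dist x x0 + dist \<eta> \<eta>0"
        unfolding dist_Pair_Pair by (rule sqrt_sum_squares_le_sum) auto
      also have "\<dots> < d1" using x \<eta> d(4) d1(1) by (simp add: dist_commute)
      finally have "\<not> dist (Phi_net f \<epsilon> (x, \<eta>)) (y, \<xi>0) < d1" using elim(1) XV[OF xX \<eta>V] by blast
      moreover have "dist (f \<epsilon> x, v /\<^sub>R n) (y, \<xi>0) \<le> dist (f \<epsilon> x) y + dist (v /\<^sub>R n) \<xi>0"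
        unfolding dist_Pair_Pair by (rule sqrt_sum_squares_le_sum) auto
      ultimately have "d1 \<le> dist (f \<epsilon> x) y + dist (v /\<^sub>R n) \<xi>0" by (simp add: Phi)
      moreover have "dist (v /\<^sub>R n) \<xi>0 \<le> norm (v /\<^sub>R n - \<xi>) + dist \<xi> \<xi>0"
        using dist_triangle[of "v /\<^sub>R n" \<xi>0 \<xi>] by (simp add: dist_norm)
      moreover have "dist (f \<epsilon> x) y < d" "dist \<xi> \<xi>0 < d" using fx \<xi> by (auto simp: dist_commute)
      ultimately have "d1 / 2 \<le> norm (v /\<^sub>R n - \<xi>)" using d(4) by linarith
      then have "(d1 / 2 / 2) * (s * n + t) \<le> norm ((s * n) *\<^sub>R (v /\<^sub>R n) - t *\<^sub>R \<xi>)"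
        using d1(1) s t n0 \<xi> by (intro angle_bound) (auto simp: n_def)
      also have "(s * n) *\<^sub>R (v /\<^sub>R n) = s *\<^sub>R v" using n0 by simp
      finally have "s * n + t \<le> (4 / d1) * norm (s *\<^sub>R v - t *\<^sub>R \<xi>)" using d1(1) by (simp add: field_simps)
      then have "(\<sigma> \<epsilon> + 1) * (s * n + t) \<le> (\<sigma> \<epsilon> + 1) * ((4 / d1) * norm (s *\<^sub>R v - t *\<^sub>R \<xi>))"
        using \<sigma>0 by (intro mult_left_mono) auto
      moreover have "s + t \<le> (\<sigma> \<epsilon> + 1) * (s * n + t)"
      proof -
        have "s * 1 \<le> s * (\<sigma> \<epsilon> * n)" using n s by (rule mult_left_mono)
        moreover have "0 \<le> s * n" "0 \<le> \<sigma> \<epsilon> * t" using s t n0 \<sigma>0 by simp_all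
        ultimately show ?thesis by (simp add: algebra_simps)
      qed
      ultimately have "s + t \<le> (\<sigma> \<epsilon> + 1) * ((4 / d1) * norm (s *\<^sub>R v - t *\<^sub>R \<xi>))" by linarith
      then show "s + t \<le> \<tau> \<epsilon> * norm (s *\<^sub>R transp_jacobian f \<epsilon> x \<eta> - t *\<^sub>R \<xi>)"
        by (simp only: \<tau>_def v_def mult.assoc)
    qed
  qed
  moreover have "slow_net \<tau>"
    unfolding \<tau>_def[abs_def] by (intro net_classD[OF net_class_slow] slow_scale_slow_net \<sigma>(1))
  ultimately show ?thesis unfolding noncharacteristic_def using d(1) by blast
qed

text \<open>The fibre is closed in the sphere, as the set of regular directions is open by definition.\<close>

lemma WF_fibre_compact: "compact {\<eta>. (y, \<eta>) \<in> WF \<Omega> u}" for u :: "('m::finite, complex) net set"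
proof (cases "y \<in> \<Omega>")
  case True
  have "closedin (top_of_set (sphere 0 1)) {\<eta>. (y, \<eta>) \<in> WF \<Omega> u}"
    unfolding closedin_def
  proof (intro conjI)
    show "{\<eta>. (y, \<eta>) \<in> WF \<Omega> u} \<subseteq> topspace (top_of_set (sphere 0 1))" by (auto simp: WF_def)
    show "openin (top_of_set (sphere 0 1)) (topspace (top_of_set (sphere 0 1)) - {\<eta>. (y, \<eta>) \<in> WF \<Omega> u})"
    proof (subst openin_subopen, intro ballI)
      fix \<eta> assume "\<eta> \<in> topspace (top_of_set (sphere 0 1)) - {\<eta>. (y, \<eta>) \<in> WF \<Omega> u}"
      then have \<eta>: "\<eta> \<in> sphere 0 1" "\<eta> \<notin> Sigma_at \<Omega> u y" using True by (auto simp: WF_def)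
      then obtain \<phi> \<Gamma> where \<phi>: "\<phi> \<in> test_functions \<Omega>" "\<phi> y \<noteq> 0"
        and \<Gamma>: "openin (top_of_set (sphere 0 1)) \<Gamma>" "\<eta> \<in> \<Gamma>" "rapidly_decreasing \<Gamma> (fourier_nets \<Omega> (gmult \<Omega> \<phi> u))"
        unfolding Sigma_at_def Sigma_dirs_def by auto
      have "\<eta>' \<notin> Sigma_at \<Omega> u y" if "\<eta>' \<in> \<Gamma>" for \<eta>'
      proof -
        have "\<eta>' \<notin> Sigma_dirs \<Omega> (gmult \<Omega> \<phi> u)" using \<Gamma> that unfolding Sigma_dirs_def by blast
        then show ?thesis using \<phi> unfolding Sigma_at_def by blast
      qed
      then have "\<Gamma> \<subseteq> topspace (top_of_set (sphere 0 1)) - {\<eta>. (y, \<eta>) \<in> WF \<Omega> u}"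
        using openin_imp_subset[OF \<Gamma>(1)] by (auto simp: WF_def)
      with \<Gamma> show "\<exists>T. openin (top_of_set (sphere 0 1)) T \<and> \<eta> \<in> T \<and> T \<subseteq> topspace (top_of_set (sphere 0 1)) - {\<eta>. (y, \<eta>) \<in> WF \<Omega> u}" by blast
    qed
  qed
  then show ?thesis using closedin_compact[OF compact_sphere] by blast
next
  case False
  then have "{\<eta>. (y, \<eta>) \<in> WF \<Omega> u} = {}" by (auto simp: WF_def)
  then show ?thesis by simp
qed

text \<open>The microlocal estimate for one cut-off. The domain of integration is the set of \<open>x\<close> for
  which \<open>f\<^sub>\<epsilon>(x)\<close> lies in the ball where \<open>\<psi>\<close> lives; this is where \<open>microlocal_estimate\<close> is
  needed for domains that vary with \<open>\<epsilon>\<close>. For a frequency \<open>\<eta>\<close> there are three cases: \<open>|\<eta>|\<close> is small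
  compared with \<open>|\<zeta>|\<close>, its direction is in \<open>V\<close>, or its direction is outside \<open>V\<close>.\<close>

lemma microlocal_piece:
  fixes f :: "('n::finite, real^'m::finite) net" and r :: "('m, complex) net" and a :: "real \<Rightarrow> real^'n \<Rightarrow> complex"
  assumes \<Omega>2: "open \<Omega>2" and r: "r \<in> moderate_nets \<Omega>2"
    and f: "tame_net slow_net (\<lambda>_. ball x0 d) f" and d: "0 < d" "ball x0 d \<subseteq> \<Omega>1"
    and a: "tame_net slow_net (\<lambda>_. ball x0 d) a" "\<And>\<epsilon> x. x \<notin> cball x0 (d / 2) \<Longrightarrow> a \<epsilon> x = 0"
    and \<psi>: "\<psi> \<in> test_functions (\<Omega>2 \<inter> ball y \<delta>)" "rapid_on (\<lambda>\<epsilon> z. \<psi> z * r \<epsilon> z) (sphere 0 1 - V)"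
    and a\<psi>: "\<And>\<epsilon> x. \<psi> (f \<epsilon> x) = 0 \<Longrightarrow> a \<epsilon> x = 0"
    and nc: "noncharacteristic \<Omega>1 f x0 \<xi>0 y \<delta> d V"
  shows "rapid_on (\<lambda>\<epsilon> x. indicator (ball x0 d) x *\<^sub>R (a \<epsilon> x * (\<psi> (f \<epsilon> x) * r \<epsilon> (f \<epsilon> x)))) (sphere 0 1 \<inter> ball \<xi>0 d)"
    and "\<forall>\<^sub>F \<epsilon> in at_right 0. integrable lborel (\<lambda>x. indicator (ball x0 d) x *\<^sub>R (a \<epsilon> x * (\<psi> (f \<epsilon> x) * r \<epsilon> (f \<epsilon> x))))"
proof -
  let ?B = "ball x0 d"
  define w where "w \<epsilon> z = \<psi> z * r \<epsilon> z" for \<epsilon> z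
  interpret B: gauge "at_right 0" "\<lambda>_. ?B" "net_gauges slow_net (\<lambda>\<epsilon>. \<epsilon>)"
    by (rule gauge_net[OF net_class_slow]) simp
  obtain L where L: "compact L" "L \<subseteq> \<Omega>2 \<inter> ball y \<delta>" "\<And>z. z \<notin> L \<Longrightarrow> \<psi> z = 0" "smooth_on UNIV \<psi>"
    by (rule test_functionsD[OF \<psi>(1)], rule that) assumption+
  have \<psi>2: "\<psi> \<in> test_functions \<Omega>2" by (rule test_functions_mono[OF \<psi>(1)]) simp
  have w: "test_net w" unfolding w_def[abs_def] by (rule test_net_moderate[OF \<Omega>2 \<psi>2 r])
  have fc: "\<forall>\<^sub>F \<epsilon> in at_right 0. continuous_on ?B (f \<epsilon>) \<and> continuous_on ?B (a \<epsilon>)"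
    using B.tame_evdiff[OF f] B.tame_evdiff[OF a(1)] unfolding B.evdiff_def
    by eventually_elim (meson differentiable_imp_continuous_within continuous_at_imp_continuous_on)
  define U where "U \<epsilon> = ?B \<inter> f \<epsilon> -` ball y \<delta>" for \<epsilon>
  define K where "K \<epsilon> = cball x0 (d / 2) \<inter> f \<epsilon> -` L" for \<epsilon>
  have hb: "cball x0 (d / 2) \<subseteq> ?B" using d(1) by auto
  have U: "\<forall>\<^sub>F \<epsilon> in at_right 0. open (U \<epsilon>)"
    using fc by eventually_elim (auto simp: U_def intro: continuous_open_preimage)
  have K: "\<forall>\<^sub>F \<epsilon> in at_right 0. compact (K \<epsilon>) \<and> K \<epsilon> \<subseteq> U \<epsilon> \<and> measure lborel (K \<epsilon>) \<le> measure lborel (cball x0 (d / 2))"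
    using fc
  proof eventually_elim
    case (elim \<epsilon>)
    have "closed (K \<epsilon>)" unfolding K_def
      using elim hb L(1) by (intro continuous_closed_preimage) (auto intro: continuous_on_subset compact_imp_closed)
    moreover have "K \<epsilon> \<subseteq> cball x0 (d / 2)" by (auto simp: K_def)
    ultimately have cK: "compact (K \<epsilon>)" by (metis compact_Int_closed compact_cball inf.absorb_iff2 Int_commute)
    moreover have "K \<epsilon> \<subseteq> U \<epsilon>" using hb L(2) by (auto simp: K_def U_def)
    moreover have "measure lborel (K \<epsilon>) \<le> measure lborel (cball x0 (d / 2))"
    proof (rule measure_mono_fmeasurable)
      show "K \<epsilon> \<in> sets lborel" using cK by (simp add: borel_compact)
      show "cball x0 (d / 2) \<in> fmeasurable lborel" by (rule fmeasurable_compact) simp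
    qed (auto simp: K_def)
    ultimately show ?case by blast
  qed
  have sub: "\<forall>\<^sub>F \<epsilon> in at_right 0. U \<epsilon> \<subseteq> ?B" by (simp add: U_def)
  have opB: "\<forall>\<^sub>F \<epsilon> in at_right (0::real). open ?B" by simp
  have aU: "tame_net slow_net U a" and fU: "tame_net slow_net U f"
    by (rule tame_net_subset[OF net_class_slow opB U sub], rule a f)+
  have aK: "\<forall>\<^sub>F \<epsilon> in at_right 0. \<forall>x\<in>U \<epsilon> - K \<epsilon>. a \<epsilon> x = 0"
  proof (intro always_eventually allI ballI)
    fix \<epsilon> x assume "x \<in> U \<epsilon> - K \<epsilon>"
    then have "x \<notin> cball x0 (d / 2) \<or> f \<epsilon> x \<notin> L" by (auto simp: K_def)
    then show "a \<epsilon> x = 0" using a(2) a\<psi> L(3) by blast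
  qed
  obtain \<tau> where \<tau>: "slow_net \<tau>" "\<forall>\<^sub>F \<epsilon> in at_right 0.
     \<forall>x\<in>?B \<inter> \<Omega>1. f \<epsilon> x \<in> ball y \<delta> \<longrightarrow> (\<forall>\<eta>\<in>V \<inter> sphere 0 1. \<forall>\<xi>\<in>sphere 0 1 \<inter> ball \<xi>0 d.
       \<forall>s\<ge>0. \<forall>t\<ge>0. s + t \<le> \<tau> \<epsilon> * norm (s *\<^sub>R transp_jacobian f \<epsilon> x \<eta> - t *\<^sub>R \<xi>))"
    using nc unfolding noncharacteristic_def by blast
  have "\<exists>\<mu>. \<forall>j. slow_net (\<mu> j) \<and> (\<forall>\<^sub>F \<epsilon> in at_right 0. \<forall>x\<in>?B. norm (partial_deriv j (f \<epsilon>) x) \<le> \<mu> j \<epsilon>)"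
    using B.tame_bdd[OF B.tame_partial_deriv[OF f]] unfolding B.bdd_def bex_net_gauges by (intro choice) auto
  then obtain \<mu> where \<mu>: "\<And>j. slow_net (\<mu> j)" "\<And>j. \<forall>\<^sub>F \<epsilon> in at_right 0. \<forall>x\<in>?B. norm (partial_deriv j (f \<epsilon>) x) \<le> \<mu> j \<epsilon>"
    by blast
  define M where "M \<epsilon> = 1 + \<bar>\<Sum>j\<in>UNIV. \<mu> j \<epsilon>\<bar>" for \<epsilon>
  have "slow_net (\<lambda>\<epsilon>. \<Sum>j\<in>J. \<mu> j \<epsilon>)" for J
    by (induction J rule: infinite_finite_induct) (auto intro: net_classD[OF net_class_slow] \<mu>(1))
  then have Ms: "slow_net M" unfolding M_def[abs_def] by (intro net_classD[OF net_class_slow])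
  have M: "\<forall>\<^sub>F \<epsilon> in at_right 0. \<forall>x\<in>?B. \<forall>\<eta>. norm (transp_jacobian f \<epsilon> x \<eta>) \<le> M \<epsilon> * norm \<eta>"
  proof -
    have "\<forall>\<^sub>F \<epsilon> in at_right 0. \<forall>j. \<forall>x\<in>?B. norm (partial_deriv j (f \<epsilon>) x) \<le> \<mu> j \<epsilon>"
      using \<mu>(2) by (rule eventually_all_finite)
    then show ?thesis
      using B.tame_evdiff[OF f] unfolding B.evdiff_def
    proof eventually_elim
      case (elim \<epsilon>)
      show ?case
      proof (intro ballI allI)
        fix x \<eta> assume x: "x \<in> ?B"
        have "norm (transp_jacobian f \<epsilon> x \<eta>) \<le> (\<Sum>j\<in>UNIV. \<bar>transp_jacobian f \<epsilon> x \<eta> $ j\<bar>)"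
          by (rule norm_le_l1_cart)
        also have "\<dots> \<le> (\<Sum>j\<in>UNIV. \<mu> j \<epsilon> * norm \<eta>)"
        proof (rule sum_mono)
          fix j
          have "\<bar>transp_jacobian f \<epsilon> x \<eta> $ j\<bar> \<le> norm (partial_deriv j (f \<epsilon>) x) * norm \<eta>"
            using elim(2) x by (simp add: transp_jacobian_nth Cauchy_Schwarz_ineq2)
          also have "\<dots> \<le> \<mu> j \<epsilon> * norm \<eta>" using elim(1) x by (intro mult_right_mono) auto
          finally show "\<bar>transp_jacobian f \<epsilon> x \<eta> $ j\<bar> \<le> \<mu> j \<epsilon> * norm \<eta>" .
        qed
        also have "\<dots> = (\<Sum>j\<in>UNIV. \<mu> j \<epsilon>) * norm \<eta>" by (rule sum_distrib_right[symmetric])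
        also have "\<dots> \<le> M \<epsilon> * norm \<eta>" unfolding M_def by (intro mult_right_mono) auto
        finally show "norm (transp_jacobian f \<epsilon> x \<eta>) \<le> M \<epsilon> * norm \<eta>" .
      qed
    qed
  qed
  have M1: "1 \<le> M \<epsilon>" for \<epsilon> by (simp add: M_def)
  \<comment> \<open>\<open>4\<close> serves \<open>|\<zeta>| > 2 M |\<eta>|\<close>, \<open>\<tau>\<close> the directions in \<open>V\<close>, and \<open>2 M\<close> bounds \<open>|\<zeta>| / |\<eta>|\<close> in the last case\<close>
  define T where "T \<epsilon> = 4 + 2 * M \<epsilon> + \<bar>\<tau> \<epsilon>\<bar>" for \<epsilon>
  have Ts: "slow_net T" unfolding T_def[abs_def] by (intro net_classD[OF net_class_slow] Ms \<tau>(1))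
  have rw: "rapid_on w (sphere 0 1 - V)" using \<psi>(2) by (simp add: w_def[abs_def])
  obtain N1 where N1: "\<And>q::nat. \<exists>C. \<forall>\<^sub>F \<epsilon> in at_right 0. \<forall>\<eta>\<in>{t *\<^sub>R \<xi> |t \<xi>. 0 < t \<and> \<xi> \<in> sphere 0 1 - V}.
      (1 + norm \<eta>) ^ q * norm (ft (w \<epsilon>) \<eta>) \<le> C * \<epsilon> powr (- N1)"
    by (rule rapid_on_as_cone[OF rw]) auto
  obtain N2 C2 where N2: "\<forall>\<^sub>F \<epsilon> in at_right 0. \<forall>\<xi>. norm (ft (w \<epsilon>) \<xi>) \<le> C2 * \<epsilon> powr (- N2)"
    using test_net_props(2)[OF w] by blast
  define N where "N = max N1 N2"
  define A where "A = {t *\<^sub>R \<xi> |t \<xi>. 0 < t \<and> \<xi> \<in> sphere 0 1 - V}"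
  define Z where "Z = {t *\<^sub>R \<xi> |t \<xi>. 0 < t \<and> \<xi> \<in> sphere 0 1 \<inter> ball \<xi>0 d}"
  have est: "\<exists>C. \<forall>\<^sub>F \<epsilon> in at_right 0. \<forall>\<zeta>\<in>Z. (1 + norm \<zeta>) ^ p *
      norm (LINT x:U \<epsilon>|lborel. a \<epsilon> x * w \<epsilon> (f \<epsilon> x) * exp (- (\<i> * of_real (x \<bullet> \<zeta>)))) \<le> C * \<epsilon> powr (- (N + 1))" for p
  proof (rule microlocal_estimate[OF U K aU aK fU Ts, where A=A and ?C0.0="\<bar>C2\<bar>"])
    show "\<forall>\<^sub>F \<epsilon> in at_right 0. 1 \<le> T \<epsilon>" using M1 by (intro always_eventually allI) (simp add: T_def add_increasing2 order_trans[OF zero_le_one])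
    show "\<forall>\<^sub>F \<epsilon> in at_right 0. integrable lborel (w \<epsilon>) \<and> continuous_on UNIV (w \<epsilon>) \<and> (\<exists>S. \<forall>y. norm (w \<epsilon> y) \<le> S)"
      by (rule test_net_props(1)[OF w])
    show "\<forall>\<^sub>F \<epsilon> in at_right 0. \<forall>\<eta>. norm (ft (w \<epsilon>) \<eta>) \<le> \<bar>C2\<bar> * \<epsilon> powr (- N)"
      using bigo_weaken[of UNIV "\<lambda>\<epsilon> \<eta>. norm (ft (w \<epsilon>) \<eta>)" C2 N2 N] N2 by (simp add: N_def)
    show "\<exists>C. \<forall>\<^sub>F \<epsilon> in at_right 0. \<forall>\<eta>\<in>A. (1 + norm \<eta>) ^ q * norm (ft (w \<epsilon>) \<eta>) \<le> C * \<epsilon> powr (- N)" for q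
    proof -
      obtain C where C: "\<forall>\<^sub>F \<epsilon> in at_right 0. \<forall>\<eta>\<in>A. (1 + norm \<eta>) ^ q * norm (ft (w \<epsilon>) \<eta>) \<le> C * \<epsilon> powr (- N1)"
        using N1[of q] unfolding A_def by blast
      have "N1 \<le> N" by (simp add: N_def)
      from bigo_weaken[OF C this] show ?thesis by blast
    qed
    show "0 \<notin> Z" using norm_zero by (auto simp: Z_def)
    show "\<forall>\<^sub>F \<epsilon> in at_right 0. \<forall>\<zeta>\<in>Z. \<forall>\<eta>.
        (\<forall>x\<in>U \<epsilon>. norm \<zeta> + norm \<eta> \<le> T \<epsilon> * norm (transp_jacobian f \<epsilon> x \<eta> - \<zeta>)) \<or>
        (\<eta> \<in> A \<and> norm \<zeta> \<le> T \<epsilon> * norm \<eta>)"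
      using \<tau>(2) M
    proof eventually_elim
      case (elim \<epsilon>)
      have T4: "4 \<le> T \<epsilon>" "2 * M \<epsilon> \<le> T \<epsilon>" "\<tau> \<epsilon> \<le> T \<epsilon>" using M1[of \<epsilon>] by (auto simp: T_def)
      show ?case
      proof (intro ballI allI)
        fix \<zeta> \<eta> assume "\<zeta> \<in> Z"
        then obtain t \<xi> where \<zeta>: "\<zeta> = t *\<^sub>R \<xi>" "0 < t" "\<xi> \<in> sphere 0 1 \<inter> ball \<xi>0 d" by (auto simp: Z_def)
        have n\<zeta>: "norm \<zeta> = t" using \<zeta> by simp
        show "(\<forall>x\<in>U \<epsilon>. norm \<zeta> + norm \<eta> \<le> T \<epsilon> * norm (transp_jacobian f \<epsilon> x \<eta> - \<zeta>)) \<or>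
            (\<eta> \<in> A \<and> norm \<zeta> \<le> T \<epsilon> * norm \<eta>)"
        proof (cases "t \<le> 2 * M \<epsilon> * norm \<eta>")
          case False
          have "norm \<zeta> + norm \<eta> \<le> T \<epsilon> * norm (transp_jacobian f \<epsilon> x \<eta> - \<zeta>)" if "x \<in> U \<epsilon>" for x
          proof -
            have "norm (transp_jacobian f \<epsilon> x \<eta>) \<le> M \<epsilon> * norm \<eta>" using elim(2) that by (auto simp: U_def)
            moreover have "norm \<zeta> - norm (transp_jacobian f \<epsilon> x \<eta>) \<le> norm (transp_jacobian f \<epsilon> x \<eta> - \<zeta>)"
              using norm_triangle_ineq2[of \<zeta> "transp_jacobian f \<epsilon> x \<eta>"] by (simp add: norm_minus_commute)
            moreover have "norm \<eta> \<le> M \<epsilon> * norm \<eta>" using mult_right_mono[OF M1 norm_ge_zero, of \<eta> \<epsilon>] by simp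
            ultimately have "norm \<zeta> + norm \<eta> \<le> 4 * norm (transp_jacobian f \<epsilon> x \<eta> - \<zeta>)"
              using False n\<zeta> norm_ge_zero[of \<eta>] unfolding mult.assoc by linarith
            also have "\<dots> \<le> T \<epsilon> * norm (transp_jacobian f \<epsilon> x \<eta> - \<zeta>)" using T4 by (intro mult_right_mono) auto
            finally show ?thesis .
          qed
          then show ?thesis by blast
        next
          case True
          then have \<eta>0: "\<eta> \<noteq> 0" using \<zeta>(2) by auto
          define s \<eta>' where "s = norm \<eta>" and "\<eta>' = \<eta> /\<^sub>R s"
          have s: "0 < s" "\<eta> = s *\<^sub>R \<eta>'" "\<eta>' \<in> sphere 0 1" using \<eta>0 by (auto simp: s_def \<eta>'_def)
          show ?thesis
          proof (cases "\<eta>' \<in> V")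
            case True
            have "norm \<zeta> + norm \<eta> \<le> T \<epsilon> * norm (transp_jacobian f \<epsilon> x \<eta> - \<zeta>)" if "x \<in> U \<epsilon>" for x
            proof -
              have "x \<in> ?B \<inter> \<Omega>1" "f \<epsilon> x \<in> ball y \<delta>" using that d(2) by (auto simp: U_def)
              then have "s + t \<le> \<tau> \<epsilon> * norm (s *\<^sub>R transp_jacobian f \<epsilon> x \<eta>' - t *\<^sub>R \<xi>)"
                using elim(1) True s \<zeta> by (meson IntI less_imp_le)
              also have "\<dots> \<le> T \<epsilon> * norm (s *\<^sub>R transp_jacobian f \<epsilon> x \<eta>' - t *\<^sub>R \<xi>)"
                using T4 by (intro mult_right_mono) auto
              also have "s *\<^sub>R transp_jacobian f \<epsilon> x \<eta>' = transp_jacobian f \<epsilon> x \<eta>"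
                by (simp only: s(2) transp_jacobian_scaleR)
              finally show ?thesis using n\<zeta> \<zeta>(1) by (simp add: s_def)
            qed
            then show ?thesis by blast
          next
            case False
            then have "\<eta> \<in> A" unfolding A_def using s by blast
            moreover have "norm \<zeta> \<le> T \<epsilon> * norm \<eta>"
              using True n\<zeta> mult_right_mono[OF T4(2) norm_ge_zero, of \<eta>] by linarith
            ultimately show ?thesis by blast
          qed
        qed
      qed
    qed
  qed
  define v where "v \<epsilon> x = indicator ?B x *\<^sub>R (a \<epsilon> x * (\<psi> (f \<epsilon> x) * r \<epsilon> (f \<epsilon> x)))" for \<epsilon> x
  have veq: "(LINT x:U \<epsilon>|lborel. a \<epsilon> x * w \<epsilon> (f \<epsilon> x) * exp (- (\<i> * of_real (x \<bullet> \<zeta>)))) = ft (v \<epsilon>) \<zeta>" for \<epsilon> \<zeta>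
  proof -
    have "\<psi> (f \<epsilon> x) = 0" if "f \<epsilon> x \<notin> ball y \<delta>" for x using L(2,3) that by blast
    then show ?thesis
      unfolding ft_def set_lebesgue_integral_def
      by (intro Bochner_Integration.integral_cong) (auto simp: indicator_def U_def v_def w_def)
  qed
  have "rapid_on v (sphere 0 1 \<inter> ball \<xi>0 d)"
    by (rule rapid_onI_cone[where N="N + 1"]) (use est in \<open>auto simp: Z_def veq\<close>)
  then show "rapid_on (\<lambda>\<epsilon> x. indicator ?B x *\<^sub>R (a \<epsilon> x * (\<psi> (f \<epsilon> x) * r \<epsilon> (f \<epsilon> x)))) (sphere 0 1 \<inter> ball \<xi>0 d)"
    by (simp add: v_def[abs_def])
  show "\<forall>\<^sub>F \<epsilon> in at_right 0. integrable lborel (\<lambda>x. indicator ?B x *\<^sub>R (a \<epsilon> x * (\<psi> (f \<epsilon> x) * r \<epsilon> (f \<epsilon> x))))"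
    using fc test_net_props(1)[OF w]
  proof eventually_elim
    case (elim \<epsilon>)
    have cf: "continuous_on ?B (f \<epsilon>)" and ca: "continuous_on ?B (a \<epsilon>)" and cw: "continuous_on UNIV (w \<epsilon>)"
      using elim by blast+
    have "continuous_on ?B (\<lambda>x. w \<epsilon> (f \<epsilon> x))"
      by (rule continuous_on_compose2[OF cw cf]) simp
    then have "continuous_on ?B (\<lambda>x. a \<epsilon> x * (\<psi> (f \<epsilon> x) * r \<epsilon> (f \<epsilon> x)))"
      unfolding w_def by (rule continuous_on_mult[OF ca])
    then have "set_integrable lborel ?B (\<lambda>x. a \<epsilon> x * (\<psi> (f \<epsilon> x) * r \<epsilon> (f \<epsilon> x)))"
      by (rule set_integrable_compact_support[OF compact_cball hb]) (simp add: a(2))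
    then show ?case by (simp add: set_integrable_def)
  qed
qed

lemma rapid_on_cong:
  assumes "rapid_on v \<Gamma>" "\<forall>\<^sub>F \<epsilon> in at_right 0. v \<epsilon> = w \<epsilon>"
  shows "rapid_on w \<Gamma>"
proof -
  obtain N where N: "\<And>q::nat. \<exists>C. \<forall>\<^sub>F \<epsilon> in at_right 0. \<forall>\<xi>\<in>\<Gamma>. \<forall>t>0.
     (1 + t) ^ q * norm (ft (v \<epsilon>) (t *\<^sub>R \<xi>)) \<le> C * \<epsilon> powr (- N)"
    using assms(1) unfolding rapid_on_def by blast
  show ?thesis unfolding rapid_on_def
  proof (rule exI[of _ N], rule allI)
    fix q :: nat
    obtain C where "\<forall>\<^sub>F \<epsilon> in at_right 0. \<forall>\<xi>\<in>\<Gamma>. \<forall>t>0.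
     (1 + t) ^ q * norm (ft (v \<epsilon>) (t *\<^sub>R \<xi>)) \<le> C * \<epsilon> powr (- N)" using N by blast
    with assms(2) have "\<forall>\<^sub>F \<epsilon> in at_right 0. \<forall>\<xi>\<in>\<Gamma>. \<forall>t>0.
     (1 + t) ^ q * norm (ft (w \<epsilon>) (t *\<^sub>R \<xi>)) \<le> C * \<epsilon> powr (- N)"
      by eventually_elim simp
    then show "\<exists>C. \<forall>\<^sub>F \<epsilon> in at_right 0. \<forall>\<xi>\<in>\<Gamma>. \<forall>t>0.
     (1 + t) ^ q * norm (ft (w \<epsilon>) (t *\<^sub>R \<xi>)) \<le> C * \<epsilon> powr (- N)" by blast
  qed
qed

lemma ft_zero: "ft (\<lambda>_. 0) \<xi> = 0"
  by (simp add: ft_def)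

lemma ft_add:
  fixes v w :: "real^'n::finite \<Rightarrow> complex"
  assumes "integrable lborel v" "integrable lborel w"
  shows "ft (\<lambda>x. v x + w x) \<xi> = ft v \<xi> + ft w \<xi>"
proof -
  have i: "integrable lborel (\<lambda>x. u x * exp (- (\<i> * of_real (x \<bullet> \<xi>))))" if u: "integrable lborel u" for u :: "real^'n \<Rightarrow> complex"
  proof (rule Bochner_Integration.integrable_bound[OF u])
    have [measurable]: "u \<in> borel_measurable borel" using u by (auto simp: integrable_iff_bounded)
    show "(\<lambda>x. u x * exp (- (\<i> * of_real (x \<bullet> \<xi>)))) \<in> borel_measurable lborel" by measurable
  qed (simp add: norm_mult)
  show ?thesis
    unfolding ft_def distrib_right by (rule Bochner_Integration.integral_add[OF i[OF assms(1)] i[OF assms(2)]])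
qed

lemma rapid_on_sum:
  fixes v :: "'k \<Rightarrow> real \<Rightarrow> real^'n::finite \<Rightarrow> complex"
  assumes "finite J" "\<And>j. j \<in> J \<Longrightarrow> rapid_on (v j) \<Gamma>"
    "\<And>j. j \<in> J \<Longrightarrow> \<forall>\<^sub>F \<epsilon> in at_right 0. integrable lborel (v j \<epsilon>)"
  shows "rapid_on (\<lambda>\<epsilon> x. \<Sum>j\<in>J. v j \<epsilon> x) \<Gamma>"
proof -
  have "rapid_on (\<lambda>\<epsilon> x. \<Sum>j\<in>J. v j \<epsilon> x) \<Gamma> \<and> (\<forall>\<^sub>F \<epsilon> in at_right 0. integrable lborel (\<lambda>x. \<Sum>j\<in>J. v j \<epsilon> x))"
    using assms
  proof (induction J rule: finite_induct)
    case empty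
    have "\<exists>C. \<forall>\<^sub>F \<epsilon> in at_right (0::real). \<forall>\<xi>\<in>\<Gamma>. \<forall>t>0.
        (1 + t) ^ q * norm (ft (\<lambda>x. \<Sum>j\<in>{}. v j \<epsilon> x) (t *\<^sub>R \<xi>)) \<le> C * \<epsilon> powr (- 0)" for q
      by (rule exI[of _ 0]) (simp add: ft_zero)
    then have "rapid_on (\<lambda>\<epsilon> x. \<Sum>j\<in>{}. v j \<epsilon> x) \<Gamma>" unfolding rapid_on_def by blast
    then show ?case by simp
  next
    case (insert j J)
    then have 1: "rapid_on (v j) \<Gamma>" "\<forall>\<^sub>F \<epsilon> in at_right 0. integrable lborel (v j \<epsilon>)"
      and 2: "rapid_on (\<lambda>\<epsilon> x. \<Sum>j\<in>J. v j \<epsilon> x) \<Gamma>" "\<forall>\<^sub>F \<epsilon> in at_right 0. integrable lborel (\<lambda>x. \<Sum>j\<in>J. v j \<epsilon> x)"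
      by auto
    have "rapid_on (\<lambda>\<epsilon> x. \<Sum>j\<in>insert j J. v j \<epsilon> x) \<Gamma>"
    proof (rule rapid_on_add[OF 1(1) 2(1)])
      show "\<forall>\<^sub>F \<epsilon> in at_right 0. \<forall>\<xi>. ft (\<lambda>x. \<Sum>j\<in>insert j J. v j \<epsilon> x) \<xi> = ft (v j \<epsilon>) \<xi> + ft (\<lambda>x. \<Sum>j\<in>J. v j \<epsilon> x) \<xi>"
        using 1(2) 2(2) by eventually_elim (simp add: insert.hyps ft_add)
    qed
    moreover have "\<forall>\<^sub>F \<epsilon> in at_right 0. integrable lborel (\<lambda>x. \<Sum>j\<in>insert j J. v j \<epsilon> x)"
      using 1(2) 2(2) by eventually_elim (simp add: insert.hyps)
    ultimately show ?case by blast
  qed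
  then show ?thesis by blast
qed

text \<open>A cut-off for which \<open>microlocal_piece\<close> applies in directions near \<open>\<xi>0\<close>.\<close>

definition good_cutoff :: "(real^'n::finite) set \<Rightarrow> (real^'m::finite) set \<Rightarrow> ('n, real^'m) net \<Rightarrow> ('m, complex) net \<Rightarrow>
    real^'n \<Rightarrow> real^'n \<Rightarrow> real \<Rightarrow> (real^'m \<Rightarrow> complex) \<Rightarrow> bool" where
  "good_cutoff \<Omega>1 \<Omega>2 f r x0 \<xi>0 d \<psi> \<longleftrightarrow> (\<exists>y \<delta> V. \<psi> \<in> test_functions (\<Omega>2 \<inter> ball y \<delta>) \<and>
     rapid_on (\<lambda>\<epsilon> z. \<psi> z * r \<epsilon> z) (sphere 0 1 - V) \<and> noncharacteristic \<Omega>1 f x0 \<xi>0 y \<delta> d V)"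

lemma good_cutoff_antimono:
  "good_cutoff \<Omega>1 \<Omega>2 f r x0 \<xi>0 d \<psi> \<Longrightarrow> d' \<le> d \<Longrightarrow> good_cutoff \<Omega>1 \<Omega>2 f r x0 \<xi>0 d' \<psi>"
  unfolding good_cutoff_def using noncharacteristic_mono[OF _ order_refl] by blast

text \<open>The directions in which \<open>u\<close> is singular at \<open>y\<close> form a compact set, so a neighbourhood \<open>V\<close> of this
  set inherits the absence of stationary points. The remaining directions are regular and
  \<open>microlocalization\<close> provides the cut-off.\<close>

lemma good_cutoff_exists:
  fixes f :: "('n::finite, real^'m::finite) net" and r :: "('m, complex) net"
  assumes \<Omega>2: "open \<Omega>2" and r: "r \<in> moderate_nets \<Omega>2" and y: "y \<in> \<Omega>2"
    and nc: "\<And>\<eta>. (y, \<eta>) \<in> WF \<Omega>2 (gclass \<Omega>2 r) \<Longrightarrow> \<exists>d>0. noncharacteristic \<Omega>1 f x0 \<xi>0 y d d (ball \<eta> d)"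
  shows "\<exists>d>0. \<exists>\<psi>. good_cutoff \<Omega>1 \<Omega>2 f r x0 \<xi>0 d \<psi> \<and> \<psi> y \<noteq> 0"
proof -
  let ?S = "{\<eta>. (y, \<eta>) \<in> WF \<Omega>2 (gclass \<Omega>2 r)}"
  obtain d V where d: "d > 0" "open V" "?S \<subseteq> V" "noncharacteristic \<Omega>1 f x0 \<xi>0 y d d V"
  proof (rule compact_cover_induct[OF WF_fibre_compact, of "\<lambda>d V. noncharacteristic \<Omega>1 f x0 \<xi>0 y d d V"])
    show "noncharacteristic \<Omega>1 f x0 \<xi>0 y d' d' V" if "noncharacteristic \<Omega>1 f x0 \<xi>0 y d d V" "d' \<le> d" for d d' V
      by (rule noncharacteristic_mono[OF that(1) that(2) that(2)])
  qed (use nc noncharacteristic_empty noncharacteristic_Un in blast)+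
  have E: "compact (sphere 0 1 - V)" by (rule compact_diff[OF compact_sphere d(2)])
  have "\<eta> \<notin> Sigma_at \<Omega>2 (gclass \<Omega>2 r) y" if "\<eta> \<in> sphere 0 1 - V" for \<eta>
    using that d(3) y by (auto simp: WF_def)
  from microlocalization[OF \<Omega>2 r y d(1) E Diff_subset this]
  obtain \<psi> where "\<psi> \<in> test_functions (\<Omega>2 \<inter> ball y d)" "\<psi> y \<noteq> 0" "rapid_on (\<lambda>\<epsilon> x. \<psi> x * r \<epsilon> x) (sphere 0 1 - V)"
    by blast
  with d show ?thesis unfolding good_cutoff_def by blast
qed

text \<open>With \<open>S = \<Sum>\<^sub>\<psi> |\<psi> \<circ> f\<^sub>\<epsilon>|\<^sup>2\<close> bounded below, the pullback is decomposed as the sum of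
  \<open>(conj (\<psi> \<circ> f\<^sub>\<epsilon>) / S) ((\<psi> r\<^sub>\<epsilon>) \<circ> f\<^sub>\<epsilon>)\<close>. The amplitudes have slow-scale derivatives because \<open>f\<^sub>\<epsilon>\<close>
  has. Using \<open>|\<psi>|\<^sup>2\<close> instead of \<open>\<psi>\<close> avoids zeros in the sum, and dividing by it after the composition
  with \<open>f\<^sub>\<epsilon>\<close> leaves the nets \<open>\<psi> r\<^sub>\<epsilon>\<close>, whose regularity is known, untouched.\<close>

lemma rapid_on_pullback:
  fixes f :: "('n::finite, real^'m::finite) net" and r :: "('m, complex) net"
  assumes \<Omega>2: "open \<Omega>2" and r: "r \<in> moderate_nets \<Omega>2" and w: "pullback_rep \<Omega>1 f r w"
    and d: "0 < d" "ball x0 d \<subseteq> \<Omega>1" and f: "tame_net slow_net (\<lambda>_. ball x0 d) f"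
    and K: "compact K" "\<forall>\<^sub>F \<epsilon> in at_right 0. \<forall>x\<in>ball x0 d. f \<epsilon> x \<in> K"
    and J: "finite J" "\<And>\<psi>. \<psi> \<in> J \<Longrightarrow> good_cutoff \<Omega>1 \<Omega>2 f r x0 \<xi>0 d \<psi>"
    and c0: "0 < c0" "\<forall>\<^sub>F \<epsilon> in at_right 0. \<forall>x\<in>ball x0 d. c0 \<le> (\<Sum>\<psi>\<in>J. (norm (\<psi> (f \<epsilon> x)))\<^sup>2)"
  shows "rapid_on (\<lambda>\<epsilon> x. of_real (bump x0 (d / 2) x) * w \<epsilon> x) (sphere 0 1 \<inter> ball \<xi>0 d)"
proof -
  let ?B = "ball x0 d"
  interpret B: gauge "at_right 0" "\<lambda>_. ?B" "net_gauges slow_net (\<lambda>\<epsilon>. \<epsilon>)"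
    by (rule gauge_net[OF net_class_slow]) simp
  define \<phi> where "\<phi> x = complex_of_real (bump x0 (d / 2) x)" for x
  have d2: "0 < d / 2" using d(1) by simp
  have \<phi>0: "\<phi> x = 0" if "x \<notin> cball x0 (d / 2)" for x
    using that bump_pos_iff[OF d2, of x0 x] bump_nonneg[of x0 "d / 2" x] by (auto simp: \<phi>_def less_eq_real_def)
  have "smooth_on UNIV \<phi>"
    unfolding \<phi>_def[abs_def] by (intro smooth_on_bounded_linear[OF open_UNIV bounded_linear_of_real] bump_smooth)
  then have \<phi>: "B.tame (\<lambda>_. \<phi>)"
    by (rule tame_fixed_function[OF net_class_slow _ open_ball ball_subset_cball]) auto
  have \<psi>s: "smooth_on UNIV \<psi>" if "\<psi> \<in> J" for \<psi>
    using J(2)[OF that] by (auto simp: good_cutoff_def test_functions_def)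
  have \<psi>f: "B.tame (\<lambda>\<epsilon> x. \<psi> (f \<epsilon> x))" if \<psi>: "\<psi> \<in> J" for \<psi>
  proof (rule B.tame_compose[OF f, where u="\<lambda>_. \<psi>"])
    fix \<alpha>
    have "bounded (partial_derivs \<alpha> \<psi> ` K)"
      by (intro compact_imp_bounded compact_continuous_image K(1)
          continuous_on_subset[OF smooth_on_continuous[OF \<psi>s[OF \<psi>]]]) simp
    then obtain b where b: "\<forall>z\<in>K. norm (partial_derivs \<alpha> \<psi> z) \<le> b" unfolding bounded_iff ball_simps by blast
    have "\<forall>\<^sub>F \<epsilon> in at_right 0. \<forall>x\<in>?B. norm (partial_derivs \<alpha> \<psi> (f \<epsilon> x)) \<le> b"
      using K(2) by eventually_elim (use b in blast)
    then show "B.bdd (\<lambda>\<epsilon> x. partial_derivs \<alpha> \<psi> (f \<epsilon> x))"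
      unfolding B.bdd_def bex_net_gauges by (intro exI[of _ "\<lambda>_. b"] conjI slow_net_const)
    show "\<forall>\<^sub>F \<epsilon> in at_right 0. \<forall>x\<in>?B. partial_derivs \<alpha> \<psi> differentiable (at (f \<epsilon> x))"
      using \<psi>s[OF \<psi>] by (simp add: smooth_on_def)
  qed
  define S where "S \<epsilon> x = (\<Sum>\<psi>\<in>J. \<psi> (f \<epsilon> x) * cnj (\<psi> (f \<epsilon> x)))" for \<epsilon> x
  have S: "B.tame S"
    unfolding S_def[abs_def] by (intro B.tame_sum B.tame_mult B.tame_bounded_linear[OF bounded_linear_cnj] \<psi>f)
  have Sreal: "S \<epsilon> x = of_real (\<Sum>\<psi>\<in>J. (norm (\<psi> (f \<epsilon> x)))\<^sup>2)" for \<epsilon> x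
    unfolding S_def by (simp add: complex_norm_square[symmetric])
  have Sinv: "\<forall>\<^sub>F \<epsilon> in at_right 0. \<forall>x\<in>?B. norm (inverse (S \<epsilon> x)) \<le> 1 / c0 \<and> S \<epsilon> x \<noteq> 0"
    using c0(2)
  proof eventually_elim
    case (elim \<epsilon>)
    show ?case
    proof
      fix x assume "x \<in> ?B"
      then have le: "c0 \<le> (\<Sum>\<psi>\<in>J. (norm (\<psi> (f \<epsilon> x)))\<^sup>2)" using elim by blast
      then have "norm (S \<epsilon> x) = (\<Sum>\<psi>\<in>J. (norm (\<psi> (f \<epsilon> x)))\<^sup>2)" unfolding Sreal norm_of_real using c0(1) by simp
      with le have "c0 \<le> norm (S \<epsilon> x)" by simp
      then show "norm (inverse (S \<epsilon> x)) \<le> 1 / c0 \<and> S \<epsilon> x \<noteq> 0"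
        using c0(1) le_imp_inverse_le[OF \<open>c0 \<le> norm (S \<epsilon> x)\<close> c0(1)] by (auto simp: norm_inverse divide_inverse)
    qed
  qed
  have Sinv_tame: "B.tame (\<lambda>\<epsilon> x. inverse (S \<epsilon> x))"
  proof (rule B.tame_inverse[OF S])
    have "\<forall>\<^sub>F \<epsilon> in at_right 0. \<forall>x\<in>?B. norm (inverse (S \<epsilon> x)) \<le> 1 / c0"
      using Sinv by eventually_elim blast
    then show "B.bdd (\<lambda>\<epsilon> x. inverse (S \<epsilon> x))"
      unfolding B.bdd_def bex_net_gauges by (intro exI[of _ "\<lambda>_. 1 / c0"] conjI slow_net_const)
    show "\<forall>\<^sub>F \<epsilon> in at_right 0. \<forall>x\<in>?B. S \<epsilon> x \<noteq> 0" using Sinv by eventually_elim blast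
  qed
  define a where "a \<psi> \<epsilon> x = \<phi> x * (cnj (\<psi> (f \<epsilon> x)) * inverse (S \<epsilon> x))" for \<psi> \<epsilon> x
  have a: "B.tame (a \<psi>)" if "\<psi> \<in> J" for \<psi>
    unfolding a_def[abs_def] by (intro B.tame_mult \<phi> B.tame_bounded_linear[OF bounded_linear_cnj] \<psi>f[OF that] Sinv_tame)
  define v where "v \<psi> \<epsilon> x = indicator ?B x *\<^sub>R (a \<psi> \<epsilon> x * (\<psi> (f \<epsilon> x) * r \<epsilon> (f \<epsilon> x)))" for \<psi> \<epsilon> x
  have v: "rapid_on (v \<psi>) (sphere 0 1 \<inter> ball \<xi>0 d) \<and> (\<forall>\<^sub>F \<epsilon> in at_right 0. integrable lborel (v \<psi> \<epsilon>))" if \<psi>: "\<psi> \<in> J" for \<psi>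
  proof -
    obtain y \<delta> V where g: "\<psi> \<in> test_functions (\<Omega>2 \<inter> ball y \<delta>)" "rapid_on (\<lambda>\<epsilon> z. \<psi> z * r \<epsilon> z) (sphere 0 1 - V)"
      "noncharacteristic \<Omega>1 f x0 \<xi>0 y \<delta> d V"
      using J(2)[OF \<psi>] unfolding good_cutoff_def by blast
    have z1: "a \<psi> \<epsilon> x = 0" if "x \<notin> cball x0 (d / 2)" for \<epsilon> x
      unfolding a_def using \<phi>0[OF that] by simp
    have z2: "a \<psi> \<epsilon> x = 0" if "\<psi> (f \<epsilon> x) = 0" for \<epsilon> x using that by (simp add: a_def)
    note piece = microlocal_piece[OF \<Omega>2 r f d a[OF \<psi>] z1 g(1,2) z2 g(3)]
    show ?thesis unfolding v_def[abs_def] by (rule conjI[OF piece])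
  qed
  have "rapid_on (\<lambda>\<epsilon> x. \<Sum>\<psi>\<in>J. v \<psi> \<epsilon> x) (sphere 0 1 \<inter> ball \<xi>0 d)"
    by (rule rapid_on_sum[OF J(1)]) (use v in blast)+
  then show ?thesis
  proof (rule rapid_on_cong)
    have "cball x0 (d / 2) \<subseteq> ?B" using d(1) by auto
    then have h: "cball x0 (d / 2) \<subseteq> \<Omega>1" using d(2) by (rule order_trans)
    have "\<forall>\<^sub>F \<epsilon> in at_right 0. \<forall>x\<in>cball x0 (d / 2). w \<epsilon> x = r \<epsilon> (f \<epsilon> x)"
      by (rule w[unfolded pullback_rep_def, THEN conjunct2, THEN spec, THEN mp, OF conjI[OF compact_cball h]])
    then show "\<forall>\<^sub>F \<epsilon> in at_right 0. (\<lambda>x. \<Sum>\<psi>\<in>J. v \<psi> \<epsilon> x) = (\<lambda>x. of_real (bump x0 (d / 2) x) * w \<epsilon> x)"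
      using Sinv
    proof eventually_elim
      case (elim \<epsilon>)
      show ?case
      proof
        fix x
        show "(\<Sum>\<psi>\<in>J. v \<psi> \<epsilon> x) = of_real (bump x0 (d / 2) x) * w \<epsilon> x"
        proof (cases "x \<in> cball x0 (d / 2)")
          case True
          then have xB: "x \<in> ?B" using d(1) by auto
          have "(\<Sum>\<psi>\<in>J. v \<psi> \<epsilon> x) = (\<Sum>\<psi>\<in>J. (\<phi> x * inverse (S \<epsilon> x) * r \<epsilon> (f \<epsilon> x)) * (\<psi> (f \<epsilon> x) * cnj (\<psi> (f \<epsilon> x))))"
            using xB by (intro sum.cong) (simp_all add: v_def a_def mult_ac)
          also have "\<dots> = (\<phi> x * inverse (S \<epsilon> x) * r \<epsilon> (f \<epsilon> x)) * S \<epsilon> x"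
            unfolding S_def by (rule sum_distrib_left[symmetric])
          also have "\<dots> = \<phi> x * w \<epsilon> x" using elim xB True by simp
          finally show ?thesis by (simp add: \<phi>_def)
        next
          case False
          then have "v \<psi> \<epsilon> x = 0" for \<psi> unfolding v_def a_def using \<phi>0[OF False] by simp
          then show ?thesis using \<phi>0[OF False] by (simp add: \<phi>_def)
        qed
      qed
    qed
  qed
qed

text \<open>The property covered by compactness is the existence of finitely many good cut-offs whose squares
  add up to at least some \<open>c0 > 0\<close> along the values of \<open>f\<^sub>\<epsilon>\<close> in \<open>V\<close>. If \<open>(x0, y)\<close> is not in \<open>C\<^sub>f\<close>, no such
  values occur near \<open>y\<close>. If it is, every direction \<open>\<eta>\<close> with \<open>(y, \<eta>) \<in> WF u\<close> satisfies
  \<open>(x0, \<eta>) \<in> D\<^sub>f\<close>, as \<open>x0 \<notin> U\<^sub>f(WF u)\<close>, and is noncharacteristic, as \<open>(x0, \<xi>0) \<notin> f\<^sup>* WF u\<close>.\<close>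

theorem WF_pullback_inside_S_set:
  fixes f :: "('n::finite, real^'m::finite) net" and r :: "('m, complex) net"
  assumes \<Omega>: "open \<Omega>1" "open \<Omega>2" and f: "f \<in> moderate_nets \<Omega>1" "cbounded_net \<Omega>1 \<Omega>2 f"
    and r: "r \<in> moderate_nets \<Omega>2" and w: "pullback_rep \<Omega>1 f r w"
    and x0: "x0 \<in> S_set \<Omega>1 f" and \<xi>0: "\<xi>0 \<in> sphere 0 1"
    and U: "x0 \<notin> U_set \<Omega>1 \<Omega>2 f (WF \<Omega>2 (gclass \<Omega>2 r))"
    and P: "(x0, \<xi>0) \<notin> pullback_dirs \<Omega>1 \<Omega>2 f (WF \<Omega>2 (gclass \<Omega>2 r))"
  shows "(x0, \<xi>0) \<notin> WF \<Omega>1 (gclass \<Omega>1 w)"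
proof -
  let ?WF = "WF \<Omega>2 (gclass \<Omega>2 r)"
  have x0\<Omega>: "x0 \<in> \<Omega>1" using x0 by (simp add: S_set_def)
  obtain X0 where X0: "open X0" "X0 \<subseteq> \<Omega>1" "x0 \<in> X0"
    "\<And>\<alpha>. \<exists>s C. slow_scale s \<and> (\<forall>\<^sub>F \<epsilon> in at_right 0. \<forall>x\<in>X0. norm (partial_derivs \<alpha> (f \<epsilon>) x) \<le> C * s \<epsilon>)"
    using x0 unfolding S_set_def by blast
  have fX0: "tame_net slow_net (\<lambda>_. X0) f"
  proof (subst tame_net_iff[OF net_class_slow])
    show "\<forall>\<^sub>F \<epsilon> in at_right (0::real). open X0" using X0(1) by simp
    show "\<forall>\<alpha>. (\<exists>s. slow_net s \<and> (\<forall>\<^sub>F \<epsilon> in at_right 0. \<forall>x\<in>X0. norm (partial_derivs \<alpha> (f \<epsilon>) x) \<le> s \<epsilon>)) \<and>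
        (\<forall>\<^sub>F \<epsilon> in at_right 0. \<forall>x\<in>X0. partial_derivs \<alpha> (f \<epsilon>) differentiable (at x))"
    proof (intro allI conjI)
      fix \<alpha>
      obtain s C where s: "slow_scale s" "\<forall>\<^sub>F \<epsilon> in at_right 0. \<forall>x\<in>X0. norm (partial_derivs \<alpha> (f \<epsilon>) x) \<le> C * s \<epsilon>"
        using X0(4) by blast
      have "slow_net (\<lambda>\<epsilon>. C * s \<epsilon>)" by (intro net_classD[OF net_class_slow] slow_scale_slow_net s(1))
      with s(2) show "\<exists>s. slow_net s \<and> (\<forall>\<^sub>F \<epsilon> in at_right 0. \<forall>x\<in>X0. norm (partial_derivs \<alpha> (f \<epsilon>) x) \<le> s \<epsilon>)" by blast
      show "\<forall>\<^sub>F \<epsilon> in at_right 0. \<forall>x\<in>X0. partial_derivs \<alpha> (f \<epsilon>) differentiable (at x)"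
        using eventually_at_right_0
      proof eventually_elim
        case (elim \<epsilon>)
        then have "smooth_on \<Omega>1 (f \<epsilon>)" using f(1) moderate_netsD_smooth by blast
        then show ?case using X0(2) unfolding smooth_on_def by blast
      qed
    qed
  qed
  obtain \<rho> where \<rho>: "\<rho> > 0" "cball x0 \<rho> \<subseteq> X0" using X0(1,3) open_contains_cball by metis
  have "cball x0 \<rho> \<subseteq> \<Omega>1" using \<rho>(2) X0(2) by blast
  then obtain K where K: "compact K" "K \<subseteq> \<Omega>2" "\<forall>\<^sub>F \<epsilon> in at_right 0. \<forall>x\<in>cball x0 \<rho>. f \<epsilon> x \<in> K"
    by (rule cbounded_netD[OF f(2) compact_cball])
  \<comment> \<open>\<open>J\<close> may be empty where \<open>f\<^sub>\<epsilon>\<close> takes no values\<close>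
  define Q where "Q d V \<longleftrightarrow> (\<exists>J c0. finite J \<and> 0 < c0 \<and> (\<forall>\<psi>\<in>J. good_cutoff \<Omega>1 \<Omega>2 f r x0 \<xi>0 d \<psi>) \<and>
      (\<forall>\<^sub>F \<epsilon> in at_right 0. \<forall>x\<in>ball x0 d \<inter> \<Omega>1. f \<epsilon> x \<in> V \<longrightarrow> c0 \<le> (\<Sum>\<psi>\<in>J. (norm (\<psi> (f \<epsilon> x)))\<^sup>2)))" for d V
  have Q_antimono: "Q d' V" if Q: "Q d V" "d' \<le> d" for d d' V
  proof -
    obtain J c0 where J: "finite J" "0 < c0" "\<forall>\<psi>\<in>J. good_cutoff \<Omega>1 \<Omega>2 f r x0 \<xi>0 d \<psi>"
      and ev: "\<forall>\<^sub>F \<epsilon> in at_right 0. \<forall>x\<in>ball x0 d \<inter> \<Omega>1. f \<epsilon> x \<in> V \<longrightarrow> c0 \<le> (\<Sum>\<psi>\<in>J. (norm (\<psi> (f \<epsilon> x)))\<^sup>2)"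
      using Q(1) unfolding Q_def by blast
    have "\<forall>\<^sub>F \<epsilon> in at_right 0. \<forall>x\<in>ball x0 d' \<inter> \<Omega>1. f \<epsilon> x \<in> V \<longrightarrow> c0 \<le> (\<Sum>\<psi>\<in>J. (norm (\<psi> (f \<epsilon> x)))\<^sup>2)"
      using ev by eventually_elim (use subset_ball[OF Q(2)] in blast)
    moreover have "\<forall>\<psi>\<in>J. good_cutoff \<Omega>1 \<Omega>2 f r x0 \<xi>0 d' \<psi>"
      using J(3) by (intro ballI good_cutoff_antimono[OF _ Q(2)]) blast
    ultimately show ?thesis unfolding Q_def using J(1,2) by (intro exI[of _ J] exI[of _ c0] conjI)
  qed
  obtain d W where dW: "d > 0" "open W" "K \<subseteq> W" "Q d W"
  proof (rule compact_cover_induct[OF K(1), of Q])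
    show "Q d {}" for d unfolding Q_def by (rule exI[of _ "{}"], rule exI[of _ 1]) simp
    show "Q d' V" if "Q d V" "d' \<le> d" for d d' V using Q_antimono[OF that] .
    show "Q d (V \<union> V')" if Q: "Q d V" "Q d V'" for d V V'
    proof -
      obtain J c0 where J: "finite J" "0 < c0" "\<forall>\<psi>\<in>J. good_cutoff \<Omega>1 \<Omega>2 f r x0 \<xi>0 d \<psi>"
        and ev: "\<forall>\<^sub>F \<epsilon> in at_right 0. \<forall>x\<in>ball x0 d \<inter> \<Omega>1. f \<epsilon> x \<in> V \<longrightarrow> c0 \<le> (\<Sum>\<psi>\<in>J. (norm (\<psi> (f \<epsilon> x)))\<^sup>2)"
        using Q(1) unfolding Q_def by blast
      obtain J' c0' where J': "finite J'" "0 < c0'" "\<forall>\<psi>\<in>J'. good_cutoff \<Omega>1 \<Omega>2 f r x0 \<xi>0 d \<psi>"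
        and ev': "\<forall>\<^sub>F \<epsilon> in at_right 0. \<forall>x\<in>ball x0 d \<inter> \<Omega>1. f \<epsilon> x \<in> V' \<longrightarrow> c0' \<le> (\<Sum>\<psi>\<in>J'. (norm (\<psi> (f \<epsilon> x)))\<^sup>2)"
        using Q(2) unfolding Q_def by blast
      have "\<forall>\<^sub>F \<epsilon> in at_right 0. \<forall>x\<in>ball x0 d \<inter> \<Omega>1. f \<epsilon> x \<in> V \<union> V' \<longrightarrow> min c0 c0' \<le> (\<Sum>\<psi>\<in>J \<union> J'. (norm (\<psi> (f \<epsilon> x)))\<^sup>2)"
        using ev ev'
      proof eventually_elim
        case (elim \<epsilon>)
        have "(\<Sum>\<psi>\<in>J. (norm (\<psi> (f \<epsilon> x)))\<^sup>2) \<le> (\<Sum>\<psi>\<in>J \<union> J'. (norm (\<psi> (f \<epsilon> x)))\<^sup>2)"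
          "(\<Sum>\<psi>\<in>J'. (norm (\<psi> (f \<epsilon> x)))\<^sup>2) \<le> (\<Sum>\<psi>\<in>J \<union> J'. (norm (\<psi> (f \<epsilon> x)))\<^sup>2)" for x
          using J(1) J'(1) by (auto intro!: sum_mono2)
        then show ?case using elim by (meson Un_iff min.coboundedI1 min.coboundedI2 order_trans)
      qed
      then show ?thesis
        unfolding Q_def using J J' by (intro exI[of _ "J \<union> J'"] exI[of _ "min c0 c0'"]) auto
    qed
    show "\<exists>d>0. Q d (ball y d)" if y: "y \<in> K" for y
    proof (cases "(x0, y) \<in> gen_graph \<Omega>1 \<Omega>2 f")
      case False
      have "y \<in> \<Omega>2" using y K(2) by blast
      obtain d where d: "d > 0" "\<forall>\<^sub>F \<epsilon> in at_right 0. \<forall>x'\<in>\<Omega>1. dist x' x0 < d \<longrightarrow> \<not> dist (f \<epsilon> x') y < d"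
        by (rule gen_graph_separation[OF x0\<Omega> \<open>y \<in> \<Omega>2\<close> False])
      have "\<forall>\<^sub>F \<epsilon> in at_right 0. \<forall>x\<in>ball x0 d \<inter> \<Omega>1. f \<epsilon> x \<in> ball y d \<longrightarrow> 1 \<le> (\<Sum>\<psi>\<in>{}. (norm (\<psi> (f \<epsilon> x)))\<^sup>2)"
        using d(2) by eventually_elim (auto simp: dist_commute)
      then have "Q d (ball y d)" unfolding Q_def by (intro exI[of _ "{}"] exI[of _ 1]) simp
      with d(1) show ?thesis by blast
    next
      case True
      have y2: "y \<in> \<Omega>2" using y K(2) by blast
      have "\<exists>d>0. noncharacteristic \<Omega>1 f x0 \<xi>0 y d d (ball \<eta> d)" if \<eta>: "(y, \<eta>) \<in> ?WF" for \<eta>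
      proof (rule noncharacteristic_direction[OF _ y2 \<xi>0])
        show D: "(x0, \<eta>) \<in> D_set \<Omega>1 f" using U True \<eta> unfolding U_set_def by blast
        show "((x0, \<eta>), (y, \<xi>0)) \<notin> gen_graph (D_set \<Omega>1 f) (\<Omega>2 \<times> sphere 0 1) (Phi_net f)"
        proof
          assume g: "((x0, \<eta>), (y, \<xi>0)) \<in> gen_graph (D_set \<Omega>1 f) (\<Omega>2 \<times> sphere 0 1) (Phi_net f)"
          have "D_set \<Omega>1 f \<noteq> {}" using D by blast
          then have "(x0, \<xi>0) \<in> pullback_dirs \<Omega>1 \<Omega>2 f ?WF"
            unfolding pullback_dirs_def using g \<eta> x0\<Omega> \<xi>0 by auto
          with P show False by blast
        qed
      qed
      then obtain d \<psi> where d: "d > 0" "good_cutoff \<Omega>1 \<Omega>2 f r x0 \<xi>0 d \<psi>" "\<psi> y \<noteq> 0"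
        using good_cutoff_exists[OF \<Omega>(2) r y2] by metis
      \<comment> \<open>by continuity \<open>|\<psi>|\<close> stays above half of its value at \<open>y\<close>\<close>
      define c0 where "c0 = (norm (\<psi> y) / 2)\<^sup>2"
      have "smooth_on UNIV \<psi>" using d(2) by (auto simp: good_cutoff_def test_functions_def)
      then have "isCont \<psi> y"
        using smooth_on_continuous[of UNIV \<psi> "[]"] by (simp add: continuous_on_eq_continuous_at)
      then obtain e where e: "e > 0" "\<And>z. dist z y < e \<Longrightarrow> dist (\<psi> z) (\<psi> y) < norm (\<psi> y) / 2"
        using d(3) unfolding continuous_at_eps_delta by (metis half_gt_zero zero_less_norm_iff)
      define d' where "d' = min d e"
      have low: "c0 \<le> (norm (\<psi> z))\<^sup>2" if "z \<in> ball y d'" for z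
      proof -
        have "dist z y < e" using that by (simp add: d'_def dist_commute)
        then have "dist (\<psi> z) (\<psi> y) < norm (\<psi> y) / 2" by (rule e(2))
        then have "norm (\<psi> y) / 2 \<le> norm (\<psi> z)"
          using norm_triangle_ineq2[of "\<psi> y" "\<psi> z"] by (simp add: dist_norm norm_minus_commute)
        then show ?thesis unfolding c0_def by (intro power_mono) auto
      qed
      have "0 < c0" using d(3) by (simp add: c0_def)
      moreover have "good_cutoff \<Omega>1 \<Omega>2 f r x0 \<xi>0 d' \<psi>" by (rule good_cutoff_antimono[OF d(2)]) (simp add: d'_def)
      ultimately have "Q d' (ball y d')"
        unfolding Q_def using low by (intro exI[of _ "{\<psi>}"] exI[of _ c0]) simp
      moreover have "d' > 0" using d(1) e(1) by (simp add: d'_def)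
      ultimately show ?thesis by blast
    qed
  qed
  define d' where "d' = min d \<rho>"
  have d': "d' > 0" "d' \<le> d" "ball x0 d' \<subseteq> cball x0 \<rho>" using dW(1) \<rho>(1) by (auto simp: d'_def)
  have B\<Omega>: "ball x0 d' \<subseteq> \<Omega>1" and BX: "ball x0 d' \<subseteq> X0" using d'(3) \<rho>(2) X0(2) by blast+
  obtain J c0 where J: "finite J" "0 < c0" "\<forall>\<psi>\<in>J. good_cutoff \<Omega>1 \<Omega>2 f r x0 \<xi>0 d' \<psi>"
    and ev: "\<forall>\<^sub>F \<epsilon> in at_right 0. \<forall>x\<in>ball x0 d' \<inter> \<Omega>1. f \<epsilon> x \<in> W \<longrightarrow> c0 \<le> (\<Sum>\<psi>\<in>J. (norm (\<psi> (f \<epsilon> x)))\<^sup>2)"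
    using Q_antimono[OF dW(4) d'(2)] unfolding Q_def by blast
  have fB: "tame_net slow_net (\<lambda>_. ball x0 d') f"
    by (rule tame_net_subset[OF net_class_slow _ _ _ fX0]) (use X0(1) BX in simp_all)
  have KB: "\<forall>\<^sub>F \<epsilon> in at_right 0. \<forall>x\<in>ball x0 d'. f \<epsilon> x \<in> K"
    using K(3) by eventually_elim (use d'(3) in blast)
  have c0: "\<forall>\<^sub>F \<epsilon> in at_right 0. \<forall>x\<in>ball x0 d'. c0 \<le> (\<Sum>\<psi>\<in>J. (norm (\<psi> (f \<epsilon> x)))\<^sup>2)"
    using ev KB by eventually_elim (use B\<Omega> dW(3) in blast)
  define \<phi> where "\<phi> x = complex_of_real (bump x0 (d' / 2) x)" for x
  define v where "v \<epsilon> x = \<phi> x * w \<epsilon> x" for \<epsilon> x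
  have h: "0 < d' / 2" "cball x0 (d' / 2) \<subseteq> \<Omega>1" using d'(1) B\<Omega> by (auto simp: subset_eq)
  have \<phi>: "\<phi> \<in> test_functions \<Omega>1" unfolding \<phi>_def[abs_def] by (rule bump_test_function[OF h])
  have \<phi>0: "\<phi> x = 0" if "x \<notin> cball x0 (d' / 2)" for x
    using that bump_pos_iff[OF h(1), of x0 x] bump_nonneg[of x0 "d' / 2" x] by (auto simp: \<phi>_def less_eq_real_def)
  have s\<phi>: "smooth_on \<Omega>1 \<phi>" using \<phi> by (auto simp: test_functions_def intro: smooth_on_subset)
  have wm: "w \<in> moderate_nets \<Omega>1" using w by (simp add: pullback_rep_def)
  have vm: "v \<in> gmult \<Omega>1 \<phi> (gclass \<Omega>1 w)"
    unfolding gmult_eq_gclass[OF \<Omega>(1) s\<phi> wm] v_def[abs_def]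
    by (rule mem_gclass_self[OF \<Omega>(1) moderate_nets_mult_fixed[OF \<Omega>(1) s\<phi> wm]])
  show ?thesis
  proof (rule not_in_WF[OF \<phi> _ d'(1) vm])
    show "\<phi> x0 \<noteq> 0" using bump_pos_iff[OF h(1), of x0 x0] h(1) by (simp add: \<phi>_def)
    show "joint_compact_support \<Omega>1 v"
      unfolding joint_compact_support_def using h \<phi>0 by (intro exI[of _ "cball x0 (d' / 2)"]) (auto simp: v_def)
    show "v \<epsilon> x = 0" if "x \<notin> \<Omega>1" for \<epsilon> x
    proof -
      have "x \<notin> cball x0 (d' / 2)" using that h(2) by blast
      from \<phi>0[OF this] show ?thesis by (simp add: v_def)
    qed
    have "rapid_on (\<lambda>\<epsilon> x. of_real (bump x0 (d' / 2) x) * w \<epsilon> x) (sphere 0 1 \<inter> ball \<xi>0 d')"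
      by (rule rapid_on_pullback[OF \<Omega>(2) r w d'(1) B\<Omega> fB K(1) KB J(1) _ J(2) c0]) (use J(3) in blast)
    then show "rapid_on v (sphere 0 1 \<inter> ball \<xi>0 d')" by (simp add: v_def[abs_def] \<phi>_def)
  qed
qed

theorem theorem4p4:
  fixes \<Omega>\<^sub>1 :: "(real^'n::finite) set" and \<Omega>\<^sub>2 :: "(real^'m::finite) set"
    and f :: "('n, real^'m) net set" and f\<^sub>\<epsilon> :: "('n, real^'m) net"
    and u :: "('m, complex) net set" and u\<^sub>\<epsilon> :: "('m, complex) net"
  assumes "open \<Omega>\<^sub>1" and "open \<Omega>\<^sub>2"
    and "f \<in> cbounded_maps \<Omega>\<^sub>1 \<Omega>\<^sub>2" and "f\<^sub>\<epsilon> \<in> f" and "cbounded_net \<Omega>\<^sub>1 \<Omega>\<^sub>2 f\<^sub>\<epsilon>"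
    and "u \<in> colombeau \<Omega>\<^sub>2" and "u\<^sub>\<epsilon> \<in> u"
  shows "pullback \<Omega>\<^sub>1 f\<^sub>\<epsilon> u\<^sub>\<epsilon> \<in> colombeau \<Omega>\<^sub>1 \<and>
    (\<forall>f\<^sub>\<epsilon>'\<in>f. \<forall>u\<^sub>\<epsilon>'\<in>u. cbounded_net \<Omega>\<^sub>1 \<Omega>\<^sub>2 f\<^sub>\<epsilon>' \<longrightarrow> pullback \<Omega>\<^sub>1 f\<^sub>\<epsilon>' u\<^sub>\<epsilon>' = pullback \<Omega>\<^sub>1 f\<^sub>\<epsilon> u\<^sub>\<epsilon>) \<and>
    WF \<Omega>\<^sub>1 (pullback \<Omega>\<^sub>1 f\<^sub>\<epsilon> u\<^sub>\<epsilon>) \<subseteq>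
      pullback_dirs \<Omega>\<^sub>1 \<Omega>\<^sub>2 f\<^sub>\<epsilon> (WF \<Omega>\<^sub>2 u)
      \<union> (U_set \<Omega>\<^sub>1 \<Omega>\<^sub>2 f\<^sub>\<epsilon> (WF \<Omega>\<^sub>2 u) \<times> sphere 0 1)
      \<union> ((K_set \<Omega>\<^sub>1 \<Omega>\<^sub>2 f\<^sub>\<epsilon> u \<inter> (\<Omega>\<^sub>1 - S_set \<Omega>\<^sub>1 f\<^sub>\<epsilon>)) \<times> sphere 0 1)"
proof -
  note \<Omega> = assms(1,2) and cb = assms(5)
  have fc: "f \<in> colombeau \<Omega>\<^sub>1" using assms(3) by (simp add: cbounded_maps_def)
  have fm: "f\<^sub>\<epsilon> \<in> moderate_nets \<Omega>\<^sub>1" and feq: "f = gclass \<Omega>\<^sub>1 f\<^sub>\<epsilon>"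
    using colombeau_eq_gclass[OF \<Omega>(1) fc assms(4)] by auto
  have um: "u\<^sub>\<epsilon> \<in> moderate_nets \<Omega>\<^sub>2" and ueq: "u = gclass \<Omega>\<^sub>2 u\<^sub>\<epsilon>"
    using colombeau_eq_gclass[OF \<Omega>(2) assms(6,7)] by auto
  obtain w where w: "pullback_rep \<Omega>\<^sub>1 f\<^sub>\<epsilon> u\<^sub>\<epsilon> w" using pullback_rep_exists[OF \<Omega> fm cb um] by blast
  then have wm: "w \<in> moderate_nets \<Omega>\<^sub>1" by (simp add: pullback_rep_def)
  have p: "pullback \<Omega>\<^sub>1 f\<^sub>\<epsilon> u\<^sub>\<epsilon> = gclass \<Omega>\<^sub>1 w" by (rule pullback_eq_gclass[OF \<Omega> fm cb um w])
  have "pullback \<Omega>\<^sub>1 f\<^sub>\<epsilon>' u\<^sub>\<epsilon>' = pullback \<Omega>\<^sub>1 f\<^sub>\<epsilon> u\<^sub>\<epsilon>"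
    if rep: "f\<^sub>\<epsilon>' \<in> f" "u\<^sub>\<epsilon>' \<in> u" "cbounded_net \<Omega>\<^sub>1 \<Omega>\<^sub>2 f\<^sub>\<epsilon>'" for f\<^sub>\<epsilon>' u\<^sub>\<epsilon>'
  proof -
    have fm': "f\<^sub>\<epsilon>' \<in> moderate_nets \<Omega>\<^sub>1" using colombeau_eq_gclass[OF \<Omega>(1) fc rep(1)] by auto
    have um': "u\<^sub>\<epsilon>' \<in> moderate_nets \<Omega>\<^sub>2" using colombeau_eq_gclass[OF \<Omega>(2) assms(6) rep(2)] by auto
    obtain w' where w': "pullback_rep \<Omega>\<^sub>1 f\<^sub>\<epsilon>' u\<^sub>\<epsilon>' w'" using pullback_rep_exists[OF \<Omega> fm' rep(3) um'] by blast
    have "(f\<^sub>\<epsilon>, f\<^sub>\<epsilon>') \<in> colombeau_rel \<Omega>\<^sub>1" "(u\<^sub>\<epsilon>, u\<^sub>\<epsilon>') \<in> colombeau_rel \<Omega>\<^sub>2"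
      using rep(1,2) feq ueq by (auto simp: gclass_def)
    then have "(w, w') \<in> colombeau_rel \<Omega>\<^sub>1" using pullback_rep_rel[OF \<Omega> _ cb rep(3) _ w w'] by blast
    then have "gclass \<Omega>\<^sub>1 w = gclass \<Omega>\<^sub>1 w'"
      using gclass_eq_iff[OF \<Omega>(1) wm] w' by (auto simp: pullback_rep_def)
    then show ?thesis using p pullback_eq_gclass[OF \<Omega> fm' rep(3) um' w'] by simp
  qed
  moreover have "z \<in> pullback_dirs \<Omega>\<^sub>1 \<Omega>\<^sub>2 f\<^sub>\<epsilon> (WF \<Omega>\<^sub>2 u)
      \<union> (U_set \<Omega>\<^sub>1 \<Omega>\<^sub>2 f\<^sub>\<epsilon> (WF \<Omega>\<^sub>2 u) \<times> sphere 0 1)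
      \<union> ((K_set \<Omega>\<^sub>1 \<Omega>\<^sub>2 f\<^sub>\<epsilon> u \<inter> (\<Omega>\<^sub>1 - S_set \<Omega>\<^sub>1 f\<^sub>\<epsilon>)) \<times> sphere 0 1)" if z: "z \<in> WF \<Omega>\<^sub>1 (gclass \<Omega>\<^sub>1 w)" for z
  proof -
    obtain x \<xi> where x: "z = (x, \<xi>)" "x \<in> \<Omega>\<^sub>1" "\<xi> \<in> sphere 0 1" using z by (auto simp: WF_def)
    have "x \<in> K_set \<Omega>\<^sub>1 \<Omega>\<^sub>2 f\<^sub>\<epsilon> u"
      using WF_pullback_outside_K_set[OF \<Omega> cb um w x(2)] z x(1) ueq by blast
    moreover have "x \<in> S_set \<Omega>\<^sub>1 f\<^sub>\<epsilon> \<Longrightarrow> x \<in> U_set \<Omega>\<^sub>1 \<Omega>\<^sub>2 f\<^sub>\<epsilon> (WF \<Omega>\<^sub>2 u) \<or> z \<in> pullback_dirs \<Omega>\<^sub>1 \<Omega>\<^sub>2 f\<^sub>\<epsilon> (WF \<Omega>\<^sub>2 u)"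
      using WF_pullback_inside_S_set[OF \<Omega> fm cb um w _ x(3)] z x(1) ueq by blast
    ultimately show ?thesis using x by blast
  qed
  ultimately show ?thesis unfolding p using gclass_colombeau[OF \<Omega>(1) wm] by (simp add: p subset_eq)
qed

end
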